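(* For $k\in\mathbb{Z}$ with $k\equiv 1\pmod 4$, let $W_k\subset\mathbb{P}^1\times\mathbb{P}^1\times\mathbb{P}^1$ be the surface over $\mathbb{Q}$ defined by the $(2,2,2)$-form with affine equation $$F_3(x,y,z) = x^2+y^2+z^2+4(x^2y^2+y^2z^2+z^2x^2)-16x^2y^2z^2-k = 0,$$ let $U_k \subset W_k$ be the affine surface over $\mathbb{Q}$ given by $F_3=0$ in $\mathbb{A}^3$, and let $\mathcal{U}_k$ be the integral model of $U_k$ over $\mathbb{Z}$ defined by the same equation. If $\mathcal{U}_k(\mathbb{Z})\neq\emptyset$, then there is a Brauer--Manin obstruction to strong approximation on $\mathcal{U}_k$ with respect to the element $\mathcal{A}_1=(4x^2+1,-2(4k+1))$, i.e. $\mathcal{U}_k(\mathbf{A}_{\mathbb{Z}})^{\mathcal{A}_1}\neq\mathcal{U}_k(\mathbf{A}_{\mathbb{Z}})$.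
   Context: Let $[x:r],[y:s],[z:t]$ be homogeneous coordinates on the three factors of $\mathbb{P}^1\times\mathbb{P}^1\times\mathbb{P}^1$; $W_k$ is the closed subscheme defined by the trihomogenization (of tridegree $(2,2,2)$) of $F_3$, and $U_k = W_k \setminus \{rst=0\} = \mathrm{Spec}\,\mathbb{Q}[x,y,z]/(F_3)$, $\mathcal{U}_k = \mathrm{Spec}\,\mathbb{Z}[x,y,z]/(F_3)$. The symbol $(f,g)$ denotes the class of the quaternion algebra attached to $f,g$ in the Brauer group of the function field; the one considered here comes from $\mathrm{Br}\,U_k=\mathrm{H}^2_{\text{ét}}(U_k,\mathbb{G}_m)$. $\mathcal{U}_k(\mathbf{A}_{\mathbb{Z}}) = \prod_{p\le\infty}\mathcal{U}_k(\mathbb{Z}_p)$ with $\mathbb{Z}_\infty=\mathbb{R}$ (by abuse of notation the real factor may be replaced by its set of connected components $\pi_0(U_k(\mathbb{R}))$, the pairing below being locally constant). There is a pairing $\mathcal{U}_k(\mathbf{A}_{\mathbb{Z}})\times \mathrm{Br}\,U_k\to\mathbb{Q}/\mathbb{Z}$, $((P_p)_p,\mathcal{B})\mapsto \sum_{p\le\infty}\mathrm{inv}_p\,\mathcal{B}(P_p)$, where $\mathrm{inv}_p:\mathrm{Br}\,\mathbb{Q}_p\to\mathbb{Q}/\mathbb{Z}$ is the local invariant map (with $\mathbb{Q}_\infty = \mathbb{R}$). $\mathcal{U}_k(\mathbf{A}_{\mathbb{Z}})^{\mathcal{A}_1}$ is the set of points pairing to $0$ with $\mathcal{A}_1$. 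*)

theory Defs
  imports
    "HOL-Algebra.Algebraic_Closure_Type"
    "HOL-Computational_Algebra.Polynomial"
    "HOL-Computational_Algebra.Primes"
    "HOL-Number_Theory.Cong"
begin

section \<open>Fields of fractions and p-adic numbers\<close>

text \<open>For an integral domain \<open>R\<close>, the class \<open>a/b\<close> is the set of all pairs \<open>(c,d)\<close> with
  \<open>d \<noteq> 0\<close> and \<open>a d = c b\<close>.\<close>

definition fraction :: "('a, 'm) ring_scheme \<Rightarrow> 'a \<Rightarrow> 'a \<Rightarrow> ('a \<times> 'a) set" where
  "fraction R a b =
     {(c, d). c \<in> carrier R \<and> d \<in> carrier R - {\<zero>\<^bsub>R\<^esub>} \<and> a \<otimes>\<^bsub>R\<^esub> d = c \<otimes>\<^bsub>R\<^esub> b}"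

definition fraction_field :: "('a, 'm) ring_scheme \<Rightarrow> ('a \<times> 'a) set ring" where
  "fraction_field R =
    \<lparr>carrier = {fraction R a b | a b. a \<in> carrier R \<and> b \<in> carrier R - {\<zero>\<^bsub>R\<^esub>}},
     monoid.mult = (\<lambda>U V. \<Union>{fraction R (a \<otimes>\<^bsub>R\<^esub> c) (b \<otimes>\<^bsub>R\<^esub> d) | a b c d. (a, b) \<in> U \<and> (c, d) \<in> V}),
     one = fraction R \<one>\<^bsub>R\<^esub> \<one>\<^bsub>R\<^esub>,
     ring.zero = fraction R \<zero>\<^bsub>R\<^esub> \<one>\<^bsub>R\<^esub>,
     add = (\<lambda>U V. \<Union>{fraction R (a \<otimes>\<^bsub>R\<^esub> d \<oplus>\<^bsub>R\<^esub> c \<otimes>\<^bsub>R\<^esub> b) (b \<otimes>\<^bsub>R\<^esub> d)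
                      | a b c d. (a, b) \<in> U \<and> (c, d) \<in> V})\<rparr>"

abbreviation to_fraction :: "('a, 'm) ring_scheme \<Rightarrow> 'a \<Rightarrow> ('a \<times> 'a) set" where
  "to_fraction R a \<equiv> fraction R a \<one>\<^bsub>R\<^esub>"

text \<open>The \<open>p\<close>-adic integers as the inverse limit of the rings of integers modulo \<open>p ^ n\<close>,
  each residue class being represented in \<open>{0..<p ^ n}\<close>.\<close>

definition Zp :: "nat \<Rightarrow> (nat \<Rightarrow> int) ring" where
  "Zp p =
    \<lparr>carrier = {a. \<forall>n. a n \<in> {0..<int p ^ n} \<and> a (Suc n) mod int p ^ n = a n},
     monoid.mult = (\<lambda>a b n. (a n * b n) mod int p ^ n),
     one = (\<lambda>n. 1 mod int p ^ n),
     ring.zero = (\<lambda>n. 0),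
     add = (\<lambda>a b n. (a n + b n) mod int p ^ n)\<rparr>"

abbreviation Qp :: "nat \<Rightarrow> ((nat \<Rightarrow> int) \<times> (nat \<Rightarrow> int)) set ring" where
  "Qp p \<equiv> fraction_field (Zp p)"

text \<open>The normalised valuation: \<open>c = p\<^sup>j u\<close> with \<open>u\<close> a unit of the \<open>p\<close>-adic integers.\<close>

definition padic_val :: "nat \<Rightarrow> ((nat \<Rightarrow> int) \<times> (nat \<Rightarrow> int)) set \<Rightarrow> int" where
  "padic_val p c =
     (THE j. \<exists>u \<in> Units (Zp p).
        c = ([p] \<cdot>\<^bsub>Qp p\<^esub> \<one>\<^bsub>Qp p\<^esub>) [^]\<^bsub>Qp p\<^esub> j \<otimes>\<^bsub>Qp p\<^esub> to_fraction (Zp p) u)"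

abbreviation real_field :: "real ring" where
  "real_field \<equiv> ring_of_type_algebra"


section \<open>Algebras that are free of finite rank over a commutative ring\<close>

text \<open>An algebra with basis \<open>e\<^sub>0, \<dots>, e\<^sub>n\<^sub>-\<^sub>1\<close> is given by its structure constants,
  \<open>e\<^sub>i e\<^sub>j = \<Sum>\<^sub>k sc i j k e\<^sub>k\<close>, and the coordinates of its unit element.
  Only values at indices below the rank matter.\<close>

record 'a falg =
  rank :: nat
  sc :: "nat \<Rightarrow> nat \<Rightarrow> nat \<Rightarrow> 'a"
  unity :: "nat \<Rightarrow> 'a"

definition alg_ring :: "('a, 'm) ring_scheme \<Rightarrow> 'a falg \<Rightarrow> (nat \<Rightarrow> 'a) ring" where
  "alg_ring R A =
    \<lparr>carrier = {..<rank A} \<rightarrow>\<^sub>E carrier R,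
     monoid.mult = (\<lambda>v w. \<lambda>k\<in>{..<rank A}.
       \<Oplus>\<^bsub>R\<^esub>i\<in>{..<rank A}. \<Oplus>\<^bsub>R\<^esub>j\<in>{..<rank A}. v i \<otimes>\<^bsub>R\<^esub> w j \<otimes>\<^bsub>R\<^esub> sc A i j k),
     one = restrict (unity A) {..<rank A},
     ring.zero = (\<lambda>k\<in>{..<rank A}. \<zero>\<^bsub>R\<^esub>),
     add = (\<lambda>v w. \<lambda>k\<in>{..<rank A}. v k \<oplus>\<^bsub>R\<^esub> w k)\<rparr>"

definition alg_smult :: "('a, 'm) ring_scheme \<Rightarrow> 'a falg \<Rightarrow> 'a \<Rightarrow> (nat \<Rightarrow> 'a) \<Rightarrow> nat \<Rightarrow> 'a" where
  "alg_smult R A a v = (\<lambda>k\<in>{..<rank A}. a \<otimes>\<^bsub>R\<^esub> v k)"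

definition alg_basis :: "('a, 'm) ring_scheme \<Rightarrow> 'a falg \<Rightarrow> nat \<Rightarrow> nat \<Rightarrow> 'a" where
  "alg_basis R A i = (\<lambda>k\<in>{..<rank A}. if k = i then \<one>\<^bsub>R\<^esub> else \<zero>\<^bsub>R\<^esub>)"

definition alg_scalar :: "('a, 'm) ring_scheme \<Rightarrow> 'a falg \<Rightarrow> 'a \<Rightarrow> nat \<Rightarrow> 'a" where
  "alg_scalar R A a = alg_smult R A a \<one>\<^bsub>alg_ring R A\<^esub>"

definition is_algebra :: "('a, 'm) ring_scheme \<Rightarrow> 'a falg \<Rightarrow> bool" where
  "is_algebra R A \<longleftrightarrow>
     (\<forall>i<rank A. \<forall>j<rank A. \<forall>k<rank A. sc A i j k \<in> carrier R) \<and>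
     (\<forall>k<rank A. unity A k \<in> carrier R) \<and> ring (alg_ring R A)"

definition alg_endomorphisms ::
    "('a, 'm) ring_scheme \<Rightarrow> 'a falg \<Rightarrow> ((nat \<Rightarrow> 'a) \<Rightarrow> (nat \<Rightarrow> 'a)) set" where
  "alg_endomorphisms R A =
     {h \<in> carrier (alg_ring R A) \<rightarrow>\<^sub>E carrier (alg_ring R A).
        (\<forall>v\<in>carrier (alg_ring R A). \<forall>w\<in>carrier (alg_ring R A).
           h (v \<oplus>\<^bsub>alg_ring R A\<^esub> w) = h v \<oplus>\<^bsub>alg_ring R A\<^esub> h w) \<and>
        (\<forall>a\<in>carrier R. \<forall>v\<in>carrier (alg_ring R A). h (alg_smult R A a v) = alg_smult R A a (h v))}"

text \<open>The canonical map \<open>A \<otimes> A\<^sup>o\<^sup>p \<rightarrow> End\<^sub>R(A)\<close>, \<open>a \<otimes> b \<mapsto> (v \<mapsto> a v b)\<close>, where an element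
  \<open>\<Sum> r\<^sub>i\<^sub>j e\<^sub>i \<otimes> e\<^sub>j\<close> of the source is given by its coefficients.\<close>

definition enveloping_map ::
    "('a, 'm) ring_scheme \<Rightarrow> 'a falg \<Rightarrow> (nat \<times> nat \<Rightarrow> 'a) \<Rightarrow> (nat \<Rightarrow> 'a) \<Rightarrow> (nat \<Rightarrow> 'a)" where
  "enveloping_map R A r = (\<lambda>v\<in>carrier (alg_ring R A).
     \<Oplus>\<^bsub>alg_ring R A\<^esub>i\<in>{..<rank A}. \<Oplus>\<^bsub>alg_ring R A\<^esub>j\<in>{..<rank A}.
       alg_smult R A (r (i, j))
         (alg_basis R A i \<otimes>\<^bsub>alg_ring R A\<^esub> v \<otimes>\<^bsub>alg_ring R A\<^esub> alg_basis R A j))"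

text \<open>Over a field, these are exactly the central simple algebras.\<close>

definition azumaya :: "('a, 'm) ring_scheme \<Rightarrow> 'a falg \<Rightarrow> bool" where
  "azumaya R A \<longleftrightarrow> is_algebra R A \<and> rank A > 0 \<and>
     bij_betw (enveloping_map R A)
       ({..<rank A} \<times> {..<rank A} \<rightarrow>\<^sub>E carrier R) (alg_endomorphisms R A)"

text \<open>The tensor product \<open>A \<otimes>\<^sub>R S\<close> along a ring homomorphism \<open>\<phi>\<close> from \<open>R\<close> to \<open>S\<close>.\<close>

definition base_change :: "('a \<Rightarrow> 'b) \<Rightarrow> 'a falg \<Rightarrow> 'b falg" where
  "base_change \<phi> A =
     \<lparr>rank = rank A, sc = (\<lambda>i j k. \<phi> (sc A i j k)), unity = (\<lambda>k. \<phi> (unity A k))\<rparr>"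

definition trivial_alg :: "('a, 'm) ring_scheme \<Rightarrow> 'a falg" where
  "trivial_alg R = \<lparr>rank = 1, sc = (\<lambda>i j k. \<one>\<^bsub>R\<^esub>), unity = (\<lambda>k. \<one>\<^bsub>R\<^esub>)\<rparr>"

text \<open>The quaternion algebra \<open>(a,b)\<close>, in the basis \<open>1, i, j, ij\<close> with
  \<open>i\<^sup>2 = a\<close>, \<open>j\<^sup>2 = b\<close>, \<open>ji = -ij\<close>.\<close>

definition quaternion_alg :: "('a, 'm) ring_scheme \<Rightarrow> 'a \<Rightarrow> 'a \<Rightarrow> 'a falg" where
  "quaternion_alg R a b =
     (let o1 = \<one>\<^bsub>R\<^esub>; z = \<zero>\<^bsub>R\<^esub>; n = (\<lambda>x. \<ominus>\<^bsub>R\<^esub> x) in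
      \<lparr>rank = 4,
       sc = (\<lambda>i j k.
         ([[[o1, z, z, z], [z, o1, z, z], [z, z, o1, z], [z, z, z, o1]],
           [[z, o1, z, z], [a, z, z, z], [z, z, z, o1], [z, z, a, z]],
           [[z, z, o1, z], [z, z, z, n o1], [b, z, z, z], [z, n b, z, z]],
           [[z, z, z, o1], [z, z, n a, z], [z, b, z, z], [n (a \<otimes>\<^bsub>R\<^esub> b), z, z, z]]]
          ! i ! j ! k)),
       unity = (\<lambda>k. if k = 0 then o1 else z)\<rparr>)"

definition matrix_ring :: "nat \<Rightarrow> ('a, 'm) ring_scheme \<Rightarrow> (nat \<times> nat \<Rightarrow> 'a) ring" where
  "matrix_ring n A =
    \<lparr>carrier = {..<n} \<times> {..<n} \<rightarrow>\<^sub>E carrier A,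
     monoid.mult = (\<lambda>M N. \<lambda>(i, j)\<in>{..<n} \<times> {..<n}. \<Oplus>\<^bsub>A\<^esub>l\<in>{..<n}. M (i, l) \<otimes>\<^bsub>A\<^esub> N (l, j)),
     one = (\<lambda>(i, j)\<in>{..<n} \<times> {..<n}. if i = j then \<one>\<^bsub>A\<^esub> else \<zero>\<^bsub>A\<^esub>),
     ring.zero = (\<lambda>(i, j)\<in>{..<n} \<times> {..<n}. \<zero>\<^bsub>A\<^esub>),
     add = (\<lambda>M N. \<lambda>(i, j)\<in>{..<n} \<times> {..<n}. M (i, j) \<oplus>\<^bsub>A\<^esub> N (i, j))\<rparr>"

definition matrix_scalar ::
    "nat \<Rightarrow> ('a, 'm) ring_scheme \<Rightarrow> 'a falg \<Rightarrow> 'a \<Rightarrow> nat \<times> nat \<Rightarrow> (nat \<Rightarrow> 'a)" where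
  "matrix_scalar n K A a = (\<lambda>(i, j)\<in>{..<n} \<times> {..<n}.
     if i = j then alg_scalar K A a else \<zero>\<^bsub>alg_ring K A\<^esub>)"

text \<open>Equality of classes in the Brauer group of a field: some matrix algebras over \<open>A\<close> and \<open>B\<close>
  are isomorphic as \<open>K\<close>-algebras.\<close>

definition brauer_equivalent :: "('a, 'm) ring_scheme \<Rightarrow> 'a falg \<Rightarrow> 'a falg \<Rightarrow> bool" where
  "brauer_equivalent K A B \<longleftrightarrow>
     (\<exists>r>0. \<exists>s>0. \<exists>h \<in> ring_iso (matrix_ring r (alg_ring K A)) (matrix_ring s (alg_ring K B)).
        \<forall>a\<in>carrier K. h (matrix_scalar r K A a) = matrix_scalar s K B a)"


section \<open>Local invariants\<close>

text \<open>Elements of the group of rationals modulo integers are represented by rationals in the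
  interval from 0 (included) to 1 (excluded).

  A central simple algebra \<open>A\<close> of dimension \<open>n\<^sup>2\<close> over the field \<open>K\<close> of \<open>p\<close>-adic numbers contains
  the unramified extension \<open>L\<close> of \<open>K\<close> of degree \<open>n\<close>, and, by Skolem--Noether, a unit \<open>g\<close>
  inducing the Frobenius on \<open>L\<close> by conjugation; the invariant of \<open>A\<close> is the class of
  \<open>v(g\<^sup>n) / n\<close>. The unramified extensions are those generated by a root of unity \<open>z\<close> of order
  prime to \<open>p\<close>, on which the Frobenius is \<open>z \<mapsto> z\<^sup>p\<close>.\<close>

definition has_local_inv ::
    "nat \<Rightarrow> ((nat \<Rightarrow> int) \<times> (nat \<Rightarrow> int)) set falg \<Rightarrow> rat \<Rightarrow> bool" where
  "has_local_inv p A q \<longleftrightarrow>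
     (let B = alg_ring (Qp p) A; S = alg_scalar (Qp p) A ` carrier (Qp p) in
      \<exists>n>0. rank A = n\<^sup>2 \<and>
        (\<exists>z\<in>carrier B. \<exists>g\<in>Units B. \<exists>m>0. \<exists>c\<in>carrier (Qp p) - {\<zero>\<^bsub>Qp p\<^esub>}.
           coprime m p \<and> z [^]\<^bsub>B\<^esub> (m::nat) = \<one>\<^bsub>B\<^esub> \<and>
           subfield (ring.simple_extension B S z) B \<and>
           ring.dimension B n S (ring.simple_extension B S z) \<and>
           g \<otimes>\<^bsub>B\<^esub> z = z [^]\<^bsub>B\<^esub> p \<otimes>\<^bsub>B\<^esub> g \<and>
           g [^]\<^bsub>B\<^esub> n = alg_scalar (Qp p) A c \<and>
           q = frac (rat_of_int (padic_val p c) / rat_of_nat n)))"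

definition local_inv :: "nat \<Rightarrow> ((nat \<Rightarrow> int) \<times> (nat \<Rightarrow> int)) set falg \<Rightarrow> rat" where
  "local_inv p A = (THE q. has_local_inv p A q)"

text \<open>The Brauer group of the real numbers has order two.\<close>

definition real_inv :: "real falg \<Rightarrow> rat" where
  "real_inv A = (if brauer_equivalent real_field A (trivial_alg real_field) then 0 else 1 / 2)"


section \<open>The surface\<close>

definition F3 :: "('a, 'm) ring_scheme \<Rightarrow> int \<Rightarrow> 'a \<Rightarrow> 'a \<Rightarrow> 'a \<Rightarrow> 'a" where
  "F3 R k x y z =
     (let x2 = x [^]\<^bsub>R\<^esub> (2::nat); y2 = y [^]\<^bsub>R\<^esub> (2::nat); z2 = z [^]\<^bsub>R\<^esub> (2::nat) in
      (x2 \<oplus>\<^bsub>R\<^esub> y2 \<oplus>\<^bsub>R\<^esub> z2)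
      \<oplus>\<^bsub>R\<^esub> [(4::int)] \<cdot>\<^bsub>R\<^esub> (x2 \<otimes>\<^bsub>R\<^esub> y2 \<oplus>\<^bsub>R\<^esub> y2 \<otimes>\<^bsub>R\<^esub> z2 \<oplus>\<^bsub>R\<^esub> z2 \<otimes>\<^bsub>R\<^esub> x2)
      \<ominus>\<^bsub>R\<^esub> [(16::int)] \<cdot>\<^bsub>R\<^esub> (x2 \<otimes>\<^bsub>R\<^esub> y2 \<otimes>\<^bsub>R\<^esub> z2)
      \<ominus>\<^bsub>R\<^esub> [k] \<cdot>\<^bsub>R\<^esub> \<one>\<^bsub>R\<^esub>)"

text \<open>The set of \<open>R\<close>-points of the affine scheme over the integers defined by \<open>F3\<close>.\<close>

definition surface_points :: "('a, 'm) ring_scheme \<Rightarrow> int \<Rightarrow> ('a \<times> 'a \<times> 'a) set" where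
  "surface_points R k =
     {(x, y, z). x \<in> carrier R \<and> y \<in> carrier R \<and> z \<in> carrier R \<and> F3 R k x y z = \<zero>\<^bsub>R\<^esub>}"

text \<open>The polynomial ring in \<open>x, y, z\<close> over the rationals is the type of iterated univariate
  polynomials, \<open>z\<close> being the outermost variable.\<close>

type_synonym qpoly = "rat poly poly poly"

abbreviation qpoly_ring :: "qpoly ring" where
  "qpoly_ring \<equiv> ring_of_type_algebra"

abbreviation varx :: qpoly where "varx \<equiv> [:[:[:0, 1:]:]:]"
abbreviation vary :: qpoly where "vary \<equiv> [:[:0, 1:]:]"
abbreviation varz :: qpoly where "varz \<equiv> [:0, 1:]"

definition surface_ideal :: "int \<Rightarrow> qpoly set" where
  "surface_ideal k = PIdl\<^bsub>qpoly_ring\<^esub> (F3 qpoly_ring k varx vary varz)"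

definition coord_ring :: "int \<Rightarrow> qpoly set ring" where
  "coord_ring k = qpoly_ring Quot surface_ideal k"

definition function_field :: "int \<Rightarrow> (qpoly set \<times> qpoly set) set ring" where
  "function_field k = fraction_field (coord_ring k)"

definition rational_function :: "int \<Rightarrow> qpoly \<Rightarrow> (qpoly set \<times> qpoly set) set" where
  "rational_function k f = to_fraction (coord_ring k) (surface_ideal k +>\<^bsub>qpoly_ring\<^esub> f)"

definition of_rat_in :: "('a, 'm) ring_scheme \<Rightarrow> rat \<Rightarrow> 'a" where
  "of_rat_in K q =
     [fst (quotient_of q)] \<cdot>\<^bsub>K\<^esub> \<one>\<^bsub>K\<^esub> \<otimes>\<^bsub>K\<^esub> inv\<^bsub>K\<^esub> ([snd (quotient_of q)] \<cdot>\<^bsub>K\<^esub> \<one>\<^bsub>K\<^esub>)"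

definition qpoly_eval :: "('a, 'm) ring_scheme \<Rightarrow> 'a \<times> 'a \<times> 'a \<Rightarrow> qpoly \<Rightarrow> 'a" where
  "qpoly_eval K = (\<lambda>(x, y, z) f.
     \<Oplus>\<^bsub>K\<^esub>i\<in>{..degree f}.
     \<Oplus>\<^bsub>K\<^esub>j\<in>{..degree (coeff f i)}.
     \<Oplus>\<^bsub>K\<^esub>l\<in>{..degree (coeff (coeff f i) j)}.
       of_rat_in K (coeff (coeff (coeff f i) j) l)
         \<otimes>\<^bsub>K\<^esub> x [^]\<^bsub>K\<^esub> l \<otimes>\<^bsub>K\<^esub> y [^]\<^bsub>K\<^esub> j \<otimes>\<^bsub>K\<^esub> z [^]\<^bsub>K\<^esub> i)"

text \<open>The homomorphism from the coordinate ring to a field \<open>K\<close> of characteristic 0 given by a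
  \<open>K\<close>-point: elements of the coordinate ring are cosets, on which evaluation is constant.\<close>

definition point_eval :: "('a, 'm) ring_scheme \<Rightarrow> 'a \<times> 'a \<times> 'a \<Rightarrow> qpoly set \<Rightarrow> 'a" where
  "point_eval K P C = the_elem (qpoly_eval K P ` C)"


section \<open>The Brauer--Manin pairing\<close>

text \<open>\<open>A\<close> represents an element of the Brauer group of the affine surface over the rationals
  whose restriction to the Brauer group of the function field is the class of the quaternion
  algebra \<open>(f,g)\<close>. As the surface is regular and integral, this restriction is injective, so that
  there is at most one such Brauer class, and the pairing depends on \<open>f\<close> and \<open>g\<close> only. The class
  is presented by an Azumaya algebra that is free, not merely projective, as a module.\<close>

definition represents_symbol :: "int \<Rightarrow> qpoly set falg \<Rightarrow> qpoly \<Rightarrow> qpoly \<Rightarrow> bool" where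
  "represents_symbol k A f g \<longleftrightarrow>
     azumaya (coord_ring k) A \<and>
     brauer_equivalent (function_field k)
       (base_change (to_fraction (coord_ring k)) A)
       (quaternion_alg (function_field k) (rational_function k f) (rational_function k g))"

text \<open>A pair \<open>(P, Q)\<close> consists of the real component \<open>P\<close> and the family \<open>Q\<close> of \<open>p\<close>-adic integral
  components, indexed by the primes.\<close>

type_synonym adelic_point =
  "(real \<times> real \<times> real) \<times> (nat \<Rightarrow> (nat \<Rightarrow> int) \<times> (nat \<Rightarrow> int) \<times> (nat \<Rightarrow> int))"

definition adelic_points :: "int \<Rightarrow> adelic_point set" where
  "adelic_points k =
     surface_points real_field k \<times> (\<Pi>\<^sub>E p\<in>{p. prime p}. surface_points (Zp p) k)"

definition real_component_inv :: "qpoly set falg \<Rightarrow> real \<times> real \<times> real \<Rightarrow> rat" where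
  "real_component_inv A P = real_inv (base_change (point_eval real_field P) A)"

definition padic_component_inv ::
    "qpoly set falg \<Rightarrow> nat \<Rightarrow> (nat \<Rightarrow> int) \<times> (nat \<Rightarrow> int) \<times> (nat \<Rightarrow> int) \<Rightarrow> rat" where
  "padic_component_inv A p = (\<lambda>(x, y, z).
     local_inv p (base_change (point_eval (Qp p)
       (to_fraction (Zp p) x, to_fraction (Zp p) y, to_fraction (Zp p) z)) A))"

text \<open>For an Azumaya algebra \<open>A\<close> and an adelic point, only finitely many local invariants are
  nonzero, so the sum below is the full sum over all places.\<close>

definition brauer_manin_pairing :: "adelic_point \<Rightarrow> qpoly set falg \<Rightarrow> rat" where
  "brauer_manin_pairing = (\<lambda>(P, Q) A.
     frac (real_component_inv A P +
       (\<Sum>p | prime p \<and> padic_component_inv A p (Q p) \<noteq> 0. padic_component_inv A p (Q p))))"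

definition brauer_manin_set :: "int \<Rightarrow> qpoly set falg \<Rightarrow> adelic_point set" where
  "brauer_manin_set k A = {P \<in> adelic_points k. brauer_manin_pairing P A = 0}"

end

theory Submission
  imports Defs "HOL-Number_Theory.Residue_Primitive_Roots"
begin

text \<open>The class of \<open>(4x\<^sup>2 + 1, -2(4k + 1))\<close> extends to the whole surface and takes two different values at
  2-adic points, which gives the obstruction.

  Write \<open>a, b, c\<close> for \<open>4x\<^sup>2 + 1, 4y\<^sup>2 + 1, 4z\<^sup>2 + 1\<close>. The equation of the surface is equivalent to
  \<open>abc - 128 x\<^sup>2y\<^sup>2z\<^sup>2 = 4k + 1\<close>, so the quadratic form \<open>a X\<^sup>2 + 32xyz XY + 2bc Y\<^sup>2\<close> has the constant
  discriminant \<open>d = (16xyz)\<^sup>2 - 2abc = -2(4k + 1)\<close> (\<open>discriminant_identity\<close>). Its Clifford algebra is free of rank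
  4 over the coordinate ring, is Azumaya because \<open>2d\<close> is a nonzero constant (\<open>azumaya_clifford\<close>), and becomes the
  quaternion algebra \<open>(a, d)\<close> wherever \<open>a\<close> is invertible, in particular over the function field
  (\<open>clifford_swap_iso\<close>, \<open>represents_brauer_algebra\<close>). The function field makes sense since the surface is
  irreducible (\<open>irreducible_surface_poly\<close>).

  Let \<open>P\<close> be an integral point. As \<open>k\<close> is congruent to 1 modulo 4, exactly one of its coordinates is odd, and as
  the equation is symmetric the coordinates may be permuted. Take the adelic point all of whose components are the
  integral point with odd first coordinate, and change its 2-adic component into the one with even first coordinate.
  The invariants away from 2 do not change, and they vanish at all primes not dividing \<open>2ad\<close>
  (\<open>local_inv_unramified\<close>), so the pairing is a finite sum. At 2 the algebra is \<open>(a, d)\<close> with \<open>d\<close> of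
  valuation 1. If \<open>x\<close> is even, then \<open>a\<close> is a 2-adic square and the invariant is 0; if \<open>x\<close> is odd, then \<open>a\<close> is 5
  modulo 8, its square root generates the unramified quadratic extension, and the invariant is \<open>1/2\<close>
  (\<open>inv_int_point\<close>). The two pairings differ by \<open>1/2\<close>, so at most one of them is zero.

  Local invariants are defined by the existence of a root of unity \<open>z\<close> and an element \<open>g\<close> inducing the Frobenius on
  \<open>K[z]\<close>, so computing one requires both a witness and a proof that all witnesses give the same value. For a
  split algebra the value is 0 since \<open>g\<^sup>2\<close> is forced to be a norm from the unramified extension
  (\<open>split_local_inv\<close>, \<open>local_inv_split\<close>). For the division algebra at 2 an explicit conjugation moves an arbitrary
  witness to the standard one (\<open>local_inv_division\<close>).\<close>

section \<open>Polynomial identities in commutative rings with a carrier\<close>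

text \<open>Automation for polynomial identities works for type classes, whereas the rings of this theory live on
  carrier sets. The bridge is the product of all commutative rings on a given type, made into an instance of
  \<open>comm_ring_1\<close>: every element of a ring is a component of an element of this product, and taking components
  commutes with all operations, so an identity valid in the product holds in every ring. Structures that are not
  commutative rings contribute a trivial factor.\<close>

definition local_component :: "'a ring \<Rightarrow> 'a set" where
  "local_component R = (if cring R then carrier R else {undefined})"

text \<open>The integer factor is there because the class requires \<open>0 \<noteq> 1\<close>, which could fail in the product
  of the remaining factors.\<close>

typedef 'a ring_family = "{(n :: int, f :: 'a ring \<Rightarrow> 'a). \<forall>R. f R \<in> local_component R}"
proof -
  have "(0, \<lambda>R. if cring R then \<zero>\<^bsub>R\<^esub> else undefined) \<in> {(n :: int, f). \<forall>R. f R \<in> local_component R}"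
    by (auto simp: local_component_def cring.cring_simprules)
  thus ?thesis by (rule exI)
qed

setup_lifting type_definition_ring_family

instantiation ring_family :: (type) comm_ring_1
begin

lift_definition zero_ring_family :: "'a ring_family"
  is "(0, \<lambda>R. if cring R then \<zero>\<^bsub>R\<^esub> else undefined)"
  by (auto simp: local_component_def cring.cring_simprules)

lift_definition one_ring_family :: "'a ring_family"
  is "(1, \<lambda>R. if cring R then \<one>\<^bsub>R\<^esub> else undefined)"
  by (auto simp: local_component_def cring.cring_simprules)

lift_definition plus_ring_family :: "'a ring_family \<Rightarrow> 'a ring_family \<Rightarrow> 'a ring_family"
  is "\<lambda>(m, f) (n, g). (m + n, \<lambda>R. if cring R then f R \<oplus>\<^bsub>R\<^esub> g R else undefined)"
  by (auto simp: local_component_def cring.cring_simprules split: if_splits)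

lift_definition times_ring_family :: "'a ring_family \<Rightarrow> 'a ring_family \<Rightarrow> 'a ring_family"
  is "\<lambda>(m, f) (n, g). (m * n, \<lambda>R. if cring R then f R \<otimes>\<^bsub>R\<^esub> g R else undefined)"
  by (auto simp: local_component_def cring.cring_simprules split: if_splits)

lift_definition uminus_ring_family :: "'a ring_family \<Rightarrow> 'a ring_family"
  is "\<lambda>(m, f). (- m, \<lambda>R. if cring R then \<ominus>\<^bsub>R\<^esub> f R else undefined)"
  by (auto simp: local_component_def cring.cring_simprules split: if_splits)

definition minus_ring_family :: "'a ring_family \<Rightarrow> 'a ring_family \<Rightarrow> 'a ring_family" where
  "minus_ring_family x y = x + - y"

instance
proof
  fix a b c :: "'a ring_family"
  show "a + b + c = a + (b + c)"
    by transfer (fastforce simp: local_component_def fun_eq_iff cring.cring_simprules split: if_splits)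
  show "a + b = b + a"
    by transfer (fastforce simp: local_component_def fun_eq_iff cring.cring_simprules split: if_splits)
  show "a * b * c = a * (b * c)"
    by transfer (fastforce simp: local_component_def fun_eq_iff cring.cring_simprules split: if_splits)
  show "a * b = b * a"
    by transfer (fastforce simp: local_component_def fun_eq_iff cring.cring_simprules split: if_splits)
  show "0 + a = a"
    by transfer (fastforce simp: local_component_def fun_eq_iff cring.cring_simprules split: if_splits)
  show "1 * a = a"
  proof -
    have "(\<lambda>R. if cring R then (if cring R then \<one>\<^bsub>R\<^esub> else undefined) \<otimes>\<^bsub>R\<^esub> f R else undefined) = f"
      if "\<forall>R. f R \<in> local_component R" for f :: "'a ring \<Rightarrow> 'a"
    proof
      fix R
      have "f R \<in> local_component R" using that ..
      then show "(if cring R then (if cring R then \<one>\<^bsub>R\<^esub> else undefined) \<otimes>\<^bsub>R\<^esub> f R else undefined) = f R"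
        by (cases "cring R") (simp_all add: local_component_def cring.cring_simprules)
    qed
    then show ?thesis
    proof (transfer, goal_cases)
      case (1 a)
      then show ?case by (cases a) simp
    qed
  qed
  show "- a + a = 0"
    by transfer (fastforce simp: local_component_def fun_eq_iff cring.cring_simprules split: if_splits)
  show "a - b = a + - b"
    by (simp add: minus_ring_family_def)
  show "(a + b) * c = a * c + b * c"
    by transfer (auto simp: local_component_def fun_eq_iff cring.cring_simprules distrib_right split: if_splits)
  show "(0 :: 'a ring_family) \<noteq> 1"
    by transfer simp
qed

end

lift_definition component :: "'a ring \<Rightarrow> 'a ring_family \<Rightarrow> 'a" is "\<lambda>R (n, f). f R" .

lemma component_homs:
  assumes "cring R"
  shows "component R u \<in> carrier R"
    and "\<zero>\<^bsub>R\<^esub> = component R 0"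
    and "\<one>\<^bsub>R\<^esub> = component R 1"
    and "component R u \<oplus>\<^bsub>R\<^esub> component R v = component R (u + v)"
    and "component R u \<otimes>\<^bsub>R\<^esub> component R v = component R (u * v)"
    and "\<ominus>\<^bsub>R\<^esub> component R u = component R (- u)"
    and "component R u \<ominus>\<^bsub>R\<^esub> component R v = component R (u - v)"
    and "component R u [^]\<^bsub>R\<^esub> (n::nat) = component R (u ^ n)"
proof -
  interpret cring R by fact
  show 1: "component R u \<in> carrier R" for u
    using assms by (transfer) (auto simp: local_component_def split: if_splits)
  show "\<zero>\<^bsub>R\<^esub> = component R 0" using assms by transfer auto
  show one: "\<one>\<^bsub>R\<^esub> = component R 1" using assms by transfer auto
  show add: "component R u \<oplus>\<^bsub>R\<^esub> component R v = component R (u + v)" for u v using assms by transfer auto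
  show mult: "component R u \<otimes>\<^bsub>R\<^esub> component R v = component R (u * v)" for u v using assms by transfer auto
  show um: "\<ominus>\<^bsub>R\<^esub> component R u = component R (- u)" for u using assms by transfer auto
  show "component R u \<ominus>\<^bsub>R\<^esub> component R v = component R (u - v)"
    by (simp add: a_minus_def um add)
  show "component R u [^]\<^bsub>R\<^esub> (n::nat) = component R (u ^ n)"
    by (induction n) (simp_all add: one mult mult.commute)
qed

lemma component_ex:
  assumes "cring R" "x \<in> carrier R"
  shows "\<exists>u. x = component R u"
proof -
  define f where "f = (\<lambda>R'. if R' = R then x else if cring R' then \<zero>\<^bsub>R'\<^esub> else undefined)"
  have "\<forall>R'. f R' \<in> local_component R'"
    using assms by (auto simp: f_def local_component_def cring.cring_simprules)
  then have "component R (Abs_ring_family (0, f)) = x"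
    by (simp add: component.rep_eq Abs_ring_family_inverse f_def)
  then show ?thesis by metis
qed

section \<open>Clifford algebras of binary quadratic forms\<close>

text \<open>The algebra generated by \<open>u\<close> and \<open>v\<close> with \<open>u\<^sup>2 = a\<close>, \<open>v\<^sup>2 = e\<close> and
  \<open>uv + vu = 2t\<close>, in the basis \<open>1, u, v, j\<close> where \<open>uv = t + j\<close>; thus \<open>j\<^sup>2 = d = t\<^sup>2 - ae\<close> and
  \<open>j\<close> anticommutes with \<open>u\<close> and \<open>v\<close>. Over a field with \<open>a \<noteq> 0\<close> it is the quaternion algebra
  \<open>(a, d)\<close>, but it stays Azumaya where \<open>a\<close> vanishes, as long as \<open>2d\<close> is invertible. This is what extends
  the symbol from the function field to the whole surface by a free Azumaya algebra.\<close>

definition clifford_table :: "('a, 'm) ring_scheme \<Rightarrow> 'a \<Rightarrow> 'a \<Rightarrow> 'a \<Rightarrow> 'a list list list" where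
  "clifford_table R a t e =
     (let o1 = \<one>\<^bsub>R\<^esub>; z = \<zero>\<^bsub>R\<^esub>; n = (\<lambda>x. \<ominus>\<^bsub>R\<^esub> x) in
         [[[o1, z, z, z], [z, o1, z, z], [z, z, o1, z], [z, z, z, o1]],
           [[z, o1, z, z], [a, z, z, z], [t, z, z, o1], [z, n t, a, z]],
           [[z, z, o1, z], [t, z, z, n o1], [e, z, z, z], [z, n e, t, z]],
           [[z, z, z, o1], [z, t, n a, z], [z, e, n t, z], [t \<otimes>\<^bsub>R\<^esub> t \<ominus>\<^bsub>R\<^esub> a \<otimes>\<^bsub>R\<^esub> e, z, z, z]]])"

definition clifford :: "('a, 'm) ring_scheme \<Rightarrow> 'a \<Rightarrow> 'a \<Rightarrow> 'a \<Rightarrow> 'a falg" where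
  "clifford R a t e =
     \<lparr>rank = 4,
      sc = (\<lambda>i j k. if i < 4 \<and> j < 4 \<and> k < 4 then clifford_table R a t e ! i ! j ! k else \<zero>\<^bsub>R\<^esub>),
      unity = (\<lambda>k. if k = 0 then \<one>\<^bsub>R\<^esub> else \<zero>\<^bsub>R\<^esub>)\<rparr>"

lemma rank_clifford [simp]: "rank (clifford R a t e) = 4"
  by (simp add: clifford_def)

lemma unity_clifford [simp]: "unity (clifford R a t e) k = (if k = 0 then \<one>\<^bsub>R\<^esub> else \<zero>\<^bsub>R\<^esub>)"
  by (simp add: clifford_def)

lemma sc_clifford:
  "i < 4 \<Longrightarrow> j < 4 \<Longrightarrow> k < 4 \<Longrightarrow> sc (clifford R a t e) i j k = clifford_table R a t e ! i ! j ! k"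
  by (simp add: clifford_def)

definition quad :: "'a \<Rightarrow> 'a \<Rightarrow> 'a \<Rightarrow> 'a \<Rightarrow> nat \<Rightarrow> 'a" where
  "quad x0 x1 x2 x3 = (\<lambda>k\<in>{..<4}. [x0, x1, x2, x3] ! k)"

lemma lt4: "k < 4 \<longleftrightarrow> k = 0 \<or> k = 1 \<or> k = 2 \<or> k = (3 :: nat)"
  by auto

lemma quad_nth [simp]:
  "quad x0 x1 x2 x3 0 = x0" "quad x0 x1 x2 x3 (Suc 0) = x1"
  "quad x0 x1 x2 x3 2 = x2" "quad x0 x1 x2 x3 3 = x3"
  by (simp_all add: quad_def)

lemma quad_eqI:
  assumes "v \<in> extensional {..<4}" "v 0 = x0" "v 1 = x1" "v 2 = x2" "v 3 = x3"
  shows "v = quad x0 x1 x2 x3"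
proof
  fix k
  show "v k = quad x0 x1 x2 x3 k"
  proof (cases "k < 4")
    case True
    then show ?thesis using assms unfolding lt4 by auto
  next
    case False
    then show ?thesis using assms(1) by (simp add: quad_def extensional_def)
  qed
qed

lemma quad_eq_iff [simp]:
  "quad x0 x1 x2 x3 = quad y0 y1 y2 y3 \<longleftrightarrow> x0 = y0 \<and> x1 = y1 \<and> x2 = y2 \<and> x3 = y3"
  by (metis quad_nth)

lemma quad_mem [simp]:
  "quad x0 x1 x2 x3 \<in> {..<4} \<rightarrow>\<^sub>E S \<longleftrightarrow> x0 \<in> S \<and> x1 \<in> S \<and> x2 \<in> S \<and> x3 \<in> S"
proof
  assume "quad x0 x1 x2 x3 \<in> {..<4} \<rightarrow>\<^sub>E S"
  then have "quad x0 x1 x2 x3 k \<in> S" if "k < 4" for k using that by auto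
  from this[of 0] this[of 1] this[of 2] this[of 3]
  show "x0 \<in> S \<and> x1 \<in> S \<and> x2 \<in> S \<and> x3 \<in> S" by simp
next
  assume "x0 \<in> S \<and> x1 \<in> S \<and> x2 \<in> S \<and> x3 \<in> S"
  then show "quad x0 x1 x2 x3 \<in> {..<4} \<rightarrow>\<^sub>E S"
    by (auto simp: quad_def PiE_def extensional_def Pi_def lt4)
qed

lemma quad_cases:
  assumes "v \<in> {..<4} \<rightarrow>\<^sub>E S"
  obtains x0 x1 x2 x3 where "v = quad x0 x1 x2 x3" "x0 \<in> S" "x1 \<in> S" "x2 \<in> S" "x3 \<in> S"
proof
  show "v = quad (v 0) (v 1) (v 2) (v 3)"
    using assms by (intro quad_eqI) (auto simp: PiE_def)
qed (use assms in auto)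

lemma (in ring) finsum_lessThan_4:
  assumes "f 0 \<in> carrier R" "f 1 \<in> carrier R" "f 2 \<in> carrier R" "f 3 \<in> carrier R"
  shows "(\<Oplus>i\<in>{..<4::nat}. f i) = f 0 \<oplus> f 1 \<oplus> f 2 \<oplus> f 3"
proof -
  have "{..<4::nat} = {0, 1, 2, 3}" by auto
  then show ?thesis using assms by (simp add: a_ac)
qed

text \<open>Outside the carrier the multiplications may differ, so the two rings need not be equal.\<close>

lemma (in ring) alg_ring_mult_cong:
  assumes rank: "rank A' = rank A"
    and sc: "\<And>i j k. i < rank A \<Longrightarrow> j < rank A \<Longrightarrow> k < rank A \<Longrightarrow> sc A i j k \<in> carrier R \<and> sc A' i j k = sc A i j k"
    and v: "v \<in> carrier (alg_ring R A)" and w: "w \<in> carrier (alg_ring R A)"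
  shows "v \<otimes>\<^bsub>alg_ring R A'\<^esub> w = v \<otimes>\<^bsub>alg_ring R A\<^esub> w"
proof -
  have c: "v i \<in> carrier R" "w i \<in> carrier R" if "i < rank A" for i
    using v w that by (auto simp: alg_ring_def)
  have "(\<Oplus>i\<in>{..<rank A}. \<Oplus>j\<in>{..<rank A}. v i \<otimes> w j \<otimes> sc A' i j k) =
        (\<Oplus>i\<in>{..<rank A}. \<Oplus>j\<in>{..<rank A}. v i \<otimes> w j \<otimes> sc A i j k)" if k: "k < rank A" for k
  proof (rule finsum_cong')
    fix i assume i: "i \<in> {..<rank A}"
    show "(\<Oplus>j\<in>{..<rank A}. v i \<otimes> w j \<otimes> sc A' i j k) = (\<Oplus>j\<in>{..<rank A}. v i \<otimes> w j \<otimes> sc A i j k)"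
      using i k sc by (intro finsum_cong') (auto intro!: c m_closed)
  qed (use k sc in \<open>auto intro!: c m_closed finsum_closed\<close>)
  then show ?thesis
    by (auto simp: alg_ring_def rank fun_eq_iff restrict_def)
qed

locale clifford_algebra = cring R for R :: "'a ring" (structure) +
  fixes a t e :: 'a
  assumes a [simp, intro]: "a \<in> carrier R" and t [simp, intro]: "t \<in> carrier R" and e [simp, intro]: "e \<in> carrier R"
begin

abbreviation B where "B \<equiv> alg_ring R (clifford R a t e)"
definition d where "d = t \<otimes> t \<ominus> a \<otimes> e"

lemma d_closed [simp, intro]: "d \<in> carrier R" by (simp add: d_def)

lemma carrier_B: "carrier B = {..<4} \<rightarrow>\<^sub>E carrier R"
  by (simp add: alg_ring_def)

lemma quad_closed [simp]:
  "quad x0 x1 x2 x3 \<in> carrier B \<longleftrightarrow>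
     x0 \<in> carrier R \<and> x1 \<in> carrier R \<and> x2 \<in> carrier R \<and> x3 \<in> carrier R"
  by (simp add: carrier_B)

lemma B_cases:
  assumes "v \<in> carrier B"
  obtains x0 x1 x2 x3 where "v = quad x0 x1 x2 x3"
    "x0 \<in> carrier R" "x1 \<in> carrier R" "x2 \<in> carrier R" "x3 \<in> carrier R"
  using assms unfolding carrier_B by (rule quad_cases)

lemma zero_B: "\<zero>\<^bsub>B\<^esub> = quad \<zero> \<zero> \<zero> \<zero>"
  by (rule quad_eqI) (simp_all add: alg_ring_def)

lemma one_B: "\<one>\<^bsub>B\<^esub> = quad \<one> \<zero> \<zero> \<zero>"
  by (rule quad_eqI) (simp_all add: alg_ring_def clifford_def Let_def)

lemma add_B:
  "quad x0 x1 x2 x3 \<oplus>\<^bsub>B\<^esub> quad y0 y1 y2 y3 = quad (x0 \<oplus> y0) (x1 \<oplus> y1) (x2 \<oplus> y2) (x3 \<oplus> y3)"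
  by (rule quad_eqI) (simp_all add: alg_ring_def)

lemma smult_B:
  "alg_smult R (clifford R a t e) r (quad y0 y1 y2 y3) = quad (r \<otimes> y0) (r \<otimes> y1) (r \<otimes> y2) (r \<otimes> y3)"
  by (rule quad_eqI) (simp_all add: alg_smult_def)

definition mul :: "nat \<Rightarrow> 'a \<Rightarrow> 'a \<Rightarrow> 'a \<Rightarrow> 'a \<Rightarrow> 'a \<Rightarrow> 'a \<Rightarrow> 'a \<Rightarrow> 'a \<Rightarrow> 'a" where
  "mul k x0 x1 x2 x3 y0 y1 y2 y3 =
    [x0 \<otimes> y0 \<oplus> a \<otimes> (x1 \<otimes> y1) \<oplus> t \<otimes> (x1 \<otimes> y2 \<oplus> x2 \<otimes> y1) \<oplus> e \<otimes> (x2 \<otimes> y2) \<oplus> (t \<otimes> t \<ominus> a \<otimes> e) \<otimes> (x3 \<otimes> y3),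
     x0 \<otimes> y1 \<oplus> x1 \<otimes> y0 \<oplus> t \<otimes> (x3 \<otimes> y1 \<ominus> x1 \<otimes> y3) \<ominus> e \<otimes> (x2 \<otimes> y3 \<ominus> x3 \<otimes> y2),
     x0 \<otimes> y2 \<oplus> x2 \<otimes> y0 \<oplus> a \<otimes> (x1 \<otimes> y3 \<ominus> x3 \<otimes> y1) \<oplus> t \<otimes> (x2 \<otimes> y3 \<ominus> x3 \<otimes> y2),
     x0 \<otimes> y3 \<oplus> x3 \<otimes> y0 \<oplus> x1 \<otimes> y2 \<ominus> x2 \<otimes> y1] ! k"

lemma mult_B:
  assumes c: "x0 \<in> carrier R" "x1 \<in> carrier R" "x2 \<in> carrier R" "x3 \<in> carrier R"
    "y0 \<in> carrier R" "y1 \<in> carrier R" "y2 \<in> carrier R" "y3 \<in> carrier R"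
  shows "quad x0 x1 x2 x3 \<otimes>\<^bsub>B\<^esub> quad y0 y1 y2 y3 =
    quad (mul 0 x0 x1 x2 x3 y0 y1 y2 y3) (mul 1 x0 x1 x2 x3 y0 y1 y2 y3)
      (mul 2 x0 x1 x2 x3 y0 y1 y2 y3) (mul 3 x0 x1 x2 x3 y0 y1 y2 y3)" (is "?l = _")
proof -
  define x where "x = (\<lambda>i. quad x0 x1 x2 x3 i)"
  define y where "y = (\<lambda>j. quad y0 y1 y2 y3 j)"
  define s where "s = sc (clifford R a t e)"
  have x: "x i \<in> carrier R" if "i < 4" for i using c that by (auto simp: x_def lt4)
  have y: "y i \<in> carrier R" if "i < 4" for i using c that by (auto simp: y_def lt4)
  have s: "s i j k \<in> carrier R" if "i < 4" "j < 4" "k < 4" for i j k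
    using that by (simp add: s_def sc_clifford) (auto simp: lt4 clifford_table_def Let_def)
  have l: "?l k = x 0 \<otimes> y 0 \<otimes> s 0 0 k \<oplus> x 0 \<otimes> y 1 \<otimes> s 0 1 k \<oplus> x 0 \<otimes> y 2 \<otimes> s 0 2 k \<oplus> x 0 \<otimes> y 3 \<otimes> s 0 3 k
     \<oplus> (x 1 \<otimes> y 0 \<otimes> s 1 0 k \<oplus> x 1 \<otimes> y 1 \<otimes> s 1 1 k \<oplus> x 1 \<otimes> y 2 \<otimes> s 1 2 k \<oplus> x 1 \<otimes> y 3 \<otimes> s 1 3 k)
     \<oplus> (x 2 \<otimes> y 0 \<otimes> s 2 0 k \<oplus> x 2 \<otimes> y 1 \<otimes> s 2 1 k \<oplus> x 2 \<otimes> y 2 \<otimes> s 2 2 k \<oplus> x 2 \<otimes> y 3 \<otimes> s 2 3 k)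
     \<oplus> (x 3 \<otimes> y 0 \<otimes> s 3 0 k \<oplus> x 3 \<otimes> y 1 \<otimes> s 3 1 k \<oplus> x 3 \<otimes> y 2 \<otimes> s 3 2 k \<oplus> x 3 \<otimes> y 3 \<otimes> s 3 3 k)"
    if k: "k < 4" for k
  proof -
    have "?l k = (\<Oplus>i\<in>{..<4}. \<Oplus>j\<in>{..<4}. x i \<otimes> y j \<otimes> s i j k)"
      using k by (simp add: alg_ring_def x_def y_def s_def)
    also have "\<dots> = (\<Oplus>i\<in>{..<4}. x i \<otimes> y 0 \<otimes> s i 0 k \<oplus> x i \<otimes> y 1 \<otimes> s i 1 k \<oplus> x i \<otimes> y 2 \<otimes> s i 2 k \<oplus> x i \<otimes> y 3 \<otimes> s i 3 k)"
      using k by (intro finsum_cong') (auto simp: finsum_lessThan_4 x y s)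
    also note finsum_lessThan_4
    finally show ?thesis
      using k by (simp add: x y s)
  qed
  note tr = c[THEN component_ex[OF is_cring]] a[THEN component_ex[OF is_cring]] t[THEN component_ex[OF is_cring]] e[THEN component_ex[OF is_cring]]
  have xy: "x 0 = x0" "x (Suc 0) = x1" "x 2 = x2" "x 3 = x3" "y 0 = y0" "y (Suc 0) = y1" "y 2 = y2" "y 3 = y3"
    by (simp_all add: x_def y_def)
  have k0: "0 < (4::nat)" and k1: "1 < (4::nat)" and k2: "2 < (4::nat)" and k3: "3 < (4::nat)" by simp_all
  have sl: "s i j k = clifford_table R a t e ! i ! j ! k" if "i < 4" "j < 4" "k < 4" for i j k
    using that by (simp add: s_def sc_clifford)
  note sl0 = sl[OF k0 k0] sl[OF k0 k1] sl[OF k0 k2] sl[OF k0 k3]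
  note sl1 = sl[OF k1 k0] sl[OF k1 k1] sl[OF k1 k2] sl[OF k1 k3]
  note sl2 = sl[OF k2 k0] sl[OF k2 k1] sl[OF k2 k2] sl[OF k2 k3]
  note sl3 = sl[OF k3 k0] sl[OF k3 k1] sl[OF k3 k2] sl[OF k3 k3]
  note st = clifford_table_def Let_def nth_Cons_0 nth_Cons_Suc numeral_2_eq_2 numeral_3_eq_3 One_nat_def mul_def xy[unfolded numeral_2_eq_2 numeral_3_eq_3]
  have 0: "?l 0 = mul 0 x0 x1 x2 x3 y0 y1 y2 y3"
    unfolding l[OF k0] sl0[OF k0] sl1[OF k0] sl2[OF k0] sl3[OF k0] unfolding st
    using tr
    by (elim exE, hypsubst, simp only: component_homs[OF is_cring], simp add: algebra_simps)
  have 1: "?l 1 = mul 1 x0 x1 x2 x3 y0 y1 y2 y3"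
    unfolding l[OF k1] sl0[OF k1] sl1[OF k1] sl2[OF k1] sl3[OF k1] unfolding st
    using tr
    by (elim exE, hypsubst, simp only: component_homs[OF is_cring], simp add: algebra_simps)
  have 2: "?l 2 = mul 2 x0 x1 x2 x3 y0 y1 y2 y3"
    unfolding l[OF k2] sl0[OF k2] sl1[OF k2] sl2[OF k2] sl3[OF k2] unfolding st
    using tr
    by (elim exE, hypsubst, simp only: component_homs[OF is_cring], simp add: algebra_simps)
  have 3: "?l 3 = mul 3 x0 x1 x2 x3 y0 y1 y2 y3"
    unfolding l[OF k3] sl0[OF k3] sl1[OF k3] sl2[OF k3] sl3[OF k3] unfolding st
    using tr
    by (elim exE, hypsubst, simp only: component_homs[OF is_cring], simp add: algebra_simps)
  show ?thesis
    by (rule quad_eqI) (simp_all only: 0 1 2 3, simp add: alg_ring_def)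
qed

lemma mul_simps:
  "mul 0 x0 x1 x2 x3 y0 y1 y2 y3 = x0 \<otimes> y0 \<oplus> a \<otimes> (x1 \<otimes> y1) \<oplus> t \<otimes> (x1 \<otimes> y2 \<oplus> x2 \<otimes> y1) \<oplus> e \<otimes> (x2 \<otimes> y2) \<oplus> (t \<otimes> t \<ominus> a \<otimes> e) \<otimes> (x3 \<otimes> y3)"
  "mul (Suc 0) x0 x1 x2 x3 y0 y1 y2 y3 = x0 \<otimes> y1 \<oplus> x1 \<otimes> y0 \<oplus> t \<otimes> (x3 \<otimes> y1 \<ominus> x1 \<otimes> y3) \<ominus> e \<otimes> (x2 \<otimes> y3 \<ominus> x3 \<otimes> y2)"
  "mul 2 x0 x1 x2 x3 y0 y1 y2 y3 = x0 \<otimes> y2 \<oplus> x2 \<otimes> y0 \<oplus> a \<otimes> (x1 \<otimes> y3 \<ominus> x3 \<otimes> y1) \<oplus> t \<otimes> (x2 \<otimes> y3 \<ominus> x3 \<otimes> y2)"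
  "mul 3 x0 x1 x2 x3 y0 y1 y2 y3 = x0 \<otimes> y3 \<oplus> x3 \<otimes> y0 \<oplus> x1 \<otimes> y2 \<ominus> x2 \<otimes> y1"
  by (simp_all add: mul_def)

lemma mul_closed [simp, intro]:
  assumes "k < 4" "x0 \<in> carrier R" "x1 \<in> carrier R" "x2 \<in> carrier R" "x3 \<in> carrier R"
    "y0 \<in> carrier R" "y1 \<in> carrier R" "y2 \<in> carrier R" "y3 \<in> carrier R"
  shows "mul k x0 x1 x2 x3 y0 y1 y2 y3 \<in> carrier R"
  using assms(1) unfolding lt4 by (elim disjE) (simp_all add: mul_simps assms(2-))

lemmas tr_ex = component_ex[OF is_cring]
lemmas tr_par = a[THEN tr_ex] t[THEN tr_ex] e[THEN tr_ex]
lemmas tr_hom = component_homs[OF is_cring]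

lemma ring_B: "ring B"
proof (rule ringI)
  show "abelian_group B"
  proof (rule abelian_groupI)
    fix x y z assume "x \<in> carrier B" "y \<in> carrier B" "z \<in> carrier B"
    then show "x \<oplus>\<^bsub>B\<^esub> y \<oplus>\<^bsub>B\<^esub> z = x \<oplus>\<^bsub>B\<^esub> (y \<oplus>\<^bsub>B\<^esub> z)"
      by (elim B_cases) (simp add: add_B a_assoc)
  next
    fix x y assume "x \<in> carrier B" "y \<in> carrier B"
    then show "x \<oplus>\<^bsub>B\<^esub> y \<in> carrier B" "x \<oplus>\<^bsub>B\<^esub> y = y \<oplus>\<^bsub>B\<^esub> x"
      by (elim B_cases, simp add: add_B a_comm)+
  next
    fix x assume "x \<in> carrier B"
    then show "\<zero>\<^bsub>B\<^esub> \<oplus>\<^bsub>B\<^esub> x = x"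
      by (elim B_cases) (simp add: add_B zero_B)
    from \<open>x \<in> carrier B\<close> obtain x0 x1 x2 x3 where x: "x = quad x0 x1 x2 x3"
      "x0 \<in> carrier R" "x1 \<in> carrier R" "x2 \<in> carrier R" "x3 \<in> carrier R" by (rule B_cases)
    then show "\<exists>y\<in>carrier B. y \<oplus>\<^bsub>B\<^esub> x = \<zero>\<^bsub>B\<^esub>"
      by (intro bexI[of _ "quad (\<ominus> x0) (\<ominus> x1) (\<ominus> x2) (\<ominus> x3)"]) (simp_all add: add_B zero_B l_neg)
  qed (simp add: zero_B)
  show "monoid B"
  proof (rule monoidI)
    fix x y z assume "x \<in> carrier B" "y \<in> carrier B" "z \<in> carrier B"
    then show "x \<otimes>\<^bsub>B\<^esub> y \<otimes>\<^bsub>B\<^esub> z = x \<otimes>\<^bsub>B\<^esub> (y \<otimes>\<^bsub>B\<^esub> z)"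
    proof (elim B_cases)
      fix x0 x1 x2 x3 y0 y1 y2 y3 z0 z1 z2 z3
      assume q: "x = quad x0 x1 x2 x3" "y = quad y0 y1 y2 y3" "z = quad z0 z1 z2 z3"
        and c: "x0 \<in> carrier R" "x1 \<in> carrier R" "x2 \<in> carrier R" "x3 \<in> carrier R"
           "y0 \<in> carrier R" "y1 \<in> carrier R" "y2 \<in> carrier R" "y3 \<in> carrier R"
           "z0 \<in> carrier R" "z1 \<in> carrier R" "z2 \<in> carrier R" "z3 \<in> carrier R"
      show "x \<otimes>\<^bsub>B\<^esub> y \<otimes>\<^bsub>B\<^esub> z = x \<otimes>\<^bsub>B\<^esub> (y \<otimes>\<^bsub>B\<^esub> z)"
        apply (simp add: q mult_B c mul_simps)
        using c[THEN tr_ex] tr_par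
        by (elim exE, hypsubst, simp only: tr_hom, simp add: algebra_simps)
    qed
  next
    fix x y assume "x \<in> carrier B" "y \<in> carrier B"
    then show "x \<otimes>\<^bsub>B\<^esub> y \<in> carrier B"
      by (elim B_cases) (simp add: mult_B)
  next
    fix x assume "x \<in> carrier B"
    then obtain x0 x1 x2 x3 where x: "x = quad x0 x1 x2 x3"
      and c: "x0 \<in> carrier R" "x1 \<in> carrier R" "x2 \<in> carrier R" "x3 \<in> carrier R" by (rule B_cases)
    show "\<one>\<^bsub>B\<^esub> \<otimes>\<^bsub>B\<^esub> x = x"
      apply (simp add: x c mult_B one_B mul_simps)
      using c[THEN tr_ex] tr_par
      by (elim exE, hypsubst, simp only: tr_hom, simp add: algebra_simps)
    show "x \<otimes>\<^bsub>B\<^esub> \<one>\<^bsub>B\<^esub> = x"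
      apply (simp add: x c mult_B one_B mul_simps)
      using c[THEN tr_ex] tr_par
      by (elim exE, hypsubst, simp only: tr_hom, simp add: algebra_simps)
  qed (simp add: one_B)
  fix x y z assume xyz: "x \<in> carrier B" "y \<in> carrier B" "z \<in> carrier B"
  obtain x0 x1 x2 x3 where x: "x = quad x0 x1 x2 x3"
    and cx: "x0 \<in> carrier R" "x1 \<in> carrier R" "x2 \<in> carrier R" "x3 \<in> carrier R"
    using xyz(1) by (rule B_cases)
  obtain y0 y1 y2 y3 where y: "y = quad y0 y1 y2 y3"
    and cy: "y0 \<in> carrier R" "y1 \<in> carrier R" "y2 \<in> carrier R" "y3 \<in> carrier R"
    using xyz(2) by (rule B_cases)
  obtain z0 z1 z2 z3 where z: "z = quad z0 z1 z2 z3"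
    and cz: "z0 \<in> carrier R" "z1 \<in> carrier R" "z2 \<in> carrier R" "z3 \<in> carrier R"
    using xyz(3) by (rule B_cases)
  note c = cx cy cz
  show "(x \<oplus>\<^bsub>B\<^esub> y) \<otimes>\<^bsub>B\<^esub> z = x \<otimes>\<^bsub>B\<^esub> z \<oplus>\<^bsub>B\<^esub> y \<otimes>\<^bsub>B\<^esub> z"
    apply (simp add: x y z mult_B add_B c mul_simps)
    using c[THEN tr_ex] tr_par
    by (elim exE, hypsubst, simp only: tr_hom, simp add: algebra_simps)
  show "z \<otimes>\<^bsub>B\<^esub> (x \<oplus>\<^bsub>B\<^esub> y) = z \<otimes>\<^bsub>B\<^esub> x \<oplus>\<^bsub>B\<^esub> z \<otimes>\<^bsub>B\<^esub> y"
    apply (simp add: x y z mult_B add_B c mul_simps)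
    using c[THEN tr_ex] tr_par
    by (elim exE, hypsubst, simp only: tr_hom, simp add: algebra_simps)
qed

end

context clifford_algebra begin

abbreviation A where "A \<equiv> clifford R a t e"

sublocale B: ring B by (rule ring_B)

lemma is_algebra_clifford: "is_algebra R A"
  unfolding is_algebra_def
proof (intro conjI allI impI)
  fix i j k assume "i < rank A" "j < rank A" "k < rank A"
  then show "sc A i j k \<in> carrier R"
    by (simp add: sc_clifford) (auto simp: lt4 clifford_table_def Let_def)
qed (simp_all add: ring_B)

lemma minus_zero [simp]: "x \<in> carrier R \<Longrightarrow> x \<ominus> \<zero> = x"
  by (simp add: a_minus_def)

definition \<iota> where "\<iota> r = quad r \<zero> \<zero> \<zero>"
definition cj where "cj v = quad (v 0) (\<ominus> v 1) (\<ominus> v 2) (\<ominus> v 3)"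
definition trd where "trd v = v 0 \<oplus> v 0"
definition nrd where "nrd v = v 0 \<otimes> v 0 \<ominus> a \<otimes> (v 1 \<otimes> v 1) \<ominus> t \<otimes> (v 1 \<otimes> v 2 \<oplus> v 1 \<otimes> v 2)
   \<ominus> e \<otimes> (v 2 \<otimes> v 2) \<ominus> (t \<otimes> t \<ominus> a \<otimes> e) \<otimes> (v 3 \<otimes> v 3)"

lemma B_coord: "v \<in> carrier B \<Longrightarrow> k < 4 \<Longrightarrow> v k \<in> carrier R"
  by (auto simp: carrier_B)

lemma neg_B:
  assumes "x0 \<in> carrier R" "x1 \<in> carrier R" "x2 \<in> carrier R" "x3 \<in> carrier R"
  shows "\<ominus>\<^bsub>B\<^esub> quad x0 x1 x2 x3 = quad (\<ominus> x0) (\<ominus> x1) (\<ominus> x2) (\<ominus> x3)"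
  using assms by (intro B.minus_equality) (simp_all add: add_B zero_B l_neg)

lemma alg_scalar_eq: "r \<in> carrier R \<Longrightarrow> alg_scalar R A r = \<iota> r"
  by (simp add: alg_scalar_def one_B smult_B \<iota>_def)

lemma \<iota>_closed [simp, intro]: "r \<in> carrier R \<Longrightarrow> \<iota> r \<in> carrier B"
  by (simp add: \<iota>_def)

lemma \<iota>_hom: "\<iota> \<in> ring_hom R B"
  by (rule ring_hom_memI) (simp_all add: \<iota>_def mult_B add_B one_B mul_simps)

sublocale \<iota>: ring_hom_ring R B \<iota>
  by (rule ring_hom_ringI2) (simp_all add: ring_axioms ring_B \<iota>_hom)

lemma \<iota>_inj: "\<iota> r = \<iota> s \<longleftrightarrow> r = s"
  by (simp add: \<iota>_def)

lemma \<iota>_mult: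
  assumes "r \<in> carrier R" "v \<in> carrier B"
  shows "\<iota> r \<otimes>\<^bsub>B\<^esub> v = alg_smult R A r v" "v \<otimes>\<^bsub>B\<^esub> \<iota> r = alg_smult R A r v"
proof -
  obtain x0 x1 x2 x3 where x: "v = quad x0 x1 x2 x3"
    and c: "x0 \<in> carrier R" "x1 \<in> carrier R" "x2 \<in> carrier R" "x3 \<in> carrier R"
    using assms(2) by (rule B_cases)
  show "\<iota> r \<otimes>\<^bsub>B\<^esub> v = alg_smult R A r v" "v \<otimes>\<^bsub>B\<^esub> \<iota> r = alg_smult R A r v"
    using assms(1) by (simp_all add: x c \<iota>_def mult_B smult_B mul_simps m_comm)
qed

lemma \<iota>_comm: "r \<in> carrier R \<Longrightarrow> v \<in> carrier B \<Longrightarrow> v \<otimes>\<^bsub>B\<^esub> \<iota> r = \<iota> r \<otimes>\<^bsub>B\<^esub> v"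
  by (simp add: \<iota>_mult)

lemma cj_closed [simp, intro]: "v \<in> carrier B \<Longrightarrow> cj v \<in> carrier B"
  by (simp add: cj_def B_coord)
lemma trd_closed [simp, intro]: "v \<in> carrier B \<Longrightarrow> trd v \<in> carrier R"
  by (simp add: trd_def B_coord)
lemma nrd_closed [simp, intro]: "v \<in> carrier B \<Longrightarrow> nrd v \<in> carrier R"
  by (simp add: nrd_def B_coord)

lemma add_cj: "v \<in> carrier B \<Longrightarrow> v \<oplus>\<^bsub>B\<^esub> cj v = \<iota> (trd v)"
  by (elim B_cases) (simp add: cj_def \<iota>_def trd_def add_B r_neg)

lemma mult_cj:
  assumes "v \<in> carrier B"
  shows "v \<otimes>\<^bsub>B\<^esub> cj v = \<iota> (nrd v)" "cj v \<otimes>\<^bsub>B\<^esub> v = \<iota> (nrd v)"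
proof -
  obtain x0 x1 x2 x3 where x: "v = quad x0 x1 x2 x3"
    and c: "x0 \<in> carrier R" "x1 \<in> carrier R" "x2 \<in> carrier R" "x3 \<in> carrier R"
    using assms by (rule B_cases)
  show "v \<otimes>\<^bsub>B\<^esub> cj v = \<iota> (nrd v)"
    apply (simp add: x c cj_def \<iota>_def nrd_def mult_B mul_simps)
    using c[THEN tr_ex] tr_par
    by (elim exE, hypsubst, simp only: tr_hom, simp add: algebra_simps)
  show "cj v \<otimes>\<^bsub>B\<^esub> v = \<iota> (nrd v)"
    apply (simp add: x c cj_def \<iota>_def nrd_def mult_B mul_simps)
    using c[THEN tr_ex] tr_par
    by (elim exE, hypsubst, simp only: tr_hom, simp add: algebra_simps)
qed

lemma cj_mult:
  assumes "v \<in> carrier B" "w \<in> carrier B"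
  shows "cj (v \<otimes>\<^bsub>B\<^esub> w) = cj w \<otimes>\<^bsub>B\<^esub> cj v"
proof -
  obtain x0 x1 x2 x3 where x: "v = quad x0 x1 x2 x3"
    and cx: "x0 \<in> carrier R" "x1 \<in> carrier R" "x2 \<in> carrier R" "x3 \<in> carrier R"
    using assms(1) by (rule B_cases)
  obtain y0 y1 y2 y3 where y: "w = quad y0 y1 y2 y3"
    and cy: "y0 \<in> carrier R" "y1 \<in> carrier R" "y2 \<in> carrier R" "y3 \<in> carrier R"
    using assms(2) by (rule B_cases)
  note c = cx cy
  show ?thesis
    apply (simp add: x y c cj_def mult_B mul_simps)
    using c[THEN tr_ex] tr_par
    by (elim exE, hypsubst, simp only: tr_hom, simp add: algebra_simps)
qed

lemma trd_add: "v \<in> carrier B \<Longrightarrow> w \<in> carrier B \<Longrightarrow> trd (v \<oplus>\<^bsub>B\<^esub> w) = trd v \<oplus> trd w"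
  by (elim B_cases) (simp add: trd_def add_B a_ac)

lemma quadratic_equation:
  assumes v: "v \<in> carrier B"
  shows "v \<otimes>\<^bsub>B\<^esub> v = \<iota> (trd v) \<otimes>\<^bsub>B\<^esub> v \<ominus>\<^bsub>B\<^esub> \<iota> (nrd v)"
proof -
  have "\<iota> (trd v) \<otimes>\<^bsub>B\<^esub> v = v \<otimes>\<^bsub>B\<^esub> v \<oplus>\<^bsub>B\<^esub> \<iota> (nrd v)"
    using v by (simp add: add_cj[symmetric] B.l_distr mult_cj)
  then show ?thesis using v by (simp add: B.minus_eq B.a_assoc B.r_neg)
qed

end

section \<open>Dual bases and the Azumaya property\<close>

lemma (in abelian_monoid) transpose_sum_4:
  assumes "\<And>i j. i < 4 \<Longrightarrow> j < 4 \<Longrightarrow> m i j \<in> carrier G"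
  shows "(m 0 0 \<oplus> m 0 1 \<oplus> m 0 2 \<oplus> m 0 3) \<oplus> (m 1 0 \<oplus> m 1 1 \<oplus> m 1 2 \<oplus> m 1 3) \<oplus>
     (m 2 0 \<oplus> m 2 1 \<oplus> m 2 2 \<oplus> m 2 3) \<oplus> (m 3 0 \<oplus> m 3 1 \<oplus> m 3 2 \<oplus> m (3::nat) (3::nat)) =
    (m 0 0 \<oplus> m 1 0 \<oplus> m 2 0 \<oplus> m 3 0) \<oplus> (m 0 1 \<oplus> m 1 1 \<oplus> m 2 1 \<oplus> m 3 1) \<oplus>
     (m 0 2 \<oplus> m 1 2 \<oplus> m 2 2 \<oplus> m 3 2) \<oplus> (m 0 3 \<oplus> m 1 3 \<oplus> m 2 3 \<oplus> m 3 3)"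
  using assms by (simp add: a_ac)

text \<open>A twisted double sum over two bases, regrouped so that the inner sums become reduced traces.\<close>

lemma (in ring) enveloping_sums:
  assumes f: "\<And>i :: nat. i < 4 \<Longrightarrow> f i \<in> carrier R" and p: "\<And>i :: nat. i < 4 \<Longrightarrow> p i \<in> carrier R"
    and q: "\<And>i :: nat. i < 4 \<Longrightarrow> q i \<in> carrier R" and c: "\<And>i :: nat. i < 4 \<Longrightarrow> c i \<in> carrier R" and s: "s \<in> carrier R"
  shows "f (0::nat) \<otimes> s \<otimes> (p 0 \<otimes> q 0 \<otimes> c 0 \<oplus> p 1 \<otimes> q 0 \<otimes> c 1 \<oplus> p 2 \<otimes> q 0 \<otimes> c 2 \<oplus> p 3 \<otimes> q 0 \<otimes> c 3) \<oplus>
     f 1 \<otimes> s \<otimes> (p 0 \<otimes> q 1 \<otimes> c 0 \<oplus> p 1 \<otimes> q 1 \<otimes> c 1 \<oplus> p 2 \<otimes> q 1 \<otimes> c 2 \<oplus> p 3 \<otimes> q 1 \<otimes> c 3) \<oplus>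
     f 2 \<otimes> s \<otimes> (p 0 \<otimes> q 2 \<otimes> c 0 \<oplus> p 1 \<otimes> q 2 \<otimes> c 1 \<oplus> p 2 \<otimes> q 2 \<otimes> c 2 \<oplus> p 3 \<otimes> q 2 \<otimes> c 3) \<oplus>
     f 3 \<otimes> s \<otimes> (p 0 \<otimes> q 3 \<otimes> c 0 \<oplus> p 1 \<otimes> q 3 \<otimes> c 1 \<oplus> p 2 \<otimes> q 3 \<otimes> c 2 \<oplus> p 3 \<otimes> q (3::nat) \<otimes> c (3::nat)) =
     (f 0 \<otimes> (s \<otimes> p 0) \<otimes> q 0 \<oplus> f 1 \<otimes> (s \<otimes> p 0) \<otimes> q 1 \<oplus> f 2 \<otimes> (s \<otimes> p 0) \<otimes> q 2 \<oplus> f 3 \<otimes> (s \<otimes> p 0) \<otimes> q 3) \<otimes> c 0 \<oplus>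
     (f 0 \<otimes> (s \<otimes> p 1) \<otimes> q 0 \<oplus> f 1 \<otimes> (s \<otimes> p 1) \<otimes> q 1 \<oplus> f 2 \<otimes> (s \<otimes> p 1) \<otimes> q 2 \<oplus> f 3 \<otimes> (s \<otimes> p 1) \<otimes> q 3) \<otimes> c 1 \<oplus>
     (f 0 \<otimes> (s \<otimes> p 2) \<otimes> q 0 \<oplus> f 1 \<otimes> (s \<otimes> p 2) \<otimes> q 1 \<oplus> f 2 \<otimes> (s \<otimes> p 2) \<otimes> q 2 \<oplus> f 3 \<otimes> (s \<otimes> p 2) \<otimes> q 3) \<otimes> c 2 \<oplus>
     (f 0 \<otimes> (s \<otimes> p 3) \<otimes> q 0 \<oplus> f 1 \<otimes> (s \<otimes> p 3) \<otimes> q 1 \<oplus> f (2::nat) \<otimes> (s \<otimes> p 3) \<otimes> q 2 \<oplus> f 3 \<otimes> (s \<otimes> p 3) \<otimes> q 3) \<otimes> c 3"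
    (is "?a0 \<oplus> ?a1 \<oplus> ?a2 \<oplus> ?a3 = ?b0 \<oplus> ?b1 \<oplus> ?b2 \<oplus> ?b3")
proof -
  define m where "m = (\<lambda>l i. f l \<otimes> (s \<otimes> p i) \<otimes> q l \<otimes> c i)"
  have m: "m l i \<in> carrier R" if "l < 4" "i < 4" for l i :: nat using that f p q c s by (simp add: m_def)
  have a: "f l \<otimes> s \<otimes> (p 0 \<otimes> q l \<otimes> c 0 \<oplus> p 1 \<otimes> q l \<otimes> c 1 \<oplus> p 2 \<otimes> q l \<otimes> c 2 \<oplus> p 3 \<otimes> q l \<otimes> c 3) = m l 0 \<oplus> m l 1 \<oplus> m l 2 \<oplus> m l 3"
    if "l < 4" for l :: nat using that f p q c s by (simp add: m_def r_distr m_assoc)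
  have b: "(f 0 \<otimes> (s \<otimes> p i) \<otimes> q 0 \<oplus> f 1 \<otimes> (s \<otimes> p i) \<otimes> q 1 \<oplus> f 2 \<otimes> (s \<otimes> p i) \<otimes> q 2 \<oplus> f 3 \<otimes> (s \<otimes> p i) \<otimes> q 3) \<otimes> c i = m 0 i \<oplus> m 1 i \<oplus> m 2 i \<oplus> m 3 i"
    if "i < 4" for i :: nat using that f p q c s by (simp add: m_def l_distr)
  have k: "0 < (4::nat)" "1 < (4::nat)" "2 < (4::nat)" "3 < (4::nat)" by simp_all
  show ?thesis
    unfolding a[OF k(1)] a[OF k(2)] a[OF k(3)] a[OF k(4)] b[OF k(1)] b[OF k(2)] b[OF k(3)] b[OF k(4)]
    by (rule transpose_sum_4) (rule m)
qed

context clifford_algebra begin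

definition bas where "bas = (\<lambda>i. [quad \<one> \<zero> \<zero> \<zero>, quad \<zero> \<one> \<zero> \<zero>, quad \<zero> \<zero> \<one> \<zero>, quad \<zero> \<zero> \<zero> \<one>] ! i)"

text \<open>With \<open>\<delta> = 1/(2d)\<close>, the basis dual to \<open>bas\<close> for the reduced trace form
  \<open>(x, y) \<mapsto> trd (xy)\<close>. Its existence is exactly the nondegeneracy of this form.\<close>

definition dual where "dual \<delta> = (\<lambda>i. [quad (d \<otimes> \<delta>) \<zero> \<zero> \<zero>, quad \<zero> (\<ominus> (\<delta> \<otimes> e)) (\<delta> \<otimes> t) \<zero>,
   quad \<zero> (\<delta> \<otimes> t) (\<ominus> (\<delta> \<otimes> a)) \<zero>, quad \<zero> \<zero> \<zero> \<delta>] ! i)"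

lemma alg_basis_eq: "i < 4 \<Longrightarrow> alg_basis R A i = bas i"
proof -
  assume i: "i < 4"
  have "alg_basis R A i = quad (if 0 = i then \<one> else \<zero>) (if 1 = i then \<one> else \<zero>)
      (if 2 = i then \<one> else \<zero>) (if 3 = i then \<one> else \<zero>)"
    by (rule quad_eqI) (simp_all add: alg_basis_def)
  then show ?thesis using i unfolding lt4 by (elim disjE) (simp_all add: bas_def)
qed

lemma bas_simps: "bas 0 = quad \<one> \<zero> \<zero> \<zero>" "bas (Suc 0) = quad \<zero> \<one> \<zero> \<zero>"
    "bas 2 = quad \<zero> \<zero> \<one> \<zero>" "bas 3 = quad \<zero> \<zero> \<zero> \<one>"
  by (simp_all add: bas_def)

lemma dual_simps: "dual \<delta> 0 = quad (d \<otimes> \<delta>) \<zero> \<zero> \<zero>" "dual \<delta> (Suc 0) = quad \<zero> (\<ominus> (\<delta> \<otimes> e)) (\<delta> \<otimes> t) \<zero>"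
    "dual \<delta> 2 = quad \<zero> (\<delta> \<otimes> t) (\<ominus> (\<delta> \<otimes> a)) \<zero>" "dual \<delta> 3 = quad \<zero> \<zero> \<zero> \<delta>"
  by (simp_all add: dual_def)

lemma bas_closed [simp]: "i < 4 \<Longrightarrow> bas i \<in> carrier B"
  unfolding lt4 by (elim disjE) (simp_all add: bas_simps)

lemma dual_closed [simp]: "i < 4 \<Longrightarrow> \<delta> \<in> carrier R \<Longrightarrow> dual \<delta> i \<in> carrier B"
  unfolding lt4 by (elim disjE) (simp_all add: dual_simps)

context
  fixes \<delta> assumes \<delta>: "\<delta> \<in> carrier R" and inv2d: "(d \<oplus> d) \<otimes> \<delta> = \<one>"
begin

text \<open>The map \<open>x \<mapsto> \<Sum>\<^sub>i dual\<^sub>i x bas\<^sub>i\<close> has central values; it computes a reduced trace, and this is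
  what separates the coordinates in the enveloping algebra.\<close>

lemma sum_dual_bas:
  assumes v: "v \<in> carrier B"
  shows "dual \<delta> 0 \<otimes>\<^bsub>B\<^esub> v \<otimes>\<^bsub>B\<^esub> bas 0 \<oplus>\<^bsub>B\<^esub> dual \<delta> 1 \<otimes>\<^bsub>B\<^esub> v \<otimes>\<^bsub>B\<^esub> bas 1
     \<oplus>\<^bsub>B\<^esub> dual \<delta> 2 \<otimes>\<^bsub>B\<^esub> v \<otimes>\<^bsub>B\<^esub> bas 2 \<oplus>\<^bsub>B\<^esub> dual \<delta> 3 \<otimes>\<^bsub>B\<^esub> v \<otimes>\<^bsub>B\<^esub> bas 3 = \<iota> (trd v)" (is "?l = _")
proof -
  obtain x0 x1 x2 x3 where x: "v = quad x0 x1 x2 x3"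
    and c: "x0 \<in> carrier R" "x1 \<in> carrier R" "x2 \<in> carrier R" "x3 \<in> carrier R"
    using v by (rule B_cases)
  have "?l = \<iota> ((d \<oplus> d) \<otimes> \<delta> \<otimes> trd v)"
    apply (simp add: x c \<delta> \<iota>_def trd_def mult_B add_B mul_simps bas_simps dual_simps)
    unfolding d_def
    using c[THEN tr_ex] tr_par \<delta>[THEN tr_ex]
    by (elim exE, hypsubst, simp only: tr_hom, simp add: algebra_simps)
  then show ?thesis using v by (simp add: inv2d)
qed

lemma sum_bas_dual:
  assumes v: "v \<in> carrier B"
  shows "bas 0 \<otimes>\<^bsub>B\<^esub> v \<otimes>\<^bsub>B\<^esub> dual \<delta> 0 \<oplus>\<^bsub>B\<^esub> bas 1 \<otimes>\<^bsub>B\<^esub> v \<otimes>\<^bsub>B\<^esub> dual \<delta> 1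
     \<oplus>\<^bsub>B\<^esub> bas 2 \<otimes>\<^bsub>B\<^esub> v \<otimes>\<^bsub>B\<^esub> dual \<delta> 2 \<oplus>\<^bsub>B\<^esub> bas 3 \<otimes>\<^bsub>B\<^esub> v \<otimes>\<^bsub>B\<^esub> dual \<delta> 3 = \<iota> (trd v)" (is "?l = _")
proof -
  obtain x0 x1 x2 x3 where x: "v = quad x0 x1 x2 x3"
    and c: "x0 \<in> carrier R" "x1 \<in> carrier R" "x2 \<in> carrier R" "x3 \<in> carrier R"
    using v by (rule B_cases)
  have "?l = \<iota> ((d \<oplus> d) \<otimes> \<delta> \<otimes> trd v)"
    apply (simp add: x c \<delta> \<iota>_def trd_def mult_B add_B mul_simps bas_simps dual_simps)
    unfolding d_def
    using c[THEN tr_ex] tr_par \<delta>[THEN tr_ex]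
    by (elim exE, hypsubst, simp only: tr_hom, simp add: algebra_simps)
  then show ?thesis using v by (simp add: inv2d)
qed

lemma trd_dual_expansion:
  assumes v: "v \<in> carrier B"
  shows "\<iota> (trd (v \<otimes>\<^bsub>B\<^esub> dual \<delta> 0)) \<otimes>\<^bsub>B\<^esub> bas 0 \<oplus>\<^bsub>B\<^esub> \<iota> (trd (v \<otimes>\<^bsub>B\<^esub> dual \<delta> 1)) \<otimes>\<^bsub>B\<^esub> bas 1
     \<oplus>\<^bsub>B\<^esub> \<iota> (trd (v \<otimes>\<^bsub>B\<^esub> dual \<delta> 2)) \<otimes>\<^bsub>B\<^esub> bas 2 \<oplus>\<^bsub>B\<^esub> \<iota> (trd (v \<otimes>\<^bsub>B\<^esub> dual \<delta> 3)) \<otimes>\<^bsub>B\<^esub> bas 3 = v" (is "?l = _")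
proof -
  obtain x0 x1 x2 x3 where x: "v = quad x0 x1 x2 x3"
    and c: "x0 \<in> carrier R" "x1 \<in> carrier R" "x2 \<in> carrier R" "x3 \<in> carrier R"
    using v by (rule B_cases)
  have "?l = \<iota> ((d \<oplus> d) \<otimes> \<delta>) \<otimes>\<^bsub>B\<^esub> v"
    apply (simp add: x c \<delta> \<iota>_def trd_def mult_B add_B mul_simps bas_simps dual_simps)
    unfolding d_def
    using c[THEN tr_ex] tr_par \<delta>[THEN tr_ex]
    by (elim exE, hypsubst, simp only: tr_hom, simp add: algebra_simps)
  then show ?thesis using v by (simp add: inv2d)
qed

lemma trd_comm:
  assumes v: "v \<in> carrier B" and w: "w \<in> carrier B"
  shows "trd (v \<otimes>\<^bsub>B\<^esub> w) = trd (w \<otimes>\<^bsub>B\<^esub> v)"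
proof -
  obtain x0 x1 x2 x3 where x: "v = quad x0 x1 x2 x3"
    and cx: "x0 \<in> carrier R" "x1 \<in> carrier R" "x2 \<in> carrier R" "x3 \<in> carrier R"
    using v by (rule B_cases)
  obtain y0 y1 y2 y3 where y: "w = quad y0 y1 y2 y3"
    and cy: "y0 \<in> carrier R" "y1 \<in> carrier R" "y2 \<in> carrier R" "y3 \<in> carrier R"
    using w by (rule B_cases)
  note c = cx cy
  show ?thesis
    apply (simp add: x y c trd_def mult_B mul_simps)
    using c[THEN tr_ex] tr_par
    by (elim exE, hypsubst, simp only: tr_hom, simp add: algebra_simps)
qed

lemma trd_dual_bas:
  assumes "s < 4" "i < 4"
  shows "trd (dual \<delta> s \<otimes>\<^bsub>B\<^esub> bas i) = (if s = i then \<one> else \<zero>)"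
proof -
  have c: "trd (bas i \<otimes>\<^bsub>B\<^esub> dual \<delta> j) \<in> carrier R" if "j < 4" for j
    using that assms \<delta> by simp
  have lin: "\<iota> r0 \<otimes>\<^bsub>B\<^esub> bas 0 \<oplus>\<^bsub>B\<^esub> \<iota> r1 \<otimes>\<^bsub>B\<^esub> bas 1 \<oplus>\<^bsub>B\<^esub> \<iota> r2 \<otimes>\<^bsub>B\<^esub> bas 2 \<oplus>\<^bsub>B\<^esub> \<iota> r3 \<otimes>\<^bsub>B\<^esub> bas 3 = quad r0 r1 r2 r3"
    if "r0 \<in> carrier R" "r1 \<in> carrier R" "r2 \<in> carrier R" "r3 \<in> carrier R" for r0 r1 r2 r3
    using that by (simp add: \<iota>_mult bas_simps smult_B add_B)
  note lin = lin[unfolded One_nat_def]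
  have "bas i = quad (trd (bas i \<otimes>\<^bsub>B\<^esub> dual \<delta> 0)) (trd (bas i \<otimes>\<^bsub>B\<^esub> dual \<delta> 1))
     (trd (bas i \<otimes>\<^bsub>B\<^esub> dual \<delta> 2)) (trd (bas i \<otimes>\<^bsub>B\<^esub> dual \<delta> 3))"
    using assms by (subst trd_dual_expansion[symmetric]) (simp_all add: lin c)
  then have "bas i s = trd (bas i \<otimes>\<^bsub>B\<^esub> dual \<delta> s)"
    using assms(1) by (auto simp: lt4 dest!: fun_cong[of _ _ s])
  moreover have "bas i s = (if s = i then \<one> else \<zero>)"
    using assms unfolding lt4 by (elim disjE) (simp_all add: bas_simps)
  moreover have "trd (dual \<delta> s \<otimes>\<^bsub>B\<^esub> bas i) = trd (bas i \<otimes>\<^bsub>B\<^esub> dual \<delta> s)"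
    using assms \<delta> by (intro trd_comm) simp_all
  ultimately show ?thesis by simp
qed

end
end

context clifford_algebra begin

definition row where "row r i = quad (r (i, 0)) (r (i, 1)) (r (i, 2)) (r (i, 3::nat))"

lemma row_closed:
  assumes r: "r \<in> {..<4} \<times> {..<4} \<rightarrow>\<^sub>E carrier R" and "i < 4"
  shows "row r i \<in> carrier B"
proof -
  have "r (i, j) \<in> carrier R" if "j < 4" for j
    using assms that by auto
  then show ?thesis by (simp add: row_def)
qed

lemma enveloping_map_eq:
  assumes r: "r \<in> {..<4} \<times> {..<4} \<rightarrow>\<^sub>E carrier R" and v: "v \<in> carrier B"
  shows "enveloping_map R A r v = bas 0 \<otimes>\<^bsub>B\<^esub> v \<otimes>\<^bsub>B\<^esub> row r 0 \<oplus>\<^bsub>B\<^esub> bas 1 \<otimes>\<^bsub>B\<^esub> v \<otimes>\<^bsub>B\<^esub> row r 1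
    \<oplus>\<^bsub>B\<^esub> bas 2 \<otimes>\<^bsub>B\<^esub> v \<otimes>\<^bsub>B\<^esub> row r 2 \<oplus>\<^bsub>B\<^esub> bas 3 \<otimes>\<^bsub>B\<^esub> v \<otimes>\<^bsub>B\<^esub> row r (3::nat)"
proof -
  have rc: "r (i, j) \<in> carrier R" if "i < 4" "j < 4" for i j
    using r that by auto
  have row: "row r i \<in> carrier B" if "i < 4" for i
    using that by (simp add: row_def rc)
  have inner: "(\<Oplus>\<^bsub>B\<^esub>j\<in>{..<4}. alg_smult R A (r (i, j)) (alg_basis R A i \<otimes>\<^bsub>B\<^esub> v \<otimes>\<^bsub>B\<^esub> alg_basis R A j))
     = bas i \<otimes>\<^bsub>B\<^esub> v \<otimes>\<^bsub>B\<^esub> row r i" (is "?l = _") if i: "i < 4" for i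
  proof -
    have "?l = (\<Oplus>\<^bsub>B\<^esub>j\<in>{..<4}. bas i \<otimes>\<^bsub>B\<^esub> v \<otimes>\<^bsub>B\<^esub> (\<iota> (r (i, j)) \<otimes>\<^bsub>B\<^esub> bas j))"
    proof (rule B.finsum_cong')
      fix j :: nat assume "j \<in> {..<4}"
      then have j: "j < 4" by simp
      have "alg_smult R A (r (i, j)) (bas i \<otimes>\<^bsub>B\<^esub> v \<otimes>\<^bsub>B\<^esub> bas j) = \<iota> (r (i, j)) \<otimes>\<^bsub>B\<^esub> (bas i \<otimes>\<^bsub>B\<^esub> v) \<otimes>\<^bsub>B\<^esub> bas j"
        using i j v rc by (simp add: \<iota>_mult(1)[symmetric] B.m_assoc)
      also have "\<dots> = bas i \<otimes>\<^bsub>B\<^esub> v \<otimes>\<^bsub>B\<^esub> \<iota> (r (i, j)) \<otimes>\<^bsub>B\<^esub> bas j"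
        using i j v rc by (simp add: \<iota>_comm)
      finally show "alg_smult R A (r (i, j)) (alg_basis R A i \<otimes>\<^bsub>B\<^esub> v \<otimes>\<^bsub>B\<^esub> alg_basis R A j)
          = bas i \<otimes>\<^bsub>B\<^esub> v \<otimes>\<^bsub>B\<^esub> (\<iota> (r (i, j)) \<otimes>\<^bsub>B\<^esub> bas j)"
        using i j v rc by (simp add: alg_basis_eq B.m_assoc)
    qed (use i v rc in auto)
    also note B.finsum_lessThan_4
    also have "bas i \<otimes>\<^bsub>B\<^esub> v \<otimes>\<^bsub>B\<^esub> (\<iota> (r (i, 0)) \<otimes>\<^bsub>B\<^esub> bas 0) \<oplus>\<^bsub>B\<^esub> bas i \<otimes>\<^bsub>B\<^esub> v \<otimes>\<^bsub>B\<^esub> (\<iota> (r (i, 1)) \<otimes>\<^bsub>B\<^esub> bas 1)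
      \<oplus>\<^bsub>B\<^esub> bas i \<otimes>\<^bsub>B\<^esub> v \<otimes>\<^bsub>B\<^esub> (\<iota> (r (i, 2)) \<otimes>\<^bsub>B\<^esub> bas 2) \<oplus>\<^bsub>B\<^esub> bas i \<otimes>\<^bsub>B\<^esub> v \<otimes>\<^bsub>B\<^esub> (\<iota> (r (i, 3)) \<otimes>\<^bsub>B\<^esub> bas 3)
      = bas i \<otimes>\<^bsub>B\<^esub> v \<otimes>\<^bsub>B\<^esub> (\<iota> (r (i, 0)) \<otimes>\<^bsub>B\<^esub> bas 0 \<oplus>\<^bsub>B\<^esub> \<iota> (r (i, 1)) \<otimes>\<^bsub>B\<^esub> bas 1 \<oplus>\<^bsub>B\<^esub> \<iota> (r (i, 2)) \<otimes>\<^bsub>B\<^esub> bas 2 \<oplus>\<^bsub>B\<^esub> \<iota> (r (i, 3)) \<otimes>\<^bsub>B\<^esub> bas 3)"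
      using i v rc by (simp add: B.r_distr)
    also have "\<iota> (r (i, 0)) \<otimes>\<^bsub>B\<^esub> bas 0 \<oplus>\<^bsub>B\<^esub> \<iota> (r (i, 1)) \<otimes>\<^bsub>B\<^esub> bas 1 \<oplus>\<^bsub>B\<^esub> \<iota> (r (i, 2)) \<otimes>\<^bsub>B\<^esub> bas 2 \<oplus>\<^bsub>B\<^esub> \<iota> (r (i, 3)) \<otimes>\<^bsub>B\<^esub> bas 3 = row r i"
      using i rc by (simp add: \<iota>_mult bas_simps smult_B add_B row_def)
    finally show ?thesis using i v rc by simp
  qed
  have "enveloping_map R A r v = (\<Oplus>\<^bsub>B\<^esub>i\<in>{..<4}. bas i \<otimes>\<^bsub>B\<^esub> v \<otimes>\<^bsub>B\<^esub> row r i)"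
    using v by (simp add: enveloping_map_def) (intro B.finsum_cong', auto simp: inner row)
  also note B.finsum_lessThan_4
  finally show ?thesis using v row by simp
qed

context
  fixes \<delta> assumes \<delta>: "\<delta> \<in> carrier R" and inv2d: "(d \<oplus> d) \<otimes> \<delta> = \<one>"
begin

text \<open>The candidate for the coefficients of a given endomorphism in the enveloping algebra.\<close>

definition unrow :: "((nat \<Rightarrow> 'a) \<Rightarrow> nat \<Rightarrow> 'a) \<Rightarrow> nat \<Rightarrow> nat \<Rightarrow> 'a" where
  "unrow \<phi> s = dual \<delta> 0 \<otimes>\<^bsub>B\<^esub> dual \<delta> s \<otimes>\<^bsub>B\<^esub> \<phi> (bas 0) \<oplus>\<^bsub>B\<^esub> dual \<delta> 1 \<otimes>\<^bsub>B\<^esub> dual \<delta> s \<otimes>\<^bsub>B\<^esub> \<phi> (bas 1)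
    \<oplus>\<^bsub>B\<^esub> dual \<delta> 2 \<otimes>\<^bsub>B\<^esub> dual \<delta> s \<otimes>\<^bsub>B\<^esub> \<phi> (bas 2) \<oplus>\<^bsub>B\<^esub> dual \<delta> 3 \<otimes>\<^bsub>B\<^esub> dual \<delta> s \<otimes>\<^bsub>B\<^esub> \<phi> (bas 3)"

lemma unrow_enveloping_map:
  assumes r: "r \<in> {..<4} \<times> {..<4} \<rightarrow>\<^sub>E carrier R" and s: "s < 4"
  shows "unrow (enveloping_map R A r) s = row r s"
proof -
  have row: "row r i \<in> carrier B" if "i < 4" for i
    by (rule row_closed[OF r that])
  have k: "0 < (4::nat)" "1 < (4::nat)" "2 < (4::nat)" "3 < (4::nat)" by simp_all
  have "unrow (enveloping_map R A r) s = \<iota> (trd (dual \<delta> s \<otimes>\<^bsub>B\<^esub> bas 0)) \<otimes>\<^bsub>B\<^esub> row r 0 \<oplus>\<^bsub>B\<^esub> \<iota> (trd (dual \<delta> s \<otimes>\<^bsub>B\<^esub> bas 1)) \<otimes>\<^bsub>B\<^esub> row r 1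
     \<oplus>\<^bsub>B\<^esub> \<iota> (trd (dual \<delta> s \<otimes>\<^bsub>B\<^esub> bas 2)) \<otimes>\<^bsub>B\<^esub> row r 2 \<oplus>\<^bsub>B\<^esub> \<iota> (trd (dual \<delta> s \<otimes>\<^bsub>B\<^esub> bas 3)) \<otimes>\<^bsub>B\<^esub> row r 3"
    unfolding unrow_def
    unfolding enveloping_map_eq[OF r bas_closed[OF k(1)]] enveloping_map_eq[OF r bas_closed[OF k(2)]]
      enveloping_map_eq[OF r bas_closed[OF k(3)]] enveloping_map_eq[OF r bas_closed[OF k(4)]]
    using s \<delta> row by (subst B.enveloping_sums[of "dual \<delta>" bas bas "row r" "dual \<delta> s"]) (simp_all only: sum_dual_bas[OF \<delta> inv2d] bas_closed dual_closed B.m_closed k)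
  also have "\<dots> = row r s"
    using s row[OF k(1)] row[OF k(2)] row[OF k(3)] row[OF k(4)] unfolding trd_dual_bas[OF \<delta> inv2d s k(1)] trd_dual_bas[OF \<delta> inv2d s k(2)]
      trd_dual_bas[OF \<delta> inv2d s k(3)] trd_dual_bas[OF \<delta> inv2d s k(4)] unfolding lt4
    by (elim disjE) simp_all
  finally show ?thesis .
qed

lemma enveloping_map_unrow:
  assumes \<phi>: "\<phi> \<in> alg_endomorphisms R A" and v: "v \<in> carrier B"
  shows "bas 0 \<otimes>\<^bsub>B\<^esub> v \<otimes>\<^bsub>B\<^esub> unrow \<phi> 0 \<oplus>\<^bsub>B\<^esub> bas 1 \<otimes>\<^bsub>B\<^esub> v \<otimes>\<^bsub>B\<^esub> unrow \<phi> 1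
    \<oplus>\<^bsub>B\<^esub> bas 2 \<otimes>\<^bsub>B\<^esub> v \<otimes>\<^bsub>B\<^esub> unrow \<phi> 2 \<oplus>\<^bsub>B\<^esub> bas 3 \<otimes>\<^bsub>B\<^esub> v \<otimes>\<^bsub>B\<^esub> unrow \<phi> 3 = \<phi> v" (is "?l = _")
proof -
  have k: "0 < (4::nat)" "1 < (4::nat)" "2 < (4::nat)" "3 < (4::nat)" by simp_all
  have \<phi>c: "\<phi> w \<in> carrier B" if "w \<in> carrier B" for w
    using \<phi> that by (auto simp: alg_endomorphisms_def)
  have add: "\<phi> (w \<oplus>\<^bsub>B\<^esub> w') = \<phi> w \<oplus>\<^bsub>B\<^esub> \<phi> w'" if "w \<in> carrier B" "w' \<in> carrier B" for w w'
    using \<phi> that by (auto simp: alg_endomorphisms_def)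
  have lin: "\<phi> (\<iota> c \<otimes>\<^bsub>B\<^esub> w) = \<iota> c \<otimes>\<^bsub>B\<^esub> \<phi> w" if "c \<in> carrier R" "w \<in> carrier B" for c w
    using \<phi> that by (auto simp: alg_endomorphisms_def \<iota>_mult \<phi>c)
  have "?l = \<iota> (trd (v \<otimes>\<^bsub>B\<^esub> dual \<delta> 0)) \<otimes>\<^bsub>B\<^esub> \<phi> (bas 0) \<oplus>\<^bsub>B\<^esub> \<iota> (trd (v \<otimes>\<^bsub>B\<^esub> dual \<delta> 1)) \<otimes>\<^bsub>B\<^esub> \<phi> (bas 1)
     \<oplus>\<^bsub>B\<^esub> \<iota> (trd (v \<otimes>\<^bsub>B\<^esub> dual \<delta> 2)) \<otimes>\<^bsub>B\<^esub> \<phi> (bas 2) \<oplus>\<^bsub>B\<^esub> \<iota> (trd (v \<otimes>\<^bsub>B\<^esub> dual \<delta> 3)) \<otimes>\<^bsub>B\<^esub> \<phi> (bas 3)"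
    unfolding unrow_def
    using v \<delta> by (subst B.enveloping_sums[of bas "dual \<delta>" "dual \<delta>" "\<lambda>i. \<phi> (bas i)" v])
      (simp_all only: sum_bas_dual[OF \<delta> inv2d] bas_closed dual_closed \<phi>c B.m_closed k)
  also have "\<dots> = \<phi> (\<iota> (trd (v \<otimes>\<^bsub>B\<^esub> dual \<delta> 0)) \<otimes>\<^bsub>B\<^esub> bas 0 \<oplus>\<^bsub>B\<^esub> \<iota> (trd (v \<otimes>\<^bsub>B\<^esub> dual \<delta> 1)) \<otimes>\<^bsub>B\<^esub> bas 1
     \<oplus>\<^bsub>B\<^esub> \<iota> (trd (v \<otimes>\<^bsub>B\<^esub> dual \<delta> 2)) \<otimes>\<^bsub>B\<^esub> bas 2 \<oplus>\<^bsub>B\<^esub> \<iota> (trd (v \<otimes>\<^bsub>B\<^esub> dual \<delta> 3)) \<otimes>\<^bsub>B\<^esub> bas 3)"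
    using v \<delta> by (simp add: add lin)
  also have "\<dots> = \<phi> v" using v by (simp only: trd_dual_expansion[OF \<delta> inv2d])
  finally show ?thesis .
qed

text \<open>The trace sums over the dual basis give an explicit two-sided inverse of the enveloping map.\<close>

lemma azumaya_clifford: "azumaya R A"
  unfolding azumaya_def
proof (intro conjI is_algebra_clifford)
  let ?P = "{..<4} \<times> {..<4} \<rightarrow>\<^sub>E carrier R"
  let ?G = "\<lambda>\<phi>. \<lambda>(s, k)\<in>{..<4} \<times> {..<4}. unrow \<phi> s k"
  have unrow_closed: "unrow \<phi> s \<in> carrier B" if "\<phi> \<in> alg_endomorphisms R A" "s < 4" for \<phi> s
    using that \<delta> by (auto simp: unrow_def alg_endomorphisms_def intro!: B.a_closed B.m_closed)
  have G: "?G \<phi> \<in> ?P" if "\<phi> \<in> alg_endomorphisms R A" for \<phi>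
    using unrow_closed[OF that] by (auto simp: B_coord)
  have row_G: "row (?G \<phi>) s = unrow \<phi> s" if "\<phi> \<in> alg_endomorphisms R A" "s < 4" for \<phi> s
    using unrow_closed[OF that] that(2)
    by (auto simp: row_def carrier_B PiE_def intro!: quad_eqI[symmetric])
  have Env: "enveloping_map R A r \<in> alg_endomorphisms R A" if r: "r \<in> ?P" for r :: "nat \<times> nat \<Rightarrow> 'a"
  proof -
    have row: "row r i \<in> carrier B" if "i < 4" for i
      by (rule row_closed[OF r that])
    have lin: "p \<otimes>\<^bsub>B\<^esub> alg_smult R A c v \<otimes>\<^bsub>B\<^esub> q = \<iota> c \<otimes>\<^bsub>B\<^esub> (p \<otimes>\<^bsub>B\<^esub> v \<otimes>\<^bsub>B\<^esub> q)"
      if "p \<in> carrier B" "q \<in> carrier B" "v \<in> carrier B" "c \<in> carrier R" for p q c v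
    proof -
      have "p \<otimes>\<^bsub>B\<^esub> alg_smult R A c v \<otimes>\<^bsub>B\<^esub> q = (p \<otimes>\<^bsub>B\<^esub> \<iota> c) \<otimes>\<^bsub>B\<^esub> v \<otimes>\<^bsub>B\<^esub> q"
        using that by (simp add: \<iota>_mult(1)[symmetric] B.m_assoc)
      also have "\<dots> = (\<iota> c \<otimes>\<^bsub>B\<^esub> p) \<otimes>\<^bsub>B\<^esub> v \<otimes>\<^bsub>B\<^esub> q"
        using that by (simp only: \<iota>_comm)
      finally show ?thesis using that by (simp add: B.m_assoc)
    qed
    have lin': "p \<otimes>\<^bsub>B\<^esub> (\<iota> c \<otimes>\<^bsub>B\<^esub> v) \<otimes>\<^bsub>B\<^esub> q = \<iota> c \<otimes>\<^bsub>B\<^esub> (p \<otimes>\<^bsub>B\<^esub> v \<otimes>\<^bsub>B\<^esub> q)"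
      if "p \<in> carrier B" "q \<in> carrier B" "v \<in> carrier B" "c \<in> carrier R" for p q c v
      using lin[OF that] that by (simp add: \<iota>_mult(1))
    have smult_closed: "alg_smult R A c v \<in> carrier B" if "v \<in> carrier B" "c \<in> carrier R" for c v
      using that by (simp add: \<iota>_mult(1)[symmetric])
    show ?thesis
      unfolding alg_endomorphisms_def
    proof (intro CollectI conjI ballI)
      show "enveloping_map R A r \<in> carrier B \<rightarrow>\<^sub>E carrier B"
      proof (rule PiE_I)
        show "enveloping_map R A r v \<in> carrier B" if "v \<in> carrier B" for v
          using that by (simp add: enveloping_map_eq[OF r] row)
        show "enveloping_map R A r v = undefined" if "v \<notin> carrier B" for v
          using that by (simp add: enveloping_map_def)
      qed
      fix v assume v: "v \<in> carrier B"
      show "enveloping_map R A r (v \<oplus>\<^bsub>B\<^esub> w) = enveloping_map R A r v \<oplus>\<^bsub>B\<^esub> enveloping_map R A r w"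
        if "w \<in> carrier B" for w
        using row[of 0] row[of 1] row[of 2] row[of 3] v that
        by (simp add: enveloping_map_eq[OF r] B.l_distr B.r_distr B.a_ac)
      show "enveloping_map R A r (alg_smult R A c v) = alg_smult R A c (enveloping_map R A r v)"
        if "c \<in> carrier R" for c
        using row[of 0] row[of 1] row[of 2] row[of 3] v that
        by (simp add: enveloping_map_eq[OF r] smult_closed lin' \<iota>_mult(1)[symmetric] B.r_distr del: One_nat_def)
    qed
  qed
  show "bij_betw (enveloping_map R A) ({..<rank A} \<times> {..<rank A} \<rightarrow>\<^sub>E carrier R) (alg_endomorphisms R A)"
    unfolding rank_clifford
  proof (rule bij_betw_byWitness[where f' = ?G])
    show "\<forall>r\<in>?P. ?G (enveloping_map R A r) = r"
    proof
      fix r :: "nat \<times> nat \<Rightarrow> 'a" assume r: "r \<in> ?P"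
      show "?G (enveloping_map R A r) = r"
      proof
        fix x :: "nat \<times> nat"
        obtain s k where x: "x = (s, k)" by force
        show "?G (enveloping_map R A r) x = r x"
        proof (cases "s < 4 \<and> k < 4")
          case True
          then have "row r s k = r (s, k)" unfolding lt4 by (auto simp: row_def)
          then show ?thesis using True by (simp add: x unrow_enveloping_map[OF r])
        next
          case False
          then show ?thesis using r by (auto simp: x PiE_def extensional_def)
        qed
      qed
    qed
    show "\<forall>\<phi>\<in>alg_endomorphisms R A. enveloping_map R A (?G \<phi>) = \<phi>"
    proof
      fix \<phi> assume \<phi>: "\<phi> \<in> alg_endomorphisms R A"
      show "enveloping_map R A (?G \<phi>) = \<phi>"
      proof
        fix v
        show "enveloping_map R A (?G \<phi>) v = \<phi> v"
        proof (cases "v \<in> carrier B")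
          case True
          then show ?thesis
            by (simp only: enveloping_map_eq[OF G[OF \<phi>]] row_G[OF \<phi>] enveloping_map_unrow[OF \<phi>] lt4 simp_thms)
        next
          case False
          then show ?thesis
            using \<phi> by (auto simp: enveloping_map_def alg_endomorphisms_def PiE_def extensional_def)
        qed
      qed
    qed
  qed (intro image_subsetI, (erule Env | erule G))+
qed simp

end
end

text \<open>Only the values of the structure constants at indices below the rank agree.\<close>

lemma quaternion_alg_eq_clifford:
  assumes "cring K" "a \<in> carrier K" "b \<in> carrier K"
  shows "rank (quaternion_alg K a b) = 4" "unity (quaternion_alg K a b) = unity (clifford K a \<zero>\<^bsub>K\<^esub> b)"
    "i < 4 \<Longrightarrow> j < 4 \<Longrightarrow> k < 4 \<Longrightarrow> sc (quaternion_alg K a b) i j k = sc (clifford K a \<zero>\<^bsub>K\<^esub> b) i j k"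
proof -
  interpret cring K by fact
  have "clifford_table K a \<zero>\<^bsub>K\<^esub> b = 
         [[[\<one>\<^bsub>K\<^esub>, \<zero>\<^bsub>K\<^esub>, \<zero>\<^bsub>K\<^esub>, \<zero>\<^bsub>K\<^esub>], [\<zero>\<^bsub>K\<^esub>, \<one>\<^bsub>K\<^esub>, \<zero>\<^bsub>K\<^esub>, \<zero>\<^bsub>K\<^esub>], [\<zero>\<^bsub>K\<^esub>, \<zero>\<^bsub>K\<^esub>, \<one>\<^bsub>K\<^esub>, \<zero>\<^bsub>K\<^esub>], [\<zero>\<^bsub>K\<^esub>, \<zero>\<^bsub>K\<^esub>, \<zero>\<^bsub>K\<^esub>, \<one>\<^bsub>K\<^esub>]],
           [[\<zero>\<^bsub>K\<^esub>, \<one>\<^bsub>K\<^esub>, \<zero>\<^bsub>K\<^esub>, \<zero>\<^bsub>K\<^esub>], [a, \<zero>\<^bsub>K\<^esub>, \<zero>\<^bsub>K\<^esub>, \<zero>\<^bsub>K\<^esub>], [\<zero>\<^bsub>K\<^esub>, \<zero>\<^bsub>K\<^esub>, \<zero>\<^bsub>K\<^esub>, \<one>\<^bsub>K\<^esub>], [\<zero>\<^bsub>K\<^esub>, \<zero>\<^bsub>K\<^esub>, a, \<zero>\<^bsub>K\<^esub>]],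
           [[\<zero>\<^bsub>K\<^esub>, \<zero>\<^bsub>K\<^esub>, \<one>\<^bsub>K\<^esub>, \<zero>\<^bsub>K\<^esub>], [\<zero>\<^bsub>K\<^esub>, \<zero>\<^bsub>K\<^esub>, \<zero>\<^bsub>K\<^esub>, \<ominus>\<^bsub>K\<^esub> \<one>\<^bsub>K\<^esub>], [b, \<zero>\<^bsub>K\<^esub>, \<zero>\<^bsub>K\<^esub>, \<zero>\<^bsub>K\<^esub>], [\<zero>\<^bsub>K\<^esub>, \<ominus>\<^bsub>K\<^esub> b, \<zero>\<^bsub>K\<^esub>, \<zero>\<^bsub>K\<^esub>]],
           [[\<zero>\<^bsub>K\<^esub>, \<zero>\<^bsub>K\<^esub>, \<zero>\<^bsub>K\<^esub>, \<one>\<^bsub>K\<^esub>], [\<zero>\<^bsub>K\<^esub>, \<zero>\<^bsub>K\<^esub>, \<ominus>\<^bsub>K\<^esub> a, \<zero>\<^bsub>K\<^esub>], [\<zero>\<^bsub>K\<^esub>, b, \<zero>\<^bsub>K\<^esub>, \<zero>\<^bsub>K\<^esub>], [\<ominus>\<^bsub>K\<^esub> (a \<otimes>\<^bsub>K\<^esub> b), \<zero>\<^bsub>K\<^esub>, \<zero>\<^bsub>K\<^esub>, \<zero>\<^bsub>K\<^esub>]]]"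
    using assms(2,3) by (simp add: clifford_table_def Let_def a_minus_def)
  then show "i < 4 \<Longrightarrow> j < 4 \<Longrightarrow> k < 4 \<Longrightarrow> sc (quaternion_alg K a b) i j k = sc (clifford K a \<zero>\<^bsub>K\<^esub> b) i j k"
    by (simp add: sc_clifford quaternion_alg_def Let_def)
  show "rank (quaternion_alg K a b) = 4" "unity (quaternion_alg K a b) = unity (clifford K a \<zero>\<^bsub>K\<^esub> b)"
    by (simp_all add: quaternion_alg_def Let_def fun_eq_iff)
qed

lemma base_change_clifford:
  assumes "ring_hom_cring R S \<phi>" "a \<in> carrier R" "t \<in> carrier R" "e \<in> carrier R"
  shows "base_change \<phi> (clifford R a t e) = clifford S (\<phi> a) (\<phi> t) (\<phi> e)"
proof -
  interpret ring_hom_cring R S \<phi> by fact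
  have "\<phi> (clifford_table R a t e ! i ! j ! k) = clifford_table S (\<phi> a) (\<phi> t) (\<phi> e) ! i ! j ! k"
    if "i < 4" "j < 4" "k < 4" for i j k
  proof -
    have "map (map (map \<phi>)) (clifford_table R a t e) = clifford_table S (\<phi> a) (\<phi> t) (\<phi> e)"
      using assms(2-) by (simp add: clifford_table_def Let_def a_minus_def)
    moreover have "length (clifford_table R a t e) = 4" "length (clifford_table R a t e ! i) = 4" "length (clifford_table R a t e ! i ! j) = 4"
      using that by (auto simp: clifford_table_def Let_def lt4)
    ultimately show ?thesis using that by (metis nth_map)
  qed
  then show ?thesis by (auto simp: base_change_def clifford_def fun_eq_iff)
qed

definition alg_iso :: "('a, 'm) ring_scheme \<Rightarrow> 'a falg \<Rightarrow> 'a falg \<Rightarrow> bool" where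
  "alg_iso K A A' \<longleftrightarrow> (\<exists>h\<in>ring_iso (alg_ring K A) (alg_ring K A').
     \<forall>c\<in>carrier K. h (alg_scalar K A c) = alg_scalar K A' c)"

lemma alg_iso_sym:
  assumes "alg_iso K A A'" "ring (alg_ring K A)" "\<And>c. c \<in> carrier K \<Longrightarrow> alg_scalar K A c \<in> carrier (alg_ring K A)"
  shows "alg_iso K A' A"
proof -
  obtain h where h: "h \<in> ring_iso (alg_ring K A) (alg_ring K A')"
    "\<And>c. c \<in> carrier K \<Longrightarrow> h (alg_scalar K A c) = alg_scalar K A' c"
    using assms(1) by (auto simp: alg_iso_def)
  have inj: "inj_on h (carrier (alg_ring K A))" using h(1) by (auto simp: ring_iso_def bij_betw_def)
  have "inv_into (carrier (alg_ring K A)) h \<in> ring_iso (alg_ring K A') (alg_ring K A)"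
    by (rule ring_iso_set_sym) (fact assms(2) h(1))+
  moreover have "inv_into (carrier (alg_ring K A)) h (alg_scalar K A' c) = alg_scalar K A c" if "c \<in> carrier K" for c
    using inv_into_f_f[OF inj assms(3)[OF that]] h(2)[OF that] by simp
  ultimately show ?thesis unfolding alg_iso_def by blast
qed

lemma alg_iso_trans:
  assumes "alg_iso K A A'" "alg_iso K A' A''"
  shows "alg_iso K A A''"
proof -
  obtain h where h: "h \<in> ring_iso (alg_ring K A) (alg_ring K A')"
    "\<And>c. c \<in> carrier K \<Longrightarrow> h (alg_scalar K A c) = alg_scalar K A' c"
    using assms(1) by (auto simp: alg_iso_def)
  obtain g where g: "g \<in> ring_iso (alg_ring K A') (alg_ring K A'')"
    "\<And>c. c \<in> carrier K \<Longrightarrow> g (alg_scalar K A' c) = alg_scalar K A'' c"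
    using assms(2) by (auto simp: alg_iso_def)
  have "g \<circ> h \<in> ring_iso (alg_ring K A) (alg_ring K A'')"
    by (rule ring_iso_set_trans) (fact h(1) g(1))+
  then show ?thesis using h(2) g(2) by (auto simp: alg_iso_def intro!: bexI[of _ "g \<circ> h"])
qed

text \<open>A linear change of the generators \<open>u, v\<close> transforms the quadratic form; \<open>j\<close> is multiplied by the
  determinant.\<close>

lemma clifford_change_hom:
  assumes "clifford_algebra R a t e" and "clifford_algebra R a' t' e'"
    and pqrs: "p \<in> carrier R" "q \<in> carrier R" "r \<in> carrier R" "s \<in> carrier R"
    and a': "a' = a \<otimes>\<^bsub>R\<^esub> (p \<otimes>\<^bsub>R\<^esub> p) \<oplus>\<^bsub>R\<^esub> t \<otimes>\<^bsub>R\<^esub> (p \<otimes>\<^bsub>R\<^esub> q \<oplus>\<^bsub>R\<^esub> p \<otimes>\<^bsub>R\<^esub> q) \<oplus>\<^bsub>R\<^esub> e \<otimes>\<^bsub>R\<^esub> (q \<otimes>\<^bsub>R\<^esub> q)"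
    and t': "t' = a \<otimes>\<^bsub>R\<^esub> (p \<otimes>\<^bsub>R\<^esub> r) \<oplus>\<^bsub>R\<^esub> t \<otimes>\<^bsub>R\<^esub> (p \<otimes>\<^bsub>R\<^esub> s \<oplus>\<^bsub>R\<^esub> r \<otimes>\<^bsub>R\<^esub> q) \<oplus>\<^bsub>R\<^esub> e \<otimes>\<^bsub>R\<^esub> (q \<otimes>\<^bsub>R\<^esub> s)"
    and e': "e' = a \<otimes>\<^bsub>R\<^esub> (r \<otimes>\<^bsub>R\<^esub> r) \<oplus>\<^bsub>R\<^esub> t \<otimes>\<^bsub>R\<^esub> (r \<otimes>\<^bsub>R\<^esub> s \<oplus>\<^bsub>R\<^esub> r \<otimes>\<^bsub>R\<^esub> s) \<oplus>\<^bsub>R\<^esub> e \<otimes>\<^bsub>R\<^esub> (s \<otimes>\<^bsub>R\<^esub> s)"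
  shows "(\<lambda>v. quad (v 0) (p \<otimes>\<^bsub>R\<^esub> v 1 \<oplus>\<^bsub>R\<^esub> r \<otimes>\<^bsub>R\<^esub> v 2) (q \<otimes>\<^bsub>R\<^esub> v 1 \<oplus>\<^bsub>R\<^esub> s \<otimes>\<^bsub>R\<^esub> v 2) ((p \<otimes>\<^bsub>R\<^esub> s \<ominus>\<^bsub>R\<^esub> q \<otimes>\<^bsub>R\<^esub> r) \<otimes>\<^bsub>R\<^esub> v (3::nat)))
     \<in> ring_hom (alg_ring R (clifford R a' t' e')) (alg_ring R (clifford R a t e))" (is "?h \<in> _")
proof -
  interpret clifford_algebra R a t e by fact
  interpret B': clifford_algebra R a' t' e' by fact
  show ?thesis
  proof (rule ring_hom_memI)
    fix x y assume "x \<in> carrier B'.B" "y \<in> carrier B'.B"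
    from this(1) obtain x0 x1 x2 x3 where x: "x = quad x0 x1 x2 x3"
      and cx: "x0 \<in> carrier R" "x1 \<in> carrier R" "x2 \<in> carrier R" "x3 \<in> carrier R"
      by (rule B'.B_cases)
    from \<open>y \<in> carrier B'.B\<close> obtain y0 y1 y2 y3 where y: "y = quad y0 y1 y2 y3"
      and cy: "y0 \<in> carrier R" "y1 \<in> carrier R" "y2 \<in> carrier R" "y3 \<in> carrier R"
      by (rule B'.B_cases)
    note c = cx cy
    show "?h x \<in> carrier B" using pqrs by (simp add: x c)
    show "?h (x \<oplus>\<^bsub>B'.B\<^esub> y) = ?h x \<oplus>\<^bsub>B\<^esub> ?h y"
      using pqrs by (simp add: x y c add_B B'.add_B r_distr a_ac)
    show "?h (x \<otimes>\<^bsub>B'.B\<^esub> y) = ?h x \<otimes>\<^bsub>B\<^esub> ?h y"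
      using pqrs
      apply (simp only: x y c mult_B B'.mult_B mul_simps B'.mul_simps m_closed a_closed minus_closed pqrs a t e quad_nth One_nat_def)
      apply (simp only: quad_eq_iff a' t' e')
      using c[THEN tr_ex] tr_par pqrs[THEN tr_ex]
      by (elim exE, hypsubst, simp only: tr_hom, simp add: algebra_simps)
  next
    show "?h \<one>\<^bsub>B'.B\<^esub> = \<one>\<^bsub>B\<^esub>" using pqrs by (simp add: one_B B'.one_B)
  qed
qed

text \<open>When \<open>a\<close> is invertible, \<open>u\<close> and \<open>j\<close> anticommute and generate: the algebra is \<open>(a, d)\<close>.\<close>

lemma clifford_swap_hom:
  assumes "clifford_algebra R a t e" and "clifford_algebra R a \<zero>\<^bsub>R\<^esub> d"
    and d: "d = t \<otimes>\<^bsub>R\<^esub> t \<ominus>\<^bsub>R\<^esub> a \<otimes>\<^bsub>R\<^esub> e"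
  shows "(\<lambda>v. quad (v 0) (v 1 \<ominus>\<^bsub>R\<^esub> t \<otimes>\<^bsub>R\<^esub> v 3) (a \<otimes>\<^bsub>R\<^esub> v (3::nat)) (v (2::nat)))
     \<in> ring_hom (alg_ring R (clifford R a \<zero>\<^bsub>R\<^esub> d)) (alg_ring R (clifford R a t e))" (is "?h \<in> _")
proof -
  interpret clifford_algebra R a t e by fact
  interpret B': clifford_algebra R a "\<zero>\<^bsub>R\<^esub>" d by fact
  show ?thesis
  proof (rule ring_hom_memI)
    fix x y assume "x \<in> carrier B'.B" "y \<in> carrier B'.B"
    from this(1) obtain x0 x1 x2 x3 where x: "x = quad x0 x1 x2 x3"
      and cx: "x0 \<in> carrier R" "x1 \<in> carrier R" "x2 \<in> carrier R" "x3 \<in> carrier R"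
      by (rule B'.B_cases)
    from \<open>y \<in> carrier B'.B\<close> obtain y0 y1 y2 y3 where y: "y = quad y0 y1 y2 y3"
      and cy: "y0 \<in> carrier R" "y1 \<in> carrier R" "y2 \<in> carrier R" "y3 \<in> carrier R"
      by (rule B'.B_cases)
    note c = cx cy
    show "?h x \<in> carrier B" by (simp add: x c)
    show "?h (x \<oplus>\<^bsub>B'.B\<^esub> y) = ?h x \<oplus>\<^bsub>B\<^esub> ?h y"
      apply (simp add: x y c add_B B'.add_B)
      using c[THEN tr_ex] tr_par
      by (elim exE, hypsubst, simp only: tr_hom, simp add: algebra_simps)
    show "?h (x \<otimes>\<^bsub>B'.B\<^esub> y) = ?h x \<otimes>\<^bsub>B\<^esub> ?h y"
      apply (simp only: x y c mult_B B'.mult_B mul_simps B'.mul_simps m_closed a_closed minus_closed a t e quad_nth One_nat_def)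
      apply (simp only: quad_eq_iff d)
      using c[THEN tr_ex] tr_par
      by (elim exE, hypsubst, simp only: tr_hom, simp add: algebra_simps)
  next
    show "?h \<one>\<^bsub>B'.B\<^esub> = \<one>\<^bsub>B\<^esub>" by (simp add: one_B B'.one_B)
  qed
qed

lemma alg_isoI:
  assumes "h \<in> ring_hom (alg_ring K A) (alg_ring K A')"
    and "\<And>y. y \<in> carrier (alg_ring K A') \<Longrightarrow> g y \<in> carrier (alg_ring K A) \<and> h (g y) = y"
    and "\<And>x. x \<in> carrier (alg_ring K A) \<Longrightarrow> g (h x) = x"
    and "\<And>c. c \<in> carrier K \<Longrightarrow> h (alg_scalar K A c) = alg_scalar K A' c"
  shows "alg_iso K A A'"
proof -
  have "bij_betw h (carrier (alg_ring K A)) (carrier (alg_ring K A'))"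
    by (rule bij_betw_byWitness[where f' = g]) (use assms(2,3) in \<open>auto simp: ring_hom_memE(1)[OF assms(1)]\<close>)
  then have "h \<in> ring_iso (alg_ring K A) (alg_ring K A')"
    using assms(1) by (simp add: ring_iso_def)
  then show ?thesis using assms(4) by (auto simp: alg_iso_def)
qed

lemma clifford_change_iso:
  assumes A: "clifford_algebra R a t e" and A': "clifford_algebra R a' t' e'"
    and pqrs: "p \<in> carrier R" "q \<in> carrier R" "r \<in> carrier R" "s \<in> carrier R" "u \<in> carrier R"
    and det: "(p \<otimes>\<^bsub>R\<^esub> s \<ominus>\<^bsub>R\<^esub> q \<otimes>\<^bsub>R\<^esub> r) \<otimes>\<^bsub>R\<^esub> u = \<one>\<^bsub>R\<^esub>"
    and a': "a' = a \<otimes>\<^bsub>R\<^esub> (p \<otimes>\<^bsub>R\<^esub> p) \<oplus>\<^bsub>R\<^esub> t \<otimes>\<^bsub>R\<^esub> (p \<otimes>\<^bsub>R\<^esub> q \<oplus>\<^bsub>R\<^esub> p \<otimes>\<^bsub>R\<^esub> q) \<oplus>\<^bsub>R\<^esub> e \<otimes>\<^bsub>R\<^esub> (q \<otimes>\<^bsub>R\<^esub> q)"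
    and t': "t' = a \<otimes>\<^bsub>R\<^esub> (p \<otimes>\<^bsub>R\<^esub> r) \<oplus>\<^bsub>R\<^esub> t \<otimes>\<^bsub>R\<^esub> (p \<otimes>\<^bsub>R\<^esub> s \<oplus>\<^bsub>R\<^esub> r \<otimes>\<^bsub>R\<^esub> q) \<oplus>\<^bsub>R\<^esub> e \<otimes>\<^bsub>R\<^esub> (q \<otimes>\<^bsub>R\<^esub> s)"
    and e': "e' = a \<otimes>\<^bsub>R\<^esub> (r \<otimes>\<^bsub>R\<^esub> r) \<oplus>\<^bsub>R\<^esub> t \<otimes>\<^bsub>R\<^esub> (r \<otimes>\<^bsub>R\<^esub> s \<oplus>\<^bsub>R\<^esub> r \<otimes>\<^bsub>R\<^esub> s) \<oplus>\<^bsub>R\<^esub> e \<otimes>\<^bsub>R\<^esub> (s \<otimes>\<^bsub>R\<^esub> s)"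
  shows "alg_iso R (clifford R a' t' e') (clifford R a t e)"
proof -
  interpret clifford_algebra R a t e by fact
  interpret B': clifford_algebra R a' t' e' by fact
  let ?g = "\<lambda>w. quad (w 0) (u \<otimes>\<^bsub>R\<^esub> (s \<otimes>\<^bsub>R\<^esub> w 1 \<ominus>\<^bsub>R\<^esub> r \<otimes>\<^bsub>R\<^esub> w 2)) (u \<otimes>\<^bsub>R\<^esub> (p \<otimes>\<^bsub>R\<^esub> w 2 \<ominus>\<^bsub>R\<^esub> q \<otimes>\<^bsub>R\<^esub> w 1)) (u \<otimes>\<^bsub>R\<^esub> w (3::nat))"
  have cancel: "((p \<otimes>\<^bsub>R\<^esub> s \<ominus>\<^bsub>R\<^esub> q \<otimes>\<^bsub>R\<^esub> r) \<otimes>\<^bsub>R\<^esub> u) \<otimes>\<^bsub>R\<^esub> x = x" if "x \<in> carrier R" for x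
    using that by (simp add: det)
  show ?thesis
  proof (rule alg_isoI[where g = ?g, OF clifford_change_hom[OF A A' pqrs(1-4) a' t' e']], goal_cases)
    case (1 y)
    then obtain y0 y1 y2 y3 where y: "y = quad y0 y1 y2 y3"
      and c: "y0 \<in> carrier R" "y1 \<in> carrier R" "y2 \<in> carrier R" "y3 \<in> carrier R"
      by (rule B_cases)
    have "p \<otimes>\<^bsub>R\<^esub> (u \<otimes>\<^bsub>R\<^esub> (s \<otimes>\<^bsub>R\<^esub> y1 \<ominus>\<^bsub>R\<^esub> r \<otimes>\<^bsub>R\<^esub> y2)) \<oplus>\<^bsub>R\<^esub> r \<otimes>\<^bsub>R\<^esub> (u \<otimes>\<^bsub>R\<^esub> (p \<otimes>\<^bsub>R\<^esub> y2 \<ominus>\<^bsub>R\<^esub> q \<otimes>\<^bsub>R\<^esub> y1))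
       = ((p \<otimes>\<^bsub>R\<^esub> s \<ominus>\<^bsub>R\<^esub> q \<otimes>\<^bsub>R\<^esub> r) \<otimes>\<^bsub>R\<^esub> u) \<otimes>\<^bsub>R\<^esub> y1"
      "q \<otimes>\<^bsub>R\<^esub> (u \<otimes>\<^bsub>R\<^esub> (s \<otimes>\<^bsub>R\<^esub> y1 \<ominus>\<^bsub>R\<^esub> r \<otimes>\<^bsub>R\<^esub> y2)) \<oplus>\<^bsub>R\<^esub> s \<otimes>\<^bsub>R\<^esub> (u \<otimes>\<^bsub>R\<^esub> (p \<otimes>\<^bsub>R\<^esub> y2 \<ominus>\<^bsub>R\<^esub> q \<otimes>\<^bsub>R\<^esub> y1))
       = ((p \<otimes>\<^bsub>R\<^esub> s \<ominus>\<^bsub>R\<^esub> q \<otimes>\<^bsub>R\<^esub> r) \<otimes>\<^bsub>R\<^esub> u) \<otimes>\<^bsub>R\<^esub> y2"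
      "(p \<otimes>\<^bsub>R\<^esub> s \<ominus>\<^bsub>R\<^esub> q \<otimes>\<^bsub>R\<^esub> r) \<otimes>\<^bsub>R\<^esub> (u \<otimes>\<^bsub>R\<^esub> y3) = ((p \<otimes>\<^bsub>R\<^esub> s \<ominus>\<^bsub>R\<^esub> q \<otimes>\<^bsub>R\<^esub> r) \<otimes>\<^bsub>R\<^esub> u) \<otimes>\<^bsub>R\<^esub> y3"
      using c(2-)[THEN tr_ex] pqrs[THEN tr_ex]
      by - (elim exE, hypsubst, simp only: tr_hom, simp add: algebra_simps)+
    then show ?case
      using c pqrs by (simp add: y cancel)
  next
    case (2 x)
    then obtain y0 y1 y2 y3 where y: "x = quad y0 y1 y2 y3"
      and c: "y0 \<in> carrier R" "y1 \<in> carrier R" "y2 \<in> carrier R" "y3 \<in> carrier R"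
      by (rule B'.B_cases)
    have "u \<otimes>\<^bsub>R\<^esub> (s \<otimes>\<^bsub>R\<^esub> (p \<otimes>\<^bsub>R\<^esub> y1 \<oplus>\<^bsub>R\<^esub> r \<otimes>\<^bsub>R\<^esub> y2) \<ominus>\<^bsub>R\<^esub> r \<otimes>\<^bsub>R\<^esub> (q \<otimes>\<^bsub>R\<^esub> y1 \<oplus>\<^bsub>R\<^esub> s \<otimes>\<^bsub>R\<^esub> y2))
       = ((p \<otimes>\<^bsub>R\<^esub> s \<ominus>\<^bsub>R\<^esub> q \<otimes>\<^bsub>R\<^esub> r) \<otimes>\<^bsub>R\<^esub> u) \<otimes>\<^bsub>R\<^esub> y1"
      "u \<otimes>\<^bsub>R\<^esub> (p \<otimes>\<^bsub>R\<^esub> (q \<otimes>\<^bsub>R\<^esub> y1 \<oplus>\<^bsub>R\<^esub> s \<otimes>\<^bsub>R\<^esub> y2) \<ominus>\<^bsub>R\<^esub> q \<otimes>\<^bsub>R\<^esub> (p \<otimes>\<^bsub>R\<^esub> y1 \<oplus>\<^bsub>R\<^esub> r \<otimes>\<^bsub>R\<^esub> y2))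
       = ((p \<otimes>\<^bsub>R\<^esub> s \<ominus>\<^bsub>R\<^esub> q \<otimes>\<^bsub>R\<^esub> r) \<otimes>\<^bsub>R\<^esub> u) \<otimes>\<^bsub>R\<^esub> y2"
      "u \<otimes>\<^bsub>R\<^esub> ((p \<otimes>\<^bsub>R\<^esub> s \<ominus>\<^bsub>R\<^esub> q \<otimes>\<^bsub>R\<^esub> r) \<otimes>\<^bsub>R\<^esub> y3) = ((p \<otimes>\<^bsub>R\<^esub> s \<ominus>\<^bsub>R\<^esub> q \<otimes>\<^bsub>R\<^esub> r) \<otimes>\<^bsub>R\<^esub> u) \<otimes>\<^bsub>R\<^esub> y3"
      using c(2-)[THEN tr_ex] pqrs[THEN tr_ex]
      by - (elim exE, hypsubst, simp only: tr_hom, simp add: algebra_simps)+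
    then show ?case
      using c pqrs by (simp add: y cancel)
  next
    case (3 c)
    then show ?case using pqrs by (simp add: alg_scalar_eq B'.alg_scalar_eq \<iota>_def B'.\<iota>_def)
  qed
qed

lemma clifford_swap_iso:
  assumes A: "clifford_algebra R a t e" and A': "clifford_algebra R a \<zero>\<^bsub>R\<^esub> d"
    and d: "d = t \<otimes>\<^bsub>R\<^esub> t \<ominus>\<^bsub>R\<^esub> a \<otimes>\<^bsub>R\<^esub> e" and u: "u \<in> carrier R" "a \<otimes>\<^bsub>R\<^esub> u = \<one>\<^bsub>R\<^esub>"
  shows "alg_iso R (clifford R a \<zero>\<^bsub>R\<^esub> d) (clifford R a t e)"
proof -
  interpret clifford_algebra R a t e by fact
  interpret B': clifford_algebra R a "\<zero>\<^bsub>R\<^esub>" d by fact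
  let ?g = "\<lambda>w. quad (w 0) (w 1 \<oplus>\<^bsub>R\<^esub> t \<otimes>\<^bsub>R\<^esub> (u \<otimes>\<^bsub>R\<^esub> w 2)) (w (3::nat)) (u \<otimes>\<^bsub>R\<^esub> w 2)"
  have cancel: "a \<otimes>\<^bsub>R\<^esub> (u \<otimes>\<^bsub>R\<^esub> x) = x" "u \<otimes>\<^bsub>R\<^esub> (a \<otimes>\<^bsub>R\<^esub> x) = x" if "x \<in> carrier R" for x
    using that u by (simp_all add: m_assoc[symmetric] m_comm[of u a])
  have cancel': "(x \<oplus>\<^bsub>R\<^esub> y) \<ominus>\<^bsub>R\<^esub> y = x" "(x \<ominus>\<^bsub>R\<^esub> y) \<oplus>\<^bsub>R\<^esub> y = x" if "x \<in> carrier R" "y \<in> carrier R" for x y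
    using that by (simp_all add: a_minus_def a_assoc r_neg l_neg)
  show ?thesis
  proof (rule alg_isoI[where g = ?g, OF clifford_swap_hom[OF A A' d]], goal_cases)
    case (1 y)
    then show ?case using u by (elim B_cases) (simp add: cancel cancel')
  next
    case (2 x)
    then show ?case using u by (elim B'.B_cases) (simp add: cancel cancel')
  next
    case (3 c)
    then show ?case by (simp add: alg_scalar_eq B'.alg_scalar_eq \<iota>_def B'.\<iota>_def)
  qed
qed

section \<open>Fields of fractions\<close>

locale fractions = domain R for R :: "'a ring" (structure)
begin

abbreviation K where "K \<equiv> fraction_field R"
abbreviation nz where "nz \<equiv> carrier R - {\<zero>}"

lemma nz_mult [simp, intro]: "b \<in> nz \<Longrightarrow> d \<in> nz \<Longrightarrow> b \<otimes> d \<in> nz"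
  using integral by auto

lemma nz_closed: "b \<in> nz \<Longrightarrow> b \<in> carrier R"
  by simp

lemma fraction_mem: "(c, d) \<in> fraction R a b \<longleftrightarrow> c \<in> carrier R \<and> d \<in> nz \<and> a \<otimes> d = c \<otimes> b"
  by (simp add: fraction_def)

lemma fraction_eq_iff:
  assumes "a \<in> carrier R" "b \<in> nz" "c \<in> carrier R" "d \<in> nz"
  shows "fraction R a b = fraction R c d \<longleftrightarrow> a \<otimes> d = c \<otimes> b"
proof
  assume "fraction R a b = fraction R c d"
  moreover have "(c, d) \<in> fraction R c d" using assms by (simp add: fraction_mem)
  ultimately have "(c, d) \<in> fraction R a b" by simp
  then show "a \<otimes> d = c \<otimes> b" by (simp add: fraction_mem)
next
  have sub: "fraction R a b \<subseteq> fraction R c d"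
    if c: "a \<in> carrier R" "b \<in> nz" "c \<in> carrier R" "d \<in> nz" and eq: "a \<otimes> d = c \<otimes> b" for a b c d
  proof (clarify)
    fix x y assume "(x, y) \<in> fraction R a b"
    then have xy: "x \<in> carrier R" "y \<in> nz" "a \<otimes> y = x \<otimes> b" by (auto simp: fraction_mem)
    have "b \<otimes> (x \<otimes> d) = (x \<otimes> b) \<otimes> d" using c xy by (simp add: m_ac)
    also have "\<dots> = (a \<otimes> d) \<otimes> y" using c xy(1,2) by (simp add: xy(3)[symmetric] m_ac)
    also have "\<dots> = b \<otimes> (c \<otimes> y)" using c xy by (simp add: eq m_ac)
    finally have "x \<otimes> d = c \<otimes> y" using c xy m_lcancel[of b "x \<otimes> d" "c \<otimes> y"] by simp
    then show "(x, y) \<in> fraction R c d" using xy by (simp add: fraction_mem)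
  qed
  assume eq: "a \<otimes> d = c \<otimes> b"
  show "fraction R a b = fraction R c d"
    using sub[OF assms eq] sub[OF assms(3,4,1,2) eq[symmetric]] by blast
qed

lemma fraction_closed [simp, intro]: "a \<in> carrier R \<Longrightarrow> b \<in> nz \<Longrightarrow> fraction R a b \<in> carrier K"
  by (auto simp: fraction_field_def)

lemma fraction_cases:
  assumes "x \<in> carrier K"
  obtains a b where "x = fraction R a b" "a \<in> carrier R" "b \<in> nz"
  using assms by (auto simp: fraction_field_def)

lemma fraction_mult:
  assumes "a \<in> carrier R" "b \<in> nz" "c \<in> carrier R" "d \<in> nz"
  shows "fraction R a b \<otimes>\<^bsub>K\<^esub> fraction R c d = fraction R (a \<otimes> c) (b \<otimes> d)"
proof -
  have "{fraction R (a' \<otimes> c') (b' \<otimes> d') | a' b' c' d'. (a', b') \<in> fraction R a b \<and> (c', d') \<in> fraction R c d}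
     = {fraction R (a \<otimes> c) (b \<otimes> d)}" (is "?S = _")
  proof (intro equalityI subsetI)
    fix z assume "z \<in> ?S"
    then obtain a' b' c' d' where z: "z = fraction R (a' \<otimes> c') (b' \<otimes> d')" and "(a', b') \<in> fraction R a b" "(c', d') \<in> fraction R c d" by blast
    then have *: "a' \<in> carrier R" "b' \<in> nz" "c' \<in> carrier R" "d' \<in> nz"
      and eq: "a \<otimes> b' = a' \<otimes> b" "c \<otimes> d' = c' \<otimes> d" by (auto simp: fraction_mem)
    have "a' \<otimes> c' \<otimes> (b \<otimes> d) = (a' \<otimes> b) \<otimes> (c' \<otimes> d)" using * assms by (simp add: m_ac)
    also have "\<dots> = a \<otimes> c \<otimes> (b' \<otimes> d')" using * assms by (simp add: eq[symmetric] m_ac)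
    finally have "fraction R (a' \<otimes> c') (b' \<otimes> d') = fraction R (a \<otimes> c) (b \<otimes> d)"
      using * assms by (simp only: fraction_eq_iff nz_mult m_closed a_closed nz_closed)
    then show "z \<in> {fraction R (a \<otimes> c) (b \<otimes> d)}" by (simp add: z)
  next
    fix z assume z: "z \<in> {fraction R (a \<otimes> c) (b \<otimes> d)}"
    have "(a, b) \<in> fraction R a b" "(c, d) \<in> fraction R c d" using assms by (auto simp: fraction_mem)
    with z show "z \<in> ?S" by blast
  qed
  then show ?thesis by (simp add: fraction_field_def)
qed

lemma fraction_add:
  assumes "a \<in> carrier R" "b \<in> nz" "c \<in> carrier R" "d \<in> nz"
  shows "fraction R a b \<oplus>\<^bsub>K\<^esub> fraction R c d = fraction R (a \<otimes> d \<oplus> c \<otimes> b) (b \<otimes> d)"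
proof -
  have "{fraction R (a' \<otimes> d' \<oplus> c' \<otimes> b') (b' \<otimes> d') | a' b' c' d'. (a', b') \<in> fraction R a b \<and> (c', d') \<in> fraction R c d}
     = {fraction R (a \<otimes> d \<oplus> c \<otimes> b) (b \<otimes> d)}" (is "?S = _")
  proof (intro equalityI subsetI)
    fix z assume "z \<in> ?S"
    then obtain a' b' c' d' where z: "z = fraction R (a' \<otimes> d' \<oplus> c' \<otimes> b') (b' \<otimes> d')" and "(a', b') \<in> fraction R a b" "(c', d') \<in> fraction R c d" by blast
    then have *: "a' \<in> carrier R" "b' \<in> nz" "c' \<in> carrier R" "d' \<in> nz"
      and eq: "a \<otimes> b' = a' \<otimes> b" "c \<otimes> d' = c' \<otimes> d" by (auto simp: fraction_mem)
    have "(a' \<otimes> d' \<oplus> c' \<otimes> b') \<otimes> (b \<otimes> d) = (a' \<otimes> b) \<otimes> (d \<otimes> d') \<oplus> (c' \<otimes> d) \<otimes> (b \<otimes> b')"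
      using * assms by (simp add: l_distr r_distr m_ac)
    also have "\<dots> = (a \<otimes> d \<oplus> c \<otimes> b) \<otimes> (b' \<otimes> d')"
      using * assms by (simp add: eq[symmetric] l_distr r_distr m_ac)
    finally have "fraction R (a' \<otimes> d' \<oplus> c' \<otimes> b') (b' \<otimes> d') = fraction R (a \<otimes> d \<oplus> c \<otimes> b) (b \<otimes> d)"
      using * assms by (simp only: fraction_eq_iff nz_mult m_closed a_closed nz_closed)
    then show "z \<in> {fraction R (a \<otimes> d \<oplus> c \<otimes> b) (b \<otimes> d)}" by (simp add: z)
  next
    fix z assume z: "z \<in> {fraction R (a \<otimes> d \<oplus> c \<otimes> b) (b \<otimes> d)}"
    have "(a, b) \<in> fraction R a b" "(c, d) \<in> fraction R c d" using assms by (auto simp: fraction_mem)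
    with z show "z \<in> ?S" by blast
  qed
  then show ?thesis by (simp add: fraction_field_def)
qed

lemma fraction_zero_one: "\<zero>\<^bsub>K\<^esub> = fraction R \<zero> \<one>" "\<one>\<^bsub>K\<^esub> = fraction R \<one> \<one>"
  by (simp_all add: fraction_field_def)

lemma fraction_field_cring: "cring K"
proof (rule cringI)
  show "abelian_group K"
  proof (rule abelian_groupI)
    fix x y z assume "x \<in> carrier K" "y \<in> carrier K" "z \<in> carrier K"
    then show "x \<oplus>\<^bsub>K\<^esub> y \<oplus>\<^bsub>K\<^esub> z = x \<oplus>\<^bsub>K\<^esub> (y \<oplus>\<^bsub>K\<^esub> z)"
      by (elim fraction_cases) (simp add: fraction_add l_distr r_distr m_ac a_ac nz_mult[simplified])
  next
    fix x y assume "x \<in> carrier K" "y \<in> carrier K"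
    then show "x \<oplus>\<^bsub>K\<^esub> y \<in> carrier K"
      by (elim fraction_cases) (simp add: fraction_add nz_mult[simplified])
    from \<open>x \<in> carrier K\<close> \<open>y \<in> carrier K\<close> show "x \<oplus>\<^bsub>K\<^esub> y = y \<oplus>\<^bsub>K\<^esub> x"
      by (elim fraction_cases) (simp add: fraction_add m_comm a_comm)
  next
    fix x assume "x \<in> carrier K"
    then obtain a b where x: "x = fraction R a b" "a \<in> carrier R" "b \<in> nz" by (rule fraction_cases)
    then show "\<zero>\<^bsub>K\<^esub> \<oplus>\<^bsub>K\<^esub> x = x" by (simp add: fraction_zero_one fraction_add)
    show "\<exists>y\<in>carrier K. y \<oplus>\<^bsub>K\<^esub> x = \<zero>\<^bsub>K\<^esub>"
      using x nz_mult[of b b] by (intro bexI[of _ "fraction R (\<ominus> a) b"])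
        (simp_all add: fraction_zero_one fraction_add fraction_eq_iff l_minus l_neg)
  qed (simp add: fraction_zero_one)
  show "comm_monoid K"
  proof (rule comm_monoidI)
    fix x y z assume "x \<in> carrier K" "y \<in> carrier K" "z \<in> carrier K"
    then show "x \<otimes>\<^bsub>K\<^esub> y \<otimes>\<^bsub>K\<^esub> z = x \<otimes>\<^bsub>K\<^esub> (y \<otimes>\<^bsub>K\<^esub> z)"
      by (elim fraction_cases) (simp add: fraction_mult m_ac nz_mult[simplified])
  next
    fix x y assume "x \<in> carrier K" "y \<in> carrier K"
    then show "x \<otimes>\<^bsub>K\<^esub> y \<in> carrier K"
      by (elim fraction_cases) (simp add: fraction_mult nz_mult[simplified])
    from \<open>x \<in> carrier K\<close> \<open>y \<in> carrier K\<close> show "x \<otimes>\<^bsub>K\<^esub> y = y \<otimes>\<^bsub>K\<^esub> x"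
      by (elim fraction_cases) (simp add: fraction_mult m_comm)
  next
    fix x assume "x \<in> carrier K"
    then show "\<one>\<^bsub>K\<^esub> \<otimes>\<^bsub>K\<^esub> x = x"
      by (elim fraction_cases) (simp add: fraction_mult fraction_zero_one)
  qed (simp add: fraction_zero_one)
  fix x y z assume "x \<in> carrier K" "y \<in> carrier K" "z \<in> carrier K"
  then obtain a b c d u v where x: "x = fraction R a b" "y = fraction R c d" "z = fraction R u v"
     and *: "a \<in> carrier R" "b \<in> nz" "c \<in> carrier R" "d \<in> nz" "u \<in> carrier R" "v \<in> nz"
    by (elim fraction_cases)
  then show "(x \<oplus>\<^bsub>K\<^esub> y) \<otimes>\<^bsub>K\<^esub> z = x \<otimes>\<^bsub>K\<^esub> z \<oplus>\<^bsub>K\<^esub> y \<otimes>\<^bsub>K\<^esub> z"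
    by (simp add: fraction_mult fraction_add nz_mult[simplified] fraction_eq_iff)
       (simp add: l_distr r_distr m_ac)
qed

lemma fraction_field_field: "field K"
proof (rule cring.cring_fieldI2[OF fraction_field_cring])
  show "\<zero>\<^bsub>K\<^esub> \<noteq> \<one>\<^bsub>K\<^esub>" by (simp add: fraction_zero_one fraction_eq_iff)
  fix x assume "x \<in> carrier K" "x \<noteq> \<zero>\<^bsub>K\<^esub>"
  from this(1) obtain a b where x: "x = fraction R a b" "a \<in> carrier R" "b \<in> nz" by (rule fraction_cases)
  with \<open>x \<noteq> \<zero>\<^bsub>K\<^esub>\<close> have "a \<in> nz" by (auto simp: fraction_zero_one fraction_eq_iff)
  then show "\<exists>y\<in>carrier K. x \<otimes>\<^bsub>K\<^esub> y = \<one>\<^bsub>K\<^esub>"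
    using x nz_mult[of b a] by (intro bexI[of _ "fraction R b a"])
      (simp_all add: fraction_zero_one fraction_mult fraction_eq_iff m_comm)
qed

sublocale K: field K by (rule fraction_field_field)

lemma to_fraction_hom: "to_fraction R \<in> ring_hom R K"
  by (rule ring_hom_memI) (simp_all add: fraction_mult fraction_add fraction_zero_one)

sublocale to_fraction: ring_hom_ring R K "to_fraction R"
  by (rule ring_hom_ringI2) (simp_all add: ring_axioms K.ring_axioms to_fraction_hom)

lemma to_fraction_inj: "a \<in> carrier R \<Longrightarrow> b \<in> carrier R \<Longrightarrow> to_fraction R a = to_fraction R b \<longleftrightarrow> a = b"
  by (subst fraction_eq_iff) auto

lemma fraction_eq_div:
  assumes "a \<in> carrier R" "b \<in> nz"
  shows "fraction R a b \<otimes>\<^bsub>K\<^esub> to_fraction R b = to_fraction R a"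
  using assms by (simp add: fraction_mult fraction_eq_iff m_ac)

end

section \<open>The ring of p-adic integers and its valuation\<close>

lemma Zp_simps [simp]:
  "a \<otimes>\<^bsub>Zp p\<^esub> b = (\<lambda>n. (a n * b n) mod int p ^ n)"
  "a \<oplus>\<^bsub>Zp p\<^esub> b = (\<lambda>n. (a n + b n) mod int p ^ n)"
  "\<one>\<^bsub>Zp p\<^esub> = (\<lambda>n. 1 mod int p ^ n)"
  "\<zero>\<^bsub>Zp p\<^esub> = (\<lambda>n. 0)"
  by (simp_all add: Zp_def)

locale padic = fixes p :: nat assumes prime_p: "prime p"
begin

lemma p_gt: "p > 1" "int p > 1" "int p > 0" "int p ^ n > 0"
  using prime_gt_1_nat[OF prime_p] by auto

lemma Zp_carrier:
  "a \<in> carrier (Zp p) \<longleftrightarrow> (\<forall>n. a n \<in> {0..<int p ^ n} \<and> a (Suc n) mod int p ^ n = a n)"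
  by (simp add: Zp_def)

lemma Zp_memI:
  assumes "\<And>n. [f (Suc n) = f n] (mod int p ^ n)"
  shows "(\<lambda>n. f n mod int p ^ n) \<in> carrier (Zp p)"
  unfolding Zp_carrier
proof (intro allI conjI)
  fix n
  show "f n mod int p ^ n \<in> {0..<int p ^ n}" using p_gt(4)[of n] by simp
  have "f (Suc n) mod int p ^ Suc n mod int p ^ n = f (Suc n) mod int p ^ n"
    by (simp add: mod_mod_cancel)
  then show "f (Suc n) mod int p ^ Suc n mod int p ^ n = f n mod int p ^ n"
    using assms[of n] by (simp add: cong_def)
qed

lemma Zp_mod: "a \<in> carrier (Zp p) \<Longrightarrow> a n mod int p ^ n = a n"
  by (metis Zp_carrier atLeastLessThan_iff mod_pos_pos_trivial)

lemma Zp_cong: "a \<in> carrier (Zp p) \<Longrightarrow> [a (Suc n) = a n] (mod int p ^ n)"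
  by (metis Zp_carrier Zp_mod cong_def)

lemma Zp_coherent: "a \<in> carrier (Zp p) \<Longrightarrow> m \<le> n \<Longrightarrow> a n mod int p ^ m = a m"
proof (induction n)
  case 0
  then show ?case using Zp_mod[of a 0] by simp
next
  case (Suc n)
  show ?case
  proof (cases "m = Suc n")
    case True
    then show ?thesis using Zp_mod[OF Suc.prems(1), of "Suc n"] by simp
  next
    case False
    then have "m \<le> n" using Suc.prems by simp
    then have "a (Suc n) mod int p ^ m = a (Suc n) mod int p ^ n mod int p ^ m"
      by (simp add: mod_mod_cancel le_imp_power_dvd)
    also have "a (Suc n) mod int p ^ n = a n" using Suc.prems by (simp add: Zp_carrier)
    finally show ?thesis using Suc \<open>m \<le> n\<close> by simp
  qed
qed

lemma Zp_range: "a \<in> carrier (Zp p) \<Longrightarrow> 0 \<le> a n \<and> a n < int p ^ n"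
  by (auto simp: Zp_carrier)

lemma Zp_eqI:
  "a \<in> carrier (Zp p) \<Longrightarrow> b \<in> carrier (Zp p) \<Longrightarrow> (\<And>n. [a n = b n] (mod int p ^ n)) \<Longrightarrow> a = b"
  by (metis Zp_mod cong_def ext)

definition zint :: "int \<Rightarrow> nat \<Rightarrow> int" where "zint k = (\<lambda>n. k mod int p ^ n)"

lemma zint_closed [simp, intro]: "zint k \<in> carrier (Zp p)"
  unfolding zint_def by (rule Zp_memI) simp

lemma Zp_cring: "cring (Zp p)"
proof (rule cringI)
  show "abelian_group (Zp p)"
  proof (rule abelian_groupI)
    fix a b c assume "a \<in> carrier (Zp p)" "b \<in> carrier (Zp p)" "c \<in> carrier (Zp p)"
    then show "a \<oplus>\<^bsub>Zp p\<^esub> b \<oplus>\<^bsub>Zp p\<^esub> c = a \<oplus>\<^bsub>Zp p\<^esub> (b \<oplus>\<^bsub>Zp p\<^esub> c)"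
      by (simp add: mod_simps add.assoc)
  next
    fix a b assume "a \<in> carrier (Zp p)" "b \<in> carrier (Zp p)"
    then show "a \<oplus>\<^bsub>Zp p\<^esub> b \<in> carrier (Zp p)"
      by (simp, intro Zp_memI cong_add Zp_cong)
    show "a \<oplus>\<^bsub>Zp p\<^esub> b = b \<oplus>\<^bsub>Zp p\<^esub> a" by (simp add: add.commute)
  next
    fix a assume a: "a \<in> carrier (Zp p)"
    then show "\<zero>\<^bsub>Zp p\<^esub> \<oplus>\<^bsub>Zp p\<^esub> a = a" by (simp add: Zp_mod)
    have "(\<lambda>n. (- a n) mod int p ^ n) \<in> carrier (Zp p)"
      using a by (intro Zp_memI) (simp add: Zp_cong cong_minus_minus_iff)
    then show "\<exists>b\<in>carrier (Zp p). b \<oplus>\<^bsub>Zp p\<^esub> a = \<zero>\<^bsub>Zp p\<^esub>"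
      by (intro bexI) (simp_all add: mod_simps)
  qed (use zint_closed[of 0] in \<open>simp add: zint_def\<close>)
  show "comm_monoid (Zp p)"
  proof (rule comm_monoidI)
    fix a b c assume "a \<in> carrier (Zp p)" "b \<in> carrier (Zp p)" "c \<in> carrier (Zp p)"
    then show "a \<otimes>\<^bsub>Zp p\<^esub> b \<otimes>\<^bsub>Zp p\<^esub> c = a \<otimes>\<^bsub>Zp p\<^esub> (b \<otimes>\<^bsub>Zp p\<^esub> c)"
      by (simp add: mod_simps mult.assoc)
  next
    fix a b assume "a \<in> carrier (Zp p)" "b \<in> carrier (Zp p)"
    then show "a \<otimes>\<^bsub>Zp p\<^esub> b \<in> carrier (Zp p)"
      by (simp, intro Zp_memI cong_mult Zp_cong)
    show "a \<otimes>\<^bsub>Zp p\<^esub> b = b \<otimes>\<^bsub>Zp p\<^esub> a" by (simp add: mult.commute)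
  next
    fix a assume "a \<in> carrier (Zp p)"
    then show "\<one>\<^bsub>Zp p\<^esub> \<otimes>\<^bsub>Zp p\<^esub> a = a" by (simp add: Zp_mod mod_simps)
  qed (use zint_closed[of 1] in \<open>simp add: zint_def\<close>)
  fix a b c assume "a \<in> carrier (Zp p)" "b \<in> carrier (Zp p)" "c \<in> carrier (Zp p)"
  then show "(a \<oplus>\<^bsub>Zp p\<^esub> b) \<otimes>\<^bsub>Zp p\<^esub> c = a \<otimes>\<^bsub>Zp p\<^esub> c \<oplus>\<^bsub>Zp p\<^esub> b \<otimes>\<^bsub>Zp p\<^esub> c"
    by (simp add: mod_simps distrib_right)
qed

sublocale Zp: cring "Zp p" by (rule Zp_cring)

lemma zint_add: "zint (k + l) = zint k \<oplus>\<^bsub>Zp p\<^esub> zint l"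
  by (simp add: zint_def mod_simps)
lemma zint_mult: "zint (k * l) = zint k \<otimes>\<^bsub>Zp p\<^esub> zint l"
  by (simp add: zint_def mod_simps)
lemma zint_0: "zint 0 = \<zero>\<^bsub>Zp p\<^esub>" and zint_1: "zint 1 = \<one>\<^bsub>Zp p\<^esub>"
  by (simp_all add: zint_def)
lemma zint_minus: "zint (- k) = \<ominus>\<^bsub>Zp p\<^esub> zint k"
  by (rule Zp.minus_equality[symmetric]) (simp_all only: zint_add[symmetric] zint_0[symmetric] zint_closed, simp)

lemma zint_power: "zint (k ^ n) = zint k [^]\<^bsub>Zp p\<^esub> n"
  by (induction n) (simp_all only: power_0 power_Suc2 zint_1 zint_mult Zp.nat_pow_0 Zp.nat_pow_Suc)

lemma Zp_pow: "a \<in> carrier (Zp p) \<Longrightarrow> (a [^]\<^bsub>Zp p\<^esub> (i::nat)) n = (a n ^ i) mod int p ^ n"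
  by (induction i) (simp_all add: mod_simps mult.commute)

lemma zint_inj: "zint k = zint l \<Longrightarrow> k = l"
proof -
  assume eq: "zint k = zint l"
  obtain n where n: "n > nat \<bar>k - l\<bar>" by blast
  have "int n < int p ^ n" using p_gt(1) power_gt_expt[of p n] by (metis One_nat_def of_nat_less_iff of_nat_power)
  then have "\<bar>k - l\<bar> < int p ^ n" using n by linarith
  moreover have "int p ^ n dvd k - l"
    using fun_cong[OF eq, of n] by (simp add: zint_def mod_eq_dvd_iff)
  ultimately show ?thesis using zdvd_not_zless[of "\<bar>k - l\<bar>" "int p ^ n"] by auto
qed

lemma Zp_Units_iff: "u \<in> Units (Zp p) \<longleftrightarrow> u \<in> carrier (Zp p) \<and> u 1 \<noteq> 0"
proof
  assume "u \<in> Units (Zp p)"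
  then obtain v where v: "u \<in> carrier (Zp p)" "v \<in> carrier (Zp p)" "v \<otimes>\<^bsub>Zp p\<^esub> u = \<one>\<^bsub>Zp p\<^esub>"
    by (auto simp: Units_def)
  have "v 1 * u 1 mod int p = 1" using fun_cong[OF v(3), of 1] p_gt by simp
  then show "u \<in> carrier (Zp p) \<and> u 1 \<noteq> 0" using v by auto
next
  assume u: "u \<in> carrier (Zp p) \<and> u 1 \<noteq> 0"
  have cop: "coprime (u n) (int p ^ n)" for n
  proof (cases n)
    case (Suc m)
    have "u n mod int p ^ 1 = u 1" by (rule Zp_coherent) (use u Suc in auto)
    then have "\<not> int p dvd u n" using u by (auto simp: dvd_eq_mod_eq_0)
    then have "coprime (u n) (int p)" using prime_p
      by (metis coprime_commute prime_imp_coprime prime_int_nat_transfer of_nat_eq_iff prime_nat_int_transfer)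
    then show ?thesis by simp
  qed simp
  define f where "f n = (SOME x. [u n * x = 1] (mod int p ^ n))" for n
  have f: "[u n * f n = 1] (mod int p ^ n)" for n
    unfolding f_def by (rule someI_ex) (rule cong_solve_coprime_int[OF cop])
  have "[f (Suc n) = f n] (mod int p ^ n)" for n
  proof -
    have "[u (Suc n) * f (Suc n) = 1] (mod int p ^ n)"
      using f[of "Suc n"] by (rule cong_dvd_modulus) simp
    then have "[u n * f (Suc n) = 1] (mod int p ^ n)"
      by (meson Zp_cong cong_scalar_right cong_sym cong_trans u)
    then have "[u n * f (Suc n) = u n * f n] (mod int p ^ n)"
      using f[of n] by (meson cong_sym cong_trans)
    then show ?thesis using cong_mult_lcancel[OF cop] by blast
  qed
  then have v: "(\<lambda>n. f n mod int p ^ n) \<in> carrier (Zp p)" by (rule Zp_memI)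
  have "(\<lambda>n. f n mod int p ^ n) \<otimes>\<^bsub>Zp p\<^esub> u = \<one>\<^bsub>Zp p\<^esub>"
    using f by (auto simp: fun_eq_iff mod_simps cong_def mult.commute)
  then show "u \<in> Units (Zp p)"
    using u v Zp.m_comm[of u "\<lambda>n. f n mod int p ^ n"] unfolding Units_def by auto
qed

text \<open>The order of vanishing is the largest \<open>j\<close> with \<open>a j = 0\<close>; dividing by \<open>p ^ j\<close> shifts the sequence
  of residues by \<open>j\<close> places.\<close>

lemma Zp_decompose:
  assumes a: "a \<in> carrier (Zp p)" "a \<noteq> \<zero>\<^bsub>Zp p\<^esub>"
  obtains j u where "u \<in> Units (Zp p)" "a = zint (int p ^ j) \<otimes>\<^bsub>Zp p\<^esub> u"
proof -
  obtain n where n: "a n \<noteq> 0" using a(2) by (auto simp: fun_eq_iff)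
  define N where "N = (LEAST n. a n \<noteq> 0)"
  have N: "a N \<noteq> 0" "\<And>i. i < N \<Longrightarrow> a i = 0"
    unfolding N_def using LeastI[of "\<lambda>n. a n \<noteq> 0", OF n] not_less_Least by blast+
  have "N \<noteq> 0" using N(1) Zp_range[OF a(1), of 0] by (intro notI) simp
  then obtain j where j: "N = Suc j" by (cases N) auto
  have aj: "a j = 0" "a (Suc j) \<noteq> 0" using N by (auto simp: j)
  define u where "u = (\<lambda>n. a (n + j) div int p ^ j)"
  have dvd: "int p ^ j dvd a (n + j)" for n
    using Zp_coherent[OF a(1), of j "n + j"] aj by (simp add: dvd_eq_mod_eq_0)
  have pu: "int p ^ j * u n = a (n + j)" for n unfolding u_def using dvd by simp
  have pj: "int p ^ j > 0" using p_gt by simp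
  have u: "u \<in> carrier (Zp p)" unfolding Zp_carrier
  proof (intro allI conjI)
    fix n
    have "0 \<le> int p ^ j * u n \<and> int p ^ j * u n < int p ^ j * int p ^ n"
      unfolding pu using Zp_range[OF a(1), of "n + j"] by (simp add: power_add mult.commute)
    then show r: "u n \<in> {0..<int p ^ n}" using pj by (simp add: zero_le_mult_iff)
    have "int p ^ j * int p ^ n dvd int p ^ j * u (Suc n) - int p ^ j * u n"
      unfolding pu using Zp_cong[OF a(1), of "n + j"]
      by (simp add: cong_iff_dvd_diff power_add mult.commute)
    then have "int p ^ n dvd u (Suc n) - u n" using p_gt(1)
      by (simp add: right_diff_distrib[symmetric])
    then show "u (Suc n) mod int p ^ n = u n"
      using r by (metis atLeastLessThan_iff mod_eq_dvd_iff mod_pos_pos_trivial)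
  qed
  have "u 1 \<noteq> 0" using pu[of 1] aj(2) by auto
  then have "u \<in> Units (Zp p)" using u by (simp add: Zp_Units_iff)
  moreover have "a = zint (int p ^ j) \<otimes>\<^bsub>Zp p\<^esub> u"
  proof
    fix n
    show "a n = (zint (int p ^ j) \<otimes>\<^bsub>Zp p\<^esub> u) n"
      using Zp_coherent[OF a(1), of n "n + j"] by (simp add: zint_def mod_simps pu)
  qed
  ultimately show ?thesis by (rule that)
qed

lemma zint_p_power_unit:
  assumes "u \<in> Units (Zp p)"
  shows "(zint (int p ^ j) \<otimes>\<^bsub>Zp p\<^esub> u) (Suc j) \<noteq> 0" "i \<le> j \<Longrightarrow> (zint (int p ^ j) \<otimes>\<^bsub>Zp p\<^esub> u) i = 0"
proof -
  have u: "u \<in> carrier (Zp p)" "u 1 \<noteq> 0" using assms by (auto simp: Zp_Units_iff)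
  have "\<not> int p dvd u (Suc j)"
    using Zp_coherent[OF u(1), of 1 "Suc j"] u(2) by (auto simp: dvd_eq_mod_eq_0)
  then have "\<not> int p ^ Suc j dvd int p ^ j * u (Suc j)"
    using p_gt(3) by simp
  then show "(zint (int p ^ j) \<otimes>\<^bsub>Zp p\<^esub> u) (Suc j) \<noteq> 0"
    by (simp add: zint_def mod_simps dvd_eq_mod_eq_0)
  show "(zint (int p ^ j) \<otimes>\<^bsub>Zp p\<^esub> u) i = 0" if "i \<le> j"
    using that by (simp add: zint_def mod_simps) (metis dvd_mult2 le_imp_power_dvd mod_0_imp_dvd dvd_imp_mod_0)
qed

sublocale Zp: domain "Zp p"
proof
  show "\<one>\<^bsub>Zp p\<^esub> \<noteq> \<zero>\<^bsub>Zp p\<^esub>"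
    using zint_inj[of 1 0] by (simp only: zint_0[symmetric] zint_1[symmetric]) auto
  fix a b assume ab: "a \<otimes>\<^bsub>Zp p\<^esub> b = \<zero>\<^bsub>Zp p\<^esub>" "a \<in> carrier (Zp p)" "b \<in> carrier (Zp p)"
  show "a = \<zero>\<^bsub>Zp p\<^esub> \<or> b = \<zero>\<^bsub>Zp p\<^esub>"
  proof (rule ccontr)
    assume "\<not> (a = \<zero>\<^bsub>Zp p\<^esub> \<or> b = \<zero>\<^bsub>Zp p\<^esub>)"
    then obtain i u j v where u: "u \<in> Units (Zp p)" "a = zint (int p ^ i) \<otimes>\<^bsub>Zp p\<^esub> u"
      and v: "v \<in> Units (Zp p)" "b = zint (int p ^ j) \<otimes>\<^bsub>Zp p\<^esub> v"
      using Zp_decompose ab(2,3) by metis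
    have "u \<in> carrier (Zp p)" "v \<in> carrier (Zp p)" using u v by auto
    then have "a \<otimes>\<^bsub>Zp p\<^esub> b = zint (int p ^ (i + j)) \<otimes>\<^bsub>Zp p\<^esub> (u \<otimes>\<^bsub>Zp p\<^esub> v)"
      unfolding u(2) v(2) power_add zint_mult using zint_closed[of "int p ^ i"] zint_closed[of "int p ^ j"]
      by (simp only: Zp.m_ac Zp.m_closed)
    moreover have "(a \<otimes>\<^bsub>Zp p\<^esub> b) (Suc (i + j)) = 0" unfolding ab(1) by simp
    ultimately show False
      using zint_p_power_unit(1)[OF Zp.Units_m_closed[OF u(1) v(1)], of "i + j"] by (simp only:)
  qed
qed

end

declare Zp_simps [simp del]

lemma (in field) int_pow_units_of:
  assumes "x \<in> carrier R" "x \<noteq> \<zero>"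
  shows "x [^]\<^bsub>units_of R\<^esub> (j::int) = x [^] j"
proof -
  have x: "x \<in> Units R" using assms by (simp add: field_Units)
  show ?thesis unfolding int_pow_def2 units_of_pow[OF x]
    by (simp only: units_of_inv[OF Units_pow_closed[OF x]])
qed

lemma (in field) int_pow_nonzero:
  assumes "x \<in> carrier R" "x \<noteq> \<zero>"
  shows "x [^] (j::int) \<in> carrier R" "x [^] (j::int) \<noteq> \<zero>" "x [^] (i + j) = x [^] i \<otimes> x [^] (j::int)"
proof -
  interpret U: group "units_of R" by (rule units_group)
  have x: "x \<in> carrier (units_of R)" using assms by (simp add: units_of_carrier field_Units)
  have "x [^]\<^bsub>units_of R\<^esub> j \<in> carrier (units_of R)" using x by (rule U.int_pow_closed)
  then show "x [^] j \<in> carrier R" "x [^] j \<noteq> \<zero>"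
    by (simp_all add: int_pow_units_of assms units_of_carrier field_Units)
  show "x [^] (i + j) = x [^] i \<otimes> x [^] j"
    using U.int_pow_mult[OF x, of i j] by (simp add: int_pow_units_of assms units_of_mult)
qed

lemma (in field) inv_closed_nonzero:
  assumes "x \<in> carrier R" "x \<noteq> \<zero>"
  shows "inv x \<in> carrier R" "inv x \<noteq> \<zero>" "x \<otimes> inv x = \<one>" "inv x \<otimes> x = \<one>"
proof -
  have x: "x \<in> Units R" using assms by (simp add: field_Units)
  have "inv x \<in> Units R" by (rule Units_inv_Units[OF x])
  then show "inv x \<in> carrier R" "inv x \<noteq> \<zero>" by (simp_all add: field_Units)
  show "x \<otimes> inv x = \<one>" "inv x \<otimes> x = \<one>" by (rule Units_r_inv[OF x], rule Units_l_inv[OF x])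
qed

context padic begin

sublocale Q: fractions "Zp p" ..

abbreviation "K \<equiv> Qp p"
abbreviation emb where "emb a \<equiv> to_fraction (Zp p) a"
definition \<O> where "\<O> = emb ` carrier (Zp p)"
definition \<pi> where "\<pi> = emb (zint (int p))"
definition \<MM> where "\<MM> = {\<pi> \<otimes>\<^bsub>K\<^esub> x | x. x \<in> \<O>}"

lemma emb_closed [simp, intro]: "a \<in> carrier (Zp p) \<Longrightarrow> emb a \<in> carrier K"
  by (rule Q.to_fraction.hom_closed)

lemma emb_eq_0: "a \<in> carrier (Zp p) \<Longrightarrow> emb a = \<zero>\<^bsub>K\<^esub> \<longleftrightarrow> a = \<zero>\<^bsub>Zp p\<^esub>"
  unfolding Q.fraction_zero_one by (rule Q.to_fraction_inj) simp_all

lemma emb_Unit: "u \<in> Units (Zp p) \<Longrightarrow> emb u \<in> carrier K \<and> emb u \<noteq> \<zero>\<^bsub>K\<^esub>"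
proof -
  assume u: "u \<in> Units (Zp p)"
  then have "u \<noteq> \<zero>\<^bsub>Zp p\<^esub>" by (auto simp: Zp_Units_iff Zp_simps)
  then show ?thesis using u emb_eq_0[of u] emb_closed[of u] by blast
qed

lemma zint_nonzero: "k \<noteq> 0 \<Longrightarrow> zint k \<noteq> \<zero>\<^bsub>Zp p\<^esub>"
  using zint_inj[of k 0] unfolding zint_0 by blast

lemma pi_K [simp, intro]: "\<pi> \<in> carrier K" and pi_nz: "\<pi> \<noteq> \<zero>\<^bsub>K\<^esub>"
proof -
  show "\<pi> \<in> carrier K" unfolding \<pi>_def by (rule emb_closed) (rule zint_closed)
  have "int p \<noteq> 0" using p_gt(3) by linarith
  then show "\<pi> \<noteq> \<zero>\<^bsub>K\<^esub>" unfolding \<pi>_def emb_eq_0[OF zint_closed] by (rule zint_nonzero)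
qed

definition P :: "int \<Rightarrow> ((nat \<Rightarrow> int) \<times> (nat \<Rightarrow> int)) set" where "P j = \<pi> [^]\<^bsub>K\<^esub> j"

lemma P_closed [simp, intro]: "P j \<in> carrier K" and P_nz: "P j \<noteq> \<zero>\<^bsub>K\<^esub>"
  and P_add: "P (i + j) = P i \<otimes>\<^bsub>K\<^esub> P j"
  unfolding P_def by (rule Q.K.int_pow_nonzero[OF pi_K pi_nz])+

lemma P_0: "P 0 = \<one>\<^bsub>K\<^esub>"
  by (simp add: P_def)

lemma P_nat: "P (int n) = emb (zint (int p ^ n))"
proof -
  have "P (int n) = \<pi> [^]\<^bsub>K\<^esub> n" by (simp add: P_def int_pow_int)
  also have "\<dots> = emb (zint (int p) [^]\<^bsub>Zp p\<^esub> n)"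
    unfolding \<pi>_def by (rule Q.to_fraction.hom_nat_pow[symmetric]) simp
  finally show ?thesis by (simp add: zint_power)
qed

lemma P_1: "P 1 = \<pi>"
  using P_nat[of 1] by (simp add: \<pi>_def)

lemma P_minus: "P j \<otimes>\<^bsub>K\<^esub> P (- j) = \<one>\<^bsub>K\<^esub>"
  using P_add[of j "- j"] by (simp add: P_0)

text \<open>Well-definedness of the valuation: a quotient of two units is not divisible by \<open>p\<close>.\<close>

lemma unit_exponent_unique:
  assumes u: "u \<in> Units (Zp p)" and w: "w \<in> Units (Zp p)"
    and eq: "P i \<otimes>\<^bsub>K\<^esub> emb u = P j \<otimes>\<^bsub>K\<^esub> emb w"
  shows "i = j"
proof -
  have *: False if u: "u \<in> Units (Zp p)" and w: "w \<in> Units (Zp p)"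
    and eq: "P i \<otimes>\<^bsub>K\<^esub> emb u = P j \<otimes>\<^bsub>K\<^esub> emb w" and "i < j" for i j u w
  proof -
    obtain n where n: "j = i + int (Suc n)"
      using \<open>i < j\<close> by (metis zless_iff_Suc_zadd)
    have c: "emb u \<in> carrier K" "emb w \<in> carrier K" "u \<in> carrier (Zp p)" "w \<in> carrier (Zp p)"
      using u w emb_Unit by auto
    have "P i \<otimes>\<^bsub>K\<^esub> emb u = P i \<otimes>\<^bsub>K\<^esub> (P (int (Suc n)) \<otimes>\<^bsub>K\<^esub> emb w)"
      unfolding eq n P_add using c by (simp add: Q.K.m_assoc del: of_nat_Suc)
    then have "emb u = P (int (Suc n)) \<otimes>\<^bsub>K\<^esub> emb w"
      using c P_nz by (subst (asm) Q.K.m_lcancel) (auto simp del: of_nat_Suc)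
    also have "\<dots> = emb (zint (int p ^ Suc n) \<otimes>\<^bsub>Zp p\<^esub> w)"
      unfolding P_nat using c by (simp only: Q.to_fraction.hom_mult zint_closed)
    finally have "u = zint (int p ^ Suc n) \<otimes>\<^bsub>Zp p\<^esub> w"
      using c by (subst (asm) Q.to_fraction_inj) (auto intro!: Zp.m_closed)
    then show False
      using zint_p_power_unit(2)[OF w, of 1 "Suc n"] u by (simp add: Zp_Units_iff)
  qed
  show ?thesis
    using *[OF u w eq] *[OF w u eq[symmetric]] by (cases i j rule: linorder_cases) auto
qed

lemma K_decompose:
  assumes c: "c \<in> carrier K" "c \<noteq> \<zero>\<^bsub>K\<^esub>"
  obtains j u where "u \<in> Units (Zp p)" "c = P j \<otimes>\<^bsub>K\<^esub> emb u"
proof -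
  obtain a b where ab: "c = fraction (Zp p) a b" "a \<in> carrier (Zp p)" "b \<in> carrier (Zp p) - {\<zero>\<^bsub>Zp p\<^esub>}"
    using c(1) by (rule Q.fraction_cases)
  have fb: "c \<otimes>\<^bsub>K\<^esub> emb b = emb a" unfolding ab(1) by (rule Q.fraction_eq_div[OF ab(2,3)])
  have "emb b \<noteq> \<zero>\<^bsub>K\<^esub>" "emb b \<in> carrier K" using ab(3) emb_eq_0 by auto
  then have "emb a \<noteq> \<zero>\<^bsub>K\<^esub>" using fb c Q.K.integral_iff[of c "emb b"] by simp
  then have "a \<noteq> \<zero>\<^bsub>Zp p\<^esub>" using emb_eq_0 ab(2) by blast
  then obtain i u where u: "u \<in> Units (Zp p)" "a = zint (int p ^ i) \<otimes>\<^bsub>Zp p\<^esub> u" using Zp_decompose ab(2) by metis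
  obtain j w where w: "w \<in> Units (Zp p)" "b = zint (int p ^ j) \<otimes>\<^bsub>Zp p\<^esub> w" using Zp_decompose[of b] ab(3) by (metis Diff_iff singletonI)
  define x where "x = u \<otimes>\<^bsub>Zp p\<^esub> inv\<^bsub>Zp p\<^esub> w"
  have x: "x \<in> Units (Zp p)" unfolding x_def using u w by (intro Zp.Units_m_closed Zp.Units_inv_Units)
  have cc: "u \<in> carrier (Zp p)" "w \<in> carrier (Zp p)" "x \<in> carrier (Zp p)" "inv\<^bsub>Zp p\<^esub> w \<in> carrier (Zp p)" using u w x by auto
  have xw: "x \<otimes>\<^bsub>Zp p\<^esub> w = u" unfolding x_def using w cc by (simp only: Zp.m_assoc Zp.Units_l_inv Zp.r_one)
  have emb_b: "emb b = P (int j) \<otimes>\<^bsub>K\<^esub> emb w" unfolding w(2) P_nat using cc by (simp only: Q.to_fraction.hom_mult zint_closed)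
  have emb_a: "emb a = P (int i) \<otimes>\<^bsub>K\<^esub> emb u" unfolding u(2) P_nat using cc by (simp only: Q.to_fraction.hom_mult zint_closed)
  have K: "emb u \<in> carrier K" "emb w \<in> carrier K" "emb x \<in> carrier K" using cc by simp_all
  have "(P (int i - int j) \<otimes>\<^bsub>K\<^esub> emb x) \<otimes>\<^bsub>K\<^esub> emb b = (P (int i - int j) \<otimes>\<^bsub>K\<^esub> P (int j)) \<otimes>\<^bsub>K\<^esub> (emb x \<otimes>\<^bsub>K\<^esub> emb w)"
    unfolding emb_b using K by (simp add: Q.K.m_ac)
  also have "\<dots> = emb a" unfolding emb_a P_add[symmetric] using xw cc by (simp add: Q.to_fraction.hom_mult[symmetric])
  also have "\<dots> = c \<otimes>\<^bsub>K\<^esub> emb b" by (rule fb[symmetric])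
  finally have "P (int i - int j) \<otimes>\<^bsub>K\<^esub> emb x = c"
    using K c(1) \<open>emb b \<noteq> \<zero>\<^bsub>K\<^esub>\<close> \<open>emb b \<in> carrier K\<close> by (subst (asm) Q.K.m_rcancel) auto
  then show ?thesis using that[OF x] by metis
qed

lemma add_pow_one: "[k] \<cdot>\<^bsub>K\<^esub> \<one>\<^bsub>K\<^esub> = emb (zint k)" "[n] \<cdot>\<^bsub>K\<^esub> \<one>\<^bsub>K\<^esub> = emb (zint (int n))"
  for k :: int and n :: nat
proof -
  show nat: "[n] \<cdot>\<^bsub>K\<^esub> \<one>\<^bsub>K\<^esub> = emb (zint (int n))" for n
  proof (induction n)
    case 0
    then show ?case by (simp add: zint_0)
  next
    case (Suc n)
    have "emb (zint (int (Suc n))) = emb (zint (int n)) \<oplus>\<^bsub>K\<^esub> emb (zint 1)"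
      by (simp only: of_nat_Suc add.commute[of 1] zint_add Q.to_fraction.hom_add zint_closed)
    then show ?case using Suc by (simp add: zint_1)
  qed
  show "[k] \<cdot>\<^bsub>K\<^esub> \<one>\<^bsub>K\<^esub> = emb (zint k)"
  proof (cases "k \<ge> 0")
    case True
    then show ?thesis by (simp add: add_pow_int_ge nat)
  next
    case False
    then have "[k] \<cdot>\<^bsub>K\<^esub> \<one>\<^bsub>K\<^esub> = \<ominus>\<^bsub>K\<^esub> emb (zint (- k))" by (simp add: add_pow_int_lt nat)
    also have "\<dots> = emb (zint k)"
      by (simp only: Q.to_fraction.hom_a_inv[symmetric] zint_closed zint_minus[symmetric]) simp
    finally show ?thesis .
  qed
qed

lemma padic_val_eq:
  assumes u: "u \<in> Units (Zp p)"
  shows "padic_val p (P j \<otimes>\<^bsub>K\<^esub> emb u) = j"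
  unfolding padic_val_def add_pow_one \<pi>_def[symmetric] P_def[symmetric]
proof (rule the_equality)
  show "\<exists>w\<in>Units (Zp p). P j \<otimes>\<^bsub>K\<^esub> emb u = P j \<otimes>\<^bsub>K\<^esub> emb w" using u by blast
  fix i assume "\<exists>w\<in>Units (Zp p). P j \<otimes>\<^bsub>K\<^esub> emb u = P i \<otimes>\<^bsub>K\<^esub> emb w"
  then show "i = j" using unit_exponent_unique[OF u] by auto
qed

abbreviation v where "v \<equiv> padic_val p"

lemma v_mult:
  assumes "c \<in> carrier K" "c \<noteq> \<zero>\<^bsub>K\<^esub>" "d \<in> carrier K" "d \<noteq> \<zero>\<^bsub>K\<^esub>"
  shows "v (c \<otimes>\<^bsub>K\<^esub> d) = v c + v d"
proof -
  obtain i u where u: "u \<in> Units (Zp p)" "c = P i \<otimes>\<^bsub>K\<^esub> emb u" using K_decompose assms(1,2) .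
  obtain j w where w: "w \<in> Units (Zp p)" "d = P j \<otimes>\<^bsub>K\<^esub> emb w" using K_decompose assms(3,4) .
  have c: "u \<in> carrier (Zp p)" "w \<in> carrier (Zp p)" using u w by auto
  then have "c \<otimes>\<^bsub>K\<^esub> d = P (i + j) \<otimes>\<^bsub>K\<^esub> emb (u \<otimes>\<^bsub>Zp p\<^esub> w)"
    unfolding u(2) w(2) P_add Q.to_fraction.hom_mult[OF c] using emb_closed[OF c(1)] emb_closed[OF c(2)]
    by (simp add: Q.K.m_ac)
  moreover have "u \<otimes>\<^bsub>Zp p\<^esub> w \<in> Units (Zp p)" using u w by (intro Zp.Units_m_closed)
  ultimately have "v (c \<otimes>\<^bsub>K\<^esub> d) = i + j" by (simp only: padic_val_eq)
  then show ?thesis unfolding u(2) w(2) by (simp only: padic_val_eq u w)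
qed

lemma O_iff:
  assumes c: "c \<in> carrier K" "c \<noteq> \<zero>\<^bsub>K\<^esub>"
  shows "c \<in> \<O> \<longleftrightarrow> v c \<ge> 0"
proof
  assume "c \<in> \<O>"
  then obtain a where a: "a \<in> carrier (Zp p)" "c = emb a" unfolding \<O>_def by blast
  have "a \<noteq> \<zero>\<^bsub>Zp p\<^esub>" using c a emb_eq_0 by blast
  then obtain j u where u: "u \<in> Units (Zp p)" "a = zint (int p ^ j) \<otimes>\<^bsub>Zp p\<^esub> u" using Zp_decompose a(1) by metis
  have "c = P (int j) \<otimes>\<^bsub>K\<^esub> emb u"
    unfolding a(2) u(2) P_nat using u(1) by (intro Q.to_fraction.hom_mult) auto
  then show "v c \<ge> 0" by (simp only: padic_val_eq u)
next
  obtain j u where u: "u \<in> Units (Zp p)" "c = P j \<otimes>\<^bsub>K\<^esub> emb u" using K_decompose c .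
  assume "v c \<ge> 0"
  then have "j \<ge> 0" unfolding u(2) by (simp only: padic_val_eq u)
  then have "c = emb (zint (int p ^ nat j) \<otimes>\<^bsub>Zp p\<^esub> u)"
    unfolding u(2) using u(1) P_nat[of "nat j"] by (subst Q.to_fraction.hom_mult) auto
  then show "c \<in> \<O>" unfolding \<O>_def using u(1) by (intro image_eqI) (auto intro!: Zp.m_closed)
qed

lemma O_cases:
  assumes "x \<in> \<O>" obtains a where "a \<in> carrier (Zp p)" "x = emb a"
  using assms unfolding \<O>_def by blast

lemma O_closed:
  "x \<in> \<O> \<Longrightarrow> x \<in> carrier K" "x \<in> \<O> \<Longrightarrow> y \<in> \<O> \<Longrightarrow> x \<oplus>\<^bsub>K\<^esub> y \<in> \<O>"
  "x \<in> \<O> \<Longrightarrow> y \<in> \<O> \<Longrightarrow> x \<otimes>\<^bsub>K\<^esub> y \<in> \<O>" "x \<in> \<O> \<Longrightarrow> \<ominus>\<^bsub>K\<^esub> x \<in> \<O>"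
  "\<zero>\<^bsub>K\<^esub> \<in> \<O>" "\<one>\<^bsub>K\<^esub> \<in> \<O>" "\<pi> \<in> \<O>" "emb (zint k) \<in> \<O>"
proof -
  show "x \<in> \<O> \<Longrightarrow> x \<in> carrier K" unfolding \<O>_def by blast
  show "x \<oplus>\<^bsub>K\<^esub> y \<in> \<O>" if x: "x \<in> \<O>" and y: "y \<in> \<O>"
  proof -
    obtain a where a: "a \<in> carrier (Zp p)" "x = emb a" using x by (rule O_cases)
    obtain b where b: "b \<in> carrier (Zp p)" "y = emb b" using y by (rule O_cases)
    show ?thesis unfolding a(2) b(2) Q.to_fraction.hom_add[OF a(1) b(1), symmetric] \<O>_def
      using a(1) b(1) by (intro imageI Zp.add.m_closed)
  qed
  show "x \<otimes>\<^bsub>K\<^esub> y \<in> \<O>" if x: "x \<in> \<O>" and y: "y \<in> \<O>"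
  proof -
    obtain a where a: "a \<in> carrier (Zp p)" "x = emb a" using x by (rule O_cases)
    obtain b where b: "b \<in> carrier (Zp p)" "y = emb b" using y by (rule O_cases)
    show ?thesis unfolding a(2) b(2) Q.to_fraction.hom_mult[OF a(1) b(1), symmetric] \<O>_def
      using a(1) b(1) by (intro imageI Zp.m_closed)
  qed
  show "\<ominus>\<^bsub>K\<^esub> x \<in> \<O>" if x: "x \<in> \<O>"
  proof -
    obtain a where a: "a \<in> carrier (Zp p)" "x = emb a" using x by (rule O_cases)
    show ?thesis unfolding a(2) Q.to_fraction.hom_a_inv[OF a(1), symmetric] \<O>_def
      using a(1) by (intro imageI Zp.a_inv_closed)
  qed
  show "\<zero>\<^bsub>K\<^esub> \<in> \<O>" unfolding Q.to_fraction.hom_zero[symmetric] \<O>_def by (intro imageI Zp.zero_closed)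
  show "\<one>\<^bsub>K\<^esub> \<in> \<O>" unfolding Q.to_fraction.hom_one[symmetric] \<O>_def by (intro imageI Zp.one_closed)
  show "emb (zint k) \<in> \<O>" for k unfolding \<O>_def by blast
  then show "\<pi> \<in> \<O>" unfolding \<pi>_def .
qed

lemma O_minus: "x \<in> \<O> \<Longrightarrow> y \<in> \<O> \<Longrightarrow> x \<ominus>\<^bsub>K\<^esub> y \<in> \<O>"
  by (simp add: a_minus_def O_closed)

lemma O_pow: "x \<in> \<O> \<Longrightarrow> x [^]\<^bsub>K\<^esub> (n::nat) \<in> \<O>"
  by (induction n) (simp_all add: O_closed)

lemma Zp_p_multiple:
  assumes a: "a \<in> carrier (Zp p)"
  shows "a 1 = 0 \<longleftrightarrow> (\<exists>b\<in>carrier (Zp p). a = zint (int p) \<otimes>\<^bsub>Zp p\<^esub> b)"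
proof
  assume a1: "a 1 = 0"
  show "\<exists>b\<in>carrier (Zp p). a = zint (int p) \<otimes>\<^bsub>Zp p\<^esub> b"
  proof (cases "a = \<zero>\<^bsub>Zp p\<^esub>")
    case True
    then show ?thesis using Zp.r_null[OF zint_closed[of "int p"]] Zp.zero_closed by metis
  next
    case False
    obtain j u where u: "u \<in> Units (Zp p)" "a = zint (int p ^ j) \<otimes>\<^bsub>Zp p\<^esub> u" using Zp_decompose a False by metis
    have "j \<noteq> 0"
    proof
      assume "j = 0"
      then have "a 1 \<noteq> 0" using zint_p_power_unit(1)[OF u(1), of 0] u(2) by simp
      then show False using a1 by simp
    qed
    then obtain i where "j = Suc i" by (cases j) auto
    then have "a = zint (int p) \<otimes>\<^bsub>Zp p\<^esub> (zint (int p ^ i) \<otimes>\<^bsub>Zp p\<^esub> u)"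
      using u(1) unfolding u(2) by (simp add: zint_mult Zp.m_assoc Zp.Units_closed)
    then show ?thesis using u(1) by (metis Zp.Units_closed Zp.m_closed zint_closed)
  qed
next
  assume "\<exists>b\<in>carrier (Zp p). a = zint (int p) \<otimes>\<^bsub>Zp p\<^esub> b"
  then show "a 1 = 0" by (auto simp: Zp_simps zint_def)
qed

lemma M_iff:
  assumes a: "a \<in> carrier (Zp p)"
  shows "emb a \<in> \<MM> \<longleftrightarrow> a 1 = 0"
proof -
  have "emb a \<in> \<MM> \<longleftrightarrow> (\<exists>b\<in>carrier (Zp p). emb a = emb (zint (int p) \<otimes>\<^bsub>Zp p\<^esub> b))"
    unfolding \<MM>_def \<O>_def \<pi>_def using Q.to_fraction.hom_mult[OF zint_closed[of "int p"]] by auto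
  also have "\<dots> \<longleftrightarrow> (\<exists>b\<in>carrier (Zp p). a = zint (int p) \<otimes>\<^bsub>Zp p\<^esub> b)"
    using a Q.to_fraction_inj[OF a Zp.m_closed[OF zint_closed[of "int p"]]] by blast
  finally show ?thesis using Zp_p_multiple[OF a] by simp
qed

lemma M_closed:
  "x \<in> \<MM> \<Longrightarrow> x \<in> \<O>" "x \<in> \<MM> \<Longrightarrow> y \<in> \<MM> \<Longrightarrow> x \<oplus>\<^bsub>K\<^esub> y \<in> \<MM>" "x \<in> \<MM> \<Longrightarrow> y \<in> \<O> \<Longrightarrow> x \<otimes>\<^bsub>K\<^esub> y \<in> \<MM>"
  "x \<in> \<MM> \<Longrightarrow> \<ominus>\<^bsub>K\<^esub> x \<in> \<MM>" "\<one>\<^bsub>K\<^esub> \<notin> \<MM>" "\<zero>\<^bsub>K\<^esub> \<in> \<MM>"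
proof -
  show "x \<in> \<MM> \<Longrightarrow> x \<in> \<O>" by (auto simp: \<MM>_def O_closed)
  show "x \<oplus>\<^bsub>K\<^esub> y \<in> \<MM>" if "x \<in> \<MM>" "y \<in> \<MM>"
  proof -
    obtain a b where "a \<in> \<O>" "b \<in> \<O>" "x = \<pi> \<otimes>\<^bsub>K\<^esub> a" "y = \<pi> \<otimes>\<^bsub>K\<^esub> b" using \<open>x \<in> \<MM>\<close> \<open>y \<in> \<MM>\<close> by (auto simp: \<MM>_def)
    moreover from this have "x \<oplus>\<^bsub>K\<^esub> y = \<pi> \<otimes>\<^bsub>K\<^esub> (a \<oplus>\<^bsub>K\<^esub> b)" by (simp add: Q.K.r_distr O_closed)
    ultimately show ?thesis unfolding \<MM>_def using O_closed(2) by blast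
  qed
  show "x \<otimes>\<^bsub>K\<^esub> y \<in> \<MM>" if "x \<in> \<MM>" "y \<in> \<O>"
  proof -
    obtain a where "a \<in> \<O>" "x = \<pi> \<otimes>\<^bsub>K\<^esub> a" using \<open>x \<in> \<MM>\<close> by (auto simp: \<MM>_def)
    moreover from this have "x \<otimes>\<^bsub>K\<^esub> y = \<pi> \<otimes>\<^bsub>K\<^esub> (a \<otimes>\<^bsub>K\<^esub> y)" using that by (simp add: Q.K.m_assoc O_closed)
    ultimately show ?thesis unfolding \<MM>_def using O_closed(3) that by blast
  qed
  show "\<ominus>\<^bsub>K\<^esub> x \<in> \<MM>" if "x \<in> \<MM>"
  proof -
    obtain a where "a \<in> \<O>" "x = \<pi> \<otimes>\<^bsub>K\<^esub> a" using \<open>x \<in> \<MM>\<close> by (auto simp: \<MM>_def)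
    moreover from this have "\<ominus>\<^bsub>K\<^esub> x = \<pi> \<otimes>\<^bsub>K\<^esub> (\<ominus>\<^bsub>K\<^esub> a)" by (simp add: Q.K.r_minus O_closed)
    ultimately show ?thesis unfolding \<MM>_def using O_closed(4) by blast
  qed
  have "\<one>\<^bsub>Zp p\<^esub> 1 \<noteq> 0" using p_gt by (simp add: Zp_simps)
  then show "\<one>\<^bsub>K\<^esub> \<notin> \<MM>" unfolding Q.to_fraction.hom_one[symmetric] M_iff[OF Zp.one_closed] .
  show "\<zero>\<^bsub>K\<^esub> \<in> \<MM>" unfolding Q.to_fraction.hom_zero[symmetric] M_iff[OF Zp.zero_closed] by (simp add: Zp_simps)
qed

lemma O_unit:
  assumes "x \<in> \<O>" "x \<notin> \<MM>"
  obtains u where "u \<in> Units (Zp p)" "x = emb u"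
  using assms M_iff Zp_Units_iff by (metis O_cases)

lemma O_unit_inv:
  assumes "x \<in> \<O>" "x \<notin> \<MM>"
  shows "x \<noteq> \<zero>\<^bsub>K\<^esub>" "inv\<^bsub>K\<^esub> x \<in> \<O>"
proof -
  obtain u where u: "u \<in> Units (Zp p)" "x = emb u" using assms by (rule O_unit)
  show "x \<noteq> \<zero>\<^bsub>K\<^esub>" using emb_Unit u by simp
  have "emb (inv\<^bsub>Zp p\<^esub> u) \<otimes>\<^bsub>K\<^esub> x = \<one>\<^bsub>K\<^esub>"
    unfolding u(2) using Q.to_fraction.hom_mult[of "inv\<^bsub>Zp p\<^esub> u" u, symmetric] Zp.Units_closed[OF u(1)] u(1) by simp
  then have "x \<otimes>\<^bsub>K\<^esub> emb (inv\<^bsub>Zp p\<^esub> u) = \<one>\<^bsub>K\<^esub>"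
    using Q.K.m_comm[of x "emb (inv\<^bsub>Zp p\<^esub> u)"] u emb_Unit[OF u(1)] by simp
  then have "inv\<^bsub>K\<^esub> x = emb (inv\<^bsub>Zp p\<^esub> u)"
    using u emb_Unit[OF u(1)] by (intro Q.K.comm_inv_char) simp_all
  then show "inv\<^bsub>K\<^esub> x \<in> \<O>" unfolding \<O>_def using u(1) by auto
qed

lemma v_P_unit: "x \<in> \<O> \<Longrightarrow> x \<notin> \<MM> \<Longrightarrow> v (P j \<otimes>\<^bsub>K\<^esub> x) = j"
  by (metis O_unit padic_val_eq)

lemma not_O_inv:
  assumes "x \<in> carrier K" "x \<notin> \<O>"
  shows "x \<noteq> \<zero>\<^bsub>K\<^esub>" "inv\<^bsub>K\<^esub> x \<in> \<MM>"
proof -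
  show nz: "x \<noteq> \<zero>\<^bsub>K\<^esub>" using assms O_closed(5) by blast
  obtain j u where u: "u \<in> Units (Zp p)" "x = P j \<otimes>\<^bsub>K\<^esub> emb u" using K_decompose assms(1) nz .
  have uK: "emb u \<in> carrier K" "emb u \<noteq> \<zero>\<^bsub>K\<^esub>" using emb_Unit u by auto
  have "j < 0"
    using O_iff[OF assms(1) nz] assms(2) unfolding u(2) by (simp add: padic_val_eq u)
  then obtain n where n: "- j = 1 + int n" by (metis add_0 add_uminus_conv_diff diff_minus_eq_add int_one_le_iff_zero_less zero_less_imp_eq_int neg_0_less_iff_less zle_iff_zadd)
  have unit: "emb u \<in> \<O>" "emb u \<notin> \<MM>" using u(1) M_iff by (auto simp: Zp_Units_iff \<O>_def)
  have "(\<pi> \<otimes>\<^bsub>K\<^esub> (P (int n) \<otimes>\<^bsub>K\<^esub> inv\<^bsub>K\<^esub> emb u)) \<otimes>\<^bsub>K\<^esub> x = (P 1 \<otimes>\<^bsub>K\<^esub> P (int n) \<otimes>\<^bsub>K\<^esub> P j) \<otimes>\<^bsub>K\<^esub> (inv\<^bsub>K\<^esub> emb u \<otimes>\<^bsub>K\<^esub> emb u)"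
    unfolding u(2) using uK Q.K.inv_closed_nonzero[OF uK] by (simp add: P_1 Q.K.m_ac)
  also have "P 1 \<otimes>\<^bsub>K\<^esub> P (int n) = P (- j)" by (simp only: n P_add)
  also have "P (- j) \<otimes>\<^bsub>K\<^esub> P j = \<one>\<^bsub>K\<^esub>" using P_minus[of "- j"] by simp
  finally have "(\<pi> \<otimes>\<^bsub>K\<^esub> (P (int n) \<otimes>\<^bsub>K\<^esub> inv\<^bsub>K\<^esub> emb u)) \<otimes>\<^bsub>K\<^esub> x = \<one>\<^bsub>K\<^esub>"
    using Q.K.inv_closed_nonzero[OF uK] by simp
  then have "inv\<^bsub>K\<^esub> x = \<pi> \<otimes>\<^bsub>K\<^esub> (P (int n) \<otimes>\<^bsub>K\<^esub> inv\<^bsub>K\<^esub> emb u)"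
    using assms(1) Q.K.inv_closed_nonzero[OF uK] by (intro Q.K.comm_inv_char) (simp_all add: Q.K.m_comm)
  moreover have "P (int n) \<otimes>\<^bsub>K\<^esub> inv\<^bsub>K\<^esub> emb u \<in> \<O>"
    using O_unit_inv(2)[OF unit] O_closed(3,8) by (simp add: P_nat)
  ultimately show "inv\<^bsub>K\<^esub> x \<in> \<MM>" unfolding \<MM>_def by blast
qed

text \<open>Fermat's little theorem: modulo \<open>p\<close> the Frobenius fixes the scalars.\<close>

lemma fermat_O:
  assumes "x \<in> \<O>"
  obtains y where "y \<in> \<O>" "x [^]\<^bsub>K\<^esub> p = x \<oplus>\<^bsub>K\<^esub> \<pi> \<otimes>\<^bsub>K\<^esub> y"
proof -
  obtain a where a: "a \<in> carrier (Zp p)" "x = emb a" using assms by (rule O_cases)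
  have "[a 1 ^ p = a 1] (mod int p)"
  proof (cases "int p dvd a 1")
    case True
    then show ?thesis using p_gt by (simp add: cong_0_iff[THEN iffD2] cong_def dvd_eq_mod_eq_0 power_mod[symmetric] zero_power)
  next
    case False
    define m where "m = nat (a 1)"
    have m: "a 1 = int m" using Zp_range[OF a(1), of 1] by (simp add: m_def)
    have "\<not> p dvd m" using False m by simp
    then have "[m ^ (p - 1) = 1] (mod p)" using prime_p by (intro fermat_theorem)
    then have "[m ^ (p - 1) * m = 1 * m] (mod p)" by (rule cong_scalar_right)
    then have "[m ^ p = m] (mod p)" using p_gt(1) by (simp add: power_Suc2[symmetric] del: power_Suc)
    then show ?thesis unfolding m by (metis cong_int_iff of_nat_power)
  qed
  then have "(a [^]\<^bsub>Zp p\<^esub> p \<ominus>\<^bsub>Zp p\<^esub> a) 1 = 0"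
  proof -
    assume c: "[a 1 ^ p = a 1] (mod int p)"
    have n: "(\<ominus>\<^bsub>Zp p\<^esub> a) = (\<lambda>n. (- a n) mod int p ^ n)"
    proof (rule Zp.minus_equality)
      show "(\<lambda>n. (- a n) mod int p ^ n) \<in> carrier (Zp p)"
        using a(1) by (intro Zp_memI) (simp add: Zp_cong cong_minus_minus_iff)
    qed (simp_all add: a Zp_simps mod_simps)
    show ?thesis using c a(1) by (simp add: a_minus_def n Zp_simps Zp_pow mod_simps cong_iff_dvd_diff)
  qed
  then have "emb (a [^]\<^bsub>Zp p\<^esub> p \<ominus>\<^bsub>Zp p\<^esub> a) \<in> \<MM>" using a(1) by (subst M_iff) auto
  moreover have "emb (a [^]\<^bsub>Zp p\<^esub> p \<ominus>\<^bsub>Zp p\<^esub> a) = x [^]\<^bsub>K\<^esub> p \<ominus>\<^bsub>K\<^esub> x"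
    using a by (simp add: a_minus_def Q.to_fraction.hom_add Q.to_fraction.hom_a_inv Q.to_fraction.hom_nat_pow)
  ultimately obtain y where y: "y \<in> \<O>" "x [^]\<^bsub>K\<^esub> p \<ominus>\<^bsub>K\<^esub> x = \<pi> \<otimes>\<^bsub>K\<^esub> y" by (auto simp: \<MM>_def)
  have "x [^]\<^bsub>K\<^esub> p = x \<oplus>\<^bsub>K\<^esub> (x [^]\<^bsub>K\<^esub> p \<ominus>\<^bsub>K\<^esub> x)" using O_closed(1)[OF assms]
    by (simp add: a_minus_def Q.K.a_lcomm[of x "x [^]\<^bsub>K\<^esub> p"] Q.K.r_neg)
  then show ?thesis using that[OF y(1)] y(2) by simp
qed

text \<open>Dividing a pair by its coordinate of smallest valuation.\<close>

lemma scale_pair: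
  assumes "l \<in> carrier K" "m \<in> carrier K" "l \<noteq> \<zero>\<^bsub>K\<^esub> \<or> m \<noteq> \<zero>\<^bsub>K\<^esub>"
  obtains j l' m' where "l' \<in> \<O>" "m' \<in> \<O>" "l = P j \<otimes>\<^bsub>K\<^esub> l'" "m = P j \<otimes>\<^bsub>K\<^esub> m'" "l' \<notin> \<MM> \<or> m' \<notin> \<MM>"
proof -
  have mul: "P j \<otimes>\<^bsub>K\<^esub> (P (- j) \<otimes>\<^bsub>K\<^esub> x) = x" if "x \<in> carrier K" for j x
    using that P_minus[of j] by (simp add: Q.K.m_assoc[symmetric])
  have unitI: "\<exists>j. P (- j) \<otimes>\<^bsub>K\<^esub> l \<in> \<O> \<and> P (- j) \<otimes>\<^bsub>K\<^esub> m \<in> \<O> \<and> P (- j) \<otimes>\<^bsub>K\<^esub> l \<notin> \<MM>"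
    if l: "l \<in> carrier K" "l \<noteq> \<zero>\<^bsub>K\<^esub>" and m: "m \<in> carrier K" "m = \<zero>\<^bsub>K\<^esub> \<or> v l \<le> v m" for l m
  proof -
    obtain j u where u: "u \<in> Units (Zp p)" "l = P j \<otimes>\<^bsub>K\<^esub> emb u" using K_decompose l .
    have uK: "emb u \<in> carrier K" using u emb_Unit by auto
    have unit: "emb u \<in> \<O>" "emb u \<notin> \<MM>" using u(1) M_iff by (auto simp: Zp_Units_iff \<O>_def)
    have l': "P (- j) \<otimes>\<^bsub>K\<^esub> l = emb u" using mul[OF uK, of "- j"] unfolding u(2) by simp
    have vl: "v l = j" unfolding u(2) by (rule padic_val_eq[OF u(1)])
    have "P (- j) \<otimes>\<^bsub>K\<^esub> m \<in> \<O>"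
    proof (cases "m = \<zero>\<^bsub>K\<^esub>")
      case True
      then show ?thesis by (simp add: O_closed)
    next
      case False
      obtain i w where w: "w \<in> Units (Zp p)" "m = P i \<otimes>\<^bsub>K\<^esub> emb w" using K_decompose m(1) False .
      have wK: "emb w \<in> carrier K" using w emb_Unit by auto
      have vm: "v m = i" unfolding w(2) by (rule padic_val_eq[OF w(1)])
      have "P (- j) \<otimes>\<^bsub>K\<^esub> m = P (- j + i) \<otimes>\<^bsub>K\<^esub> emb w"
        unfolding w(2) P_add using wK by (simp add: Q.K.m_assoc)
      also have "- j + i = int (nat (i - j))" using m(2) False vl vm by simp
      also have "P (int (nat (i - j))) \<otimes>\<^bsub>K\<^esub> emb w \<in> \<O>"
        unfolding P_nat by (rule O_closed(3)[OF O_closed(8)]) (use w(1) in \<open>auto simp: \<O>_def\<close>)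
      finally show ?thesis .
    qed
    then show ?thesis using l' unit by metis
  qed
  show ?thesis
  proof (cases "l \<noteq> \<zero>\<^bsub>K\<^esub> \<and> (m = \<zero>\<^bsub>K\<^esub> \<or> v l \<le> v m)")
    case True
    then obtain j where "P (- j) \<otimes>\<^bsub>K\<^esub> l \<in> \<O>" "P (- j) \<otimes>\<^bsub>K\<^esub> m \<in> \<O>" "P (- j) \<otimes>\<^bsub>K\<^esub> l \<notin> \<MM>"
      using unitI[of l m] assms(1,2) by blast
    then show ?thesis using that[of _ _ j] mul[OF assms(1), of j, symmetric] mul[OF assms(2), of j, symmetric] by blast
  next
    case False
    then have "m \<noteq> \<zero>\<^bsub>K\<^esub> \<and> (l = \<zero>\<^bsub>K\<^esub> \<or> v m \<le> v l)" using assms(3) by auto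
    then obtain j where "P (- j) \<otimes>\<^bsub>K\<^esub> m \<in> \<O>" "P (- j) \<otimes>\<^bsub>K\<^esub> l \<in> \<O>" "P (- j) \<otimes>\<^bsub>K\<^esub> m \<notin> \<MM>"
      using unitI[of m l] assms(1,2) by blast
    then show ?thesis using that[of _ _ j] mul[OF assms(1), of j, symmetric] mul[OF assms(2), of j, symmetric] by blast
  qed
qed

end

section \<open>Quadratic subfields of a quaternion algebra\<close>

context clifford_algebra begin

definition lin where "lin z \<alpha> \<beta> = \<iota> \<alpha> \<oplus>\<^bsub>B\<^esub> \<iota> \<beta> \<otimes>\<^bsub>B\<^esub> z"

lemma lin_closed [simp, intro]:
  "z \<in> carrier B \<Longrightarrow> \<alpha> \<in> carrier R \<Longrightarrow> \<beta> \<in> carrier R \<Longrightarrow> lin z \<alpha> \<beta> \<in> carrier B"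
  by (simp add: lin_def)

lemma lin_quad:
  assumes "z0 \<in> carrier R" "z1 \<in> carrier R" "z2 \<in> carrier R" "z3 \<in> carrier R" "\<alpha> \<in> carrier R" "\<beta> \<in> carrier R"
  shows "lin (quad z0 z1 z2 z3) \<alpha> \<beta> = quad (\<alpha> \<oplus> \<beta> \<otimes> z0) (\<beta> \<otimes> z1) (\<beta> \<otimes> z2) (\<beta> \<otimes> z3)"
  using assms by (simp add: lin_def \<iota>_mult smult_B) (simp add: \<iota>_def add_B)

lemma lin_add:
  assumes "z \<in> carrier B" "\<alpha> \<in> carrier R" "\<beta> \<in> carrier R" "\<gamma> \<in> carrier R" "\<delta> \<in> carrier R"
  shows "lin z \<alpha> \<beta> \<oplus>\<^bsub>B\<^esub> lin z \<gamma> \<delta> = lin z (\<alpha> \<oplus> \<gamma>) (\<beta> \<oplus> \<delta>)"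
proof -
  obtain x0 x1 x2 x3 where x: "z = quad x0 x1 x2 x3"
    and c: "x0 \<in> carrier R" "x1 \<in> carrier R" "x2 \<in> carrier R" "x3 \<in> carrier R"
    using assms(1) by (rule B_cases)
  show ?thesis using assms(2-) by (simp add: x c lin_quad add_B l_distr a_ac)
qed

lemma lin_mult:
  assumes "z \<in> carrier B" "\<alpha> \<in> carrier R" "\<beta> \<in> carrier R" "\<gamma> \<in> carrier R" "\<delta> \<in> carrier R"
  shows "lin z \<alpha> \<beta> \<otimes>\<^bsub>B\<^esub> lin z \<gamma> \<delta> =
    lin z (\<alpha> \<otimes> \<gamma> \<ominus> \<beta> \<otimes> \<delta> \<otimes> nrd z) (\<alpha> \<otimes> \<delta> \<oplus> \<beta> \<otimes> \<gamma> \<oplus> \<beta> \<otimes> \<delta> \<otimes> trd z)"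
proof -
  obtain x0 x1 x2 x3 where x: "z = quad x0 x1 x2 x3"
    and c: "x0 \<in> carrier R" "x1 \<in> carrier R" "x2 \<in> carrier R" "x3 \<in> carrier R"
    using assms(1) by (rule B_cases)
  show ?thesis
    apply (simp add: x c assms lin_quad mult_B mul_simps nrd_def trd_def)
    using c[THEN tr_ex] tr_par assms(2-)[THEN tr_ex]
    by (elim exE, hypsubst, simp only: tr_hom, simp add: algebra_simps)
qed

lemma lin_minus:
  assumes "z \<in> carrier B" "\<alpha> \<in> carrier R" "\<beta> \<in> carrier R"
  shows "\<ominus>\<^bsub>B\<^esub> lin z \<alpha> \<beta> = lin z (\<ominus> \<alpha>) (\<ominus> \<beta>)"
proof (rule B.minus_equality)
  show "lin z (\<ominus> \<alpha>) (\<ominus> \<beta>) \<oplus>\<^bsub>B\<^esub> lin z \<alpha> \<beta> = \<zero>\<^bsub>B\<^esub>"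
    using assms by (simp add: lin_add l_neg) (simp add: lin_def)
qed (use assms in simp_all)

lemma lin_comm:
  assumes "z \<in> carrier B" "\<alpha> \<in> carrier R" "\<beta> \<in> carrier R" "\<gamma> \<in> carrier R" "\<delta> \<in> carrier R"
  shows "lin z \<alpha> \<beta> \<otimes>\<^bsub>B\<^esub> lin z \<gamma> \<delta> = lin z \<gamma> \<delta> \<otimes>\<^bsub>B\<^esub> lin z \<alpha> \<beta>"
  using assms by (simp add: lin_mult m_ac a_ac)

lemma lin_scalar: "z \<in> carrier B \<Longrightarrow> r \<in> carrier R \<Longrightarrow> lin z r \<zero> = \<iota> r"
  by (simp add: lin_def)

lemma lin_self: "z \<in> carrier B \<Longrightarrow> lin z \<zero> \<one> = z"
  by (simp add: lin_def)

lemma lin_trd_nrd: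
  assumes "z \<in> carrier B" "\<alpha> \<in> carrier R" "\<beta> \<in> carrier R"
  shows "nrd (lin z \<alpha> \<beta>) = \<alpha> \<otimes> \<alpha> \<oplus> \<alpha> \<otimes> \<beta> \<otimes> trd z \<oplus> \<beta> \<otimes> \<beta> \<otimes> nrd z"
    "trd (lin z \<alpha> \<beta>) = \<alpha> \<oplus> \<alpha> \<oplus> \<beta> \<otimes> trd z"
    "cj (lin z \<alpha> \<beta>) = lin z (\<alpha> \<oplus> \<beta> \<otimes> trd z) (\<ominus> \<beta>)"
proof -
  obtain x0 x1 x2 x3 where x: "z = quad x0 x1 x2 x3"
    and c: "x0 \<in> carrier R" "x1 \<in> carrier R" "x2 \<in> carrier R" "x3 \<in> carrier R"
    using assms(1) by (rule B_cases)
  show "nrd (lin z \<alpha> \<beta>) = \<alpha> \<otimes> \<alpha> \<oplus> \<alpha> \<otimes> \<beta> \<otimes> trd z \<oplus> \<beta> \<otimes> \<beta> \<otimes> nrd z"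
    apply (simp add: x c assms lin_quad nrd_def trd_def)
    using c[THEN tr_ex] tr_par assms(2-)[THEN tr_ex]
    by (elim exE, hypsubst, simp only: tr_hom, simp add: algebra_simps)
  show "trd (lin z \<alpha> \<beta>) = \<alpha> \<oplus> \<alpha> \<oplus> \<beta> \<otimes> trd z"
    using assms(2-) by (simp add: x c lin_quad trd_def r_distr a_ac)
  show "cj (lin z \<alpha> \<beta>) = lin z (\<alpha> \<oplus> \<beta> \<otimes> trd z) (\<ominus> \<beta>)"
    apply (simp add: x c assms lin_quad trd_def cj_def)
    using c[THEN tr_ex] tr_par assms(2-)[THEN tr_ex]
    by (elim exE, hypsubst, simp only: tr_hom, simp add: algebra_simps)
qed

definition scalars where "scalars = \<iota> ` carrier R"

lemma scalars_eq: "alg_scalar R A ` carrier R = scalars"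
  by (simp add: scalars_def alg_scalar_eq)

text \<open>By the quadratic equation of \<open>z\<close>, the linear polynomials in \<open>z\<close> already form a subring.\<close>

lemma simple_extension_eq:
  assumes z: "z \<in> carrier B"
  shows "B.simple_extension scalars z = {lin z \<alpha> \<beta> | \<alpha> \<beta>. \<alpha> \<in> carrier R \<and> \<beta> \<in> carrier R}"
proof (intro equalityI subsetI)
  fix x assume "x \<in> B.simple_extension scalars z"
  then show "x \<in> {lin z \<alpha> \<beta> | \<alpha> \<beta>. \<alpha> \<in> carrier R \<and> \<beta> \<in> carrier R}"
  proof induction
    case zero
    have "\<zero>\<^bsub>B\<^esub> = lin z \<zero> \<zero>" using z by (simp add: lin_def)
    then show ?case by blast
  next
    case (lin k1 k2)
    then obtain \<alpha> \<beta> r where k: "k1 = lin z \<alpha> \<beta>" "k2 = \<iota> r" "\<alpha> \<in> carrier R" "\<beta> \<in> carrier R" "r \<in> carrier R"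
      by (auto simp: scalars_def)
    have "k1 \<otimes>\<^bsub>B\<^esub> z \<oplus>\<^bsub>B\<^esub> k2 = lin z \<alpha> \<beta> \<otimes>\<^bsub>B\<^esub> lin z \<zero> \<one> \<oplus>\<^bsub>B\<^esub> lin z r \<zero>"
      using k z by (simp add: lin_self lin_scalar)
    also have "\<dots> = lin z (\<ominus> (\<beta> \<otimes> nrd z) \<oplus> r) (\<alpha> \<oplus> \<beta> \<otimes> trd z)"
      using k z by (simp add: lin_mult lin_add a_minus_def)
    finally show ?case using k z by blast
  qed
next
  fix x assume "x \<in> {lin z \<alpha> \<beta> | \<alpha> \<beta>. \<alpha> \<in> carrier R \<and> \<beta> \<in> carrier R}"
  then obtain \<alpha> \<beta> where x: "x = lin z \<alpha> \<beta>" "\<alpha> \<in> carrier R" "\<beta> \<in> carrier R" by blast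
  have "\<zero>\<^bsub>B\<^esub> \<otimes>\<^bsub>B\<^esub> z \<oplus>\<^bsub>B\<^esub> \<iota> \<beta> \<in> B.simple_extension scalars z"
    using x by (intro B.simple_extension.lin B.simple_extension.zero) (auto simp: scalars_def)
  then have "\<iota> \<beta> \<otimes>\<^bsub>B\<^esub> z \<oplus>\<^bsub>B\<^esub> \<iota> \<alpha> \<in> B.simple_extension scalars z"
    using x z by (intro B.simple_extension.lin) (auto simp: scalars_def)
  then show "x \<in> B.simple_extension scalars z"
    using x z by (simp add: lin_def B.a_comm)
qed

text \<open>\<open>K[z]\<close> is a field exactly if the quadratic polynomial of \<open>z\<close> does not split into linear factors. The
  factors are multiplied in the algebra, so that an isomorphism visibly preserves the condition.\<close>

definition noroot where
  "noroot z \<longleftrightarrow> (\<forall>r\<in>carrier R. \<forall>r'\<in>carrier R. (z \<ominus>\<^bsub>B\<^esub> \<iota> r) \<otimes>\<^bsub>B\<^esub> (z \<ominus>\<^bsub>B\<^esub> \<iota> r') \<noteq> \<zero>\<^bsub>B\<^esub>)"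

lemma lin_root_product:
  assumes z: "z \<in> carrier B" and r: "r \<in> carrier R" "r' \<in> carrier R"
  shows "(z \<ominus>\<^bsub>B\<^esub> \<iota> r) \<otimes>\<^bsub>B\<^esub> (z \<ominus>\<^bsub>B\<^esub> \<iota> r') = lin z (r \<otimes> r' \<ominus> nrd z) (trd z \<ominus> (r \<oplus> r'))"
proof -
  have sub: "z \<ominus>\<^bsub>B\<^esub> \<iota> r = lin z (\<ominus> r) \<one>" if "r \<in> carrier R" for r
    using z that by (simp add: lin_def B.minus_eq B.a_comm)
  show ?thesis unfolding sub[OF r(1)] sub[OF r(2)]
    using z r by (simp add: lin_mult a_minus_def minus_add l_minus r_minus a_ac)
qed

end

locale clifford_field = clifford_algebra + field
begin

lemma noroot_imp:
  assumes z: "z \<in> carrier B" and nr: "noroot z" and r: "r \<in> carrier R"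
  shows "r \<otimes> r \<ominus> trd z \<otimes> r \<oplus> nrd z \<noteq> \<zero>"
proof
  assume 0: "r \<otimes> r \<ominus> trd z \<otimes> r \<oplus> nrd z = \<zero>"
  have "(z \<ominus>\<^bsub>B\<^esub> \<iota> r) \<otimes>\<^bsub>B\<^esub> (z \<ominus>\<^bsub>B\<^esub> \<iota> (trd z \<ominus> r)) = lin z (r \<otimes> (trd z \<ominus> r) \<ominus> nrd z) (trd z \<ominus> (r \<oplus> (trd z \<ominus> r)))"
    using z r by (intro lin_root_product) auto
  also have "r \<otimes> (trd z \<ominus> r) \<ominus> nrd z = \<ominus> (r \<otimes> r \<ominus> trd z \<otimes> r \<oplus> nrd z)"
    using r[THEN tr_ex] trd_closed[OF z, THEN tr_ex] nrd_closed[OF z, THEN tr_ex]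
    by - (elim exE, simp only: tr_hom, simp add: algebra_simps)
  also have "trd z \<ominus> (r \<oplus> (trd z \<ominus> r)) = \<zero>"
    using r[THEN tr_ex] trd_closed[OF z, THEN tr_ex]
    by - (elim exE, simp only: tr_hom, simp add: algebra_simps)
  finally have "(z \<ominus>\<^bsub>B\<^esub> \<iota> r) \<otimes>\<^bsub>B\<^esub> (z \<ominus>\<^bsub>B\<^esub> \<iota> (trd z \<ominus> r)) = \<zero>\<^bsub>B\<^esub>"
    unfolding 0 using z by (simp add: lin_def)
  then show False using nr z r unfolding noroot_def by blast
qed

text \<open>A zero of the norm on \<open>K[z]\<close> would give a root of the quadratic polynomial of \<open>z\<close>.\<close>

lemma nrd_lin_nonzero:
  assumes z: "z \<in> carrier B" and nr: "noroot z" and c: "\<alpha> \<in> carrier R" "\<beta> \<in> carrier R"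
    and nz: "\<alpha> \<noteq> \<zero> \<or> \<beta> \<noteq> \<zero>"
  shows "nrd (lin z \<alpha> \<beta>) \<noteq> \<zero>"
proof (cases "\<beta> = \<zero>")
  case True
  then show ?thesis using z c nz by (simp add: lin_trd_nrd integral_iff)
next
  case False
  define b where "b = inv \<beta>"
  have b: "b \<in> carrier R" "b \<otimes> \<beta> = \<one>" using inv_closed_nonzero[OF c(2) False] by (auto simp: b_def)
  note T = trd_closed[OF z] nrd_closed[OF z]
  have "nrd (lin z \<alpha> \<beta>) \<otimes> (b \<otimes> b) = (\<alpha> \<otimes> b) \<otimes> (\<alpha> \<otimes> b) \<oplus> (\<alpha> \<otimes> b) \<otimes> (b \<otimes> \<beta>) \<otimes> trd z \<oplus> (b \<otimes> \<beta>) \<otimes> (b \<otimes> \<beta>) \<otimes> nrd z"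
    unfolding lin_trd_nrd(1)[OF z c]
    using c[THEN tr_ex] T[THEN tr_ex] b(1)[THEN tr_ex]
    by - (elim exE, simp only: tr_hom, simp add: algebra_simps)
  also have "\<dots> = (\<ominus> (\<alpha> \<otimes> b)) \<otimes> (\<ominus> (\<alpha> \<otimes> b)) \<ominus> trd z \<otimes> (\<ominus> (\<alpha> \<otimes> b)) \<oplus> nrd z"
    using b c T by (simp add: a_minus_def l_minus r_minus m_comm[of "\<alpha> \<otimes> b" "trd z"])
  also have "\<dots> \<noteq> \<zero>" using noroot_imp[OF z nr, of "\<ominus> (\<alpha> \<otimes> b)"] b c by simp
  finally show ?thesis using b c z by auto
qed

lemma lin_eq_zero:
  assumes z: "z \<in> carrier B" and nr: "noroot z" and c: "\<alpha> \<in> carrier R" "\<beta> \<in> carrier R" and x: "x \<in> carrier B" "x \<noteq> \<zero>\<^bsub>B\<^esub>"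
    and 0: "lin z \<alpha> \<beta> \<otimes>\<^bsub>B\<^esub> x = \<zero>\<^bsub>B\<^esub>"
  shows "\<alpha> = \<zero> \<and> \<beta> = \<zero>"
proof (rule ccontr)
  let ?n = "nrd (lin z \<alpha> \<beta>)"
  assume "\<not> (\<alpha> = \<zero> \<and> \<beta> = \<zero>)"
  then have n: "?n \<noteq> \<zero>" "?n \<in> carrier R" using nrd_lin_nonzero[OF z nr c] z c by auto
  have "cj (lin z \<alpha> \<beta>) \<otimes>\<^bsub>B\<^esub> (lin z \<alpha> \<beta> \<otimes>\<^bsub>B\<^esub> x) = \<zero>\<^bsub>B\<^esub>" unfolding 0 using z c by simp
  then have "\<iota> ?n \<otimes>\<^bsub>B\<^esub> x = \<zero>\<^bsub>B\<^esub>" using z c x by (simp add: B.m_assoc[symmetric] mult_cj)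
  then have "\<iota> (inv ?n) \<otimes>\<^bsub>B\<^esub> (\<iota> ?n \<otimes>\<^bsub>B\<^esub> x) = \<zero>\<^bsub>B\<^esub>" using inv_closed_nonzero[OF n(2,1)] by simp
  moreover have "\<iota> (inv ?n \<otimes> ?n) \<otimes>\<^bsub>B\<^esub> x = \<iota> (inv ?n) \<otimes>\<^bsub>B\<^esub> (\<iota> ?n \<otimes>\<^bsub>B\<^esub> x)"
    using inv_closed_nonzero(1)[OF n(2,1)] n x by (simp only: \<iota>.hom_mult B.m_assoc \<iota>_closed)
  ultimately have "\<iota> (inv ?n \<otimes> ?n) \<otimes>\<^bsub>B\<^esub> x = \<zero>\<^bsub>B\<^esub>" by simp
  then show False using inv_closed_nonzero[OF n(2,1)] x by simp
qed

lemma one_B_nonzero: "\<one>\<^bsub>B\<^esub> \<noteq> \<zero>\<^bsub>B\<^esub>"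
  by (simp add: one_B zero_B)

lemma lin_inj:
  assumes z: "z \<in> carrier B" and nr: "noroot z" and c: "\<alpha> \<in> carrier R" "\<beta> \<in> carrier R" "\<gamma> \<in> carrier R" "\<delta> \<in> carrier R"
    and eq: "lin z \<alpha> \<beta> = lin z \<gamma> \<delta>"
  shows "\<alpha> = \<gamma> \<and> \<beta> = \<delta>"
proof -
  have "lin z (\<alpha> \<ominus> \<gamma>) (\<beta> \<ominus> \<delta>) = lin z \<alpha> \<beta> \<oplus>\<^bsub>B\<^esub> \<ominus>\<^bsub>B\<^esub> lin z \<gamma> \<delta>"
    using z c by (simp add: lin_minus lin_add a_minus_def)
  also have "\<dots> = \<zero>\<^bsub>B\<^esub>" unfolding eq using z c by (simp add: B.r_neg)
  finally have "\<alpha> \<ominus> \<gamma> = \<zero> \<and> \<beta> \<ominus> \<delta> = \<zero>"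
    using lin_eq_zero[OF z nr, of "\<alpha> \<ominus> \<gamma>" "\<beta> \<ominus> \<delta>" "\<one>\<^bsub>B\<^esub>"] z c one_B_nonzero by simp
  then show ?thesis using c by simp
qed

lemma scalars_subfield: "subfield scalars B"
  unfolding scalars_def using carrier_is_subfield one_B_nonzero by (rule \<iota>.img_is_subfield(2))

text \<open>The definition of the local invariant asks for a subfield of degree 2; this lemma and the next replace that
  condition by the elementary one.\<close>

lemma noroot_dimension:
  assumes z: "z \<in> carrier B" and nr: "noroot z"
  shows "subfield (B.simple_extension scalars z) B" "B.dimension 2 scalars (B.simple_extension scalars z)"
proof -
  let ?E = "B.simple_extension scalars z"
  note E = simple_extension_eq[OF z]
  have EI: "lin z \<alpha> \<beta> \<in> ?E" if "\<alpha> \<in> carrier R" "\<beta> \<in> carrier R" for \<alpha> \<beta>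
    unfolding E using that by blast
  have sub: "subring ?E B"
  proof (rule B.subringI)
    show "?E \<subseteq> carrier B" unfolding E using z by auto
    have "\<one>\<^bsub>B\<^esub> = lin z \<one> \<zero>" using z by (simp add: lin_scalar)
    then show "\<one>\<^bsub>B\<^esub> \<in> ?E" unfolding E by blast
    fix x assume "x \<in> ?E"
    then obtain \<alpha> \<beta> where x: "x = lin z \<alpha> \<beta>" "\<alpha> \<in> carrier R" "\<beta> \<in> carrier R" unfolding E by blast
    have "\<ominus>\<^bsub>B\<^esub> x = lin z (\<ominus> \<alpha>) (\<ominus> \<beta>)" using x z by (simp add: lin_minus)
    then show "\<ominus>\<^bsub>B\<^esub> x \<in> ?E" unfolding E using x by blast
    fix y assume "y \<in> ?E"
    then obtain \<gamma> \<delta> where y: "y = lin z \<gamma> \<delta>" "\<gamma> \<in> carrier R" "\<delta> \<in> carrier R" unfolding E by blast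
    show "x \<otimes>\<^bsub>B\<^esub> y \<in> ?E" "x \<oplus>\<^bsub>B\<^esub> y \<in> ?E"
      using x y z by (simp_all add: lin_mult lin_add EI)
  qed
  have "cring (B\<lparr>carrier := ?E\<rparr>)"
  proof (rule cring.intro)
    show "ring (B\<lparr>carrier := ?E\<rparr>)" by (rule B.subring_is_ring[OF sub])
    show "comm_monoid (B\<lparr>carrier := ?E\<rparr>)"
    proof (rule monoid.monoid_comm_monoidI)
      show "monoid (B\<lparr>carrier := ?E\<rparr>)" using B.subring_is_ring[OF sub] by (simp add: ring_def)
      fix x y assume "x \<in> carrier (B\<lparr>carrier := ?E\<rparr>)" "y \<in> carrier (B\<lparr>carrier := ?E\<rparr>)"
      then show "x \<otimes>\<^bsub>B\<lparr>carrier := ?E\<rparr>\<^esub> y = y \<otimes>\<^bsub>B\<lparr>carrier := ?E\<rparr>\<^esub> x"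
        unfolding E using z by (auto simp: lin_comm)
    qed
  qed
  then have "field (B\<lparr>carrier := ?E\<rparr>)"
  proof (rule cring.cring_fieldI2)
    show "\<zero>\<^bsub>B\<lparr>carrier := ?E\<rparr>\<^esub> \<noteq> \<one>\<^bsub>B\<lparr>carrier := ?E\<rparr>\<^esub>" using one_B_nonzero by simp
    fix x assume x: "x \<in> carrier (B\<lparr>carrier := ?E\<rparr>)" "x \<noteq> \<zero>\<^bsub>B\<lparr>carrier := ?E\<rparr>\<^esub>"
    then obtain \<alpha> \<beta> where ab: "x = lin z \<alpha> \<beta>" "\<alpha> \<in> carrier R" "\<beta> \<in> carrier R" unfolding E by auto
    have "\<alpha> \<noteq> \<zero> \<or> \<beta> \<noteq> \<zero>" using x ab z by (auto simp: lin_def)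
    then have n: "nrd x \<in> carrier R" "nrd x \<noteq> \<zero>" using nrd_lin_nonzero[OF z nr ab(2,3)] ab z by auto
    note i = inv_closed_nonzero[OF n]
    have xB: "x \<in> carrier B" using ab z by simp
    have "x \<otimes>\<^bsub>B\<^esub> (cj x \<otimes>\<^bsub>B\<^esub> \<iota> (inv (nrd x))) = \<one>\<^bsub>B\<^esub>"
      using xB i n by (simp add: B.m_assoc[symmetric] mult_cj \<iota>.hom_mult[symmetric])
    moreover have "cj x \<otimes>\<^bsub>B\<^esub> \<iota> (inv (nrd x)) = lin z (\<alpha> \<oplus> \<beta> \<otimes> trd z) (\<ominus> \<beta>) \<otimes>\<^bsub>B\<^esub> lin z (inv (nrd x)) \<zero>"
      using ab z i by (simp add: lin_trd_nrd lin_scalar)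
    moreover have "\<dots> \<in> ?E" using ab z i by (simp add: lin_mult EI)
    ultimately show "\<exists>y\<in>carrier (B\<lparr>carrier := ?E\<rparr>). x \<otimes>\<^bsub>B\<lparr>carrier := ?E\<rparr>\<^esub> y = \<one>\<^bsub>B\<lparr>carrier := ?E\<rparr>\<^esub>"
      by (auto intro!: bexI[of _ "cj x \<otimes>\<^bsub>B\<^esub> \<iota> (inv (nrd x))"])
  qed
  then show "subfield ?E B" using subringE(1)[OF sub] by (intro B.subfield_iff(1)) auto
  have "z \<notin> scalars"
  proof
    assume "z \<in> scalars"
    then obtain r where r: "z = \<iota> r" "r \<in> carrier R" by (auto simp: scalars_def)
    then have "lin z \<zero> \<one> = lin z r \<zero>" using z by (simp add: lin_self lin_scalar)
    then show False using lin_inj[OF z nr, of \<zero> \<one> r \<zero>] r by simp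
  qed
  moreover have "B.dimension 1 scalars scalars" by (rule B.dimension_one[OF scalars_subfield])
  ultimately have "B.dimension (Suc 1) scalars (B.line_extension scalars z scalars)"
    using z by (intro B.Suc_dim) auto
  moreover have "B.line_extension scalars z scalars = ?E"
  proof -
    have "x \<in> B.line_extension scalars z scalars \<longleftrightarrow> (\<exists>\<beta>\<in>carrier R. \<exists>\<alpha>\<in>carrier R. x = lin z \<alpha> \<beta>)" for x
      unfolding B.line_extension_mem_iff scalars_def using z by (simp add: lin_def B.a_comm)
    then show ?thesis unfolding E by blast
  qed
  ultimately show "B.dimension 2 scalars ?E" by (simp add: numeral_2_eq_2)
qed

lemma dimension_noroot:
  assumes z: "z \<in> carrier B" and sf: "subfield (B.simple_extension scalars z) B"
    and dim: "B.dimension 2 scalars (B.simple_extension scalars z)"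
  shows "noroot z"
  unfolding noroot_def
proof (intro ballI notI)
  let ?E = "B.simple_extension scalars z"
  note E = simple_extension_eq[OF z]
  have zS: "z \<notin> scalars"
  proof
    assume "z \<in> scalars"
    then have "?E \<subseteq> scalars"
      using subfieldE(1)[OF scalars_subfield] by (intro B.simple_extension_subring_incl) auto
    moreover have "scalars \<subseteq> ?E"
      using z subfieldE(3)[OF scalars_subfield] by (intro B.simple_extension_incl)
    ultimately have "?E = scalars" by blast
    then show False
      using B.dimension_is_inj[OF scalars_subfield dim] B.dimension_one[OF scalars_subfield] by fastforce
  qed
  fix r r' assume r: "r \<in> carrier R" "r' \<in> carrier R"
    and 0: "(z \<ominus>\<^bsub>B\<^esub> \<iota> r) \<otimes>\<^bsub>B\<^esub> (z \<ominus>\<^bsub>B\<^esub> \<iota> r') = \<zero>\<^bsub>B\<^esub>"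
  have mem: "z \<ominus>\<^bsub>B\<^esub> \<iota> r \<in> ?E" if "r \<in> carrier R" for r
  proof -
    have "z \<ominus>\<^bsub>B\<^esub> \<iota> r = lin z (\<ominus> r) \<one>" using z that by (simp add: lin_def B.minus_eq B.a_comm)
    then show ?thesis unfolding E using that by blast
  qed
  have "z \<ominus>\<^bsub>B\<^esub> \<iota> r = \<zero>\<^bsub>B\<^esub> \<or> z \<ominus>\<^bsub>B\<^esub> \<iota> r' = \<zero>\<^bsub>B\<^esub>"
    using subfieldE(5)[OF sf mem mem 0] r by blast
  then have "z = \<iota> r \<or> z = \<iota> r'" using z r by simp
  then show False using zS r by (auto simp: scalars_def)
qed

lemma norootI:
  assumes z: "z \<in> carrier B" and nr: "\<And>r. r \<in> carrier R \<Longrightarrow> r \<otimes> r \<ominus> trd z \<otimes> r \<oplus> nrd z \<noteq> \<zero>"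
  shows "noroot z"
  unfolding noroot_def
proof (intro ballI notI)
  fix r r' assume r: "r \<in> carrier R" "r' \<in> carrier R"
    and 0: "(z \<ominus>\<^bsub>B\<^esub> \<iota> r) \<otimes>\<^bsub>B\<^esub> (z \<ominus>\<^bsub>B\<^esub> \<iota> r') = \<zero>\<^bsub>B\<^esub>"
  note T = trd_closed[OF z] nrd_closed[OF z]
  have 0: "lin z (r \<otimes> r' \<ominus> nrd z) (trd z \<ominus> (r \<oplus> r')) = \<zero>\<^bsub>B\<^esub>"
    using lin_root_product[OF z r] 0 by simp
  have nS: "z \<noteq> \<iota> s" if s: "s \<in> carrier R" for s
  proof
    assume zs: "z = \<iota> s"
    have "s \<otimes> s \<ominus> trd z \<otimes> s \<oplus> nrd z = \<zero>"
      apply (simp add: zs \<iota>_def trd_def nrd_def s)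
      using s[THEN tr_ex] tr_par by (elim exE, hypsubst, simp only: tr_hom, simp add: algebra_simps)
    then show False using nr[OF s] by simp
  qed
  have eqT: "trd z = r \<oplus> r'"
  proof (rule ccontr)
    let ?u = "trd z \<ominus> (r \<oplus> r')" and ?v = "r \<otimes> r' \<ominus> nrd z"
    assume "trd z \<noteq> r \<oplus> r'"
    then have u: "?u \<in> carrier R" "?u \<noteq> \<zero>" using T r by auto
    note i = inv_closed_nonzero[OF u]
    have v: "?v \<in> carrier R" using T r by simp
    have "\<iota> (inv ?u) \<otimes>\<^bsub>B\<^esub> lin z ?v ?u = \<iota> (inv ?u \<otimes> ?v) \<oplus>\<^bsub>B\<^esub> z"
      unfolding lin_def using i u(1) v z by (simp add: B.r_distr B.m_assoc[symmetric] \<iota>.hom_mult[symmetric] del: \<iota>.hom_mult)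
    then have "\<iota> (inv ?u \<otimes> ?v) \<oplus>\<^bsub>B\<^esub> z = \<zero>\<^bsub>B\<^esub>" unfolding 0 using i by simp
    then have "z = \<ominus>\<^bsub>B\<^esub> \<iota> (inv ?u \<otimes> ?v)"
      using i v z by (metis B.minus_equality B.a_comm \<iota>_closed m_closed)
    then have "z = \<iota> (\<ominus> (inv ?u \<otimes> ?v))" using i v by (simp only: \<iota>.hom_a_inv m_closed)
    then show False using nS[of "\<ominus> (inv ?u \<otimes> ?v)"] i v by simp
  qed
  then have "\<iota> (r \<otimes> r' \<ominus> nrd z) = \<zero>\<^bsub>B\<^esub>"
    using 0 z r T lin_scalar[OF z, of "r \<otimes> r' \<ominus> nrd z"] by (simp add: r_neg a_minus_def[of _ "r \<oplus> r'"])
  then have eqN: "nrd z = r \<otimes> r'" using r T by (simp add: \<iota>_def zero_B)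
  have "r \<otimes> r \<ominus> trd z \<otimes> r \<oplus> nrd z = \<zero>"
    unfolding eqT eqN using r[THEN tr_ex] by - (elim exE, simp only: tr_hom, simp add: algebra_simps)
  then show False using nr[OF r(1)] by simp
qed

end

section \<open>Witnesses for the local invariant\<close>

text \<open>The binomial coefficients other than the outer two are divisible by \<open>p\<close>.\<close>

lemma frobenius_expansion:
  fixes x y :: "'a :: comm_ring_1"
  assumes "prime (p :: nat)"
  shows "\<exists>w. (x + y) ^ p = x ^ p + y ^ p + of_nat p * w"
proof -
  let ?f = "\<lambda>k. of_nat (p choose k) * x ^ k * y ^ (p - k)"
  have p: "p > 1" using assms prime_gt_1_nat by blast
  have split: "{..p} = insert 0 (insert p {0<..<p})" using p by auto
  have "(x + y) ^ p = (\<Sum>k\<le>p. ?f k)" by (rule binomial_ring)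
  also have "\<dots> = y ^ p + (x ^ p + (\<Sum>k\<in>{0<..<p}. ?f k))"
    unfolding split using p by simp
  also have "(\<Sum>k\<in>{0<..<p}. ?f k) = (\<Sum>k\<in>{0<..<p}. of_nat p * (of_nat ((p choose k) div p) * x ^ k * y ^ (p - k)))"
  proof (rule sum.cong[OF refl])
    fix k assume k: "k \<in> {0<..<p}"
    then have "p dvd p choose k" using assms by (intro dvd_choose_prime) auto
    then have "of_nat (p choose k) = (of_nat p * of_nat ((p choose k) div p) :: 'a)"
      by (metis dvd_mult_div_cancel of_nat_mult)
    then show "?f k = of_nat p * (of_nat ((p choose k) div p) * x ^ k * y ^ (p - k))"
      by (simp add: mult.assoc)
  qed
  also have "\<dots> = of_nat p * (\<Sum>k\<in>{0<..<p}. of_nat ((p choose k) div p) * x ^ k * y ^ (p - k))"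
    by (simp add: sum_distrib_left)
  finally have "(x + y) ^ p = x ^ p + y ^ p + of_nat p * (\<Sum>k\<in>{0<..<p}. of_nat ((p choose k) div p) * x ^ k * y ^ (p - k))"
    by (simp only: ac_simps)
  then show ?thesis by blast
qed

lemma component_of_nat:
  assumes "cring R"
  shows "component R (of_nat n) = [n] \<cdot>\<^bsub>R\<^esub> \<one>\<^bsub>R\<^esub>"
proof -
  interpret cring R by fact
  show ?thesis
  proof (induction n)
    case 0
    then show ?case using component_homs(2)[OF assms] by simp
  next
    case (Suc n)
    have "component R (of_nat (Suc n)) = component R (of_nat n) \<oplus>\<^bsub>R\<^esub> component R 1"
      unfolding component_homs(4)[OF assms] by (simp add: add.commute)
    then show ?case using Suc by (simp add: component_homs(3)[OF assms, symmetric])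
  qed
qed

lemma cring_frobenius:
  fixes R :: "'a ring" (structure)
  assumes "cring R" "prime (p :: nat)" and char: "[p] \<cdot> \<one> = \<zero>" and xy: "x \<in> carrier R" "y \<in> carrier R"
  shows "(x \<oplus> y) [^] p = x [^] p \<oplus> y [^] p"
proof -
  interpret cring R by fact
  obtain u w where u: "x = component R u" "y = component R w"
    using component_ex[OF assms(1)] xy by metis
  obtain s where s: "(u + w) ^ p = u ^ p + w ^ p + of_nat p * s"
    using frobenius_expansion[OF assms(2)] by blast
  have "(x \<oplus> y) [^] p = x [^] p \<oplus> y [^] p \<oplus> component R (of_nat p) \<otimes> component R s"
    unfolding u component_homs[OF assms(1)] s ..
  also have "component R (of_nat p) = \<zero>" using char by (simp add: component_of_nat[OF assms(1)])
  finally show ?thesis using xy component_homs(1)[OF assms(1)] by simp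
qed

text \<open>In characteristic \<open>p\<close>, let \<open>l, u\<close> be fixed by the Frobenius and let its square fix \<open>z\<close>. If the norm
  \<open>(l + u z\<^sup>p) (l + u z)\<close> is zero, then so is \<open>l + u z\<close>: for \<open>w = l + uz\<close> the hypothesis reads
  \<open>w\<^sup>p w = 0\<close>, and \<open>w\<close> equals \<open>w ^ (p * p)\<close>.\<close>

lemma frobenius_norm_vanish:
  fixes R :: "'a ring" (structure)
  assumes R: "cring R" and p: "prime (p :: nat)" and char: "[p] \<cdot> \<one> = \<zero>"
    and l: "l \<in> carrier R" "l [^] p = l" and m: "m \<in> carrier R" "m [^] p = m"
    and z: "z \<in> carrier R" "z [^] (p * p) = z"
    and 0: "(l \<oplus> m \<otimes> z [^] p) \<otimes> (l \<oplus> m \<otimes> z) = \<zero>"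
  shows "l \<oplus> m \<otimes> z = \<zero>"
proof -
  interpret cring R by fact
  let ?x = "l \<oplus> m \<otimes> z" and ?y = "l \<oplus> m \<otimes> z [^] p"
  have c: "?x \<in> carrier R" "?y \<in> carrier R" using l m z by auto
  have xp: "?x [^] p = ?y"
    using l m z by (simp add: cring_frobenius[OF R p char] nat_pow_distrib)
  have "?y [^] p = ?x"
    using l m z by (simp add: cring_frobenius[OF R p char] nat_pow_distrib nat_pow_pow)
  then have x: "?x [^] (p * p) = ?x" using c by (simp add: nat_pow_pow[symmetric] xp)
  have "p > 1" using p prime_gt_1_nat by blast
  then have "p * p \<ge> p + 1" by (metis Suc_eq_plus1 Suc_leI less_1_mult mult_le_mono1 nat_mult_less_cancel1 nat_mult_1_right not_less_eq less_trans zero_less_one)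
  then obtain i where i: "p * p = (p + 1) + i" using le_Suc_ex by blast
  have "?x = ?x [^] (p + 1) \<otimes> ?x [^] i" using c x unfolding i by (simp only: nat_pow_mult)
  also have "?x [^] (p + 1) = ?x [^] p \<otimes> ?x" using c by simp
  also have "\<dots> = \<zero>" unfolding xp by (rule 0)
  finally show ?thesis using c by simp
qed

lemma add_pow_carrier_update: "[n] \<cdot>\<^bsub>R\<lparr>carrier := S\<rparr>\<^esub> x = [n] \<cdot>\<^bsub>R\<^esub> x" for n :: nat
  by (simp add: add_pow_def nat_pow_def)

lemma (in ring_hom_ring) hom_add_pow_nat:
  fixes n :: nat
  assumes "x \<in> carrier R"
  shows "h ([n] \<cdot>\<^bsub>R\<^esub> x) = [n] \<cdot>\<^bsub>S\<^esub> h x"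
  using assms by (induction n) simp_all

locale padic_clifford = clifford_field "Qp p" a t e + padic p for p a t e
begin

abbreviation has_inv_witness where
  "has_inv_witness z g (m::nat) c q \<equiv> z \<in> carrier B \<and> g \<in> Units B \<and> m > 0 \<and> c \<in> carrier K \<and> c \<noteq> \<zero>\<^bsub>K\<^esub> \<and>
    coprime m p \<and> z [^]\<^bsub>B\<^esub> m = \<one>\<^bsub>B\<^esub> \<and> noroot z \<and> g \<otimes>\<^bsub>B\<^esub> z = z [^]\<^bsub>B\<^esub> p \<otimes>\<^bsub>B\<^esub> g \<and>
    g \<otimes>\<^bsub>B\<^esub> g = \<iota> c \<and> q = frac (rat_of_int (v c) / 2)"

text \<open>Since the rank is 4, the field generated by \<open>z\<close> has degree 2.\<close>

lemma has_local_inv_iff: "has_local_inv p A q \<longleftrightarrow> (\<exists>z g m c. has_inv_witness z g m c q)"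
proof
  assume "has_local_inv p A q"
  then obtain n z g m c where n: "n > 0" "4 = n\<^sup>2" and z: "z \<in> carrier B" and g: "g \<in> Units B" and m: "m > 0"
    and c: "c \<in> carrier K - {\<zero>\<^bsub>K\<^esub>}" and cop: "coprime m p" and zm: "z [^]\<^bsub>B\<^esub> (m::nat) = \<one>\<^bsub>B\<^esub>"
    and sf: "subfield (B.simple_extension scalars z) B" and dim: "B.dimension n scalars (B.simple_extension scalars z)"
    and gz: "g \<otimes>\<^bsub>B\<^esub> z = z [^]\<^bsub>B\<^esub> p \<otimes>\<^bsub>B\<^esub> g" and gn: "g [^]\<^bsub>B\<^esub> n = alg_scalar K A c"
    and q: "q = frac (rat_of_int (v c) / rat_of_nat n)"
    unfolding has_local_inv_def Let_def scalars_eq rank_clifford by blast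
  have n2: "n = 2"
  proof -
    have "n\<^sup>2 = 2\<^sup>2" using n by simp
    then show ?thesis by (simp only: power2_eq_iff_nonneg)
  qed
  have "noroot z" using dimension_noroot[OF z sf] dim n2 by simp
  moreover have "g \<otimes>\<^bsub>B\<^esub> g = \<iota> c" using gn B.Units_closed[OF g] c by (simp add: n2 alg_scalar_eq numeral_2_eq_2)
  ultimately show "\<exists>z g m c. has_inv_witness z g m c q"
    using z g m c cop zm gz q n2 by (intro exI[of _ z] exI[of _ g] exI[of _ m] exI[of _ c]) simp
next
  assume "\<exists>z g m c. has_inv_witness z g m c q"
  then obtain z g m c where w: "has_inv_witness z g m c q" by blast
  then have "g \<in> carrier B" by blast
  with w have gg: "g [^]\<^bsub>B\<^esub> (2::nat) = alg_scalar K A c" by (simp add: alg_scalar_eq numeral_2_eq_2)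
  have dim: "subfield (B.simple_extension scalars z) B" "B.dimension 2 scalars (B.simple_extension scalars z)"
    using noroot_dimension w by blast+
  show "has_local_inv p A q"
    unfolding has_local_inv_def Let_def scalars_eq rank_clifford
  proof (rule exI[of _ "2::nat"], intro conjI)
    show "\<exists>z\<in>carrier B. \<exists>g\<in>Units B. \<exists>m>0. \<exists>c\<in>carrier K - {\<zero>\<^bsub>K\<^esub>}.
       coprime m p \<and> z [^]\<^bsub>B\<^esub> (m::nat) = \<one>\<^bsub>B\<^esub> \<and>
       subfield (B.simple_extension scalars z) B \<and>
       B.dimension 2 scalars (B.simple_extension scalars z) \<and>
       g \<otimes>\<^bsub>B\<^esub> z = z [^]\<^bsub>B\<^esub> p \<otimes>\<^bsub>B\<^esub> g \<and> g [^]\<^bsub>B\<^esub> (2::nat) = alg_scalar K A c \<and>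
       q = frac (rat_of_int (v c) / rat_of_nat 2)"
    proof (rule bexI[of _ z], rule bexI[of _ g], rule exI[of _ m], rule conjI[OF _ bexI[of _ c]], goal_cases)
      case 2
      have "q = frac (rat_of_int (v c) / rat_of_nat 2)" using w by simp
      then show ?case using w gg dim by blast
    qed (use w in blast)+
  qed simp_all
qed

end

lemma has_local_inv_transport:
  assumes "padic_clifford p a t e" "padic_clifford p a' t' e'"
    and iso: "alg_iso (Qp p) (clifford (Qp p) a t e) (clifford (Qp p) a' t' e')"
    and inv: "has_local_inv p (clifford (Qp p) a t e) q"
  shows "has_local_inv p (clifford (Qp p) a' t' e') q"
proof -
  interpret A: padic_clifford p a t e by fact
  interpret A': padic_clifford p a' t' e' by fact
  obtain z g m c where w: "A.has_inv_witness z g m c q" using inv A.has_local_inv_iff by blast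
  obtain h where h: "h \<in> ring_iso A.B A'.B"
    and hs: "\<And>c. c \<in> carrier (Qp p) \<Longrightarrow> h (alg_scalar (Qp p) A.A c) = alg_scalar (Qp p) A'.A c"
    using iso unfolding alg_iso_def by blast
  have hom: "h \<in> ring_hom A.B A'.B" and bij: "bij_betw h (carrier A.B) (carrier A'.B)"
    using h by (auto simp: ring_iso_def)
  interpret h: ring_hom_ring A.B A'.B h
    by (rule ring_hom_ringI2) (simp_all add: A.ring_B A'.ring_B hom)
  have h\<iota>: "h (A.\<iota> c) = A'.\<iota> c" if "c \<in> carrier (Qp p)" for c
    using hs[OF that] that by (simp add: A.alg_scalar_eq A'.alg_scalar_eq)
  have inj: "h x = h y \<longleftrightarrow> x = y" if "x \<in> carrier A.B" "y \<in> carrier A.B" for x y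
    using bij that by (auto simp: bij_betw_def inj_on_def)
  have g: "g \<in> carrier A.B" "inv\<^bsub>A.B\<^esub> g \<in> carrier A.B" using w by auto
  have hg: "h g \<in> Units A'.B"
    unfolding Units_def
  proof (intro CollectI conjI bexI)
    show "h (inv\<^bsub>A.B\<^esub> g) \<otimes>\<^bsub>A'.B\<^esub> h g = \<one>\<^bsub>A'.B\<^esub>" "h g \<otimes>\<^bsub>A'.B\<^esub> h (inv\<^bsub>A.B\<^esub> g) = \<one>\<^bsub>A'.B\<^esub>"
      using w g by (simp_all add: h.hom_mult[symmetric] del: h.hom_mult)
  qed (use g in simp_all)
  have nr: "A'.noroot (h z)"
    unfolding A'.noroot_def
  proof (intro ballI notI)
    fix r r' assume r: "r \<in> carrier (Qp p)" "r' \<in> carrier (Qp p)"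
      and 0: "(h z \<ominus>\<^bsub>A'.B\<^esub> A'.\<iota> r) \<otimes>\<^bsub>A'.B\<^esub> (h z \<ominus>\<^bsub>A'.B\<^esub> A'.\<iota> r') = \<zero>\<^bsub>A'.B\<^esub>"
    have "h ((z \<ominus>\<^bsub>A.B\<^esub> A.\<iota> r) \<otimes>\<^bsub>A.B\<^esub> (z \<ominus>\<^bsub>A.B\<^esub> A.\<iota> r')) = h \<zero>\<^bsub>A.B\<^esub>"
      using w r 0 by (simp add: a_minus_def h\<iota>)
    then have "(z \<ominus>\<^bsub>A.B\<^esub> A.\<iota> r) \<otimes>\<^bsub>A.B\<^esub> (z \<ominus>\<^bsub>A.B\<^esub> A.\<iota> r') = \<zero>\<^bsub>A.B\<^esub>"
      using w r by (subst (asm) inj) auto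
    then show False using w r unfolding A.noroot_def by blast
  qed
  have z: "z \<in> carrier A.B" and gz: "g \<otimes>\<^bsub>A.B\<^esub> z = z [^]\<^bsub>A.B\<^esub> p \<otimes>\<^bsub>A.B\<^esub> g"
    and zm: "z [^]\<^bsub>A.B\<^esub> m = \<one>\<^bsub>A.B\<^esub>"
    and gg: "g \<otimes>\<^bsub>A.B\<^esub> g = A.\<iota> c" and c: "c \<in> carrier (Qp p)" using w by blast+
  note w' = w[THEN conjunct2, THEN conjunct2]
  have 1: "h z [^]\<^bsub>A'.B\<^esub> m = \<one>\<^bsub>A'.B\<^esub>" using h.hom_nat_pow[OF z, of m] by (simp only: zm h.hom_one)
  have 2: "h g \<otimes>\<^bsub>A'.B\<^esub> h z = h z [^]\<^bsub>A'.B\<^esub> p \<otimes>\<^bsub>A'.B\<^esub> h g"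
    using h.hom_mult[OF g(1) z] h.hom_mult[OF A.B.nat_pow_closed[OF z] g(1), of p] h.hom_nat_pow[OF z, of p] by (simp only: gz)
  have 3: "h g \<otimes>\<^bsub>A'.B\<^esub> h g = A'.\<iota> c" using h.hom_mult[OF g(1) g(1)] h\<iota>[OF c] by (simp only: gg)
  show ?thesis
    unfolding A'.has_local_inv_iff
    by (intro exI[of _ "h z"] exI[of _ "h g"] exI[of _ m] exI[of _ c])
      (intro conjI hg nr 1 2 3 h.hom_closed[OF z]; insert w', elim conjE; assumption)
qed

context padic_clifford begin

text \<open>An element \<open>s\<close> with \<open>s\<^sup>2 = \<eta>\<close> generates the unramified quadratic extension: for odd \<open>p\<close>,
  \<open>\<eta>\<close> is a root of unity that is not a square, so that \<open>s\<close> is itself a root of unity and Frobenius is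
  \<open>s \<mapsto> -s\<close>; for \<open>p = 2\<close> and \<open>\<eta> = -3\<close>, the cube root of unity \<open>(-1 + s)/2\<close> is used. An element
  anticommuting with \<open>s\<close> then induces the Frobenius.\<close>

lemma has_local_inv_exists:
  assumes s: "s \<in> carrier B" and g: "g \<in> carrier B" and \<eta>: "\<eta> \<in> carrier K" and c: "c \<in> carrier K" "c \<noteq> \<zero>\<^bsub>K\<^esub>"
    and tr: "trd s = \<zero>\<^bsub>K\<^esub>" and nrd: "nrd s = \<ominus>\<^bsub>K\<^esub> \<eta>"
    and gs: "g \<otimes>\<^bsub>B\<^esub> s = \<ominus>\<^bsub>B\<^esub> (s \<otimes>\<^bsub>B\<^esub> g)" and gg: "g \<otimes>\<^bsub>B\<^esub> g = \<iota> c"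
    and nsq: "\<And>r. r \<in> carrier K \<Longrightarrow> r \<otimes>\<^bsub>K\<^esub> r \<noteq> \<eta>"
    and two: "\<one>\<^bsub>K\<^esub> \<oplus>\<^bsub>K\<^esub> \<one>\<^bsub>K\<^esub> \<noteq> \<zero>\<^bsub>K\<^esub>"
    and cases: "odd p \<and> \<eta> [^]\<^bsub>K\<^esub> ((p - 1) div 2) = \<ominus>\<^bsub>K\<^esub> \<one>\<^bsub>K\<^esub> \<or>
        p = 2 \<and> \<eta> = \<ominus>\<^bsub>K\<^esub> (\<one>\<^bsub>K\<^esub> \<oplus>\<^bsub>K\<^esub> \<one>\<^bsub>K\<^esub> \<oplus>\<^bsub>K\<^esub> \<one>\<^bsub>K\<^esub>)"
  shows "has_local_inv p A (frac (rat_of_int (v c) / 2))"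
proof -
  have gU: "g \<in> Units B"
    unfolding Units_def
  proof (intro CollectI conjI bexI)
    have i: "inv\<^bsub>K\<^esub> c \<in> carrier K" "inv\<^bsub>K\<^esub> c \<otimes>\<^bsub>K\<^esub> c = \<one>\<^bsub>K\<^esub>" using inv_closed_nonzero[OF c] by auto
    have *: "\<iota> (inv\<^bsub>K\<^esub> c) \<otimes>\<^bsub>B\<^esub> (g \<otimes>\<^bsub>B\<^esub> g) = \<one>\<^bsub>B\<^esub>"
      unfolding gg using i c by (simp only: \<iota>.hom_mult[symmetric] \<iota>.hom_one)
    then show "\<iota> (inv\<^bsub>K\<^esub> c) \<otimes>\<^bsub>B\<^esub> g \<otimes>\<^bsub>B\<^esub> g = \<one>\<^bsub>B\<^esub>" using g i by (simp add: B.m_assoc)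
    have "g \<otimes>\<^bsub>B\<^esub> (\<iota> (inv\<^bsub>K\<^esub> c) \<otimes>\<^bsub>B\<^esub> g) = (g \<otimes>\<^bsub>B\<^esub> \<iota> (inv\<^bsub>K\<^esub> c)) \<otimes>\<^bsub>B\<^esub> g" using g i by (simp add: B.m_assoc)
    also have "\<dots> = \<iota> (inv\<^bsub>K\<^esub> c) \<otimes>\<^bsub>B\<^esub> (g \<otimes>\<^bsub>B\<^esub> g)" using g i by (simp only: \<iota>_comm B.m_assoc \<iota>_closed)
    finally show "g \<otimes>\<^bsub>B\<^esub> (\<iota> (inv\<^bsub>K\<^esub> c) \<otimes>\<^bsub>B\<^esub> g) = \<one>\<^bsub>B\<^esub>" using * by simp
    show "\<iota> (inv\<^bsub>K\<^esub> c) \<otimes>\<^bsub>B\<^esub> g \<in> carrier B" using g i by simp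
  qed (rule g)
  have ss: "s \<otimes>\<^bsub>B\<^esub> s = \<iota> \<eta>"
    using quadratic_equation[OF s] s \<eta> by (simp add: tr nrd B.minus_eq)
  have "\<exists>z g m c'. has_inv_witness z g m c' (frac (rat_of_int (v c) / 2))"
    using cases
  proof
    assume p: "odd p \<and> \<eta> [^]\<^bsub>K\<^esub> ((p - 1) div 2) = \<ominus>\<^bsub>K\<^esub> \<one>\<^bsub>K\<^esub>"
    define l where "l = (p - 1) div 2"
    have pl: "p = Suc (2 * l)" using p p_gt(1) by (auto simp: l_def elim!: oddE)
    have \<eta>l: "\<eta> [^]\<^bsub>K\<^esub> l = \<ominus>\<^bsub>K\<^esub> \<one>\<^bsub>K\<^esub>" using p by (simp add: l_def)
    have s2: "s [^]\<^bsub>B\<^esub> (2 * i) = \<iota> (\<eta> [^]\<^bsub>K\<^esub> i)" for i :: nat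
    proof -
      have "s [^]\<^bsub>B\<^esub> (2 * i) = (s [^]\<^bsub>B\<^esub> (2::nat)) [^]\<^bsub>B\<^esub> i" using s by (simp add: B.nat_pow_pow)
      also have "s [^]\<^bsub>B\<^esub> (2::nat) = \<iota> \<eta>" using s ss by (simp add: numeral_2_eq_2)
      finally show ?thesis using \<eta> by (simp add: \<iota>.hom_nat_pow)
    qed
    have sp: "s [^]\<^bsub>B\<^esub> p = \<ominus>\<^bsub>B\<^esub> s"
    proof -
      have "s [^]\<^bsub>B\<^esub> p = s [^]\<^bsub>B\<^esub> (2 * l) \<otimes>\<^bsub>B\<^esub> s" using pl B.nat_pow_Suc[of s "2 * l"] by metis
      then show ?thesis using s s2[of l] \<eta>l by (simp add: B.l_minus)
    qed
    have "s [^]\<^bsub>B\<^esub> (2 * (2 * l)) = \<iota> ((\<eta> [^]\<^bsub>K\<^esub> l) [^]\<^bsub>K\<^esub> (2::nat))"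
      unfolding s2 using \<eta> by (simp add: nat_pow_pow mult.commute)
    also have "\<dots> = \<one>\<^bsub>B\<^esub>" unfolding \<eta>l by (simp add: numeral_2_eq_2 l_minus del: \<iota>.hom_nat_pow)
    finally have sm: "s [^]\<^bsub>B\<^esub> (4 * l) = \<one>\<^bsub>B\<^esub>" by simp
    have "coprime (4 * l) p"
    proof -
      have "coprime p (2 * l)" using coprime_Suc_left_nat[of "2 * l"] pl by metis
      moreover have "coprime p 2" using p by simp
      ultimately have "coprime p (2 * (2 * l))" by (simp only: coprime_mult_right_iff)
      then show ?thesis by (simp add: coprime_commute)
    qed
    moreover have "4 * l > 0" using pl p_gt(1) by simp
    moreover have "noroot s"
    proof (rule norootI[OF s])
      fix r assume r: "r \<in> carrier K"
      show "r \<otimes>\<^bsub>K\<^esub> r \<ominus>\<^bsub>K\<^esub> trd s \<otimes>\<^bsub>K\<^esub> r \<oplus>\<^bsub>K\<^esub> nrd s \<noteq> \<zero>\<^bsub>K\<^esub>"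
        using nsq[OF r] r \<eta> by (simp add: tr nrd a_minus_def[of K "r \<otimes>\<^bsub>K\<^esub> r" \<eta>, symmetric])
    qed
    moreover have "g \<otimes>\<^bsub>B\<^esub> s = s [^]\<^bsub>B\<^esub> p \<otimes>\<^bsub>B\<^esub> g" unfolding sp gs using s g by (simp add: B.l_minus)
    ultimately have "has_inv_witness s g (4 * l) c (frac (rat_of_int (v c) / 2))"
      using s gU c sm gg by simp
    then show ?thesis by blast
  next
    assume p': "p = 2 \<and> \<eta> = \<ominus>\<^bsub>K\<^esub> (\<one>\<^bsub>K\<^esub> \<oplus>\<^bsub>K\<^esub> \<one>\<^bsub>K\<^esub> \<oplus>\<^bsub>K\<^esub> \<one>\<^bsub>K\<^esub>)"
    note p = p'[THEN conjunct2] and p2 = p'[THEN conjunct1]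
    have zp: "z [^]\<^bsub>B\<^esub> p = z [^]\<^bsub>B\<^esub> (2::nat)" for z by (rule arg_cong[OF p2])
    let ?t = "\<one>\<^bsub>K\<^esub> \<oplus>\<^bsub>K\<^esub> \<one>\<^bsub>K\<^esub>"
    define h where "h = inv\<^bsub>K\<^esub> ?t"
    have h: "h \<in> carrier K" "?t \<otimes>\<^bsub>K\<^esub> h = \<one>\<^bsub>K\<^esub>" unfolding h_def using inv_closed_nonzero[OF _ two] by auto
    have h2: "h \<oplus>\<^bsub>K\<^esub> h = \<one>\<^bsub>K\<^esub>" using h by (simp add: l_distr)
    \<comment> \<open>The cube root of unity \<open>(-1 + s)/2\<close>.\<close>
    define z where "z = lin s (\<ominus>\<^bsub>K\<^esub> h) h"
    have z: "z \<in> carrier B" using s h by (simp add: z_def)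
    have trz: "trd z = \<ominus>\<^bsub>K\<^esub> \<one>\<^bsub>K\<^esub>"
      using s h h2 by (simp add: z_def lin_trd_nrd tr minus_add[symmetric])
    have "nrd z = h \<otimes>\<^bsub>K\<^esub> h \<oplus>\<^bsub>K\<^esub> h \<otimes>\<^bsub>K\<^esub> h \<otimes>\<^bsub>K\<^esub> (?t \<oplus>\<^bsub>K\<^esub> \<one>\<^bsub>K\<^esub>)"
      using s h p by (simp add: z_def lin_trd_nrd tr nrd l_minus r_minus)
    also have "\<dots> = (h \<oplus>\<^bsub>K\<^esub> h) \<otimes>\<^bsub>K\<^esub> (h \<oplus>\<^bsub>K\<^esub> h)"
      using h(1) by (simp add: l_distr r_distr a_ac)
    finally have nz: "nrd z = \<one>\<^bsub>K\<^esub>" by (simp add: h2)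
    have zz: "z \<otimes>\<^bsub>B\<^esub> z = lin s (\<ominus>\<^bsub>K\<^esub> h) (\<ominus>\<^bsub>K\<^esub> h)"
    proof -
      have "z \<otimes>\<^bsub>B\<^esub> z = \<ominus>\<^bsub>B\<^esub> z \<ominus>\<^bsub>B\<^esub> \<one>\<^bsub>B\<^esub>" using quadratic_equation[OF z] z by (simp add: trz nz B.l_minus)
      also have "\<dots> = lin s h (\<ominus>\<^bsub>K\<^esub> h) \<oplus>\<^bsub>B\<^esub> lin s (\<ominus>\<^bsub>K\<^esub> \<one>\<^bsub>K\<^esub>) \<zero>\<^bsub>K\<^esub>"
        using s h by (simp add: z_def lin_minus lin_scalar B.minus_eq)
      also have "\<dots> = lin s (\<ominus>\<^bsub>K\<^esub> h) (\<ominus>\<^bsub>K\<^esub> h)"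
        using s h by (simp add: lin_add h2[symmetric] minus_add a_assoc[symmetric] r_neg)
      finally show ?thesis .
    qed
    have z3: "z [^]\<^bsub>B\<^esub> (3::nat) = \<one>\<^bsub>B\<^esub>"
    proof -
      have "z [^]\<^bsub>B\<^esub> (3::nat) = z \<otimes>\<^bsub>B\<^esub> z \<otimes>\<^bsub>B\<^esub> z" using z by (simp add: numeral_3_eq_3)
      also have "z \<otimes>\<^bsub>B\<^esub> z = cj z"
        unfolding zz using s h h2 by (simp add: z_def lin_trd_nrd tr)
      finally show ?thesis using z by (simp add: mult_cj nz)
    qed
    have "noroot z"
    proof (rule norootI[OF z])
      fix r assume r: "r \<in> carrier K"
      show "r \<otimes>\<^bsub>K\<^esub> r \<ominus>\<^bsub>K\<^esub> trd z \<otimes>\<^bsub>K\<^esub> r \<oplus>\<^bsub>K\<^esub> nrd z \<noteq> \<zero>\<^bsub>K\<^esub>"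
      proof
        assume 0: "r \<otimes>\<^bsub>K\<^esub> r \<ominus>\<^bsub>K\<^esub> trd z \<otimes>\<^bsub>K\<^esub> r \<oplus>\<^bsub>K\<^esub> nrd z = \<zero>\<^bsub>K\<^esub>"
        let ?x = "r \<oplus>\<^bsub>K\<^esub> r \<oplus>\<^bsub>K\<^esub> \<one>\<^bsub>K\<^esub>"
        have "?x \<otimes>\<^bsub>K\<^esub> ?x = (?t \<otimes>\<^bsub>K\<^esub> ?t) \<otimes>\<^bsub>K\<^esub> (r \<otimes>\<^bsub>K\<^esub> r \<ominus>\<^bsub>K\<^esub> (\<ominus>\<^bsub>K\<^esub> \<one>\<^bsub>K\<^esub>) \<otimes>\<^bsub>K\<^esub> r \<oplus>\<^bsub>K\<^esub> \<one>\<^bsub>K\<^esub>) \<oplus>\<^bsub>K\<^esub> \<eta>"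
          unfolding p using r[THEN tr_ex] by (elim exE, hypsubst, simp only: tr_hom, simp add: algebra_simps)
        also have "\<dots> = \<eta>" using 0 \<eta> unfolding trz nz by simp
        finally show False using nsq[of ?x] r by simp
      qed
    qed
    moreover have "g \<otimes>\<^bsub>B\<^esub> z = z [^]\<^bsub>B\<^esub> p \<otimes>\<^bsub>B\<^esub> g"
    proof -
      have "z [^]\<^bsub>B\<^esub> p = lin s (\<ominus>\<^bsub>K\<^esub> h) (\<ominus>\<^bsub>K\<^esub> h)" unfolding zp using z zz by (simp add: numeral_2_eq_2)
      moreover have "g \<otimes>\<^bsub>B\<^esub> z = \<iota> (\<ominus>\<^bsub>K\<^esub> h) \<otimes>\<^bsub>B\<^esub> g \<oplus>\<^bsub>B\<^esub> (g \<otimes>\<^bsub>B\<^esub> \<iota> h) \<otimes>\<^bsub>B\<^esub> s"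
        unfolding z_def lin_def using g s h \<iota>_comm[of "\<ominus>\<^bsub>K\<^esub> h" g] by (simp add: B.r_distr B.m_assoc)
      moreover have "(g \<otimes>\<^bsub>B\<^esub> \<iota> h) \<otimes>\<^bsub>B\<^esub> s = \<iota> h \<otimes>\<^bsub>B\<^esub> (g \<otimes>\<^bsub>B\<^esub> s)"
        using g s h by (simp only: \<iota>_comm B.m_assoc \<iota>_closed)
      ultimately show ?thesis
        unfolding lin_def gs using g s h by (simp add: B.l_distr B.l_minus B.r_minus B.m_assoc)
    qed
    moreover have "coprime (3::nat) p" by (subst p2) simp
    ultimately have "has_inv_witness z g 3 c (frac (rat_of_int (v c) / 2))"
      using z gU c z3 gg by (intro conjI) (assumption | rule refl zero_less_numeral)+
    then show ?thesis by blast
  qed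
  then show ?thesis unfolding has_local_inv_iff .
qed

end

context padic_clifford begin

lemma nrd_mult:
  assumes "x \<in> carrier B" "y \<in> carrier B"
  shows "nrd (x \<otimes>\<^bsub>B\<^esub> y) = nrd x \<otimes>\<^bsub>K\<^esub> nrd y"
proof -
  have "\<iota> (nrd (x \<otimes>\<^bsub>B\<^esub> y)) = x \<otimes>\<^bsub>B\<^esub> y \<otimes>\<^bsub>B\<^esub> (cj y \<otimes>\<^bsub>B\<^esub> cj x)"
    using assms by (simp only: mult_cj(1)[symmetric] cj_mult B.m_closed)
  also have "\<dots> = x \<otimes>\<^bsub>B\<^esub> ((y \<otimes>\<^bsub>B\<^esub> cj y) \<otimes>\<^bsub>B\<^esub> cj x)" using assms by (simp only: B.m_assoc B.m_closed cj_closed)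
  also have "\<dots> = (x \<otimes>\<^bsub>B\<^esub> \<iota> (nrd y)) \<otimes>\<^bsub>B\<^esub> cj x" using assms by (simp only: mult_cj B.m_assoc \<iota>_closed nrd_closed cj_closed)
  also have "\<dots> = \<iota> (nrd y) \<otimes>\<^bsub>B\<^esub> (x \<otimes>\<^bsub>B\<^esub> cj x)" using assms by (simp only: \<iota>_comm B.m_assoc \<iota>_closed nrd_closed cj_closed)
  also have "\<dots> = \<iota> (nrd x \<otimes>\<^bsub>K\<^esub> nrd y)" using assms by (simp only: mult_cj \<iota>.hom_mult[symmetric] nrd_closed m_comm)
  finally show ?thesis by (simp only: \<iota>_inj)
qed

lemma nrd_pow:
  assumes "x \<in> carrier B"
  shows "nrd (x [^]\<^bsub>B\<^esub> (m::nat)) = nrd x [^]\<^bsub>K\<^esub> m"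
proof (induction m)
  case 0
  show ?case by (simp add: nrd_def one_B)
next
  case (Suc m)
  then show ?case using assms by (simp only: B.nat_pow_Suc nrd_mult B.nat_pow_closed nat_pow_Suc)
qed

text \<open>The norm of a root of unity is a root of unity. If the trace \<open>T\<close> were not integral, then \<open>trd (z\<^sup>i)\<close>
  would be \<open>T\<^sup>i\<close> up to a factor congruent to 1, by the linear recurrence, so \<open>trd (z\<^sup>m) = 2\<close> would not be
  integral either.\<close>

lemma root_of_unity_integral:
  assumes z: "z \<in> carrier B" and m: "m > 0" and zm: "z [^]\<^bsub>B\<^esub> (m::nat) = \<one>\<^bsub>B\<^esub>"
  shows "nrd z \<in> \<O>" "trd z \<in> \<O>"
proof -
  let ?T = "trd z" and ?n = "nrd z"
  have Tn: "?T \<in> carrier K" "?n \<in> carrier K" using z by auto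
  have M_pow: "x [^]\<^bsub>K\<^esub> m \<in> \<MM>" if "x \<in> \<MM>" for x
  proof -
    obtain i where i: "m = Suc i" using m by (cases m) auto
    have "x \<in> carrier K" using that M_closed(1) O_closed(1) by blast
    then have "x [^]\<^bsub>K\<^esub> m = x \<otimes>\<^bsub>K\<^esub> x [^]\<^bsub>K\<^esub> i" unfolding i by (simp add: m_comm)
    then show ?thesis using M_closed(1,3)[OF that] O_pow by simp
  qed
  have nm: "?n [^]\<^bsub>K\<^esub> m = \<one>\<^bsub>K\<^esub>"
    using nrd_pow[OF z, of m] unfolding zm by (simp add: nrd_def one_B)
  show nO: "?n \<in> \<O>"
  proof (rule ccontr)
    assume "?n \<notin> \<O>"
    then have i: "?n \<noteq> \<zero>\<^bsub>K\<^esub>" "inv\<^bsub>K\<^esub> ?n \<in> \<MM>" using not_O_inv Tn by blast+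
    have "(inv\<^bsub>K\<^esub> ?n \<otimes>\<^bsub>K\<^esub> ?n) [^]\<^bsub>K\<^esub> m = (inv\<^bsub>K\<^esub> ?n) [^]\<^bsub>K\<^esub> m"
      using inv_closed_nonzero[OF Tn(2) i(1)] Tn nm nat_pow_distrib[of "inv\<^bsub>K\<^esub> ?n" ?n m] by (simp only: r_one nat_pow_closed)
    then have "\<one>\<^bsub>K\<^esub> \<in> \<MM>" using inv_closed_nonzero[OF Tn(2) i(1)] M_pow[OF i(2)] by simp
    then show False using M_closed(5) by blast
  qed
  show "?T \<in> \<O>"
  proof (rule ccontr)
    assume "?T \<notin> \<O>"
    then have Tnz: "?T \<noteq> \<zero>\<^bsub>K\<^esub>" and uM: "inv\<^bsub>K\<^esub> ?T \<in> \<MM>" using not_O_inv Tn by blast+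
    define u where "u = inv\<^bsub>K\<^esub> ?T"
    have u: "u \<in> carrier K" "?T \<otimes>\<^bsub>K\<^esub> u = \<one>\<^bsub>K\<^esub>" "u \<in> \<MM>" "u \<in> \<O>"
      using inv_closed_nonzero[OF Tn(1) Tnz] uM M_closed(1) by (simp_all add: u_def)
    define S where "S = (\<lambda>i::nat. trd (z [^]\<^bsub>B\<^esub> i))"
    have S: "S i \<in> carrier K" for i using z by (simp add: S_def)
    have rec: "S (Suc (Suc i)) = ?T \<otimes>\<^bsub>K\<^esub> S (Suc i) \<ominus>\<^bsub>K\<^esub> ?n \<otimes>\<^bsub>K\<^esub> S i" for i
    proof -
      let ?w = "z [^]\<^bsub>B\<^esub> i"
      have "z [^]\<^bsub>B\<^esub> Suc (Suc i) = ?w \<otimes>\<^bsub>B\<^esub> (z \<otimes>\<^bsub>B\<^esub> z)" using z by (simp add: B.m_assoc)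
      also have "\<dots> = ?w \<otimes>\<^bsub>B\<^esub> (\<iota> ?T \<otimes>\<^bsub>B\<^esub> z) \<oplus>\<^bsub>B\<^esub> ?w \<otimes>\<^bsub>B\<^esub> \<iota> (\<ominus>\<^bsub>K\<^esub> ?n)"
        unfolding quadratic_equation[OF z] using z by (simp add: B.minus_eq B.r_distr)
      also have "?w \<otimes>\<^bsub>B\<^esub> (\<iota> ?T \<otimes>\<^bsub>B\<^esub> z) = (?w \<otimes>\<^bsub>B\<^esub> \<iota> ?T) \<otimes>\<^bsub>B\<^esub> z" using z by (simp add: B.m_assoc)
      also have "\<dots> = \<iota> ?T \<otimes>\<^bsub>B\<^esub> z [^]\<^bsub>B\<^esub> Suc i" using z by (simp add: \<iota>_comm[of ?T ?w] B.m_assoc)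
      also have "?w \<otimes>\<^bsub>B\<^esub> \<iota> (\<ominus>\<^bsub>K\<^esub> ?n) = \<iota> (\<ominus>\<^bsub>K\<^esub> ?n) \<otimes>\<^bsub>B\<^esub> ?w" using z by (intro \<iota>_comm) auto
      finally have "z [^]\<^bsub>B\<^esub> Suc (Suc i) = \<iota> ?T \<otimes>\<^bsub>B\<^esub> z [^]\<^bsub>B\<^esub> Suc i \<oplus>\<^bsub>B\<^esub> \<iota> (\<ominus>\<^bsub>K\<^esub> ?n) \<otimes>\<^bsub>B\<^esub> ?w" .
      moreover have "trd (\<iota> r \<otimes>\<^bsub>B\<^esub> x) = r \<otimes>\<^bsub>K\<^esub> trd x" if r: "r \<in> carrier K" and x: "x \<in> carrier B" for r x
      proof -
        obtain x0 x1 x2 x3 where xq: "x = quad x0 x1 x2 x3"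
          and c: "x0 \<in> carrier K" "x1 \<in> carrier K" "x2 \<in> carrier K" "x3 \<in> carrier K"
          using x by (rule B_cases)
        show ?thesis using r c by (simp add: xq \<iota>_mult smult_B trd_def r_distr)
      qed
      ultimately show ?thesis unfolding S_def using z
        by (simp only: trd_add B.m_closed \<iota>_closed B.nat_pow_closed trd_closed nrd_closed a_inv_closed) (simp add: a_minus_def l_minus)
    qed
    \<comment> \<open>Traces of powers of \<open>z\<close>, rescaled by powers of the trace; they stay congruent to 1.\<close>
    define s where "s = (\<lambda>i::nat. S i \<otimes>\<^bsub>K\<^esub> u [^]\<^bsub>K\<^esub> i)"
    have s: "s i \<in> carrier K" for i using S u by (simp add: s_def)
    have srec: "s (Suc (Suc i)) = s (Suc i) \<oplus>\<^bsub>K\<^esub> \<ominus>\<^bsub>K\<^esub> (u \<otimes>\<^bsub>K\<^esub> (?n \<otimes>\<^bsub>K\<^esub> u \<otimes>\<^bsub>K\<^esub> s i))" for i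
    proof -
      let ?ui = "u [^]\<^bsub>K\<^esub> i"
      have ui: "?ui \<in> carrier K" using u by simp
      have "s (Suc (Suc i)) = (?T \<otimes>\<^bsub>K\<^esub> u) \<otimes>\<^bsub>K\<^esub> (S (Suc i) \<otimes>\<^bsub>K\<^esub> (?ui \<otimes>\<^bsub>K\<^esub> u)) \<oplus>\<^bsub>K\<^esub> \<ominus>\<^bsub>K\<^esub> (u \<otimes>\<^bsub>K\<^esub> (?n \<otimes>\<^bsub>K\<^esub> u \<otimes>\<^bsub>K\<^esub> (S i \<otimes>\<^bsub>K\<^esub> ?ui)))"
        unfolding s_def rec nat_pow_Suc
        using Tn[THEN tr_ex] S[of i, THEN tr_ex] S[of "Suc i", THEN tr_ex] ui[THEN tr_ex] u(1)[THEN tr_ex]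
        by (elim exE, simp only: tr_hom, simp add: algebra_simps)
      then show ?thesis using u S by (simp add: s_def)
    qed
    have two: "\<one>\<^bsub>K\<^esub> \<oplus>\<^bsub>K\<^esub> \<one>\<^bsub>K\<^esub> \<in> \<O>" by (intro O_closed)
    have s0: "s 0 = \<one>\<^bsub>K\<^esub> \<oplus>\<^bsub>K\<^esub> \<one>\<^bsub>K\<^esub>" by (simp add: s_def S_def trd_def one_B)
    have s1: "s (Suc 0) = \<one>\<^bsub>K\<^esub>" using z u by (simp add: s_def S_def)
    have inv: "s i \<in> \<O> \<and> (\<exists>y\<in>\<MM>. s (Suc i) = \<one>\<^bsub>K\<^esub> \<oplus>\<^bsub>K\<^esub> y)" for i
    proof (induction i)
      case 0
      show ?case using two M_closed(6) s0 s1 by (auto intro!: bexI[of _ "\<zero>\<^bsub>K\<^esub>"])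
    next
      case (Suc i)
      then obtain y where y: "y \<in> \<MM>" "s (Suc i) = \<one>\<^bsub>K\<^esub> \<oplus>\<^bsub>K\<^esub> y" and si: "s i \<in> \<O>" by blast
      define w where "w = \<ominus>\<^bsub>K\<^esub> (u \<otimes>\<^bsub>K\<^esub> (?n \<otimes>\<^bsub>K\<^esub> u \<otimes>\<^bsub>K\<^esub> s i))"
      have w: "w \<in> \<MM>" unfolding w_def by (intro M_closed(3,4) O_closed(3) u nO si)
      have "s (Suc i) \<in> \<O>" unfolding y(2) by (intro O_closed(2,6) M_closed(1) y)
      moreover have "s (Suc (Suc i)) = \<one>\<^bsub>K\<^esub> \<oplus>\<^bsub>K\<^esub> (y \<oplus>\<^bsub>K\<^esub> w)"
        unfolding srec w_def[symmetric] y(2) using y(1) w M_closed(1) O_closed(1) by (intro a_assoc) auto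
      ultimately show ?case using M_closed(2)[OF y(1) w] by blast
    qed
    obtain i where i: "m = Suc i" using m by (cases m) auto
    then obtain y where y: "y \<in> \<MM>" "s m = \<one>\<^bsub>K\<^esub> \<oplus>\<^bsub>K\<^esub> y" using inv[of i] by blast
    have "S m = \<one>\<^bsub>K\<^esub> \<oplus>\<^bsub>K\<^esub> \<one>\<^bsub>K\<^esub>" unfolding S_def zm by (simp add: trd_def one_B)
    then have "s m = u [^]\<^bsub>K\<^esub> m \<otimes>\<^bsub>K\<^esub> (\<one>\<^bsub>K\<^esub> \<oplus>\<^bsub>K\<^esub> \<one>\<^bsub>K\<^esub>)" using u by (simp add: s_def m_comm)
    then have "s m \<in> \<MM>" using M_closed(3)[OF M_pow[OF u(3)] two] by simp
    then have "(\<one>\<^bsub>K\<^esub> \<oplus>\<^bsub>K\<^esub> y) \<oplus>\<^bsub>K\<^esub> \<ominus>\<^bsub>K\<^esub> y \<in> \<MM>" unfolding y(2)[symmetric] using M_closed(2,4) y(1) by blast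
    moreover have "(\<one>\<^bsub>K\<^esub> \<oplus>\<^bsub>K\<^esub> y) \<oplus>\<^bsub>K\<^esub> \<ominus>\<^bsub>K\<^esub> y = \<one>\<^bsub>K\<^esub>"
      using O_closed(1)[OF M_closed(1)[OF y(1)]] by (simp add: a_assoc r_neg)
    ultimately show False using M_closed(5) by simp
  qed
qed

end

section \<open>The invariant of a split algebra vanishes\<close>

context padic_clifford begin

text \<open>Norms from the unramified extension: \<open>\<O>[z]\<close> modulo \<open>p\<close> has no nonzero element of norm zero, so a norm
  that is divisible by \<open>p\<close> comes from an element that is divisible by \<open>p\<close>.\<close>

lemma integral_norm_unit:
  assumes z: "z \<in> carrier B" and nr: "noroot z" and m: "m > 0" and zm: "z [^]\<^bsub>B\<^esub> (m::nat) = \<one>\<^bsub>B\<^esub>"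
    and zpp: "z [^]\<^bsub>B\<^esub> (p * p) = z" and l: "l \<in> \<O>" and u: "u \<in> \<O>" and c: "c \<in> carrier K"
    and norm: "(\<iota> l \<oplus>\<^bsub>B\<^esub> \<iota> u \<otimes>\<^bsub>B\<^esub> z [^]\<^bsub>B\<^esub> p) \<otimes>\<^bsub>B\<^esub> lin z l u = \<iota> c"
  shows "c \<in> \<O>" "c \<in> \<MM> \<Longrightarrow> l \<in> \<MM> \<and> u \<in> \<MM>"
proof -
  note T = root_of_unity_integral[OF z m zm]
  define C where "C = {lin z \<alpha> \<beta> | \<alpha> \<beta>. \<alpha> \<in> \<O> \<and> \<beta> \<in> \<O>}"
  have CI: "lin z \<alpha> \<beta> \<in> C" if "\<alpha> \<in> \<O>" "\<beta> \<in> \<O>" for \<alpha> \<beta> unfolding C_def using that by blast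
  have C\<iota>: "\<iota> r \<in> C" if "r \<in> \<O>" for r
    using CI[OF that O_closed(5)] lin_scalar[OF z O_closed(1)[OF that]] by simp
  have zC: "z \<in> C" using CI[OF O_closed(5,6)] lin_self[OF z] by simp
  have sub: "subring C B"
  proof (rule B.subringI)
    show "C \<subseteq> carrier B" unfolding C_def using z O_closed(1) by blast
    show "\<one>\<^bsub>B\<^esub> \<in> C" using C\<iota>[OF O_closed(6)] by simp
    fix x assume "x \<in> C"
    then obtain \<alpha> \<beta> where x: "x = lin z \<alpha> \<beta>" "\<alpha> \<in> \<O>" "\<beta> \<in> \<O>" unfolding C_def by blast
    note xK = x(2,3)[THEN O_closed(1)]
    show "\<ominus>\<^bsub>B\<^esub> x \<in> C" unfolding x(1) lin_minus[OF z xK] using x by (intro CI O_closed(4))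
    fix y assume "y \<in> C"
    then obtain \<gamma> \<delta> where y: "y = lin z \<gamma> \<delta>" "\<gamma> \<in> \<O>" "\<delta> \<in> \<O>" unfolding C_def by blast
    note yK = y(2,3)[THEN O_closed(1)]
    show "x \<otimes>\<^bsub>B\<^esub> y \<in> C" unfolding x(1) y(1) lin_mult[OF z xK yK] using x y T by (intro CI O_minus O_closed(2,3))
    show "x \<oplus>\<^bsub>B\<^esub> y \<in> C" unfolding x(1) y(1) lin_add[OF z xK yK] using x y by (intro CI O_closed(2))
  qed
  let ?C = "B\<lparr>carrier := C\<rparr>"
  interpret C: cring ?C
  proof (rule cring.intro)
    show "ring ?C" by (rule B.subring_is_ring[OF sub])
    show "comm_monoid ?C"
    proof (rule monoid.monoid_comm_monoidI)
      show "monoid ?C" using B.subring_is_ring[OF sub] by (simp add: ring_def)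
      fix x y assume "x \<in> carrier ?C" "y \<in> carrier ?C"
      then obtain \<alpha> \<beta> \<gamma> \<delta> where "x = lin z \<alpha> \<beta>" "\<alpha> \<in> \<O>" "\<beta> \<in> \<O>" "y = lin z \<gamma> \<delta>" "\<gamma> \<in> \<O>" "\<delta> \<in> \<O>"
        unfolding C_def by auto
      then show "x \<otimes>\<^bsub>?C\<^esub> y = y \<otimes>\<^bsub>?C\<^esub> x" using lin_comm[OF z] O_closed(1) by simp
    qed
  qed
  define I where "I = PIdl\<^bsub>?C\<^esub> (\<iota> \<pi>)"
  have \<pi>C: "\<iota> \<pi> \<in> carrier ?C" using C\<iota>[OF O_closed(7)] by simp
  have I: "x \<in> I \<longleftrightarrow> (\<exists>y\<in>C. x = y \<otimes>\<^bsub>B\<^esub> \<iota> \<pi>)" for x unfolding I_def cgenideal_def by auto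
  interpret I: ideal I ?C unfolding I_def by (rule C.cgenideal_ideal[OF \<pi>C])
  let ?D = "?C Quot I"
  let ?\<phi> = "(+>\<^bsub>?C\<^esub>) I"
  interpret \<phi>: ring_hom_ring ?C ?D ?\<phi> by (rule I.rcos_ring_hom_ring)
  have D: "cring ?D" by (rule I.quotient_is_cring[OF C.is_cring])
  have \<phi>0: "?\<phi> x = \<zero>\<^bsub>?D\<^esub> \<longleftrightarrow> x \<in> I" if "x \<in> C" for x
    using that I.rcos_const_imp_mem[of x] I.a_rcos_const[of x] by (auto simp: FactRing_def)
  have I\<iota>: "\<iota> (\<pi> \<otimes>\<^bsub>K\<^esub> y) \<in> I" if "y \<in> \<O>" for y
    unfolding I using C\<iota>[OF that] O_closed(1)[OF that] \<iota>_comm[of "\<pi>" "\<iota> y"] by (intro bexI[of _ "\<iota> y"]) simp_all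
  have char: "[p] \<cdot>\<^bsub>?D\<^esub> \<one>\<^bsub>?D\<^esub> = \<zero>\<^bsub>?D\<^esub>"
  proof -
    have "[p] \<cdot>\<^bsub>?D\<^esub> \<one>\<^bsub>?D\<^esub> = ?\<phi> ([p] \<cdot>\<^bsub>?C\<^esub> \<one>\<^bsub>?C\<^esub>)"
      using \<phi>.hom_add_pow_nat[OF C.one_closed] by (simp only: \<phi>.hom_one)
    also have "[p] \<cdot>\<^bsub>?C\<^esub> \<one>\<^bsub>?C\<^esub> = \<iota> ([p] \<cdot>\<^bsub>K\<^esub> \<one>\<^bsub>K\<^esub>)"
      using \<iota>.hom_add_pow_nat[OF one_closed, of p] by (simp add: add_pow_carrier_update)
    also have "[p] \<cdot>\<^bsub>K\<^esub> \<one>\<^bsub>K\<^esub> = \<pi>" by (simp add: add_pow_one \<pi>_def)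
    also have "?\<phi> (\<iota> \<pi>) = \<zero>\<^bsub>?D\<^esub>" using I\<iota>[OF O_closed(6)] C\<iota>[OF O_closed(7)] by (simp add: \<phi>0)
    finally show ?thesis .
  qed
  have powC: "x [^]\<^bsub>?C\<^esub> n = x [^]\<^bsub>B\<^esub> n" for x and n :: nat by (simp add: nat_pow_def)
  have fermat: "?\<phi> (\<iota> x) [^]\<^bsub>?D\<^esub> p = ?\<phi> (\<iota> x)" if x: "x \<in> \<O>" for x
  proof -
    obtain y where y: "y \<in> \<O>" "x [^]\<^bsub>K\<^esub> p = x \<oplus>\<^bsub>K\<^esub> \<pi> \<otimes>\<^bsub>K\<^esub> y" using x by (rule fermat_O)
    have xC: "\<iota> x \<in> carrier ?C" and yC: "\<iota> (\<pi> \<otimes>\<^bsub>K\<^esub> y) \<in> carrier ?C"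
      using C\<iota>[OF x] C\<iota>[OF O_closed(3)[OF O_closed(7) y(1)]] by simp_all
    have "?\<phi> (\<iota> x) [^]\<^bsub>?D\<^esub> p = ?\<phi> (\<iota> x [^]\<^bsub>?C\<^esub> p)" by (rule \<phi>.hom_nat_pow[OF xC, symmetric])
    also have "\<iota> x [^]\<^bsub>?C\<^esub> p = \<iota> (x [^]\<^bsub>K\<^esub> p)" unfolding powC by (rule \<iota>.hom_nat_pow[OF O_closed(1)[OF x], symmetric])
    also have "\<dots> = \<iota> x \<oplus>\<^bsub>?C\<^esub> \<iota> (\<pi> \<otimes>\<^bsub>K\<^esub> y)"
      unfolding y(2) using O_closed(1)[OF x] O_closed(1)[OF y(1)] by simp
    also have "?\<phi> \<dots> = ?\<phi> (\<iota> x) \<oplus>\<^bsub>?D\<^esub> ?\<phi> (\<iota> (\<pi> \<otimes>\<^bsub>K\<^esub> y))" by (rule \<phi>.hom_add[OF xC yC])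
    also have "?\<phi> (\<iota> (\<pi> \<otimes>\<^bsub>K\<^esub> y)) = \<zero>\<^bsub>?D\<^esub>" using I\<iota>[OF y(1)] yC by (simp add: \<phi>0)
    also have "?\<phi> (\<iota> x) \<oplus>\<^bsub>?D\<^esub> \<zero>\<^bsub>?D\<^esub> = ?\<phi> (\<iota> x)" using \<phi>.hom_closed[OF xC] by (rule \<phi>.S.r_zero)
    finally show ?thesis .
  qed
  have lC: "\<iota> l \<in> carrier ?C" and uC: "\<iota> u \<in> carrier ?C" and zC': "z \<in> carrier ?C"
    using C\<iota> l u zC by simp_all
  have zpC: "z [^]\<^bsub>?C\<^esub> p \<in> carrier ?C" by (rule C.nat_pow_closed[OF zC'])
  have lin_C: "lin z l u = \<iota> l \<oplus>\<^bsub>?C\<^esub> \<iota> u \<otimes>\<^bsub>?C\<^esub> z" by (simp add: lin_def)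
  let ?w = "\<iota> l \<oplus>\<^bsub>?C\<^esub> \<iota> u \<otimes>\<^bsub>?C\<^esub> z [^]\<^bsub>?C\<^esub> p"
  have norm': "?w \<otimes>\<^bsub>?C\<^esub> (\<iota> l \<oplus>\<^bsub>?C\<^esub> \<iota> u \<otimes>\<^bsub>?C\<^esub> z) = \<iota> c"
    using norm unfolding lin_def powC by simp
  have wC: "?w \<in> carrier ?C" and lC': "\<iota> l \<oplus>\<^bsub>?C\<^esub> \<iota> u \<otimes>\<^bsub>?C\<^esub> z \<in> carrier ?C"
    by (rule C.a_closed[OF lC C.m_closed[OF uC zpC]], rule C.a_closed[OF lC C.m_closed[OF uC zC']])
  have "\<iota> c \<in> C" using C.m_closed[OF wC lC'] unfolding norm' by simp
  then obtain \<alpha> \<beta> where ab: "\<iota> c = lin z \<alpha> \<beta>" "\<alpha> \<in> \<O>" "\<beta> \<in> \<O>" unfolding C_def by blast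
  then have "c = \<alpha>" using lin_inj[OF z nr c zero_closed, of \<alpha> \<beta>] lin_scalar[OF z c] O_closed(1) by simp
  then show "c \<in> \<O>" using ab by simp
  assume cM: "c \<in> \<MM>"
  have "\<iota> c \<in> I" using cM I\<iota> by (auto simp: \<MM>_def)
  then have c0: "?\<phi> (\<iota> c) = \<zero>\<^bsub>?D\<^esub>" using \<phi>0[OF \<open>\<iota> c \<in> C\<close>] by simp
  have "?\<phi> (\<iota> l) \<oplus>\<^bsub>?D\<^esub> ?\<phi> (\<iota> u) \<otimes>\<^bsub>?D\<^esub> ?\<phi> z = \<zero>\<^bsub>?D\<^esub>"
  proof (rule frobenius_norm_vanish[OF D prime_p char \<phi>.hom_closed[OF lC] fermat[OF l] \<phi>.hom_closed[OF uC] fermat[OF u] \<phi>.hom_closed[OF zC']])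
    show "?\<phi> z [^]\<^bsub>?D\<^esub> (p * p) = ?\<phi> z"
      using \<phi>.hom_nat_pow[OF zC', of "p * p"] by (simp only: powC zpp)
    have "(?\<phi> (\<iota> l) \<oplus>\<^bsub>?D\<^esub> ?\<phi> (\<iota> u) \<otimes>\<^bsub>?D\<^esub> ?\<phi> z [^]\<^bsub>?D\<^esub> p) \<otimes>\<^bsub>?D\<^esub> (?\<phi> (\<iota> l) \<oplus>\<^bsub>?D\<^esub> ?\<phi> (\<iota> u) \<otimes>\<^bsub>?D\<^esub> ?\<phi> z)
      = ?\<phi> (?w \<otimes>\<^bsub>?C\<^esub> (\<iota> l \<oplus>\<^bsub>?C\<^esub> \<iota> u \<otimes>\<^bsub>?C\<^esub> z))"
      using lC uC zC' zpC by (simp only: \<phi>.hom_mult \<phi>.hom_add \<phi>.hom_nat_pow C.m_closed C.a_closed)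
    then show "(?\<phi> (\<iota> l) \<oplus>\<^bsub>?D\<^esub> ?\<phi> (\<iota> u) \<otimes>\<^bsub>?D\<^esub> ?\<phi> z [^]\<^bsub>?D\<^esub> p) \<otimes>\<^bsub>?D\<^esub> (?\<phi> (\<iota> l) \<oplus>\<^bsub>?D\<^esub> ?\<phi> (\<iota> u) \<otimes>\<^bsub>?D\<^esub> ?\<phi> z) = \<zero>\<^bsub>?D\<^esub>"
      unfolding norm' c0 .
  qed
  moreover have "?\<phi> (\<iota> l) \<oplus>\<^bsub>?D\<^esub> ?\<phi> (\<iota> u) \<otimes>\<^bsub>?D\<^esub> ?\<phi> z = ?\<phi> (lin z l u)"
    unfolding lin_C using lC uC zC' by (simp only: \<phi>.hom_mult \<phi>.hom_add C.m_closed)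
  ultimately have "lin z l u \<in> I" using \<phi>0[OF CI[OF l u]] by simp
  then obtain y where y: "y \<in> C" "lin z l u = y \<otimes>\<^bsub>B\<^esub> \<iota> \<pi>" unfolding I by blast
  then obtain \<alpha> \<beta> where y': "y = lin z \<alpha> \<beta>" "\<alpha> \<in> \<O>" "\<beta> \<in> \<O>" unfolding C_def by blast
  note yK = y'(2,3)[THEN O_closed(1)]
  have "lin z l u = lin z (\<alpha> \<otimes>\<^bsub>K\<^esub> \<pi>) (\<beta> \<otimes>\<^bsub>K\<^esub> \<pi>)"
    unfolding y(2) y'(1) lin_scalar[OF z pi_K, symmetric] lin_mult[OF z yK pi_K zero_closed] using yK z by (simp add: a_minus_def)
  then have "l = \<alpha> \<otimes>\<^bsub>K\<^esub> \<pi>" "u = \<beta> \<otimes>\<^bsub>K\<^esub> \<pi>"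
    using lin_inj[OF z nr O_closed(1)[OF l] O_closed(1)[OF u] m_closed[OF yK(1) pi_K] m_closed[OF yK(2) pi_K]] by simp_all
  then show "l \<in> \<MM> \<and> u \<in> \<MM>" unfolding \<MM>_def using yK y' m_comm[OF _ pi_K] by blast
qed

lemma witness_frobenius_order:
  assumes w: "has_inv_witness z g m c q"
  shows "z [^]\<^bsub>B\<^esub> (p * p) = z"
proof -
  have z: "z \<in> carrier B" and g: "g \<in> carrier B" and c: "c \<in> carrier K" "c \<noteq> \<zero>\<^bsub>K\<^esub>"
    and gz: "g \<otimes>\<^bsub>B\<^esub> z = z [^]\<^bsub>B\<^esub> p \<otimes>\<^bsub>B\<^esub> g" and gg: "g \<otimes>\<^bsub>B\<^esub> g = \<iota> c" using w by blast+
  let ?zp = "z [^]\<^bsub>B\<^esub> p"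
  have zp: "?zp \<in> carrier B" using z by simp
  have gzn: "g \<otimes>\<^bsub>B\<^esub> z [^]\<^bsub>B\<^esub> n = ?zp [^]\<^bsub>B\<^esub> n \<otimes>\<^bsub>B\<^esub> g" for n :: nat
  proof (induction n)
    case 0 then show ?case using g by simp
  next
    case (Suc n)
    have "g \<otimes>\<^bsub>B\<^esub> z [^]\<^bsub>B\<^esub> Suc n = (g \<otimes>\<^bsub>B\<^esub> z [^]\<^bsub>B\<^esub> n) \<otimes>\<^bsub>B\<^esub> z" using g z by (simp add: B.m_assoc)
    also have "\<dots> = ?zp [^]\<^bsub>B\<^esub> n \<otimes>\<^bsub>B\<^esub> (g \<otimes>\<^bsub>B\<^esub> z)" unfolding Suc.IH using g z zp by (simp add: B.m_assoc)
    also have "\<dots> = ?zp [^]\<^bsub>B\<^esub> Suc n \<otimes>\<^bsub>B\<^esub> g" unfolding gz using g z zp by (simp add: B.m_assoc)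
    finally show ?case .
  qed
    have "z [^]\<^bsub>B\<^esub> (p * p) \<otimes>\<^bsub>B\<^esub> \<iota> c = (?zp [^]\<^bsub>B\<^esub> p \<otimes>\<^bsub>B\<^esub> g) \<otimes>\<^bsub>B\<^esub> g"
      using z g by (simp add: gg[symmetric] B.nat_pow_pow B.m_assoc)
    also have "\<dots> = g \<otimes>\<^bsub>B\<^esub> (?zp \<otimes>\<^bsub>B\<^esub> g)" unfolding gzn[symmetric] using g zp by (simp add: B.m_assoc)
    also have "\<dots> = (g \<otimes>\<^bsub>B\<^esub> g) \<otimes>\<^bsub>B\<^esub> z" unfolding gz[symmetric] using g z by (simp add: B.m_assoc)
    also have "\<dots> = z \<otimes>\<^bsub>B\<^esub> \<iota> c" unfolding gg using z c by (simp add: \<iota>_comm)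
    finally have eq: "z [^]\<^bsub>B\<^esub> (p * p) \<otimes>\<^bsub>B\<^esub> \<iota> c = z \<otimes>\<^bsub>B\<^esub> \<iota> c" .
    note i = inv_closed_nonzero[OF c]
    have cancel: "x = x \<otimes>\<^bsub>B\<^esub> \<iota> c \<otimes>\<^bsub>B\<^esub> \<iota> (inv\<^bsub>K\<^esub> c)" if "x \<in> carrier B" for x
      using that i c by (simp add: B.m_assoc \<iota>.hom_mult[symmetric] del: \<iota>.hom_mult)
    show ?thesis using cancel[of "z [^]\<^bsub>B\<^esub> (p * p)"] cancel[of z] eq z by simp
qed

lemma lin_mult_ex:
  assumes "z \<in> carrier B" "\<alpha> \<in> carrier K" "\<beta> \<in> carrier K" "\<gamma> \<in> carrier K" "\<delta> \<in> carrier K"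
  shows "\<exists>\<alpha>'\<in>carrier K. \<exists>\<beta>'\<in>carrier K. lin z \<alpha> \<beta> \<otimes>\<^bsub>B\<^esub> lin z \<gamma> \<delta> = lin z \<alpha>' \<beta>'"
  by (intro bexI, rule lin_mult[OF assms]) (use assms in simp_all)

text \<open>If a left ideal \<open>B \<epsilon>\<close> has dimension at most 2 over \<open>K\<close>, it is a line over the field \<open>K[z]\<close>. Then
  \<open>g \<epsilon> = w \<epsilon>\<close> for some \<open>w\<close> in \<open>K[z]\<close>, which makes \<open>g\<^sup>2 = c\<close> the norm of \<open>w\<close>. Norms from the
  unramified extension have even valuation.\<close>

lemma split_local_inv:
  assumes inv: "has_local_inv p A q" and \<epsilon>: "\<epsilon> \<in> carrier B" "\<epsilon> \<noteq> \<zero>\<^bsub>B\<^esub>" and \<kappa>: "\<kappa> \<in> carrier B"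
    and span: "\<And>x. x \<in> carrier B \<Longrightarrow> \<exists>\<alpha>\<in>carrier K. \<exists>\<beta>\<in>carrier K. x \<otimes>\<^bsub>B\<^esub> \<epsilon> = \<iota> \<alpha> \<otimes>\<^bsub>B\<^esub> \<epsilon> \<oplus>\<^bsub>B\<^esub> \<iota> \<beta> \<otimes>\<^bsub>B\<^esub> \<kappa>"
  shows "q = 0"
proof -
  obtain z g m c where w: "has_inv_witness z g m c q" using inv has_local_inv_iff by blast
  then have z: "z \<in> carrier B" and g: "g \<in> carrier B" and gU: "g \<in> Units B" and m: "m > 0" and c: "c \<in> carrier K" "c \<noteq> \<zero>\<^bsub>K\<^esub>"
    and zm: "z [^]\<^bsub>B\<^esub> m = \<one>\<^bsub>B\<^esub>" and nr: "noroot z" and gz: "g \<otimes>\<^bsub>B\<^esub> z = z [^]\<^bsub>B\<^esub> p \<otimes>\<^bsub>B\<^esub> g"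
    and gg: "g \<otimes>\<^bsub>B\<^esub> g = \<iota> c" and q: "q = frac (rat_of_int (v c) / 2)" by blast+
  let ?zp = "z [^]\<^bsub>B\<^esub> p"
  have zp: "?zp \<in> carrier B" using z by simp
  note zpp = witness_frobenius_order[OF w]
  obtain z1 z2 where z12: "z1 \<in> carrier K" "z2 \<in> carrier K" "z \<otimes>\<^bsub>B\<^esub> \<epsilon> = \<iota> z1 \<otimes>\<^bsub>B\<^esub> \<epsilon> \<oplus>\<^bsub>B\<^esub> \<iota> z2 \<otimes>\<^bsub>B\<^esub> \<kappa>"
    using span[OF z] by blast
  obtain g1 g2 where g12: "g1 \<in> carrier K" "g2 \<in> carrier K" "g \<otimes>\<^bsub>B\<^esub> \<epsilon> = \<iota> g1 \<otimes>\<^bsub>B\<^esub> \<epsilon> \<oplus>\<^bsub>B\<^esub> \<iota> g2 \<otimes>\<^bsub>B\<^esub> \<kappa>"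
    using span[OF g] by blast
  have z2: "z2 \<noteq> \<zero>\<^bsub>K\<^esub>"
  proof
    assume "z2 = \<zero>\<^bsub>K\<^esub>"
    then have "z \<otimes>\<^bsub>B\<^esub> \<epsilon> = \<iota> z1 \<otimes>\<^bsub>B\<^esub> \<epsilon>" using z12 \<epsilon> \<kappa> by simp
    then have "lin z (\<ominus>\<^bsub>K\<^esub> z1) \<one>\<^bsub>K\<^esub> \<otimes>\<^bsub>B\<^esub> \<epsilon> = \<zero>\<^bsub>B\<^esub>"
      using z z12(1) \<epsilon> by (simp add: lin_def B.l_distr B.l_minus B.l_neg)
    then show False using lin_eq_zero[OF z nr _ _ \<epsilon>, of "\<ominus>\<^bsub>K\<^esub> z1" "\<one>\<^bsub>K\<^esub>"] z12 by simp
  qed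
  note i = inv_closed_nonzero[OF z12(2) z2]
  \<comment> \<open>The scalars for which \<open>(l + u z) \<epsilon>\<close> and \<open>g \<epsilon>\<close> have the same coordinates.\<close>
  define u where "u = g2 \<otimes>\<^bsub>K\<^esub> inv\<^bsub>K\<^esub> z2"
  define l where "l = g1 \<ominus>\<^bsub>K\<^esub> u \<otimes>\<^bsub>K\<^esub> z1"
  have lu: "l \<in> carrier K" "u \<in> carrier K" using i g12 z12 by (simp_all add: l_def u_def)
  have uz: "u \<otimes>\<^bsub>K\<^esub> z2 = g2" unfolding u_def using i g12 z12 by (simp add: m_assoc)
  have lg: "l \<oplus>\<^bsub>K\<^esub> u \<otimes>\<^bsub>K\<^esub> z1 = g1" unfolding l_def using lu g12 z12 by (simp add: a_minus_def a_assoc l_neg)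
  have lin_\<epsilon>: "lin z l u \<otimes>\<^bsub>B\<^esub> \<epsilon> = g \<otimes>\<^bsub>B\<^esub> \<epsilon>"
  proof -
    have "lin z l u \<otimes>\<^bsub>B\<^esub> \<epsilon> = \<iota> l \<otimes>\<^bsub>B\<^esub> \<epsilon> \<oplus>\<^bsub>B\<^esub> \<iota> u \<otimes>\<^bsub>B\<^esub> (z \<otimes>\<^bsub>B\<^esub> \<epsilon>)"
      unfolding lin_def using lu z \<epsilon> by (simp add: B.l_distr B.m_assoc)
    also have "\<dots> = \<iota> (l \<oplus>\<^bsub>K\<^esub> u \<otimes>\<^bsub>K\<^esub> z1) \<otimes>\<^bsub>B\<^esub> \<epsilon> \<oplus>\<^bsub>B\<^esub> \<iota> (u \<otimes>\<^bsub>K\<^esub> z2) \<otimes>\<^bsub>B\<^esub> \<kappa>"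
      unfolding z12(3) using lu z12(1,2) \<epsilon> \<kappa> by (simp add: B.l_distr B.r_distr B.m_assoc B.a_assoc)
    finally show ?thesis unfolding uz lg g12(3) .
  qed
  let ?W = "\<lambda>l u. \<iota> l \<oplus>\<^bsub>B\<^esub> \<iota> u \<otimes>\<^bsub>B\<^esub> ?zp"
  have W: "g \<otimes>\<^bsub>B\<^esub> lin z l u = ?W l u \<otimes>\<^bsub>B\<^esub> g"
  proof -
    have "g \<otimes>\<^bsub>B\<^esub> lin z l u = g \<otimes>\<^bsub>B\<^esub> \<iota> l \<oplus>\<^bsub>B\<^esub> (g \<otimes>\<^bsub>B\<^esub> \<iota> u) \<otimes>\<^bsub>B\<^esub> z"
      unfolding lin_def using g z lu by (simp add: B.r_distr B.m_assoc)
    also have "\<dots> = \<iota> l \<otimes>\<^bsub>B\<^esub> g \<oplus>\<^bsub>B\<^esub> \<iota> u \<otimes>\<^bsub>B\<^esub> (g \<otimes>\<^bsub>B\<^esub> z)"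
      using g z lu by (simp only: \<iota>_comm B.m_assoc \<iota>_closed)
    also have "\<dots> = ?W l u \<otimes>\<^bsub>B\<^esub> g" unfolding gz using g zp lu by (simp add: B.l_distr B.m_assoc)
    finally show ?thesis .
  qed
  have zplin: "\<exists>\<alpha>\<in>carrier K. \<exists>\<beta>\<in>carrier K. z [^]\<^bsub>B\<^esub> n = lin z \<alpha> \<beta>" for n :: nat
  proof (induction n)
    case 0
    then show ?case using lin_scalar[OF z one_closed] by (intro bexI[of _ "\<one>\<^bsub>K\<^esub>"] bexI[of _ "\<zero>\<^bsub>K\<^esub>"]) simp_all
  next
    case (Suc n)
    then obtain \<alpha> \<beta> where ab: "\<alpha> \<in> carrier K" "\<beta> \<in> carrier K" "z [^]\<^bsub>B\<^esub> n = lin z \<alpha> \<beta>" by blast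
    have "z [^]\<^bsub>B\<^esub> Suc n = lin z \<alpha> \<beta> \<otimes>\<^bsub>B\<^esub> lin z \<zero>\<^bsub>K\<^esub> \<one>\<^bsub>K\<^esub>" using ab z by (simp add: lin_self)
    then show ?case using lin_mult_ex[OF z ab(1,2) zero_closed one_closed] by (simp only:)
  qed
  obtain x y where xy: "x \<in> carrier K" "y \<in> carrier K" "?zp = lin z x y" using zplin[of p] by blast
  have WL: "\<exists>\<alpha>\<in>carrier K. \<exists>\<beta>\<in>carrier K. ?W l u \<otimes>\<^bsub>B\<^esub> lin z l u = lin z \<alpha> \<beta>"
  proof -
    define x' y' where "x' = l \<oplus>\<^bsub>K\<^esub> u \<otimes>\<^bsub>K\<^esub> x" and "y' = u \<otimes>\<^bsub>K\<^esub> y"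
    have xy': "x' \<in> carrier K" "y' \<in> carrier K" using lu xy(1,2) by (simp_all add: x'_def y'_def)
    have "?W l u = lin z l \<zero>\<^bsub>K\<^esub> \<oplus>\<^bsub>B\<^esub> lin z u \<zero>\<^bsub>K\<^esub> \<otimes>\<^bsub>B\<^esub> lin z x y" using lu z by (simp add: lin_scalar xy(3))
    also have "\<dots> = lin z x' y'"
      using lu z xy(1,2) by (simp add: x'_def y'_def lin_mult lin_add a_minus_def)
    finally have "?W l u = lin z x' y'" .
    then show ?thesis using lin_mult_ex[OF z xy' lu] by (simp only:)
  qed
  then obtain \<alpha> \<beta> where ab: "\<alpha> \<in> carrier K" "\<beta> \<in> carrier K" "?W l u \<otimes>\<^bsub>B\<^esub> lin z l u = lin z \<alpha> \<beta>" by blast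
  have WK: "?W l u \<in> carrier B" using lu zp by simp
  have "lin z \<alpha> \<beta> \<otimes>\<^bsub>B\<^esub> \<epsilon> = ?W l u \<otimes>\<^bsub>B\<^esub> (g \<otimes>\<^bsub>B\<^esub> \<epsilon>)"
    unfolding ab(3)[symmetric] lin_\<epsilon>[symmetric] using WK lu z \<epsilon> by (intro B.m_assoc) auto
  also have "\<dots> = g \<otimes>\<^bsub>B\<^esub> (lin z l u \<otimes>\<^bsub>B\<^esub> \<epsilon>)"
    using W WK g z lu \<epsilon> by (simp add: B.m_assoc[symmetric])
  also have "\<dots> = (g \<otimes>\<^bsub>B\<^esub> g) \<otimes>\<^bsub>B\<^esub> \<epsilon>" unfolding lin_\<epsilon> using g \<epsilon> by (simp add: B.m_assoc)
  also have "\<dots> = lin z c \<zero>\<^bsub>K\<^esub> \<otimes>\<^bsub>B\<^esub> \<epsilon>" unfolding gg lin_scalar[OF z c(1)] ..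
  finally have eq: "lin z \<alpha> \<beta> \<otimes>\<^bsub>B\<^esub> \<epsilon> = lin z c \<zero>\<^bsub>K\<^esub> \<otimes>\<^bsub>B\<^esub> \<epsilon>" .
  have "lin z (\<alpha> \<ominus>\<^bsub>K\<^esub> c) \<beta> = lin z \<alpha> \<beta> \<oplus>\<^bsub>B\<^esub> \<ominus>\<^bsub>B\<^esub> lin z c \<zero>\<^bsub>K\<^esub>"
    using z ab c by (simp add: lin_minus lin_add a_minus_def)
  then have "lin z (\<alpha> \<ominus>\<^bsub>K\<^esub> c) \<beta> \<otimes>\<^bsub>B\<^esub> \<epsilon> = \<zero>\<^bsub>B\<^esub>"
    using z ab(1,2) c \<epsilon> eq by (simp add: B.l_distr B.l_minus B.r_neg)
  then have "\<alpha> \<ominus>\<^bsub>K\<^esub> c = \<zero>\<^bsub>K\<^esub> \<and> \<beta> = \<zero>\<^bsub>K\<^esub>" using ab(1,2) c(1) by (intro lin_eq_zero[OF z nr _ _ \<epsilon>]) simp_all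
  then have "\<alpha> = c" "\<beta> = \<zero>\<^bsub>K\<^esub>" using r_right_minus_eq[OF ab(1) c(1)] by simp_all
  then have norm: "?W l u \<otimes>\<^bsub>B\<^esub> lin z l u = \<iota> c" using ab lin_scalar[OF z c(1)] by simp
  have "l \<noteq> \<zero>\<^bsub>K\<^esub> \<or> u \<noteq> \<zero>\<^bsub>K\<^esub>"
  proof (rule ccontr)
    assume "\<not> ?thesis"
    then have "\<iota> c = \<zero>\<^bsub>B\<^esub>" using norm[symmetric] z zp by (simp add: lin_def)
    then show False using c by (simp add: \<iota>_def zero_B)
  qed
  with lu obtain j l' u' where s: "l' \<in> \<O>" "u' \<in> \<O>" "l = P j \<otimes>\<^bsub>K\<^esub> l'" "u = P j \<otimes>\<^bsub>K\<^esub> u'" "l' \<notin> \<MM> \<or> u' \<notin> \<MM>"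
    by (rule scale_pair)
  note sK = s(1,2)[THEN O_closed(1)]
  \<comment> \<open>After removing the common power of \<open>p\<close> from \<open>l\<close> and \<open>u\<close>, the norm is a unit.\<close>
  define c' where "c' = P (- (2 * j)) \<otimes>\<^bsub>K\<^esub> c"
  have c': "c' \<in> carrier K" using c by (simp add: c'_def)
  have PPc: "P (2 * j) \<otimes>\<^bsub>K\<^esub> c' = c" unfolding c'_def using c P_minus[of "2 * j"] by (simp add: m_assoc[symmetric])
  have norm': "?W l' u' \<otimes>\<^bsub>B\<^esub> lin z l' u' = \<iota> c'"
  proof -
    have 1: "?W l u = \<iota> (P j) \<otimes>\<^bsub>B\<^esub> ?W l' u'" and 2: "lin z l u = \<iota> (P j) \<otimes>\<^bsub>B\<^esub> lin z l' u'"
      unfolding s(3,4) lin_def using sK z zp by (simp_all add: B.r_distr B.m_assoc)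
    have W': "?W l' u' \<in> carrier B" "lin z l' u' \<in> carrier B" using sK z zp by auto
    have "\<iota> c = \<iota> (P j) \<otimes>\<^bsub>B\<^esub> (?W l' u' \<otimes>\<^bsub>B\<^esub> \<iota> (P j)) \<otimes>\<^bsub>B\<^esub> lin z l' u'"
      unfolding norm[symmetric] 1 2 using W' by (simp add: B.m_assoc)
    also have "\<dots> = \<iota> (P j \<otimes>\<^bsub>K\<^esub> P j) \<otimes>\<^bsub>B\<^esub> (?W l' u' \<otimes>\<^bsub>B\<^esub> lin z l' u')"
      using W' \<iota>_comm[OF P_closed W'(1), of j] by (simp add: B.m_assoc)
    also have "P j \<otimes>\<^bsub>K\<^esub> P j = P (2 * j)" by (simp add: P_add[symmetric])
    finally have "\<iota> (P (- (2 * j))) \<otimes>\<^bsub>B\<^esub> \<iota> c = \<iota> (P (- (2 * j)) \<otimes>\<^bsub>K\<^esub> P (2 * j)) \<otimes>\<^bsub>B\<^esub> (?W l' u' \<otimes>\<^bsub>B\<^esub> lin z l' u')"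
      using W' by (simp add: B.m_assoc)
    moreover have "P (- (2 * j)) \<otimes>\<^bsub>K\<^esub> P (2 * j) = \<one>\<^bsub>K\<^esub>" using P_minus[of "- (2 * j)"] by simp
    ultimately show ?thesis using c(1) B.l_one[OF B.m_closed[OF W']]
      by (simp only: c'_def \<iota>.hom_mult[symmetric] P_closed \<iota>.hom_one)
  qed
  note un = integral_norm_unit[OF z nr m zm zpp s(1,2) c' norm']
  have "c' \<notin> \<MM>" using un(2) s(5) by blast
  then have "v c = 2 * j" using v_P_unit[OF un(1), of "2 * j"] PPc by simp
  then show "q = 0" unfolding q by simp
qed

end

section \<open>Squares, roots of unity and norms over the p-adic numbers\<close>

lemma square_mod_8: "x mod 2 = 0 \<and> x * x mod 8 \<in> {0, 4} \<or> x mod 2 = 1 \<and> x * x mod 8 = 1" for x :: int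
proof -
  have "x mod 8 = 0 \<or> x mod 8 = 1 \<or> x mod 8 = 2 \<or> x mod 8 = 3 \<or> x mod 8 = 4 \<or> x mod 8 = 5 \<or> x mod 8 = 6 \<or> x mod 8 = 7"
    by presburger
  moreover have "x * x mod 8 = (x mod 8) * (x mod 8) mod 8" by (simp add: mod_simps)
  moreover have "x mod 2 = (x mod 8) mod 2" by (simp add: mod_mod_cancel)
  ultimately show ?thesis by auto
qed

context padic begin

lemma v_emb_eq:
  assumes a: "a \<in> carrier (Zp p)" and j: "a j = 0" "a (Suc j) \<noteq> 0"
  shows "emb a \<noteq> \<zero>\<^bsub>K\<^esub>" "v (emb a) = int j"
proof -
  have "a \<noteq> \<zero>\<^bsub>Zp p\<^esub>" using j by (auto simp: Zp_simps)
  then show "emb a \<noteq> \<zero>\<^bsub>K\<^esub>" using emb_eq_0[OF a] by simp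
  obtain i u where u: "u \<in> Units (Zp p)" "a = zint (int p ^ i) \<otimes>\<^bsub>Zp p\<^esub> u"
    using a \<open>a \<noteq> _\<close> by (rule Zp_decompose)
  note z = zint_p_power_unit[OF u(1), where j = i, folded u(2)]
  have "\<not> j < i" using z(2)[of "Suc j"] j by auto
  moreover have "\<not> i < j" using z(1) j Zp_coherent[OF a, of "Suc i" j] by auto
  ultimately have "i = j" by simp
  then have "emb a = P (int j) \<otimes>\<^bsub>K\<^esub> emb u"
    unfolding u(2) P_nat using Zp_Units_iff[of u] u(1) by (simp add: Q.to_fraction.hom_mult)
  then show "v (emb a) = int j" using padic_val_eq[OF u(1)] by simp
qed

text \<open>Iterating \<open>y \<mapsto> c - y\<^sup>2\<close> from 0 converges, since it contracts the multiples of \<open>p\<close>.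
  This form of Hensel's lemma covers all primes at once: \<open>1 + 4c = (1 + 2y)\<^sup>2\<close>.\<close>

lemma artin_schreier_root:
  assumes c: "c \<in> carrier (Zp p)" and c1: "c 1 = 0"
  shows "\<exists>y\<in>carrier (Zp p). y \<otimes>\<^bsub>Zp p\<^esub> y \<oplus>\<^bsub>Zp p\<^esub> y = c"
proof -
  define Y where "Y = rec_nat \<zero>\<^bsub>Zp p\<^esub> (\<lambda>_ y. c \<ominus>\<^bsub>Zp p\<^esub> y \<otimes>\<^bsub>Zp p\<^esub> y)"
  have Y0: "Y 0 = \<zero>\<^bsub>Zp p\<^esub>" and YS: "Y (Suc n) = c \<ominus>\<^bsub>Zp p\<^esub> Y n \<otimes>\<^bsub>Zp p\<^esub> Y n" for n
    by (simp_all add: Y_def)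
  have Y: "Y n \<in> carrier (Zp p)" for n by (induction n) (use c in \<open>simp_all add: Y0 YS\<close>)
  have "Y (Suc n) \<oplus>\<^bsub>Zp p\<^esub> Y n \<otimes>\<^bsub>Zp p\<^esub> Y n = c" for n
    using Y c by (simp add: YS a_minus_def Zp.a_assoc Zp.l_neg)
  then have "c k = (Y (Suc n) k + Y n k * Y n k mod int p ^ k) mod int p ^ k" for n k
    unfolding Zp_simps by (metis (lifting))
  then have E: "[Y (Suc n) k + Y n k * Y n k = c k] (mod int p ^ k)" for n k
    using Zp_mod[OF c] by (simp add: cong_def mod_simps)
  have Y1: "Y n 1 = 0" for n
  proof (induction n)
    case (Suc n)
    have "[Y (Suc n) 1 = 0] (mod int p ^ 1)" using E[of n 1] Suc c1 by simp
    then show ?case using Zp_mod[OF Y, of "Suc n" 1] by (simp add: cong_def)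
  qed (simp add: Y0 Zp_simps)
  have step: "[Y (Suc n) (Suc n) = Y n (Suc n)] (mod int p ^ Suc n)" for n
  proof (induction n)
    case 0
    show ?case using Y1 by simp
  next
    case (Suc n)
    let ?k = "Suc (Suc n)"
    let ?a = "Y (Suc n) ?k" and ?b = "Y n ?k"
    have "?a mod int p ^ Suc n = Y (Suc n) (Suc n)" "?b mod int p ^ Suc n = Y n (Suc n)"
      by (rule Zp_coherent[OF Y], simp)+
    then have "[?a = ?b] (mod int p ^ Suc n)"
      using Suc unfolding cong_def Zp_mod[OF Y] by (simp only:)
    then have d1: "int p ^ Suc n dvd ?a - ?b" by (simp add: cong_iff_dvd_diff)
    have "?a mod int p ^ 1 = 0" "?b mod int p ^ 1 = 0" using Zp_coherent[OF Y, of 1 ?k] Y1 by auto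
    then have d2: "int p dvd ?a + ?b" by (simp add: dvd_eq_mod_eq_0[symmetric])
    have "int p ^ Suc n * int p dvd (?a - ?b) * (?a + ?b)" by (rule mult_dvd_mono[OF d1 d2])
    then have "int p ^ ?k dvd (?a - ?b) * (?a + ?b)" by (simp add: mult.commute)
    moreover have "[Y ?k ?k + ?a * ?a = ?a + ?b * ?b] (mod int p ^ ?k)"
      using E[of "Suc n" ?k] E[of n ?k] by (meson cong_sym cong_trans)
    then have "int p ^ ?k dvd (Y ?k ?k + ?a * ?a) - (?a + ?b * ?b)" by (simp only: cong_iff_dvd_diff)
    moreover have "Y ?k ?k - ?a = ((Y ?k ?k + ?a * ?a) - (?a + ?b * ?b)) - (?a - ?b) * (?a + ?b)"
      by (simp add: algebra_simps)
    ultimately have "int p ^ ?k dvd Y ?k ?k - ?a" by (metis dvd_diff)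
    then show ?case by (simp only: cong_iff_dvd_diff)
  qed
  define y where "y = (\<lambda>k. Y k k)"
  have y: "y \<in> carrier (Zp p)"
  proof -
    have "[Y (Suc n) (Suc n) = Y n n] (mod int p ^ n)" for n
    proof -
      have "[Y (Suc n) (Suc n) = Y n (Suc n)] (mod int p ^ n)"
        using step[of n] by (rule cong_dvd_modulus) (simp add: le_imp_power_dvd)
      moreover have "[Y n (Suc n) = Y n n] (mod int p ^ n)" using Zp_cong[OF Y] .
      ultimately show ?thesis by (rule cong_trans)
    qed
    then have "(\<lambda>n. Y n n mod int p ^ n) \<in> carrier (Zp p)" by (intro Zp_memI)
    then show ?thesis unfolding y_def using Zp_mod[OF Y] by simp
  qed
  have "y \<otimes>\<^bsub>Zp p\<^esub> y \<oplus>\<^bsub>Zp p\<^esub> y = c"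
  proof (rule Zp_eqI)
    fix k
    show "[(y \<otimes>\<^bsub>Zp p\<^esub> y \<oplus>\<^bsub>Zp p\<^esub> y) k = c k] (mod int p ^ k)"
    proof (cases k)
      case (Suc n)
      have "Y (Suc k) k = Y k k"
        using step[of k] Zp_coherent[OF Y, of k "Suc k" k] Zp_coherent[OF Y, of k "Suc k" "Suc k"]
        by (metis cong_def cong_dvd_modulus le_SucI le_imp_power_dvd order_refl)
      then show ?thesis using E[of k k] by (simp add: y_def Zp_simps cong_def mod_simps add.commute)
    qed simp
  qed (use y c in simp_all)
  then show ?thesis using y by blast
qed

lemma zint_numeral_4: "zint 4 = \<one>\<^bsub>Zp p\<^esub> \<oplus>\<^bsub>Zp p\<^esub> \<one>\<^bsub>Zp p\<^esub> \<oplus>\<^bsub>Zp p\<^esub> (\<one>\<^bsub>Zp p\<^esub> \<oplus>\<^bsub>Zp p\<^esub> \<one>\<^bsub>Zp p\<^esub>)"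
  by (simp add: zint_1[symmetric] zint_add[symmetric])

lemma square_root:
  assumes c: "c \<in> carrier (Zp p)" "c 1 = 0" and w: "zint 4 \<otimes>\<^bsub>Zp p\<^esub> c = zint (w - 1)"
  shows "\<exists>r\<in>carrier (Zp p). r \<otimes>\<^bsub>Zp p\<^esub> r = zint w"
proof -
  obtain y where y: "y \<in> carrier (Zp p)" "y \<otimes>\<^bsub>Zp p\<^esub> y \<oplus>\<^bsub>Zp p\<^esub> y = c" using artin_schreier_root[OF c] by blast
  let ?r = "\<one>\<^bsub>Zp p\<^esub> \<oplus>\<^bsub>Zp p\<^esub> (y \<oplus>\<^bsub>Zp p\<^esub> y)"
  have "?r \<otimes>\<^bsub>Zp p\<^esub> ?r = \<one>\<^bsub>Zp p\<^esub> \<oplus>\<^bsub>Zp p\<^esub> zint 4 \<otimes>\<^bsub>Zp p\<^esub> (y \<otimes>\<^bsub>Zp p\<^esub> y \<oplus>\<^bsub>Zp p\<^esub> y)"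
    unfolding zint_numeral_4 using component_ex[OF Zp_cring y(1)]
    by (elim exE, hypsubst, simp only: component_homs[OF Zp_cring], simp add: algebra_simps)
  also have "\<dots> = zint w" unfolding y(2) w by (simp add: zint_1[symmetric] zint_add[symmetric])
  finally show ?thesis using y(1) by (intro bexI[of _ ?r]) simp_all
qed

lemma square_root_dyadic:
  assumes p: "p = 2" and w: "w mod 8 = 1"
  shows "\<exists>r\<in>carrier (Zp p). r \<otimes>\<^bsub>Zp p\<^esub> r = zint w"
proof (rule square_root)
  define n where "n = (w - 1) div 8"
  have n: "w - 1 = 4 * (2 * n)" using w unfolding n_def by presburger
  show "zint 4 \<otimes>\<^bsub>Zp p\<^esub> zint (2 * n) = zint (w - 1)" unfolding n by (simp add: zint_mult[symmetric])
  have "zint (2 * n) 1 = 2 * n mod int p ^ 1" by (simp only: zint_def)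
  then show "zint (2 * n) 1 = 0" by (simp add: p)
qed simp

lemma square_root_odd:
  assumes p: "odd p" and w: "[w = 1] (mod int p)"
  shows "\<exists>r\<in>carrier (Zp p). r \<otimes>\<^bsub>Zp p\<^esub> r = zint w"
proof -
  have n4: "\<not> int p dvd 4"
  proof
    assume "int p dvd 4"
    then have "int p dvd 2 ^ 2" by simp
    then have "int p dvd 2" using prime_p by (metis prime_dvd_power prime_nat_int_transfer)
    then have "p dvd 2" by (metis int_dvd_int_iff of_nat_numeral)
    then show False using p prime_p by (metis even_numeral dvd_antisym prime_nat_iff one_dvd primes_dvd_imp_eq two_is_prime_nat dvd_refl)
  qed
  have "zint 4 1 \<noteq> 0" using n4 by (simp add: zint_def dvd_eq_mod_eq_0)
  then have u: "zint 4 \<in> Units (Zp p)" by (simp add: Zp_Units_iff)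
  define c where "c = inv\<^bsub>Zp p\<^esub> zint 4 \<otimes>\<^bsub>Zp p\<^esub> zint (w - 1)"
  have c: "c \<in> carrier (Zp p)" using u by (simp add: c_def)
  have eq: "zint 4 \<otimes>\<^bsub>Zp p\<^esub> c = zint (w - 1)"
    unfolding c_def using u by (simp add: Zp.m_assoc[symmetric])
  have "(zint 4 \<otimes>\<^bsub>Zp p\<^esub> c) 1 = 0" unfolding eq using w by (simp add: zint_def cong_iff_dvd_diff)
  then have "int p dvd 4 * c 1" by (simp add: Zp_simps zint_def dvd_eq_mod_eq_0 mod_simps)
  then have "int p dvd c 1" using n4 prime_p by (simp add: prime_dvd_mult_iff)
  then have "c 1 = 0" using Zp_mod[OF c, of 1] by (simp add: dvd_eq_mod_eq_0)
  then show ?thesis using square_root[OF c _ eq] by simp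
qed

lemma root_of_unity_O:
  assumes x: "x \<in> carrier K" and m: "m > 0" and xm: "x [^]\<^bsub>K\<^esub> (m::nat) \<in> \<O>"
  shows "x \<in> \<O>"
proof (rule ccontr)
  assume "x \<notin> \<O>"
  note i = not_O_inv[OF x this]
  note i' = Q.K.inv_closed_nonzero[OF x i(1)]
  let ?i = "inv\<^bsub>K\<^esub> x"
  obtain n where n: "m = Suc n" using m by (cases m) auto
  have "?i [^]\<^bsub>K\<^esub> m = ?i \<otimes>\<^bsub>K\<^esub> ?i [^]\<^bsub>K\<^esub> n" unfolding n using i' by (simp add: Q.K.m_comm)
  then have iM: "?i [^]\<^bsub>K\<^esub> m \<in> \<MM>" using M_closed(3)[OF i(2) O_pow[OF M_closed(1)[OF i(2)]]] by simp
  have "(?i \<otimes>\<^bsub>K\<^esub> x) [^]\<^bsub>K\<^esub> m = ?i [^]\<^bsub>K\<^esub> m \<otimes>\<^bsub>K\<^esub> x [^]\<^bsub>K\<^esub> m" using i' x by (intro Q.K.nat_pow_distrib) auto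
  then have "\<one>\<^bsub>K\<^esub> = ?i [^]\<^bsub>K\<^esub> m \<otimes>\<^bsub>K\<^esub> x [^]\<^bsub>K\<^esub> m" using i' by (simp only: Q.K.nat_pow_one)
  then show False using M_closed(3)[OF iM xm] M_closed(5) by simp
qed

lemma square_emb:
  assumes "r \<in> carrier K" "r \<otimes>\<^bsub>K\<^esub> r \<in> \<O>"
  obtains b where "b \<in> carrier (Zp p)" "r = emb b"
proof -
  have "r [^]\<^bsub>K\<^esub> (2::nat) \<in> \<O>" using assms by (simp add: numeral_2_eq_2)
  then have "r \<in> \<O>" using root_of_unity_O[OF assms(1), of 2] by simp
  then show ?thesis using O_cases that by blast
qed

text \<open>A square is never 5 modulo 8.\<close>

lemma minus_three_nonsquare:
  assumes p: "p = 2" and r: "r \<in> carrier K"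
  shows "r \<otimes>\<^bsub>K\<^esub> r \<noteq> \<ominus>\<^bsub>K\<^esub> (\<one>\<^bsub>K\<^esub> \<oplus>\<^bsub>K\<^esub> \<one>\<^bsub>K\<^esub> \<oplus>\<^bsub>K\<^esub> \<one>\<^bsub>K\<^esub>)"
proof
  assume eq: "r \<otimes>\<^bsub>K\<^esub> r = \<ominus>\<^bsub>K\<^esub> (\<one>\<^bsub>K\<^esub> \<oplus>\<^bsub>K\<^esub> \<one>\<^bsub>K\<^esub> \<oplus>\<^bsub>K\<^esub> \<one>\<^bsub>K\<^esub>)"
  then have "r \<otimes>\<^bsub>K\<^esub> r \<in> \<O>" by (simp add: O_closed)
  then obtain b where b: "b \<in> carrier (Zp p)" "r = emb b" using r square_emb by blast
  have "emb (zint 3) = \<one>\<^bsub>K\<^esub> \<oplus>\<^bsub>K\<^esub> \<one>\<^bsub>K\<^esub> \<oplus>\<^bsub>K\<^esub> \<one>\<^bsub>K\<^esub>"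
    using zint_add[of 2 1] zint_add[of 1 1] by (simp add: zint_1)
  then have "emb (b \<otimes>\<^bsub>Zp p\<^esub> b) = emb (zint (- 3))"
    using eq b by (simp add: zint_minus)
  then have "b \<otimes>\<^bsub>Zp p\<^esub> b = zint (- 3)" using b by (subst (asm) Q.to_fraction_inj) simp_all
  then have "(b \<otimes>\<^bsub>Zp p\<^esub> b) 3 = zint (- 3) 3" by simp
  then have "b 3 * b 3 mod int p ^ 3 = - 3 mod int p ^ 3" by (simp only: Zp_simps zint_def)
  then have "b 3 * b 3 mod 8 = 5" by (simp add: p)
  moreover have "b 3 * b 3 mod 8 \<noteq> 5" using square_mod_8[of "b 3"] by auto
  ultimately show False by simp
qed

lemma O_not_M_two: "odd p \<Longrightarrow> \<one>\<^bsub>K\<^esub> \<oplus>\<^bsub>K\<^esub> \<one>\<^bsub>K\<^esub> \<notin> \<MM>"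
proof -
  assume "odd p"
  then have "p \<noteq> 1" "p \<noteq> 2" using p_gt by auto
  then have "2 mod int p = 2" using p_gt(1) by simp
  moreover have "\<one>\<^bsub>K\<^esub> \<oplus>\<^bsub>K\<^esub> \<one>\<^bsub>K\<^esub> = emb (zint 2)" using zint_add[of 1 1] by (simp add: zint_1)
  ultimately show ?thesis by (simp add: M_iff) (simp add: zint_def)
qed

text \<open>The Teichmueller representative of a primitive root \<open>g\<close> modulo \<open>p\<close>, given modulo \<open>p\<^sup>n\<close> by
  \<open>g\<close> to the power \<open>p\<^sup>n\<close>.\<close>

lemma teichmuller_nonsquare:
  assumes p: "odd p"
  obtains \<eta> where "\<eta> \<in> carrier K" "\<eta> [^]\<^bsub>K\<^esub> ((p - 1) div 2) = \<ominus>\<^bsub>K\<^esub> \<one>\<^bsub>K\<^esub>"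
    "\<And>r. r \<in> carrier K \<Longrightarrow> r \<otimes>\<^bsub>K\<^esub> r \<noteq> \<eta>"
proof -
  define l where "l = (p - 1) div 2"
  have pl: "p = Suc (2 * l)" using p p_gt(1) by (auto simp: l_def elim!: oddE)
  have l: "l > 0" using pl p_gt(1) by (cases l) auto
  obtain g0 where g0: "residue_primroot p g0" using prime_primitive_root_exists[OF p_gt(1) prime_p] by blast
  have cop: "coprime p g0" and ordg: "ord p g0 = 2 * l"
    using g0 totient_prime[OF prime_p] pl by (auto simp: residue_primroot_def)
  define g where "g = int g0"
  have copg: "coprime g (int p ^ n)" for n using cop by (simp add: g_def coprime_commute)
  have fermat: "[g ^ (2 * l) = 1] (mod int p)"
    using ord_works[of g0 p] ordg by (metis cong_int_iff g_def of_nat_1 of_nat_power)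
  have gl: "[g ^ l = - 1] (mod int p)"
  proof -
    have "\<not> [g0 ^ l = 1] (mod p)" using ordg l ord_divides[of g0 l p] by (auto dest: dvd_imp_le)
    then have n1: "\<not> int p dvd g ^ l - 1"
      by (metis cong_iff_dvd_diff cong_int_iff g_def of_nat_1 of_nat_power)
    have "int p dvd g ^ (2 * l) - 1" using fermat by (simp add: cong_iff_dvd_diff)
    also have "g ^ (2 * l) - 1 = (g ^ l - 1) * (g ^ l + 1)"
      by (simp add: power_mult power2_eq_square mult.commute[of 2 l] algebra_simps)
    finally have "int p dvd g ^ l + 1" using n1 prime_p by (simp add: prime_dvd_mult_iff)
    then show ?thesis by (simp add: cong_iff_dvd_diff)
  qed
  have pow_cong: "[x = y] (mod int p) \<Longrightarrow> [x ^ (p ^ n) = y ^ (p ^ n)] (mod int p ^ Suc n)" for x y :: int and n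
  proof (induction n)
    case (Suc n)
    have lift: "[u ^ p = w ^ p] (mod int p * m)" if "[u = w] (mod m)" "int p dvd m" for u w m :: int
    proof -
      have dm: "m dvd u - w" using that by (simp add: cong_iff_dvd_diff)
      have "[(\<Sum>i<p. w ^ (p - Suc i) * u ^ i) = (\<Sum>i<p. w ^ (p - Suc 0))] (mod int p)"
      proof (rule cong_sum)
        fix i assume i: "i \<in> {..<p}"
        have "[u = w] (mod int p)" using that by (rule cong_dvd_modulus)
        then have "[w ^ (p - Suc i) * u ^ i = w ^ (p - Suc i) * w ^ i] (mod int p)"
          by (intro cong_mult cong_pow cong_refl)
        also have "w ^ (p - Suc i) * w ^ i = w ^ (p - Suc 0)" using i by (simp add: power_add[symmetric])
        finally show "[w ^ (p - Suc i) * u ^ i = w ^ (p - Suc 0)] (mod int p)" .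
      qed
      note cong_dvd_iff[OF this]
      then have "int p dvd (\<Sum>i<p. w ^ (p - Suc i) * u ^ i)" by simp
      from mult_dvd_mono[OF dm this] have "m * int p dvd u ^ p - w ^ p"
        unfolding power_diff_sumr2[of u p w] .
      then show ?thesis by (simp add: cong_iff_dvd_diff mult.commute)
    qed
    show ?case using lift[OF Suc.IH[OF Suc.prems]] by (simp add: power_mult[symmetric] mult.commute)
  qed simp
  define Z where "Z = (\<lambda>n. g ^ (p ^ n) mod int p ^ n)"
  have Z: "Z \<in> carrier (Zp p)"
    unfolding Z_def
  proof (rule Zp_memI)
    fix n
    have "[g ^ p = g] (mod int p)" using cong_mult[OF fermat cong_refl[of g]] pl by (simp add: mult.commute)
    then have "[(g ^ p) ^ (p ^ n) = g ^ (p ^ n)] (mod int p ^ Suc n)" by (rule pow_cong)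
    then have "[(g ^ p) ^ (p ^ n) = g ^ (p ^ n)] (mod int p ^ n)"
      by (rule cong_dvd_modulus) (simp add: le_imp_power_dvd)
    then show "[g ^ (p ^ Suc n) = g ^ (p ^ n)] (mod int p ^ n)" by (simp add: power_mult)
  qed
  have "Z [^]\<^bsub>Zp p\<^esub> l = zint (- 1)"
  proof (rule Zp_eqI)
    fix n
    have "[(g ^ l) ^ (p ^ n) = (- 1) ^ (p ^ n)] (mod int p ^ Suc n)" by (rule pow_cong[OF gl])
    also have "(- 1 :: int) ^ (p ^ n) = - 1" using p by simp
    finally have "[(g ^ l) ^ (p ^ n) = - 1] (mod int p ^ n)"
      by (rule cong_dvd_modulus) (simp add: le_imp_power_dvd)
    then have "[(g ^ (p ^ n)) ^ l = - 1] (mod int p ^ n)" by (simp add: power_mult[symmetric] mult.commute)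
    then show "[(Z [^]\<^bsub>Zp p\<^esub> l) n = zint (- 1) n] (mod int p ^ n)"
      using Z by (simp add: Zp_pow) (simp add: Z_def zint_def cong_def mod_simps)
  qed (use Z in simp_all)
  then have "emb (Z [^]\<^bsub>Zp p\<^esub> l) = emb (\<ominus>\<^bsub>Zp p\<^esub> \<one>\<^bsub>Zp p\<^esub>)" by (simp add: zint_minus zint_1)
  then have \<eta>l: "emb Z [^]\<^bsub>K\<^esub> l = \<ominus>\<^bsub>K\<^esub> \<one>\<^bsub>K\<^esub>" using Z by (simp add: Q.to_fraction.hom_nat_pow)
  have "r \<otimes>\<^bsub>K\<^esub> r \<noteq> emb Z" if r: "r \<in> carrier K" for r
  proof
    assume eq: "r \<otimes>\<^bsub>K\<^esub> r = emb Z"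
    have "r [^]\<^bsub>K\<^esub> (2 * l) = (r [^]\<^bsub>K\<^esub> (2::nat)) [^]\<^bsub>K\<^esub> l" using r by (simp add: Q.K.nat_pow_pow)
    also have "r [^]\<^bsub>K\<^esub> (2::nat) = emb Z" using r eq by (simp add: numeral_2_eq_2)
    finally have r2l: "r [^]\<^bsub>K\<^esub> (2 * l) = \<ominus>\<^bsub>K\<^esub> \<one>\<^bsub>K\<^esub>" by (simp add: \<eta>l)
    then have rO: "r \<in> \<O>" using root_of_unity_O[OF r, of "2 * l"] l O_closed(4,6) by simp
    have "r [^]\<^bsub>K\<^esub> p = r [^]\<^bsub>K\<^esub> (2 * l) \<otimes>\<^bsub>K\<^esub> r" using pl Q.K.nat_pow_Suc[of r "2 * l"] by metis
    then have rp: "r [^]\<^bsub>K\<^esub> p = \<ominus>\<^bsub>K\<^esub> r" unfolding r2l using r by (simp add: Q.K.l_minus)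
    obtain y where y: "y \<in> \<O>" "r [^]\<^bsub>K\<^esub> p = r \<oplus>\<^bsub>K\<^esub> \<pi> \<otimes>\<^bsub>K\<^esub> y" using rO by (rule fermat_O)
    have "(\<one>\<^bsub>K\<^esub> \<oplus>\<^bsub>K\<^esub> \<one>\<^bsub>K\<^esub>) \<otimes>\<^bsub>K\<^esub> r = \<ominus>\<^bsub>K\<^esub> (\<pi> \<otimes>\<^bsub>K\<^esub> y)"
    proof -
      have yK: "\<pi> \<otimes>\<^bsub>K\<^esub> y \<in> carrier K" using O_closed(1)[OF y(1)] by simp
      have "(\<one>\<^bsub>K\<^esub> \<oplus>\<^bsub>K\<^esub> \<one>\<^bsub>K\<^esub>) \<otimes>\<^bsub>K\<^esub> r = r \<oplus>\<^bsub>K\<^esub> \<ominus>\<^bsub>K\<^esub> (\<ominus>\<^bsub>K\<^esub> r)" using r by (simp add: Q.K.l_distr)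
      also have "\<dots> = \<ominus>\<^bsub>K\<^esub> (\<pi> \<otimes>\<^bsub>K\<^esub> y)"
        unfolding rp[symmetric] y(2) using r yK by (simp add: Q.K.minus_add Q.K.a_assoc[symmetric] Q.K.r_neg)
      finally show ?thesis .
    qed
    moreover have "\<pi> \<otimes>\<^bsub>K\<^esub> y \<in> \<MM>" using y(1) by (auto simp: \<MM>_def)
    ultimately have "(\<one>\<^bsub>K\<^esub> \<oplus>\<^bsub>K\<^esub> \<one>\<^bsub>K\<^esub>) \<otimes>\<^bsub>K\<^esub> r \<in> \<MM>" using M_closed(4) by simp
    note M = M_closed(3)[OF this]
    have t: "\<one>\<^bsub>K\<^esub> \<oplus>\<^bsub>K\<^esub> \<one>\<^bsub>K\<^esub> \<in> \<O>" by (intro O_closed)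
    note ti = O_unit_inv[OF t O_not_M_two[OF p]]
    have tK: "\<one>\<^bsub>K\<^esub> \<oplus>\<^bsub>K\<^esub> \<one>\<^bsub>K\<^esub> \<in> carrier K" by simp
    note tj = Q.K.inv_closed_nonzero[OF tK ti(1)]
    let ?t = "\<one>\<^bsub>K\<^esub> \<oplus>\<^bsub>K\<^esub> \<one>\<^bsub>K\<^esub>"
    have "?t \<otimes>\<^bsub>K\<^esub> r \<otimes>\<^bsub>K\<^esub> inv\<^bsub>K\<^esub> ?t = (?t \<otimes>\<^bsub>K\<^esub> inv\<^bsub>K\<^esub> ?t) \<otimes>\<^bsub>K\<^esub> r"
      using tK tj(1) r by (metis Q.K.m_assoc Q.K.m_comm)
    then have rM: "r \<in> \<MM>" using M[OF ti(2)] tj(3) r by simp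
    obtain n where n: "2 * l = Suc n" using l by (cases "2 * l") auto
    have "r [^]\<^bsub>K\<^esub> (2 * l) = r \<otimes>\<^bsub>K\<^esub> r [^]\<^bsub>K\<^esub> n" unfolding n using r by (simp add: Q.K.m_comm)
    then have "\<ominus>\<^bsub>K\<^esub> \<one>\<^bsub>K\<^esub> \<in> \<MM>" unfolding r2l using M_closed(3)[OF rM O_pow[OF rO]] by simp
    then show False using M_closed(4)[of "\<ominus>\<^bsub>K\<^esub> \<one>\<^bsub>K\<^esub>"] M_closed(5) by simp
  qed
  then show ?thesis using that[of "emb Z"] Z \<eta>l unfolding l_def by blast
qed

text \<open>The values of \<open>a x\<^sup>2\<close> and of \<open>1 - d y\<^sup>2\<close> modulo \<open>p\<close> form two sets of \<open>(p + 1)/2\<close> residues each,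
  so they meet; the solution is lifted by rescaling with a square root of a number congruent to 1.\<close>

lemma conic_point:
  assumes p: "odd p" and a: "\<not> int p dvd a" and d: "\<not> int p dvd d"
  obtains x y where "x \<in> carrier K" "y \<in> carrier K"
    "emb (zint a) \<otimes>\<^bsub>K\<^esub> (x \<otimes>\<^bsub>K\<^esub> x) \<oplus>\<^bsub>K\<^esub> emb (zint d) \<otimes>\<^bsub>K\<^esub> (y \<otimes>\<^bsub>K\<^esub> y) = \<one>\<^bsub>K\<^esub>"
proof -
  define l where "l = int ((p - 1) div 2)"
  have pl: "int p = 2 * l + 1" using p p_gt(1) by (auto simp: l_def elim!: oddE)
  have l: "l \<ge> 0" by (simp add: l_def)
  have sq: "x = y" if x: "x \<in> {0..l}" and y: "y \<in> {0..l}" and dv: "int p dvd b * (x * x) - b * (y * y)" and b: "\<not> int p dvd b" for b x y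
  proof -
    have "b * (x * x) - b * (y * y) = b * ((x - y) * (x + y))" by (simp add: algebra_simps)
    then have "int p dvd x - y \<or> int p dvd x + y" using dv b prime_p by (simp add: prime_dvd_mult_iff)
    moreover have "\<bar>x - y\<bar> < int p" "\<bar>x + y\<bar> < int p" using x y pl by auto
    ultimately have "x - y = 0 \<or> x + y = 0" using dvd_imp_le_int[of "x - y" "int p"] dvd_imp_le_int[of "x + y" "int p"] by fastforce
    then show ?thesis using x y by auto
  qed
  let ?f = "\<lambda>x. a * (x * x) mod int p" and ?h = "\<lambda>y. (1 - d * (y * y)) mod int p"
  have f: "inj_on ?f {0..l}"
    using sq[OF _ _ _ a] by (auto simp: inj_on_def mod_eq_dvd_iff)
  have h: "inj_on ?h {0..l}"
  proof (rule inj_onI)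
    fix x y assume xy: "x \<in> {0..l}" "y \<in> {0..l}" "?h x = ?h y"
    then have "int p dvd d * (y * y) - d * (x * x)" by (simp add: mod_eq_dvd_iff)
    then show "x = y" using sq[OF xy(2,1) _ d] by blast
  qed
  have "?f ` {0..l} \<inter> ?h ` {0..l} \<noteq> {}"
  proof
    assume "?f ` {0..l} \<inter> ?h ` {0..l} = {}"
    then have "card (?f ` {0..l} \<union> ?h ` {0..l}) = card (?f ` {0..l}) + card (?h ` {0..l})"
      by (intro card_Un_disjoint) auto
    also have "\<dots> = nat (2 * l + 2)" using card_image[OF f] card_image[OF h] l by (simp add: nat_add_distrib)
    finally have "card (?f ` {0..l} \<union> ?h ` {0..l}) = nat (2 * l + 2)" .
    moreover have "?f ` {0..l} \<union> ?h ` {0..l} \<subseteq> {0..<int p}" using p_gt by auto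
    then have "card (?f ` {0..l} \<union> ?h ` {0..l}) \<le> card {0..<int p}" by (intro card_mono) auto
    ultimately show False using pl l by simp
  qed
  then obtain i j where ij: "?f i = ?h j" by blast
  define w where "w = a * (i * i) + d * (j * j)"
  have "int p dvd a * (i * i) - (1 - d * (j * j))" using ij by (simp add: mod_eq_dvd_iff)
  then have w1: "[w = 1] (mod int p)" by (simp add: cong_iff_dvd_diff w_def algebra_simps)
  then obtain r where r: "r \<in> carrier (Zp p)" "r \<otimes>\<^bsub>Zp p\<^esub> r = zint w" using square_root_odd[OF p] by blast
  let ?r = "emb r"
  have "w \<noteq> 0" using w1 p_gt by (auto simp: cong_iff_dvd_diff)
  then have "emb (zint w) \<noteq> \<zero>\<^bsub>K\<^esub>" using zint_nonzero emb_eq_0 by blast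
  then have "?r \<otimes>\<^bsub>K\<^esub> ?r \<noteq> \<zero>\<^bsub>K\<^esub>" using r Q.to_fraction.hom_mult[OF r(1) r(1)] by simp
  then have rn: "?r \<noteq> \<zero>\<^bsub>K\<^esub>"
  proof (rule contrapos_nn)
    assume "?r = \<zero>\<^bsub>K\<^esub>"
    then show "?r \<otimes>\<^bsub>K\<^esub> ?r = \<zero>\<^bsub>K\<^esub>" by (simp only: Q.K.l_null Q.K.zero_closed)
  qed
  note s = Q.K.inv_closed_nonzero[OF emb_closed[OF r(1)] rn]
  define s where "s = inv\<^bsub>K\<^esub> ?r"
  have sK: "s \<in> carrier K" "s \<otimes>\<^bsub>K\<^esub> ?r = \<one>\<^bsub>K\<^esub>" using s by (simp_all add: s_def)
  let ?i = "emb (zint i)" and ?j = "emb (zint j)" and ?a = "emb (zint a)" and ?d = "emb (zint d)"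
  have w: "?a \<otimes>\<^bsub>K\<^esub> (?i \<otimes>\<^bsub>K\<^esub> ?i) \<oplus>\<^bsub>K\<^esub> ?d \<otimes>\<^bsub>K\<^esub> (?j \<otimes>\<^bsub>K\<^esub> ?j) = ?r \<otimes>\<^bsub>K\<^esub> ?r"
    using r Q.to_fraction.hom_mult[OF r(1) r(1)] by (simp add: w_def zint_add zint_mult)
  have cl: "?i \<in> carrier K" "?j \<in> carrier K" "?a \<in> carrier K" "?d \<in> carrier K" "s \<in> carrier K" "?r \<in> carrier K"
    using sK r by simp_all
  have "?a \<otimes>\<^bsub>K\<^esub> ((?i \<otimes>\<^bsub>K\<^esub> s) \<otimes>\<^bsub>K\<^esub> (?i \<otimes>\<^bsub>K\<^esub> s)) \<oplus>\<^bsub>K\<^esub> ?d \<otimes>\<^bsub>K\<^esub> ((?j \<otimes>\<^bsub>K\<^esub> s) \<otimes>\<^bsub>K\<^esub> (?j \<otimes>\<^bsub>K\<^esub> s))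
    = (s \<otimes>\<^bsub>K\<^esub> s) \<otimes>\<^bsub>K\<^esub> (?a \<otimes>\<^bsub>K\<^esub> (?i \<otimes>\<^bsub>K\<^esub> ?i) \<oplus>\<^bsub>K\<^esub> ?d \<otimes>\<^bsub>K\<^esub> (?j \<otimes>\<^bsub>K\<^esub> ?j))"
    using cl[THEN component_ex[OF Q.K.is_cring]]
    by (elim exE, simp only: component_homs[OF Q.K.is_cring], simp add: algebra_simps)
  also have "\<dots> = (s \<otimes>\<^bsub>K\<^esub> ?r) \<otimes>\<^bsub>K\<^esub> (s \<otimes>\<^bsub>K\<^esub> ?r)"
    unfolding w using cl[THEN component_ex[OF Q.K.is_cring]]
    by (elim exE, simp only: component_homs[OF Q.K.is_cring], simp add: algebra_simps)
  finally show ?thesis using that[of "?i \<otimes>\<^bsub>K\<^esub> s" "?j \<otimes>\<^bsub>K\<^esub> s"] sK by simp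
qed

text \<open>For \<open>a\<close> congruent to 5 modulo 8 the form is the norm form of the unramified quadratic extension. For coprime
  integral arguments its value modulo 8 is odd or 4.\<close>

lemma norm_valuation_even:
  assumes p: "p = 2" and a: "a mod 8 = 5" and c: "\<beta> \<in> carrier K" "\<gamma> \<in> carrier K" "\<beta> \<noteq> \<zero>\<^bsub>K\<^esub> \<or> \<gamma> \<noteq> \<zero>\<^bsub>K\<^esub>"
  defines "N \<equiv> \<beta> \<otimes>\<^bsub>K\<^esub> \<beta> \<ominus>\<^bsub>K\<^esub> emb (zint a) \<otimes>\<^bsub>K\<^esub> (\<gamma> \<otimes>\<^bsub>K\<^esub> \<gamma>)"
  shows "N \<noteq> \<zero>\<^bsub>K\<^esub>" "even (v N)"
proof -
  obtain j \<beta>' \<gamma>' where s: "\<beta>' \<in> \<O>" "\<gamma>' \<in> \<O>" "\<beta> = P j \<otimes>\<^bsub>K\<^esub> \<beta>'" "\<gamma> = P j \<otimes>\<^bsub>K\<^esub> \<gamma>'" "\<beta>' \<notin> \<MM> \<or> \<gamma>' \<notin> \<MM>"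
    using c by (rule scale_pair)
  obtain b where b: "b \<in> carrier (Zp p)" "\<beta>' = emb b" using s(1) by (rule O_cases)
  obtain c where c: "c \<in> carrier (Zp p)" "\<gamma>' = emb c" using s(2) by (rule O_cases)
  define n where "n = b \<otimes>\<^bsub>Zp p\<^esub> b \<ominus>\<^bsub>Zp p\<^esub> zint a \<otimes>\<^bsub>Zp p\<^esub> (c \<otimes>\<^bsub>Zp p\<^esub> c)"
  have n: "n \<in> carrier (Zp p)" using b c by (simp add: n_def)
  have "n \<oplus>\<^bsub>Zp p\<^esub> zint a \<otimes>\<^bsub>Zp p\<^esub> (c \<otimes>\<^bsub>Zp p\<^esub> c) = b \<otimes>\<^bsub>Zp p\<^esub> b"
    using b c by (simp add: n_def a_minus_def Zp.a_assoc Zp.l_neg)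
  then have "(n \<oplus>\<^bsub>Zp p\<^esub> zint a \<otimes>\<^bsub>Zp p\<^esub> (c \<otimes>\<^bsub>Zp p\<^esub> c)) 3 = (b \<otimes>\<^bsub>Zp p\<^esub> b) 3" by simp
  then have "[n 3 + a * (c 3 * c 3) = b 3 * b 3] (mod int p ^ 3)" by (simp add: Zp_simps zint_def cong_def mod_simps)
  then have "[n 3 + a * (c 3 * c 3) = b 3 * b 3] (mod 8)" by (simp add: p)
  then have "(n 3 + a * (c 3 * c 3) - b 3 * b 3) mod 8 = 0" by (simp add: cong_iff_dvd_diff dvd_eq_mod_eq_0)
  then have e: "(n 3 + 5 * (c 3 * c 3) - b 3 * b 3) mod 8 = 0" using a by (metis mod_diff_left_eq mod_add_right_eq mod_mult_left_eq mod_mult_right_eq mod_mult_eq)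
  have lev: "x i = x 3 mod int p ^ i" if "x \<in> carrier (Zp p)" "i \<le> 3" for x i using Zp_coherent[OF that] by simp
  have "b 1 = b 3 mod 2" "c 1 = c 3 mod 2" using lev[OF b(1), of 1] lev[OF c(1), of 1] by (simp_all add: p)
  moreover have "b 1 \<noteq> 0 \<or> c 1 \<noteq> 0" using s(5) unfolding b(2) c(2) M_iff[OF b(1)] M_iff[OF c(1)] .
  ultimately have odd: "odd (b 3) \<or> odd (c 3)" by presburger
  have "n 3 mod 2 = 1 \<or> n 3 mod 8 = 4"
    using square_mod_8[of "b 3"] square_mod_8[of "c 3"] odd e by (simp add: odd_iff_mod_2_eq_one) presburger
  moreover have "0 \<le> n 3" "n 3 < 8" using Zp_range[OF n, of 3] by (simp_all add: p)
  ultimately have "n 1 \<noteq> 0 \<or> n 2 = 0 \<and> n 3 \<noteq> 0"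
    using lev[OF n, of 1] lev[OF n, of 2] by (auto simp: p)
  then have vn: "emb n \<noteq> \<zero>\<^bsub>K\<^esub> \<and> even (v (emb n))"
  proof
    assume 1: "n 1 \<noteq> 0"
    have "n 0 = 0" using Zp_range[OF n, of 0] by simp
    then show ?thesis using v_emb_eq[OF n, of 0] 1 by simp
  next
    assume "n 2 = 0 \<and> n 3 \<noteq> 0"
    then show ?thesis using v_emb_eq[OF n, of 2] by (simp add: numeral_3_eq_3 numeral_2_eq_2)
  qed
  have eb: "emb n = \<beta>' \<otimes>\<^bsub>K\<^esub> \<beta>' \<ominus>\<^bsub>K\<^esub> emb (zint a) \<otimes>\<^bsub>K\<^esub> (\<gamma>' \<otimes>\<^bsub>K\<^esub> \<gamma>')"
    unfolding n_def b(2) c(2) a_minus_def using b c by simp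
  have cl: "\<beta>' \<in> carrier K" "\<gamma>' \<in> carrier K" "P j \<in> carrier K" "emb (zint a) \<in> carrier K"
    using s(1,2) O_closed(1) by auto
  have "N = P j \<otimes>\<^bsub>K\<^esub> P j \<otimes>\<^bsub>K\<^esub> emb n"
    unfolding N_def s(3,4) eb using cl[THEN component_ex[OF Q.K.is_cring]]
    by (elim exE, simp only: component_homs[OF Q.K.is_cring], simp add: algebra_simps)
  then have N: "N = P (2 * j) \<otimes>\<^bsub>K\<^esub> emb n" by (simp add: P_add[symmetric])
  obtain u where u: "u \<in> Units (Zp p)" "emb n = P (v (emb n)) \<otimes>\<^bsub>K\<^esub> emb u"
    using K_decompose[OF emb_closed[OF n]] vn padic_val_eq by metis
  have uK: "emb u \<in> carrier K" "emb u \<noteq> \<zero>\<^bsub>K\<^esub>" using emb_Unit[OF u(1)] by auto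
  have "N = P (2 * j + v (emb n)) \<otimes>\<^bsub>K\<^esub> emb u"
    unfolding N P_add using uK by (subst u(2)) (simp add: Q.K.m_assoc)
  then show "N \<noteq> \<zero>\<^bsub>K\<^esub>" "even (v N)" using padic_val_eq[OF u(1)] vn uK P_nz by (simp_all add: Q.K.integral_iff)
qed

end

section \<open>The two local algebras\<close>

lemma frac_half_odd: "odd n \<Longrightarrow> frac (rat_of_int n / 2) = 1 / 2"
  by (elim oddE) (simp add: frac_unique_iff add_divide_distrib)

context padic_clifford begin

lemma two_nonzero: "\<one>\<^bsub>K\<^esub> \<oplus>\<^bsub>K\<^esub> \<one>\<^bsub>K\<^esub> \<noteq> \<zero>\<^bsub>K\<^esub>"
proof -
  have "\<one>\<^bsub>K\<^esub> \<oplus>\<^bsub>K\<^esub> \<one>\<^bsub>K\<^esub> = emb (zint 2)" using zint_add[of 1 1] by (simp add: zint_1)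
  then show ?thesis using zint_nonzero[of 2] emb_eq_0[of "zint 2"] by simp
qed

lemma half:
  obtains h where "h \<in> carrier K" "h \<oplus>\<^bsub>K\<^esub> h = \<one>\<^bsub>K\<^esub>"
proof -
  let ?t = "\<one>\<^bsub>K\<^esub> \<oplus>\<^bsub>K\<^esub> \<one>\<^bsub>K\<^esub>"
  have "inv\<^bsub>K\<^esub> ?t \<in> carrier K" "?t \<otimes>\<^bsub>K\<^esub> inv\<^bsub>K\<^esub> ?t = \<one>\<^bsub>K\<^esub>" using inv_closed_nonzero[OF _ two_nonzero] by auto
  then show ?thesis using that[of "inv\<^bsub>K\<^esub> ?t"] by (simp add: l_distr)
qed

lemma v_one: "v \<one>\<^bsub>K\<^esub> = 0"
  using v_P_unit[of "\<one>\<^bsub>K\<^esub>" 0] O_closed(6) M_closed(5) by (simp add: P_0)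

text \<open>The algebra \<open>(1, b)\<close> is a matrix algebra. Existence: the pure quaternions \<open>\<alpha>v + \<beta>j\<close> anticommute with
  \<open>u\<close> and have square \<open>b(\<alpha>\<^sup>2 - \<beta>\<^sup>2)\<close>, which takes every value; and \<open>u\<^sup>2 = 1\<close> is a unit. Uniqueness:
  the left ideal generated by the zero divisor \<open>1 + u\<close> has dimension 2.\<close>

lemma local_inv_split:
  assumes a1: "a = \<one>\<^bsub>K\<^esub>" and t0: "t = \<zero>\<^bsub>K\<^esub>" and e0: "e \<noteq> \<zero>\<^bsub>K\<^esub>"
  shows "has_local_inv p A 0" "has_local_inv p A q \<Longrightarrow> q = 0"
proof -
  have eK: "e \<in> carrier K" by simp
  obtain \<eta> where \<eta>: "\<eta> \<in> carrier K" "\<And>r. r \<in> carrier K \<Longrightarrow> r \<otimes>\<^bsub>K\<^esub> r \<noteq> \<eta>"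
    "odd p \<and> \<eta> [^]\<^bsub>K\<^esub> ((p - 1) div 2) = \<ominus>\<^bsub>K\<^esub> \<one>\<^bsub>K\<^esub> \<or>
        p = 2 \<and> \<eta> = \<ominus>\<^bsub>K\<^esub> (\<one>\<^bsub>K\<^esub> \<oplus>\<^bsub>K\<^esub> \<one>\<^bsub>K\<^esub> \<oplus>\<^bsub>K\<^esub> \<one>\<^bsub>K\<^esub>)"
  proof (cases "odd p")
    case True
    then show ?thesis using teichmuller_nonsquare[OF True] that by metis
  next
    case False
    then have p2: "p = 2" using prime_p by (metis prime_prime_factor_sqrt primes_dvd_imp_eq two_is_prime_nat)
    show ?thesis
      by (rule that[of "\<ominus>\<^bsub>K\<^esub> (\<one>\<^bsub>K\<^esub> \<oplus>\<^bsub>K\<^esub> \<one>\<^bsub>K\<^esub> \<oplus>\<^bsub>K\<^esub> \<one>\<^bsub>K\<^esub>)"])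
        (simp, rule minus_three_nonsquare[OF p2], assumption, rule disjI2, rule conjI[OF p2 refl])
  qed
  obtain h where h: "h \<in> carrier K" "h \<oplus>\<^bsub>K\<^esub> h = \<one>\<^bsub>K\<^esub>" by (rule half)
  note i = inv_closed_nonzero[OF eK e0]
  define j where "j = \<eta> \<otimes>\<^bsub>K\<^esub> inv\<^bsub>K\<^esub> e"
  have jK: "j \<in> carrier K" using \<eta> i by (simp add: j_def)
  have ej: "e \<otimes>\<^bsub>K\<^esub> j = \<eta>" unfolding j_def using \<eta>(1) i eK by (metis m_lcomm r_one)
  \<comment> \<open>Chosen so that \<open>e (\<alpha>\<^sup>2 - \<beta>\<^sup>2) = \<eta>\<close>: the factors \<open>\<alpha> + \<beta>\<close> and \<open>\<alpha> - \<beta>\<close> are 1 and \<open>\<eta>/e\<close>.\<close>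
  define \<alpha> \<beta> where "\<alpha> = h \<otimes>\<^bsub>K\<^esub> (\<one>\<^bsub>K\<^esub> \<oplus>\<^bsub>K\<^esub> j)" and "\<beta> = h \<otimes>\<^bsub>K\<^esub> (\<one>\<^bsub>K\<^esub> \<ominus>\<^bsub>K\<^esub> j)"
  have ab: "\<alpha> \<in> carrier K" "\<beta> \<in> carrier K" using h jK by (simp_all add: \<alpha>_def \<beta>_def)
  have eab: "e \<otimes>\<^bsub>K\<^esub> (\<alpha> \<otimes>\<^bsub>K\<^esub> \<alpha>) \<ominus>\<^bsub>K\<^esub> e \<otimes>\<^bsub>K\<^esub> (\<beta> \<otimes>\<^bsub>K\<^esub> \<beta>) = \<eta>"
  proof -
    have "e \<otimes>\<^bsub>K\<^esub> (\<alpha> \<otimes>\<^bsub>K\<^esub> \<alpha>) \<ominus>\<^bsub>K\<^esub> e \<otimes>\<^bsub>K\<^esub> (\<beta> \<otimes>\<^bsub>K\<^esub> \<beta>) = (e \<otimes>\<^bsub>K\<^esub> j) \<otimes>\<^bsub>K\<^esub> ((h \<oplus>\<^bsub>K\<^esub> h) \<otimes>\<^bsub>K\<^esub> (h \<oplus>\<^bsub>K\<^esub> h))"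
      unfolding \<alpha>_def \<beta>_def using h(1)[THEN tr_ex] jK[THEN tr_ex] eK[THEN tr_ex]
      by (elim exE, simp only: tr_hom, simp add: algebra_simps)
    then show ?thesis using \<eta>(1) by (simp only: ej h(2) r_one one_closed)
  qed
  have jj: "t \<otimes>\<^bsub>K\<^esub> t \<ominus>\<^bsub>K\<^esub> a \<otimes>\<^bsub>K\<^esub> e = \<ominus>\<^bsub>K\<^esub> e" using eK by (simp add: a1 t0 a_minus_def)
  let ?s = "quad \<zero>\<^bsub>K\<^esub> \<zero>\<^bsub>K\<^esub> \<alpha> \<beta>" and ?u = "quad \<zero>\<^bsub>K\<^esub> \<one>\<^bsub>K\<^esub> \<zero>\<^bsub>K\<^esub> \<zero>\<^bsub>K\<^esub>"
  have "has_local_inv p A (frac (rat_of_int (v \<one>\<^bsub>K\<^esub>) / 2))"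
  proof (rule has_local_inv_exists[where s = ?s and g = ?u and \<eta> = \<eta>])
    show "trd ?s = \<zero>\<^bsub>K\<^esub>" by (simp add: trd_def)
    have "nrd ?s = \<ominus>\<^bsub>K\<^esub> (e \<otimes>\<^bsub>K\<^esub> (\<alpha> \<otimes>\<^bsub>K\<^esub> \<alpha>) \<ominus>\<^bsub>K\<^esub> e \<otimes>\<^bsub>K\<^esub> (\<beta> \<otimes>\<^bsub>K\<^esub> \<beta>))"
      unfolding nrd_def jj using ab eK a1 t0 by (simp add: a_minus_def minus_add l_minus)
    then show "nrd ?s = \<ominus>\<^bsub>K\<^esub> \<eta>" by (simp only: eab)
    show "?u \<otimes>\<^bsub>B\<^esub> ?s = \<ominus>\<^bsub>B\<^esub> (?s \<otimes>\<^bsub>B\<^esub> ?u)"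
      using ab eK by (simp add: mult_B mul_simps jj neg_B) (simp add: a1 t0 a_minus_def minus_add l_minus)
    show "?u \<otimes>\<^bsub>B\<^esub> ?u = \<iota> \<one>\<^bsub>K\<^esub>"
      by (simp add: mult_B mul_simps jj \<iota>_def) (simp add: a1 t0 a_minus_def)
  qed (use \<eta> ab two_nonzero in \<open>simp_all only: quad_closed zero_closed one_closed simp_thms zero_not_one one_not_zero not_False_eq_True\<close>)
  then show "has_local_inv p A 0" by (simp only: v_one) simp
  let ?\<epsilon> = "quad \<one>\<^bsub>K\<^esub> \<one>\<^bsub>K\<^esub> \<zero>\<^bsub>K\<^esub> \<zero>\<^bsub>K\<^esub>" and ?\<kappa> = "quad \<zero>\<^bsub>K\<^esub> \<zero>\<^bsub>K\<^esub> \<one>\<^bsub>K\<^esub> (\<ominus>\<^bsub>K\<^esub> \<one>\<^bsub>K\<^esub>)"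
  show "q = 0" if "has_local_inv p A q"
  proof (rule split_local_inv[OF that, where \<epsilon> = ?\<epsilon> and \<kappa> = ?\<kappa>])
    fix x assume "x \<in> carrier B"
    then obtain x0 x1 x2 x3 where x: "x = quad x0 x1 x2 x3"
      and c: "x0 \<in> carrier K" "x1 \<in> carrier K" "x2 \<in> carrier K" "x3 \<in> carrier K"
      by (rule B_cases)
    have "x \<otimes>\<^bsub>B\<^esub> ?\<epsilon> = \<iota> (x0 \<oplus>\<^bsub>K\<^esub> x1) \<otimes>\<^bsub>B\<^esub> ?\<epsilon> \<oplus>\<^bsub>B\<^esub> \<iota> (x2 \<ominus>\<^bsub>K\<^esub> x3) \<otimes>\<^bsub>B\<^esub> ?\<kappa>"
      using c eK by (simp add: x \<iota>_mult smult_B mult_B mul_simps jj add_B del: \<iota>.hom_add)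
        (simp add: a1 t0 a_minus_def minus_add r_minus a_comm)
    then show "\<exists>\<alpha>\<in>carrier K. \<exists>\<beta>\<in>carrier K. x \<otimes>\<^bsub>B\<^esub> ?\<epsilon> = \<iota> \<alpha> \<otimes>\<^bsub>B\<^esub> ?\<epsilon> \<oplus>\<^bsub>B\<^esub> \<iota> \<beta> \<otimes>\<^bsub>B\<^esub> ?\<kappa>"
      using c by (intro bexI[of _ "x0 \<oplus>\<^bsub>K\<^esub> x1"] bexI[of _ "x2 \<ominus>\<^bsub>K\<^esub> x3"]) simp_all
  qed (simp_all add: zero_B)
qed

text \<open>The norm form is \<open>N(x\<^sub>0, x\<^sub>1) - e N(x\<^sub>2, x\<^sub>3)\<close>, where the two terms have valuations of different
  parity.\<close>

lemma anisotropic: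
  assumes t0: "t = \<zero>\<^bsub>K\<^esub>" and e0: "e \<noteq> \<zero>\<^bsub>K\<^esub>" and oe: "odd (v e)"
    and N: "\<And>\<beta> \<gamma>. \<beta> \<in> carrier K \<Longrightarrow> \<gamma> \<in> carrier K \<Longrightarrow> \<beta> \<noteq> \<zero>\<^bsub>K\<^esub> \<or> \<gamma> \<noteq> \<zero>\<^bsub>K\<^esub> \<Longrightarrow>
      \<beta> \<otimes>\<^bsub>K\<^esub> \<beta> \<ominus>\<^bsub>K\<^esub> a \<otimes>\<^bsub>K\<^esub> (\<gamma> \<otimes>\<^bsub>K\<^esub> \<gamma>) \<noteq> \<zero>\<^bsub>K\<^esub> \<and> even (v (\<beta> \<otimes>\<^bsub>K\<^esub> \<beta> \<ominus>\<^bsub>K\<^esub> a \<otimes>\<^bsub>K\<^esub> (\<gamma> \<otimes>\<^bsub>K\<^esub> \<gamma>)))"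
    and x: "x \<in> carrier B" "nrd x = \<zero>\<^bsub>K\<^esub>"
  shows "x = \<zero>\<^bsub>B\<^esub>"
proof -
  have eK: "e \<in> carrier K" and aK: "a \<in> carrier K" by simp_all
  obtain x0 x1 x2 x3 where xq: "x = quad x0 x1 x2 x3"
    and c: "x0 \<in> carrier K" "x1 \<in> carrier K" "x2 \<in> carrier K" "x3 \<in> carrier K"
    using x(1) by (rule B_cases)
  let ?N = "\<lambda>b g. b \<otimes>\<^bsub>K\<^esub> b \<ominus>\<^bsub>K\<^esub> a \<otimes>\<^bsub>K\<^esub> (g \<otimes>\<^bsub>K\<^esub> g)"
  have NK: "?N x0 x1 \<in> carrier K" "?N x2 x3 \<in> carrier K" using c aK by simp_all
  have "nrd x = ?N x0 x1 \<ominus>\<^bsub>K\<^esub> e \<otimes>\<^bsub>K\<^esub> ?N x2 x3"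
    unfolding xq nrd_def One_nat_def quad_nth unfolding t0 using c[THEN tr_ex] eK[THEN tr_ex] aK[THEN tr_ex]
    by (elim exE, simp only: tr_hom, simp add: algebra_simps)
  then have eq: "?N x0 x1 = e \<otimes>\<^bsub>K\<^esub> ?N x2 x3" using x(2) NK eK r_right_minus_eq[of "?N x0 x1" "e \<otimes>\<^bsub>K\<^esub> ?N x2 x3"] by simp
  have z: "?N \<zero>\<^bsub>K\<^esub> \<zero>\<^bsub>K\<^esub> = \<zero>\<^bsub>K\<^esub>" using aK by (simp add: a_minus_def)
  have 23: "x2 = \<zero>\<^bsub>K\<^esub> \<and> x3 = \<zero>\<^bsub>K\<^esub>"
  proof (rule ccontr)
    assume "\<not> ?thesis"
    then have "x2 \<noteq> \<zero>\<^bsub>K\<^esub> \<or> x3 \<noteq> \<zero>\<^bsub>K\<^esub>" by blast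
    note n2 = N[OF c(3,4) this]
    have nz: "?N x0 x1 \<noteq> \<zero>\<^bsub>K\<^esub>" unfolding eq using n2 e0 eK NK integral by blast
    have "x0 \<noteq> \<zero>\<^bsub>K\<^esub> \<or> x1 \<noteq> \<zero>\<^bsub>K\<^esub>"
    proof (rule ccontr)
      assume "\<not> ?thesis"
      then have "x0 = \<zero>\<^bsub>K\<^esub>" "x1 = \<zero>\<^bsub>K\<^esub>" by blast+
      then show False using nz z by (simp only:)
    qed
    note n1 = N[OF c(1,2) this]
    have "v (?N x0 x1) = v e + v (?N x2 x3)" unfolding eq using v_mult[OF eK e0 NK(2)] n2 by blast
    then show False using n1 n2 oe by simp
  qed
  then have x23: "x2 = \<zero>\<^bsub>K\<^esub>" "x3 = \<zero>\<^bsub>K\<^esub>" by blast+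
  have "?N x0 x1 = \<zero>\<^bsub>K\<^esub>" unfolding eq x23 z using eK by simp
  then have "x0 = \<zero>\<^bsub>K\<^esub> \<and> x1 = \<zero>\<^bsub>K\<^esub>" using N[OF c(1,2)] by blast
  then show ?thesis by (simp add: xq x23 zero_B)
qed

text \<open>For \<open>p = 2\<close> the Frobenius squares \<open>z\<close> and has order 2, so \<open>z\<^sup>4 = z\<close>.\<close>

lemma cube_root_of_unity:
  assumes p2: "p = 2" and w: "has_inv_witness z g m c q"
  shows "z \<otimes>\<^bsub>B\<^esub> z \<oplus>\<^bsub>B\<^esub> z \<oplus>\<^bsub>B\<^esub> \<one>\<^bsub>B\<^esub> = \<zero>\<^bsub>B\<^esub>"
proof -
  have z: "z \<in> carrier B" and nr: "noroot z" using w by blast+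
  have "z [^]\<^bsub>B\<^esub> (4::nat) = z" using witness_frobenius_order[OF w] arg_cong[OF p2, of "\<lambda>n. z [^]\<^bsub>B\<^esub> (n * n)"] by simp
  then have z4: "z \<otimes>\<^bsub>B\<^esub> (z \<otimes>\<^bsub>B\<^esub> (z \<otimes>\<^bsub>B\<^esub> z)) = z" using z by (simp add: eval_nat_numeral B.m_assoc)
  let ?k = "z \<otimes>\<^bsub>B\<^esub> (z \<otimes>\<^bsub>B\<^esub> z) \<oplus>\<^bsub>B\<^esub> \<ominus>\<^bsub>B\<^esub> \<one>\<^bsub>B\<^esub>"
  have kB: "?k \<in> carrier B" using z by simp
  have "lin z \<zero>\<^bsub>K\<^esub> \<one>\<^bsub>K\<^esub> \<otimes>\<^bsub>B\<^esub> ?k = \<zero>\<^bsub>B\<^esub>" using z z4 by (simp add: lin_self B.r_distr B.r_minus B.r_neg)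
  then have k0: "?k = \<zero>\<^bsub>B\<^esub>" using lin_eq_zero[OF z nr zero_closed one_closed kB] one_not_zero by blast
  let ?l = "z \<otimes>\<^bsub>B\<^esub> z \<oplus>\<^bsub>B\<^esub> z \<oplus>\<^bsub>B\<^esub> \<one>\<^bsub>B\<^esub>"
  have lB: "?l \<in> carrier B" using z by simp
  have "lin z (\<ominus>\<^bsub>K\<^esub> \<one>\<^bsub>K\<^esub>) \<one>\<^bsub>K\<^esub> \<otimes>\<^bsub>B\<^esub> ?l = (z \<oplus>\<^bsub>B\<^esub> \<ominus>\<^bsub>B\<^esub> \<one>\<^bsub>B\<^esub>) \<otimes>\<^bsub>B\<^esub> ?l" using z by (simp add: lin_def B.a_comm)
  also have "\<dots> = ?k"
  proof -
    have "(z \<oplus>\<^bsub>B\<^esub> \<ominus>\<^bsub>B\<^esub> \<one>\<^bsub>B\<^esub>) \<otimes>\<^bsub>B\<^esub> ?l =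
      z \<otimes>\<^bsub>B\<^esub> (z \<otimes>\<^bsub>B\<^esub> z) \<oplus>\<^bsub>B\<^esub> (z \<otimes>\<^bsub>B\<^esub> z \<oplus>\<^bsub>B\<^esub> \<ominus>\<^bsub>B\<^esub> (z \<otimes>\<^bsub>B\<^esub> z)) \<oplus>\<^bsub>B\<^esub> (z \<oplus>\<^bsub>B\<^esub> \<ominus>\<^bsub>B\<^esub> z) \<oplus>\<^bsub>B\<^esub> \<ominus>\<^bsub>B\<^esub> \<one>\<^bsub>B\<^esub>"
      using z by (simp add: B.l_distr B.r_distr B.l_minus B.minus_add B.a_ac)
    then show ?thesis using z by (simp add: B.r_neg)
  qed
  finally have "lin z (\<ominus>\<^bsub>K\<^esub> \<one>\<^bsub>K\<^esub>) \<one>\<^bsub>K\<^esub> \<otimes>\<^bsub>B\<^esub> ?l = \<zero>\<^bsub>B\<^esub>" unfolding k0 .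
  then show ?thesis using lin_eq_zero[OF z nr a_inv_closed[OF one_closed] one_closed lB] one_not_zero by blast
qed

text \<open>The algebra is \<open>(a, e)\<close> with \<open>K(\<surd>a)\<close> the unramified quadratic extension of the 2-adic numbers and \<open>e\<close>
  of odd valuation. Existence takes \<open>g = v\<close>, \<open>g\<^sup>2 = e\<close>. For uniqueness, an explicit form of the
  Skolem--Noether theorem conjugates an arbitrary witness \<open>z\<close> to the cube root of unity \<open>y\<close> in \<open>K(\<surd>a)\<close>;
  then \<open>g\<close> is conjugated into \<open>Kv + Kj\<close>, whose elements have squares of odd valuation.\<close>

lemma local_inv_division:
  assumes p2: "p = 2" and t0: "t = \<zero>\<^bsub>K\<^esub>" and e0: "e \<noteq> \<zero>\<^bsub>K\<^esub>" and oe: "odd (v e)"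
    and \<rho>: "\<rho> \<in> carrier K" "a \<otimes>\<^bsub>K\<^esub> (\<rho> \<otimes>\<^bsub>K\<^esub> \<rho>) = \<ominus>\<^bsub>K\<^esub> (\<one>\<^bsub>K\<^esub> \<oplus>\<^bsub>K\<^esub> \<one>\<^bsub>K\<^esub> \<oplus>\<^bsub>K\<^esub> \<one>\<^bsub>K\<^esub>)"
    and N: "\<And>\<beta> \<gamma>. \<beta> \<in> carrier K \<Longrightarrow> \<gamma> \<in> carrier K \<Longrightarrow> \<beta> \<noteq> \<zero>\<^bsub>K\<^esub> \<or> \<gamma> \<noteq> \<zero>\<^bsub>K\<^esub> \<Longrightarrow>
      \<beta> \<otimes>\<^bsub>K\<^esub> \<beta> \<ominus>\<^bsub>K\<^esub> a \<otimes>\<^bsub>K\<^esub> (\<gamma> \<otimes>\<^bsub>K\<^esub> \<gamma>) \<noteq> \<zero>\<^bsub>K\<^esub> \<and> even (v (\<beta> \<otimes>\<^bsub>K\<^esub> \<beta> \<ominus>\<^bsub>K\<^esub> a \<otimes>\<^bsub>K\<^esub> (\<gamma> \<otimes>\<^bsub>K\<^esub> \<gamma>)))"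
  shows "has_local_inv p A (1 / 2)" "has_local_inv p A q \<Longrightarrow> q = 1 / 2"
proof -
  let ?\<eta> = "\<ominus>\<^bsub>K\<^esub> (\<one>\<^bsub>K\<^esub> \<oplus>\<^bsub>K\<^esub> \<one>\<^bsub>K\<^esub> \<oplus>\<^bsub>K\<^esub> \<one>\<^bsub>K\<^esub>)"
  have eK: "e \<in> carrier K" and aK: "a \<in> carrier K" by simp_all
  obtain h where h: "h \<in> carrier K" "h \<oplus>\<^bsub>K\<^esub> h = \<one>\<^bsub>K\<^esub>" by (rule half)
  have jj: "t \<otimes>\<^bsub>K\<^esub> t \<ominus>\<^bsub>K\<^esub> a \<otimes>\<^bsub>K\<^esub> e = \<ominus>\<^bsub>K\<^esub> (a \<otimes>\<^bsub>K\<^esub> e)" using eK aK by (simp add: t0 a_minus_def)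
  let ?s = "quad \<zero>\<^bsub>K\<^esub> \<rho> \<zero>\<^bsub>K\<^esub> \<zero>\<^bsub>K\<^esub>" and ?v = "quad \<zero>\<^bsub>K\<^esub> \<zero>\<^bsub>K\<^esub> \<one>\<^bsub>K\<^esub> \<zero>\<^bsub>K\<^esub>"
  have sB: "?s \<in> carrier B" and vB: "?v \<in> carrier B" using \<rho> by simp_all
  have \<eta>K: "?\<eta> \<in> carrier K" by simp
  have trs: "trd ?s = \<zero>\<^bsub>K\<^esub>" by (simp add: trd_def)
  have "nrd ?s = \<ominus>\<^bsub>K\<^esub> (a \<otimes>\<^bsub>K\<^esub> (\<rho> \<otimes>\<^bsub>K\<^esub> \<rho>))"
    unfolding nrd_def jj using \<rho>(1) aK eK by (simp add: t0 a_minus_def)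
  then have ns: "nrd ?s = \<ominus>\<^bsub>K\<^esub> ?\<eta>" by (simp only: \<rho>(2))
  have nsq: "\<And>r. r \<in> carrier K \<Longrightarrow> r \<otimes>\<^bsub>K\<^esub> r \<noteq> ?\<eta>" by (rule minus_three_nonsquare[OF p2])
  have \<rho>0: "\<rho> \<noteq> \<zero>\<^bsub>K\<^esub>"
  proof
    assume r0: "\<rho> = \<zero>\<^bsub>K\<^esub>"
    have "a \<otimes>\<^bsub>K\<^esub> (\<rho> \<otimes>\<^bsub>K\<^esub> \<rho>) = \<zero>\<^bsub>K\<^esub> \<otimes>\<^bsub>K\<^esub> \<zero>\<^bsub>K\<^esub>" unfolding r0 using aK by simp
    then show False using nsq[OF zero_closed] by (simp only: \<rho>(2))
  qed
  have "has_local_inv p A (frac (rat_of_int (v e) / 2))"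
  proof (rule has_local_inv_exists[where s = ?s and g = ?v and \<eta> = ?\<eta>])
    show "?v \<otimes>\<^bsub>B\<^esub> ?s = \<ominus>\<^bsub>B\<^esub> (?s \<otimes>\<^bsub>B\<^esub> ?v)"
      using \<rho>(1) eK aK by (simp add: mult_B mul_simps jj neg_B) (simp add: t0 a_minus_def minus_add l_minus)
    show "?v \<otimes>\<^bsub>B\<^esub> ?v = \<iota> e"
      using eK aK by (simp add: mult_B mul_simps jj \<iota>_def)
    show "odd p \<and> ?\<eta> [^]\<^bsub>K\<^esub> ((p - 1) div 2) = \<ominus>\<^bsub>K\<^esub> \<one>\<^bsub>K\<^esub> \<or> p = 2 \<and> ?\<eta> = ?\<eta>" by (rule disjI2, rule conjI[OF p2 refl])
  qed (rule sB vB \<eta>K eK e0 trs ns nsq two_nonzero, assumption?)+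
  then show "has_local_inv p A (1 / 2)" by (simp only: frac_half_odd[OF oe])
  show "q = 1 / 2" if inv: "has_local_inv p A q"
  proof -
    obtain z g m c where w: "has_inv_witness z g m c q" using inv unfolding has_local_inv_iff by blast
    then have z: "z \<in> carrier B" and nr: "noroot z" and g: "g \<in> carrier B" and c: "c \<in> carrier K" "c \<noteq> \<zero>\<^bsub>K\<^esub>"
      and gz': "g \<otimes>\<^bsub>B\<^esub> z = z [^]\<^bsub>B\<^esub> p \<otimes>\<^bsub>B\<^esub> g" and gg: "g \<otimes>\<^bsub>B\<^esub> g = \<iota> c"
      and q: "q = frac (rat_of_int (v c) / 2)" by blast+
    have "z [^]\<^bsub>B\<^esub> p = z [^]\<^bsub>B\<^esub> (2::nat)" by (rule arg_cong[OF p2])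
    then have gz: "g \<otimes>\<^bsub>B\<^esub> z = z \<otimes>\<^bsub>B\<^esub> z \<otimes>\<^bsub>B\<^esub> g" using gz' z by (simp add: numeral_2_eq_2)
    have eqm: "x \<otimes>\<^bsub>B\<^esub> x = \<ominus>\<^bsub>B\<^esub> x \<oplus>\<^bsub>B\<^esub> \<ominus>\<^bsub>B\<^esub> \<one>\<^bsub>B\<^esub>" if "x \<otimes>\<^bsub>B\<^esub> x \<oplus>\<^bsub>B\<^esub> x \<oplus>\<^bsub>B\<^esub> \<one>\<^bsub>B\<^esub> = \<zero>\<^bsub>B\<^esub>" "x \<in> carrier B" for x
    proof -
      have "x \<otimes>\<^bsub>B\<^esub> x \<oplus>\<^bsub>B\<^esub> (x \<oplus>\<^bsub>B\<^esub> \<one>\<^bsub>B\<^esub>) = \<zero>\<^bsub>B\<^esub>" using that by (simp add: B.a_assoc)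
      then have "x \<otimes>\<^bsub>B\<^esub> x = \<ominus>\<^bsub>B\<^esub> (x \<oplus>\<^bsub>B\<^esub> \<one>\<^bsub>B\<^esub>)" using that(2) by (intro B.minus_equality[symmetric]) auto
      then show ?thesis using that(2) by (simp add: B.minus_add)
    qed
    have zz: "z \<otimes>\<^bsub>B\<^esub> z = \<ominus>\<^bsub>B\<^esub> z \<oplus>\<^bsub>B\<^esub> \<ominus>\<^bsub>B\<^esub> \<one>\<^bsub>B\<^esub>" by (rule eqm[OF cube_root_of_unity[OF p2 w] z])
    have "lin z (\<ominus>\<^bsub>K\<^esub> \<one>\<^bsub>K\<^esub>) (\<ominus>\<^bsub>K\<^esub> \<one>\<^bsub>K\<^esub>) = z \<otimes>\<^bsub>B\<^esub> z"
      unfolding zz lin_def using z by (simp add: B.l_minus B.a_comm)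
    also have "\<dots> = lin z (\<ominus>\<^bsub>K\<^esub> nrd z) (trd z)"
      unfolding quadratic_equation[OF z] lin_def using z by (simp add: B.minus_eq B.a_comm)
    finally have "\<ominus>\<^bsub>K\<^esub> \<one>\<^bsub>K\<^esub> = \<ominus>\<^bsub>K\<^esub> nrd z \<and> \<ominus>\<^bsub>K\<^esub> \<one>\<^bsub>K\<^esub> = trd z" using z by (intro lin_inj[OF z nr]) auto
    then have trz: "trd z = \<ominus>\<^bsub>K\<^esub> \<one>\<^bsub>K\<^esub>" by (elim conjE) (erule sym)
    have cjz: "cj x = \<ominus>\<^bsub>B\<^esub> x \<oplus>\<^bsub>B\<^esub> \<ominus>\<^bsub>B\<^esub> \<one>\<^bsub>B\<^esub>" if "x \<in> carrier B" "trd x = \<ominus>\<^bsub>K\<^esub> \<one>\<^bsub>K\<^esub>" for x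
    proof -
      have "x \<oplus>\<^bsub>B\<^esub> cj x = \<ominus>\<^bsub>B\<^esub> \<one>\<^bsub>B\<^esub>" using add_cj[OF that(1)] by (simp add: that(2))
      then have "\<ominus>\<^bsub>B\<^esub> x \<oplus>\<^bsub>B\<^esub> (x \<oplus>\<^bsub>B\<^esub> cj x) = \<ominus>\<^bsub>B\<^esub> x \<oplus>\<^bsub>B\<^esub> \<ominus>\<^bsub>B\<^esub> \<one>\<^bsub>B\<^esub>" by simp
      then show ?thesis using that(1) by (simp add: B.r_neg1)
    qed
    define y where "y = lin ?s (\<ominus>\<^bsub>K\<^esub> h) h"
    have yB: "y \<in> carrier B" using sB h by (simp add: y_def)
    have yq: "y = quad (\<ominus>\<^bsub>K\<^esub> h) (h \<otimes>\<^bsub>K\<^esub> \<rho>) \<zero>\<^bsub>K\<^esub> \<zero>\<^bsub>K\<^esub>" unfolding y_def using h \<rho>(1) by (simp add: lin_quad)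
    have tr_y: "trd y = \<ominus>\<^bsub>K\<^esub> \<one>\<^bsub>K\<^esub>" using h(1) by (simp add: yq trd_def minus_add[symmetric] h(2))
    have "nrd y = h \<otimes>\<^bsub>K\<^esub> h \<oplus>\<^bsub>K\<^esub> h \<otimes>\<^bsub>K\<^esub> h \<otimes>\<^bsub>K\<^esub> (\<one>\<^bsub>K\<^esub> \<oplus>\<^bsub>K\<^esub> \<one>\<^bsub>K\<^esub> \<oplus>\<^bsub>K\<^esub> \<one>\<^bsub>K\<^esub>)"
      unfolding y_def using sB h by (simp add: lin_trd_nrd trs ns l_minus r_minus)
    also have "\<dots> = (h \<oplus>\<^bsub>K\<^esub> h) \<otimes>\<^bsub>K\<^esub> (h \<oplus>\<^bsub>K\<^esub> h)"
      using h(1) by (simp add: l_distr r_distr a_ac)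
    finally have nry: "nrd y = \<one>\<^bsub>K\<^esub>" by (simp add: h(2))
    have yy: "y \<otimes>\<^bsub>B\<^esub> y = \<ominus>\<^bsub>B\<^esub> y \<oplus>\<^bsub>B\<^esub> \<ominus>\<^bsub>B\<^esub> \<one>\<^bsub>B\<^esub>"
      using quadratic_equation[OF yB] yB by (simp add: tr_y nry B.minus_eq B.l_minus)
    have cube: "x \<otimes>\<^bsub>B\<^esub> (x \<otimes>\<^bsub>B\<^esub> x) = \<one>\<^bsub>B\<^esub>" if "x \<in> carrier B" "x \<otimes>\<^bsub>B\<^esub> x = \<ominus>\<^bsub>B\<^esub> x \<oplus>\<^bsub>B\<^esub> \<ominus>\<^bsub>B\<^esub> \<one>\<^bsub>B\<^esub>" for x
    proof -
      have "x \<otimes>\<^bsub>B\<^esub> (x \<otimes>\<^bsub>B\<^esub> x) = \<ominus>\<^bsub>B\<^esub> (x \<otimes>\<^bsub>B\<^esub> x) \<oplus>\<^bsub>B\<^esub> \<ominus>\<^bsub>B\<^esub> x"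
        using that(1) by (subst that(2)) (simp add: B.r_distr B.r_minus)
      also have "\<dots> = \<ominus>\<^bsub>B\<^esub> (x \<otimes>\<^bsub>B\<^esub> x \<oplus>\<^bsub>B\<^esub> x)" using that(1) by (simp add: B.minus_add)
      also have "x \<otimes>\<^bsub>B\<^esub> x \<oplus>\<^bsub>B\<^esub> x = \<ominus>\<^bsub>B\<^esub> \<one>\<^bsub>B\<^esub> \<oplus>\<^bsub>B\<^esub> (\<ominus>\<^bsub>B\<^esub> x \<oplus>\<^bsub>B\<^esub> x)"
        unfolding that(2) using that(1) by (simp only: B.a_ac B.a_inv_closed B.one_closed B.a_closed)
      finally show ?thesis using that(1) by (simp add: B.l_neg)
    qed
    have fourth: "(x \<otimes>\<^bsub>B\<^esub> x) \<otimes>\<^bsub>B\<^esub> (x \<otimes>\<^bsub>B\<^esub> x) = x" if "x \<in> carrier B" "x \<otimes>\<^bsub>B\<^esub> x = \<ominus>\<^bsub>B\<^esub> x \<oplus>\<^bsub>B\<^esub> \<ominus>\<^bsub>B\<^esub> \<one>\<^bsub>B\<^esub>" for x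
      using cube[OF that] that(1) by (simp only: B.m_assoc B.m_closed B.r_one)
    \<comment> \<open>\<open>y\<close> and \<open>z\<close> are both primitive cube roots of unity, so some \<open>f\<close> intertwines them.\<close>
    define f where "f = (\<lambda>x. y \<otimes>\<^bsub>B\<^esub> x \<oplus>\<^bsub>B\<^esub> x \<oplus>\<^bsub>B\<^esub> x \<otimes>\<^bsub>B\<^esub> z)"
    have fB: "f x \<in> carrier B" if "x \<in> carrier B" for x using that yB z by (simp add: f_def)
    have yf: "y \<otimes>\<^bsub>B\<^esub> f x = f x \<otimes>\<^bsub>B\<^esub> z" if x: "x \<in> carrier B" for x
    proof -
      let ?a = "y \<otimes>\<^bsub>B\<^esub> x" and ?b = "x \<otimes>\<^bsub>B\<^esub> z"
      have cl: "?a \<in> carrier B" "?b \<in> carrier B" "?a \<otimes>\<^bsub>B\<^esub> z \<in> carrier B" using x yB z by simp_all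
      have "y \<otimes>\<^bsub>B\<^esub> f x = (y \<otimes>\<^bsub>B\<^esub> y) \<otimes>\<^bsub>B\<^esub> x \<oplus>\<^bsub>B\<^esub> ?a \<oplus>\<^bsub>B\<^esub> ?a \<otimes>\<^bsub>B\<^esub> z"
        unfolding f_def using x yB z by (simp add: B.r_distr B.m_assoc)
      also have "\<dots> = ((\<ominus>\<^bsub>B\<^esub> ?a \<oplus>\<^bsub>B\<^esub> ?a) \<oplus>\<^bsub>B\<^esub> \<ominus>\<^bsub>B\<^esub> x) \<oplus>\<^bsub>B\<^esub> ?a \<otimes>\<^bsub>B\<^esub> z"
        unfolding yy using x cl yB by (simp add: B.l_distr B.l_minus B.a_ac)
      also have "\<dots> = ?a \<otimes>\<^bsub>B\<^esub> z \<oplus>\<^bsub>B\<^esub> (\<ominus>\<^bsub>B\<^esub> x \<oplus>\<^bsub>B\<^esub> (\<ominus>\<^bsub>B\<^esub> ?b \<oplus>\<^bsub>B\<^esub> ?b))"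
        using x cl by (simp add: B.l_neg B.r_neg B.a_comm)
      also have "\<dots> = ?a \<otimes>\<^bsub>B\<^esub> z \<oplus>\<^bsub>B\<^esub> (?b \<oplus>\<^bsub>B\<^esub> x \<otimes>\<^bsub>B\<^esub> (z \<otimes>\<^bsub>B\<^esub> z))"
        unfolding zz using x cl z by (simp add: B.r_distr B.r_minus B.a_ac)
      also have "\<dots> = f x \<otimes>\<^bsub>B\<^esub> z"
        unfolding f_def using x cl yB z by (simp add: B.l_distr B.m_assoc B.a_assoc)
      finally show ?thesis .
    qed
    have "\<exists>x\<in>carrier B. f x \<noteq> \<zero>\<^bsub>B\<^esub>"
    proof (rule ccontr)
      assume "\<not> ?thesis"
      then have f0: "f \<one>\<^bsub>B\<^esub> = \<zero>\<^bsub>B\<^esub>" "f ?v = \<zero>\<^bsub>B\<^esub>" using vB B.one_closed by blast+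
      have "y \<oplus>\<^bsub>B\<^esub> \<one>\<^bsub>B\<^esub> \<oplus>\<^bsub>B\<^esub> z = \<zero>\<^bsub>B\<^esub>" using f0(1) yB z by (simp add: f_def)
      then have "z = \<ominus>\<^bsub>B\<^esub> (y \<oplus>\<^bsub>B\<^esub> \<one>\<^bsub>B\<^esub>)" using yB z by (metis B.a_closed B.a_comm B.minus_equality B.one_closed)
      then have vz: "?v \<otimes>\<^bsub>B\<^esub> z = \<ominus>\<^bsub>B\<^esub> (?v \<otimes>\<^bsub>B\<^esub> y) \<oplus>\<^bsub>B\<^esub> \<ominus>\<^bsub>B\<^esub> ?v"
        using vB yB by (simp only: B.r_minus B.r_distr B.minus_add B.r_one B.m_closed B.a_closed B.a_inv_closed B.one_closed)
      have "(y \<otimes>\<^bsub>B\<^esub> ?v \<oplus>\<^bsub>B\<^esub> \<ominus>\<^bsub>B\<^esub> (?v \<otimes>\<^bsub>B\<^esub> y)) \<oplus>\<^bsub>B\<^esub> (?v \<oplus>\<^bsub>B\<^esub> \<ominus>\<^bsub>B\<^esub> ?v) = f ?v"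
        unfolding f_def vz using vB yB by (simp only: B.a_ac B.a_inv_closed B.a_closed B.m_closed)
      then have "y \<otimes>\<^bsub>B\<^esub> ?v \<oplus>\<^bsub>B\<^esub> \<ominus>\<^bsub>B\<^esub> (?v \<otimes>\<^bsub>B\<^esub> y) = \<zero>\<^bsub>B\<^esub>"
        unfolding f0(2) using vB yB by (simp only: B.r_neg B.r_zero B.a_inv_closed B.a_closed B.m_closed)
      then have "h \<otimes>\<^bsub>K\<^esub> \<rho> \<oplus>\<^bsub>K\<^esub> h \<otimes>\<^bsub>K\<^esub> \<rho> = \<zero>\<^bsub>K\<^esub>"
        unfolding yq using h(1) \<rho>(1) eK aK by (simp add: mult_B mul_simps neg_B add_B zero_B) (simp add: a_minus_def)
      then have "(h \<oplus>\<^bsub>K\<^esub> h) \<otimes>\<^bsub>K\<^esub> \<rho> = \<zero>\<^bsub>K\<^esub>" using h(1) \<rho>(1) by (simp only: l_distr)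
      then show False using \<rho>(1) \<rho>0 by (simp only: h(2) l_one)
    qed
    then obtain x where x: "x \<in> carrier B" "f x \<noteq> \<zero>\<^bsub>B\<^esub>" by blast
    define H where "H = f x"
    have H: "H \<in> carrier B" "H \<noteq> \<zero>\<^bsub>B\<^esub>" using x fB by (simp_all only: H_def simp_thms)
    have yH: "y \<otimes>\<^bsub>B\<^esub> H = H \<otimes>\<^bsub>B\<^esub> z" unfolding H_def by (rule yf[OF x(1)])
    let ?n = "nrd H"
    have n0: "?n \<noteq> \<zero>\<^bsub>K\<^esub>" using anisotropic[OF t0 e0 oe N H(1)] H(2) by blast
    have cH: "cj H \<in> carrier B" and nK: "?n \<in> carrier K" using H by simp_all
    have cc: "cj H \<otimes>\<^bsub>B\<^esub> (y \<otimes>\<^bsub>B\<^esub> y) = (z \<otimes>\<^bsub>B\<^esub> z) \<otimes>\<^bsub>B\<^esub> cj H"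
      using arg_cong[OF yH, of cj] cj_mult[OF yB H(1)] cj_mult[OF H(1) z] cjz[OF yB tr_y] cjz[OF z trz] by (simp only: yy zz)
    have yyB: "y \<otimes>\<^bsub>B\<^esub> y \<in> carrier B" and zzB: "z \<otimes>\<^bsub>B\<^esub> z \<in> carrier B" using yB z by simp_all
    have cy: "cj H \<otimes>\<^bsub>B\<^esub> y = z \<otimes>\<^bsub>B\<^esub> cj H"
    proof -
      have "cj H \<otimes>\<^bsub>B\<^esub> y = cj H \<otimes>\<^bsub>B\<^esub> ((y \<otimes>\<^bsub>B\<^esub> y) \<otimes>\<^bsub>B\<^esub> (y \<otimes>\<^bsub>B\<^esub> y))" by (simp only: fourth[OF yB yy])
      also have "\<dots> = (cj H \<otimes>\<^bsub>B\<^esub> (y \<otimes>\<^bsub>B\<^esub> y)) \<otimes>\<^bsub>B\<^esub> (y \<otimes>\<^bsub>B\<^esub> y)" by (rule B.m_assoc[OF cH yyB yyB, symmetric])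
      also have "\<dots> = (z \<otimes>\<^bsub>B\<^esub> z) \<otimes>\<^bsub>B\<^esub> (cj H \<otimes>\<^bsub>B\<^esub> (y \<otimes>\<^bsub>B\<^esub> y))" by (subst cc) (rule B.m_assoc[OF zzB cH yyB])
      also have "\<dots> = ((z \<otimes>\<^bsub>B\<^esub> z) \<otimes>\<^bsub>B\<^esub> (z \<otimes>\<^bsub>B\<^esub> z)) \<otimes>\<^bsub>B\<^esub> cj H" by (subst cc) (rule B.m_assoc[OF zzB zzB cH, symmetric])
      finally show ?thesis by (simp only: fourth[OF z zz])
    qed
    have Hz: "H \<otimes>\<^bsub>B\<^esub> (z \<otimes>\<^bsub>B\<^esub> r) = y \<otimes>\<^bsub>B\<^esub> (H \<otimes>\<^bsub>B\<^esub> r)" if "r \<in> carrier B" for r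
      using B.m_assoc[OF H(1) z that] B.m_assoc[OF yB H(1) that] by (simp only: yH)
    \<comment> \<open>Conjugation of \<open>g\<close> by \<open>H\<close>, up to the scalar \<open>nrd H\<close>: it acts on \<open>y\<close> by conjugation as \<open>g\<close> acts on \<open>z\<close>.\<close>
    define W where "W = H \<otimes>\<^bsub>B\<^esub> (g \<otimes>\<^bsub>B\<^esub> cj H)"
    have WB: "W \<in> carrier B" using H g by (simp add: W_def)
    have "W \<otimes>\<^bsub>B\<^esub> y = H \<otimes>\<^bsub>B\<^esub> (g \<otimes>\<^bsub>B\<^esub> (cj H \<otimes>\<^bsub>B\<^esub> y))" unfolding W_def using H cH g yB by (simp add: B.m_assoc)
    also have "\<dots> = H \<otimes>\<^bsub>B\<^esub> ((g \<otimes>\<^bsub>B\<^esub> z) \<otimes>\<^bsub>B\<^esub> cj H)" unfolding cy using H cH g z by (simp add: B.m_assoc)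
    also have "\<dots> = H \<otimes>\<^bsub>B\<^esub> (z \<otimes>\<^bsub>B\<^esub> (z \<otimes>\<^bsub>B\<^esub> (g \<otimes>\<^bsub>B\<^esub> cj H)))" unfolding gz using H cH g z by (simp add: B.m_assoc)
    also have "\<dots> = y \<otimes>\<^bsub>B\<^esub> (y \<otimes>\<^bsub>B\<^esub> W)" unfolding W_def using Hz cH g z by simp
    also have "\<dots> = (y \<otimes>\<^bsub>B\<^esub> y) \<otimes>\<^bsub>B\<^esub> W" by (rule B.m_assoc[OF yB yB WB, symmetric])
    finally have Wy: "W \<otimes>\<^bsub>B\<^esub> y = cj y \<otimes>\<^bsub>B\<^esub> W" by (simp only: yy cjz[OF yB tr_y])
    obtain w0 w1 w2 w3 where Wq: "W = quad w0 w1 w2 w3"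
      and wK: "w0 \<in> carrier K" "w1 \<in> carrier K" "w2 \<in> carrier K" "w3 \<in> carrier K"
      using WB by (rule B_cases)
    have cjy: "cj y = quad (\<ominus>\<^bsub>K\<^esub> h) (\<ominus>\<^bsub>K\<^esub> (h \<otimes>\<^bsub>K\<^esub> \<rho>)) \<zero>\<^bsub>K\<^esub> \<zero>\<^bsub>K\<^esub>" by (simp add: yq cj_def)
    have hp: "h \<otimes>\<^bsub>K\<^esub> \<rho> \<in> carrier K" using h \<rho> by simp
    have comp: "w0 \<otimes>\<^bsub>K\<^esub> (\<ominus>\<^bsub>K\<^esub> h) \<oplus>\<^bsub>K\<^esub> a \<otimes>\<^bsub>K\<^esub> (w1 \<otimes>\<^bsub>K\<^esub> (h \<otimes>\<^bsub>K\<^esub> \<rho>)) = \<ominus>\<^bsub>K\<^esub> h \<otimes>\<^bsub>K\<^esub> w0 \<oplus>\<^bsub>K\<^esub> a \<otimes>\<^bsub>K\<^esub> (\<ominus>\<^bsub>K\<^esub> (h \<otimes>\<^bsub>K\<^esub> \<rho>) \<otimes>\<^bsub>K\<^esub> w1)"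
      "w0 \<otimes>\<^bsub>K\<^esub> (h \<otimes>\<^bsub>K\<^esub> \<rho>) \<oplus>\<^bsub>K\<^esub> w1 \<otimes>\<^bsub>K\<^esub> (\<ominus>\<^bsub>K\<^esub> h) = \<ominus>\<^bsub>K\<^esub> h \<otimes>\<^bsub>K\<^esub> w1 \<oplus>\<^bsub>K\<^esub> \<ominus>\<^bsub>K\<^esub> (h \<otimes>\<^bsub>K\<^esub> \<rho>) \<otimes>\<^bsub>K\<^esub> w0"
      using Wy[unfolded cjy, unfolded yq Wq] wK hp h(1) eK aK
      by (simp_all add: mult_B mul_simps jj del: l_minus r_minus) (simp_all add: t0 a_minus_def)
    have dbl: "(h \<oplus>\<^bsub>K\<^esub> h) \<otimes>\<^bsub>K\<^esub> x = x" if "x \<in> carrier K" for x using that by (simp add: h(2))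
    have "a \<otimes>\<^bsub>K\<^esub> (\<rho> \<otimes>\<^bsub>K\<^esub> w1) = \<zero>\<^bsub>K\<^esub>"
    proof -
      let ?l = "w0 \<otimes>\<^bsub>K\<^esub> (\<ominus>\<^bsub>K\<^esub> h) \<oplus>\<^bsub>K\<^esub> a \<otimes>\<^bsub>K\<^esub> (w1 \<otimes>\<^bsub>K\<^esub> (h \<otimes>\<^bsub>K\<^esub> \<rho>))" and ?r = "\<ominus>\<^bsub>K\<^esub> h \<otimes>\<^bsub>K\<^esub> w0 \<oplus>\<^bsub>K\<^esub> a \<otimes>\<^bsub>K\<^esub> (\<ominus>\<^bsub>K\<^esub> (h \<otimes>\<^bsub>K\<^esub> \<rho>) \<otimes>\<^bsub>K\<^esub> w1)"
      have "(h \<oplus>\<^bsub>K\<^esub> h) \<otimes>\<^bsub>K\<^esub> (a \<otimes>\<^bsub>K\<^esub> (\<rho> \<otimes>\<^bsub>K\<^esub> w1)) = ?l \<oplus>\<^bsub>K\<^esub> \<ominus>\<^bsub>K\<^esub> ?r"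
        using wK[THEN tr_ex] h(1)[THEN tr_ex] aK[THEN tr_ex] \<rho>(1)[THEN tr_ex]
        by (elim exE, simp only: tr_hom, simp add: algebra_simps)
      then show ?thesis unfolding comp(1) using wK aK \<rho>(1) h(1) by (simp only: dbl r_neg m_closed a_closed a_inv_closed)
    qed
    then have "(a \<otimes>\<^bsub>K\<^esub> (\<rho> \<otimes>\<^bsub>K\<^esub> \<rho>)) \<otimes>\<^bsub>K\<^esub> w1 = \<rho> \<otimes>\<^bsub>K\<^esub> \<zero>\<^bsub>K\<^esub>" using wK aK \<rho>(1) by (metis m_assoc m_lcomm m_closed)
    moreover have "a \<otimes>\<^bsub>K\<^esub> (\<rho> \<otimes>\<^bsub>K\<^esub> \<rho>) \<noteq> \<zero>\<^bsub>K\<^esub>"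
    proof
      assume "a \<otimes>\<^bsub>K\<^esub> (\<rho> \<otimes>\<^bsub>K\<^esub> \<rho>) = \<zero>\<^bsub>K\<^esub>"
      then have "\<zero>\<^bsub>K\<^esub> \<otimes>\<^bsub>K\<^esub> \<zero>\<^bsub>K\<^esub> = ?\<eta>" unfolding \<rho>(2) by (simp only: l_null zero_closed)
      then show False using nsq[OF zero_closed] by blast
    qed
    ultimately have w1: "w1 = \<zero>\<^bsub>K\<^esub>" using integral[of "a \<otimes>\<^bsub>K\<^esub> (\<rho> \<otimes>\<^bsub>K\<^esub> \<rho>)" w1] wK aK \<rho>(1) by simp
    have "\<rho> \<otimes>\<^bsub>K\<^esub> w0 = \<zero>\<^bsub>K\<^esub>"
    proof -
      let ?l = "w0 \<otimes>\<^bsub>K\<^esub> (h \<otimes>\<^bsub>K\<^esub> \<rho>) \<oplus>\<^bsub>K\<^esub> w1 \<otimes>\<^bsub>K\<^esub> (\<ominus>\<^bsub>K\<^esub> h)" and ?r = "\<ominus>\<^bsub>K\<^esub> h \<otimes>\<^bsub>K\<^esub> w1 \<oplus>\<^bsub>K\<^esub> \<ominus>\<^bsub>K\<^esub> (h \<otimes>\<^bsub>K\<^esub> \<rho>) \<otimes>\<^bsub>K\<^esub> w0"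
      have "(h \<oplus>\<^bsub>K\<^esub> h) \<otimes>\<^bsub>K\<^esub> (\<rho> \<otimes>\<^bsub>K\<^esub> w0) = ?l \<oplus>\<^bsub>K\<^esub> \<ominus>\<^bsub>K\<^esub> ?r"
        using wK[THEN tr_ex] h(1)[THEN tr_ex] \<rho>(1)[THEN tr_ex]
        by (elim exE, simp only: tr_hom, simp add: algebra_simps)
      then show ?thesis unfolding comp(2) using wK \<rho>(1) h(1) by (simp only: dbl r_neg m_closed a_closed a_inv_closed)
    qed
    then have w0: "w0 = \<zero>\<^bsub>K\<^esub>" using integral[of \<rho> w0] wK \<rho>(1) \<rho>0 by blast
    let ?N = "w2 \<otimes>\<^bsub>K\<^esub> w2 \<ominus>\<^bsub>K\<^esub> a \<otimes>\<^bsub>K\<^esub> (w3 \<otimes>\<^bsub>K\<^esub> w3)"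
    have NK: "?N \<in> carrier K" using wK aK by simp
    have WW: "W \<otimes>\<^bsub>B\<^esub> W = \<iota> (e \<otimes>\<^bsub>K\<^esub> ?N)"
      unfolding Wq w0 w1 using wK(3,4) eK aK
      by (simp add: mult_B mul_simps jj \<iota>_def) (simp add: t0 a_minus_def r_distr r_minus l_minus m_ac r_neg)
    have "W \<otimes>\<^bsub>B\<^esub> W = H \<otimes>\<^bsub>B\<^esub> (g \<otimes>\<^bsub>B\<^esub> ((cj H \<otimes>\<^bsub>B\<^esub> H) \<otimes>\<^bsub>B\<^esub> (g \<otimes>\<^bsub>B\<^esub> cj H)))"
      unfolding W_def using H(1) cH g by (simp add: B.m_assoc)
    also have "\<dots> = H \<otimes>\<^bsub>B\<^esub> ((g \<otimes>\<^bsub>B\<^esub> \<iota> ?n) \<otimes>\<^bsub>B\<^esub> (g \<otimes>\<^bsub>B\<^esub> cj H))"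
      unfolding mult_cj[OF H(1)] using H(1) cH g by (simp add: B.m_assoc)
    also have "\<dots> = (H \<otimes>\<^bsub>B\<^esub> \<iota> ?n) \<otimes>\<^bsub>B\<^esub> ((g \<otimes>\<^bsub>B\<^esub> g) \<otimes>\<^bsub>B\<^esub> cj H)"
      unfolding \<iota>_comm[OF nK g] using H(1) cH g by (simp add: B.m_assoc)
    also have "\<dots> = \<iota> ?n \<otimes>\<^bsub>B\<^esub> ((H \<otimes>\<^bsub>B\<^esub> \<iota> c) \<otimes>\<^bsub>B\<^esub> cj H)"
      unfolding gg \<iota>_comm[OF nK H(1)] using H(1) cH c(1) by (simp add: B.m_assoc)
    also have "\<dots> = \<iota> ?n \<otimes>\<^bsub>B\<^esub> (\<iota> c \<otimes>\<^bsub>B\<^esub> (H \<otimes>\<^bsub>B\<^esub> cj H))"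
      unfolding \<iota>_comm[OF c(1) H(1)] using H(1) cH c(1) by (simp add: B.m_assoc)
    also have "\<dots> = \<iota> (?n \<otimes>\<^bsub>K\<^esub> (c \<otimes>\<^bsub>K\<^esub> ?n))"
      unfolding mult_cj[OF H(1)] using nK c(1) by simp
    finally have eq: "?n \<otimes>\<^bsub>K\<^esub> (c \<otimes>\<^bsub>K\<^esub> ?n) = e \<otimes>\<^bsub>K\<^esub> ?N" unfolding WW \<iota>_inj by (rule sym)
    have cn: "c \<otimes>\<^bsub>K\<^esub> ?n \<in> carrier K" "c \<otimes>\<^bsub>K\<^esub> ?n \<noteq> \<zero>\<^bsub>K\<^esub>" using c nK n0 integral by blast+
    have "?n \<otimes>\<^bsub>K\<^esub> (c \<otimes>\<^bsub>K\<^esub> ?n) \<noteq> \<zero>\<^bsub>K\<^esub>" using cn nK n0 integral by blast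
    then have eN: "e \<otimes>\<^bsub>K\<^esub> ?N \<noteq> \<zero>\<^bsub>K\<^esub>" unfolding eq .
    have N0: "?N \<noteq> \<zero>\<^bsub>K\<^esub>"
    proof
      assume "?N = \<zero>\<^bsub>K\<^esub>"
      then show False using eN r_null[OF eK] by (simp only: simp_thms)
    qed
    have "w2 \<noteq> \<zero>\<^bsub>K\<^esub> \<or> w3 \<noteq> \<zero>\<^bsub>K\<^esub>"
    proof (rule ccontr)
      assume "\<not> ?thesis"
      then have w: "w2 = \<zero>\<^bsub>K\<^esub>" "w3 = \<zero>\<^bsub>K\<^esub>" by blast+
      have "?N = \<zero>\<^bsub>K\<^esub>" unfolding w using aK by (simp add: a_minus_def)
      then show False using N0 by blast
    qed
    then have "even (v ?N)" using N[OF wK(3,4)] by blast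
    moreover have "v ?n + (v c + v ?n) = v e + v ?N"
      using arg_cong[OF eq, of v] by (simp only: v_mult[OF nK n0 cn] v_mult[OF c nK n0] v_mult[OF eK e0 NK N0])
    ultimately have "odd (v c)" using oe by presburger
    then show ?thesis unfolding q by (rule frac_half_odd)
  qed
qed

end

section \<open>Local invariants of algebras with integral parameters\<close>

lemma clifford_iso_sym:
  assumes "clifford_algebra R a t e" "alg_iso R (clifford R a t e) A'"
  shows "alg_iso R A' (clifford R a t e)"
proof -
  interpret clifford_algebra R a t e by fact
  show ?thesis by (rule alg_iso_sym[OF assms(2) ring_B]) (simp add: alg_scalar_eq)
qed

context padic begin

lemma clifford_algebraI:
  assumes "a \<in> carrier K" "t \<in> carrier K" "e \<in> carrier K"
  shows "clifford_algebra K a t e"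
  using assms by (intro clifford_algebra.intro clifford_algebra_axioms.intro Q.K.is_cring)

lemma padic_cliffordI:
  assumes "a \<in> carrier K" "t \<in> carrier K" "e \<in> carrier K"
  shows "padic_clifford p a t e"
  using clifford_algebraI[OF assms] Q.K.field_axioms padic_axioms
  by (intro padic_clifford.intro clifford_field.intro)

lemma local_inv_eqI:
  assumes c: "a \<in> carrier K" "t \<in> carrier K" "e \<in> carrier K" "a' \<in> carrier K" "t' \<in> carrier K" "e' \<in> carrier K"
    and iso: "alg_iso K (clifford K a t e) (clifford K a' t' e')"
    and ex: "has_local_inv p (clifford K a t e) q"
    and uniq: "\<And>r. has_local_inv p (clifford K a t e) r \<Longrightarrow> r = q"
  shows "local_inv p (clifford K a' t' e') = q"
  unfolding local_inv_def
proof (rule the_equality)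
  note PC = padic_cliffordI[OF c(1-3)] padic_cliffordI[OF c(4-6)]
  show "has_local_inv p (clifford K a' t' e') q" by (rule has_local_inv_transport[OF PC iso ex])
  fix r assume "has_local_inv p (clifford K a' t' e') r"
  then show "r = q"
    by (intro uniq has_local_inv_transport[OF PC(2,1) clifford_iso_sym[OF clifford_algebraI[OF c(1-3)] iso]])
qed

lemmas K_ex = component_ex[OF Q.K.is_cring]
lemmas K_hom = component_homs[OF Q.K.is_cring]

text \<open>By the linear change of generators \<open>u' = xu + yj\<close> the algebra becomes \<open>(1, ad)\<close>.\<close>

lemma local_inv_conic:
  assumes c: "a \<in> carrier K" "t \<in> carrier K" "e \<in> carrier K" and d: "d = t \<otimes>\<^bsub>K\<^esub> t \<ominus>\<^bsub>K\<^esub> a \<otimes>\<^bsub>K\<^esub> e"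
    and nz: "a \<noteq> \<zero>\<^bsub>K\<^esub>" "d \<noteq> \<zero>\<^bsub>K\<^esub>" and xy: "x \<in> carrier K" "y \<in> carrier K"
    and conic: "a \<otimes>\<^bsub>K\<^esub> (x \<otimes>\<^bsub>K\<^esub> x) \<oplus>\<^bsub>K\<^esub> d \<otimes>\<^bsub>K\<^esub> (y \<otimes>\<^bsub>K\<^esub> y) = \<one>\<^bsub>K\<^esub>"
  shows "local_inv p (clifford K a t e) = 0"
proof -
  have dK: "d \<in> carrier K" using c by (simp add: d)
  have ad: "a \<otimes>\<^bsub>K\<^esub> d \<in> carrier K" "a \<otimes>\<^bsub>K\<^esub> d \<noteq> \<zero>\<^bsub>K\<^esub>" using c dK nz Q.K.integral by blast+
  note u = Q.K.inv_closed_nonzero[OF c(1) nz(1)]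
  note CA0 = clifford_algebraI[OF c(1) Q.K.zero_closed dK]
  note CA1 = clifford_algebraI[OF Q.K.one_closed Q.K.zero_closed ad(1)]
  have swap: "alg_iso K (clifford K a \<zero>\<^bsub>K\<^esub> d) (clifford K a t e)"
    by (rule clifford_swap_iso[OF clifford_algebraI[OF c] CA0 d u(1,3)])
  let ?q = "a \<otimes>\<^bsub>K\<^esub> (x \<otimes>\<^bsub>K\<^esub> x) \<oplus>\<^bsub>K\<^esub> d \<otimes>\<^bsub>K\<^esub> (y \<otimes>\<^bsub>K\<^esub> y)"
  let ?r = "\<ominus>\<^bsub>K\<^esub> (d \<otimes>\<^bsub>K\<^esub> y)" and ?s = "a \<otimes>\<^bsub>K\<^esub> x"
  note ex = c(1)[THEN K_ex] dK[THEN K_ex] xy[THEN K_ex]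
  have det: "(x \<otimes>\<^bsub>K\<^esub> ?s \<ominus>\<^bsub>K\<^esub> y \<otimes>\<^bsub>K\<^esub> ?r) \<otimes>\<^bsub>K\<^esub> \<one>\<^bsub>K\<^esub> = ?q"
    using ex by (elim exE, simp only: K_hom, simp add: algebra_simps)
  have a': "a \<otimes>\<^bsub>K\<^esub> (x \<otimes>\<^bsub>K\<^esub> x) \<oplus>\<^bsub>K\<^esub> \<zero>\<^bsub>K\<^esub> \<otimes>\<^bsub>K\<^esub> (x \<otimes>\<^bsub>K\<^esub> y \<oplus>\<^bsub>K\<^esub> x \<otimes>\<^bsub>K\<^esub> y) \<oplus>\<^bsub>K\<^esub> d \<otimes>\<^bsub>K\<^esub> (y \<otimes>\<^bsub>K\<^esub> y) = ?q"
    using ex by (elim exE, simp only: K_hom, simp add: algebra_simps)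
  have t': "\<zero>\<^bsub>K\<^esub> = a \<otimes>\<^bsub>K\<^esub> (x \<otimes>\<^bsub>K\<^esub> ?r) \<oplus>\<^bsub>K\<^esub> \<zero>\<^bsub>K\<^esub> \<otimes>\<^bsub>K\<^esub> (x \<otimes>\<^bsub>K\<^esub> ?s \<oplus>\<^bsub>K\<^esub> ?r \<otimes>\<^bsub>K\<^esub> y) \<oplus>\<^bsub>K\<^esub> d \<otimes>\<^bsub>K\<^esub> (y \<otimes>\<^bsub>K\<^esub> ?s)"
    using ex by (elim exE, simp only: K_hom, simp add: algebra_simps)
  have e': "a \<otimes>\<^bsub>K\<^esub> (?r \<otimes>\<^bsub>K\<^esub> ?r) \<oplus>\<^bsub>K\<^esub> \<zero>\<^bsub>K\<^esub> \<otimes>\<^bsub>K\<^esub> (?r \<otimes>\<^bsub>K\<^esub> ?s \<oplus>\<^bsub>K\<^esub> ?r \<otimes>\<^bsub>K\<^esub> ?s) \<oplus>\<^bsub>K\<^esub> d \<otimes>\<^bsub>K\<^esub> (?s \<otimes>\<^bsub>K\<^esub> ?s) = (a \<otimes>\<^bsub>K\<^esub> d) \<otimes>\<^bsub>K\<^esub> ?q"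
    using ex by (elim exE, simp only: K_hom, simp add: algebra_simps)
  have change: "alg_iso K (clifford K \<one>\<^bsub>K\<^esub> \<zero>\<^bsub>K\<^esub> (a \<otimes>\<^bsub>K\<^esub> d)) (clifford K a \<zero>\<^bsub>K\<^esub> d)"
  proof (rule clifford_change_iso[OF CA0 CA1 xy _ _ Q.K.one_closed, where r = ?r and s = ?s])
    show "\<one>\<^bsub>K\<^esub> = a \<otimes>\<^bsub>K\<^esub> (x \<otimes>\<^bsub>K\<^esub> x) \<oplus>\<^bsub>K\<^esub> \<zero>\<^bsub>K\<^esub> \<otimes>\<^bsub>K\<^esub> (x \<otimes>\<^bsub>K\<^esub> y \<oplus>\<^bsub>K\<^esub> x \<otimes>\<^bsub>K\<^esub> y) \<oplus>\<^bsub>K\<^esub> d \<otimes>\<^bsub>K\<^esub> (y \<otimes>\<^bsub>K\<^esub> y)" by (simp only: a' conic)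
    show "a \<otimes>\<^bsub>K\<^esub> d = a \<otimes>\<^bsub>K\<^esub> (?r \<otimes>\<^bsub>K\<^esub> ?r) \<oplus>\<^bsub>K\<^esub> \<zero>\<^bsub>K\<^esub> \<otimes>\<^bsub>K\<^esub> (?r \<otimes>\<^bsub>K\<^esub> ?s \<oplus>\<^bsub>K\<^esub> ?r \<otimes>\<^bsub>K\<^esub> ?s) \<oplus>\<^bsub>K\<^esub> d \<otimes>\<^bsub>K\<^esub> (?s \<otimes>\<^bsub>K\<^esub> ?s)"
      using ad(1) by (simp only: e' conic Q.K.r_one)
    show "(x \<otimes>\<^bsub>K\<^esub> ?s \<ominus>\<^bsub>K\<^esub> y \<otimes>\<^bsub>K\<^esub> ?r) \<otimes>\<^bsub>K\<^esub> \<one>\<^bsub>K\<^esub> = \<one>\<^bsub>K\<^esub>" by (simp only: det conic)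
    show "\<zero>\<^bsub>K\<^esub> = a \<otimes>\<^bsub>K\<^esub> (x \<otimes>\<^bsub>K\<^esub> ?r) \<oplus>\<^bsub>K\<^esub> \<zero>\<^bsub>K\<^esub> \<otimes>\<^bsub>K\<^esub> (x \<otimes>\<^bsub>K\<^esub> ?s \<oplus>\<^bsub>K\<^esub> ?r \<otimes>\<^bsub>K\<^esub> y) \<oplus>\<^bsub>K\<^esub> d \<otimes>\<^bsub>K\<^esub> (y \<otimes>\<^bsub>K\<^esub> ?s)" by (rule t')
  qed (use c dK xy in simp_all)
  note split = padic_clifford.local_inv_split[OF padic_cliffordI[OF Q.K.one_closed Q.K.zero_closed ad(1)] refl refl ad(2)]
  show ?thesis
    by (rule local_inv_eqI[OF Q.K.one_closed Q.K.zero_closed ad(1) c alg_iso_trans[OF change swap] split])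
qed

abbreviation embi where "embi n \<equiv> emb (zint n)"

lemma embi_hom: "embi (m + n) = embi m \<oplus>\<^bsub>K\<^esub> embi n" "embi (m * n) = embi m \<otimes>\<^bsub>K\<^esub> embi n"
  "embi (- n) = \<ominus>\<^bsub>K\<^esub> embi n" "embi (m - n) = embi m \<ominus>\<^bsub>K\<^esub> embi n" "embi 0 = \<zero>\<^bsub>K\<^esub>" "embi 1 = \<one>\<^bsub>K\<^esub>"
  using zint_add[of m "- n"] by (simp_all add: zint_add zint_mult zint_minus zint_0 zint_1 a_minus_def)

lemma embi_nonzero: "n \<noteq> 0 \<Longrightarrow> embi n \<noteq> \<zero>\<^bsub>K\<^esub>"
  using zint_nonzero[of n] emb_eq_0[of "zint n"] by simp

text \<open>When \<open>a\<close> and \<open>d\<close> are units and \<open>p\<close> is odd, the conic \<open>ax\<^sup>2 + dy\<^sup>2 = 1\<close> has a point, so the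
  algebra is split. This leaves finitely many primes that can contribute to the pairing.\<close>

lemma local_inv_unramified:
  assumes "odd p" "\<not> int p dvd a" "\<not> int p dvd t * t - a * e"
  shows "local_inv p (clifford K (embi a) (embi t) (embi e)) = 0"
proof -
  obtain x y where xy: "x \<in> carrier K" "y \<in> carrier K"
    "embi a \<otimes>\<^bsub>K\<^esub> (x \<otimes>\<^bsub>K\<^esub> x) \<oplus>\<^bsub>K\<^esub> embi (t * t - a * e) \<otimes>\<^bsub>K\<^esub> (y \<otimes>\<^bsub>K\<^esub> y) = \<one>\<^bsub>K\<^esub>"
    using conic_point[OF assms] by blast
  have "a \<noteq> 0" "t * t - a * e \<noteq> 0" using assms by (metis dvd_0_right)+
  then show ?thesis
    by (intro local_inv_conic[OF _ _ _ _ _ _ xy] embi_nonzero) (simp_all add: embi_hom)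
qed

lemma local_inv_dyadic_square:
  assumes p: "p = 2" and a: "a mod 8 = 1" and d: "t * t - a * e \<noteq> 0"
  shows "local_inv p (clifford K (embi a) (embi t) (embi e)) = 0"
proof -
  obtain r where r: "r \<in> carrier (Zp p)" "r \<otimes>\<^bsub>Zp p\<^esub> r = zint a" using square_root_dyadic[OF p a] by blast
  have a0: "embi a \<noteq> \<zero>\<^bsub>K\<^esub>" using a by (intro embi_nonzero) auto
  have rr: "emb r \<otimes>\<^bsub>K\<^esub> emb r = embi a" using Q.to_fraction.hom_mult[OF r(1) r(1)] r(2) by simp
  have rK: "emb r \<in> carrier K" using r by simp
  have r0: "emb r \<noteq> \<zero>\<^bsub>K\<^esub>"
  proof
    assume "emb r = \<zero>\<^bsub>K\<^esub>"
    then show False using a0 rr[symmetric] by (simp only: Q.K.l_null Q.K.zero_closed simp_thms)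
  qed
  note i = Q.K.inv_closed_nonzero[OF rK r0]
  have "embi a \<otimes>\<^bsub>K\<^esub> (inv\<^bsub>K\<^esub> emb r \<otimes>\<^bsub>K\<^esub> inv\<^bsub>K\<^esub> emb r) = (emb r \<otimes>\<^bsub>K\<^esub> inv\<^bsub>K\<^esub> emb r) \<otimes>\<^bsub>K\<^esub> (emb r \<otimes>\<^bsub>K\<^esub> inv\<^bsub>K\<^esub> emb r)"
    unfolding rr[symmetric] using rK[THEN K_ex] i(1)[THEN K_ex] by (elim exE, simp only: K_hom, simp add: algebra_simps)
  then have "embi a \<otimes>\<^bsub>K\<^esub> (inv\<^bsub>K\<^esub> emb r \<otimes>\<^bsub>K\<^esub> inv\<^bsub>K\<^esub> emb r) = \<one>\<^bsub>K\<^esub>"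
    by (simp only: i(3) Q.K.r_one Q.K.one_closed)
  then have "embi a \<otimes>\<^bsub>K\<^esub> (inv\<^bsub>K\<^esub> emb r \<otimes>\<^bsub>K\<^esub> inv\<^bsub>K\<^esub> emb r) \<oplus>\<^bsub>K\<^esub> embi (t * t - a * e) \<otimes>\<^bsub>K\<^esub> (\<zero>\<^bsub>K\<^esub> \<otimes>\<^bsub>K\<^esub> \<zero>\<^bsub>K\<^esub>) = \<one>\<^bsub>K\<^esub>"
    by simp
  then show ?thesis
    by (intro local_inv_conic[OF _ _ _ _ a0 embi_nonzero[OF d] i(1) Q.K.zero_closed]) (simp_all add: embi_hom)
qed

lemma local_inv_dyadic_nonsquare:
  assumes p: "p = 2" and a: "a mod 8 = 5" and d: "(t * t - a * e) mod 4 = 2"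
  shows "local_inv p (clifford K (embi a) (embi t) (embi e)) = 1 / 2"
proof -
  define D where "D = t * t - a * e"
  have a0: "embi a \<noteq> \<zero>\<^bsub>K\<^esub>" using a by (intro embi_nonzero) auto
  have aK: "embi a \<in> carrier K" by simp
  note u = Q.K.inv_closed_nonzero[OF aK a0]
  have "zint D 1 = D mod int p ^ 1" "zint D (Suc 1) = D mod int p ^ Suc 1" by (simp_all only: zint_def)
  moreover have "D mod 2 = 0" "D mod 4 = 2" using d unfolding D_def by presburger+
  ultimately have zD: "zint D 1 = 0" "zint D (Suc 1) \<noteq> 0" by (simp_all add: p)
  note vD = v_emb_eq[OF zint_closed zD]
  obtain r where r: "r \<in> carrier (Zp p)" "r \<otimes>\<^bsub>Zp p\<^esub> r = zint (- 3 * a)"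
  proof -
    have "(- 3 * a) mod 8 = 1" using a by presburger
    then show ?thesis using square_root_dyadic[OF p, of "- 3 * a"] that by blast
  qed
  define \<rho> where "\<rho> = emb r \<otimes>\<^bsub>K\<^esub> inv\<^bsub>K\<^esub> embi a"
  have rK: "emb r \<in> carrier K" using r by simp
  have \<rho>: "\<rho> \<in> carrier K" using rK u by (simp add: \<rho>_def)
  have rr: "emb r \<otimes>\<^bsub>K\<^esub> emb r = embi (- 3) \<otimes>\<^bsub>K\<^esub> embi a"
    using Q.to_fraction.hom_mult[OF r(1) r(1)] r(2) by (simp add: embi_hom(2)[symmetric])
  have e3: "embi (- 3) = \<ominus>\<^bsub>K\<^esub> (\<one>\<^bsub>K\<^esub> \<oplus>\<^bsub>K\<^esub> \<one>\<^bsub>K\<^esub> \<oplus>\<^bsub>K\<^esub> \<one>\<^bsub>K\<^esub>)"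
    by (simp only: embi_hom(1,3,6)[symmetric]) simp
  have "embi a \<otimes>\<^bsub>K\<^esub> (\<rho> \<otimes>\<^bsub>K\<^esub> \<rho>) = (embi a \<otimes>\<^bsub>K\<^esub> inv\<^bsub>K\<^esub> embi a) \<otimes>\<^bsub>K\<^esub> inv\<^bsub>K\<^esub> embi a \<otimes>\<^bsub>K\<^esub> (emb r \<otimes>\<^bsub>K\<^esub> emb r)"
    unfolding \<rho>_def using rK[THEN K_ex] u(1)[THEN K_ex] aK[THEN K_ex]
    by (elim exE, simp only: K_hom, simp add: algebra_simps)
  also have "\<dots> = (embi a \<otimes>\<^bsub>K\<^esub> inv\<^bsub>K\<^esub> embi a) \<otimes>\<^bsub>K\<^esub> (embi a \<otimes>\<^bsub>K\<^esub> inv\<^bsub>K\<^esub> embi a) \<otimes>\<^bsub>K\<^esub> embi (- 3)"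
    unfolding rr using emb_closed[OF zint_closed, of "- 3", THEN K_ex] u(1)[THEN K_ex] aK[THEN K_ex]
    by (elim exE, simp only: K_hom, simp add: algebra_simps)
  also have "\<dots> = embi (- 3)" by (simp add: u(3))
  finally have a\<rho>: "embi a \<otimes>\<^bsub>K\<^esub> (\<rho> \<otimes>\<^bsub>K\<^esub> \<rho>) = \<ominus>\<^bsub>K\<^esub> (\<one>\<^bsub>K\<^esub> \<oplus>\<^bsub>K\<^esub> \<one>\<^bsub>K\<^esub> \<oplus>\<^bsub>K\<^esub> \<one>\<^bsub>K\<^esub>)" by (simp only: e3)
  have DK: "embi D \<in> carrier K" by simp
  have swap: "alg_iso K (clifford K (embi a) \<zero>\<^bsub>K\<^esub> (embi D)) (clifford K (embi a) (embi t) (embi e))"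
    by (rule clifford_swap_iso[OF clifford_algebraI clifford_algebraI _ u(1,3)]) (simp_all add: D_def embi_hom)
  have N: "\<beta> \<otimes>\<^bsub>K\<^esub> \<beta> \<ominus>\<^bsub>K\<^esub> embi a \<otimes>\<^bsub>K\<^esub> (\<gamma> \<otimes>\<^bsub>K\<^esub> \<gamma>) \<noteq> \<zero>\<^bsub>K\<^esub> \<and> even (v (\<beta> \<otimes>\<^bsub>K\<^esub> \<beta> \<ominus>\<^bsub>K\<^esub> embi a \<otimes>\<^bsub>K\<^esub> (\<gamma> \<otimes>\<^bsub>K\<^esub> \<gamma>)))"
    if "\<beta> \<in> carrier K" "\<gamma> \<in> carrier K" "\<beta> \<noteq> \<zero>\<^bsub>K\<^esub> \<or> \<gamma> \<noteq> \<zero>\<^bsub>K\<^esub>" for \<beta> \<gamma>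
    using norm_valuation_even[OF p a that] by blast
  have ov: "odd (v (embi D))" by (simp only: vD(2)) simp
  note div = padic_clifford.local_inv_division[OF padic_cliffordI[OF aK Q.K.zero_closed DK] p refl vD(1) ov \<rho> a\<rho> N]
  show ?thesis
    by (rule local_inv_eqI[OF aK Q.K.zero_closed DK aK _ _ swap div]) simp_all
qed

end

section \<open>The surface, its function field and the Azumaya algebra\<close>

lemma type_ring_simps:
  "carrier (ring_of_type_algebra :: 'a::comm_ring_1 ring) = UNIV"
  "x \<otimes>\<^bsub>ring_of_type_algebra\<^esub> y = x * y" "x \<oplus>\<^bsub>ring_of_type_algebra\<^esub> y = x + y"
  "\<one>\<^bsub>ring_of_type_algebra\<^esub> = (1::'a)" "\<zero>\<^bsub>ring_of_type_algebra\<^esub> = (0::'a)"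
  for x y :: "'a::comm_ring_1"
  by (simp_all add: ring_of_type_algebra_def)

lemma type_ring_ops:
  fixes x y :: "'a::comm_ring_1"
  shows "\<ominus>\<^bsub>ring_of_type_algebra\<^esub> x = - x" "x \<ominus>\<^bsub>ring_of_type_algebra\<^esub> y = x - y"
    "x [^]\<^bsub>ring_of_type_algebra\<^esub> (n::nat) = x ^ n" "[n] \<cdot>\<^bsub>ring_of_type_algebra\<^esub> x = of_nat n * x"
    "[k] \<cdot>\<^bsub>ring_of_type_algebra\<^esub> x = of_int k * x"
proof -
  interpret R: cring "ring_of_type_algebra :: 'a ring" by (rule cring_from_type_algebra)
  show m: "\<ominus>\<^bsub>ring_of_type_algebra\<^esub> x = - x" for x :: 'a
    by (rule R.minus_equality) (simp_all add: type_ring_simps)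
  then show "x \<ominus>\<^bsub>ring_of_type_algebra\<^esub> y = x - y" by (simp add: a_minus_def type_ring_simps)
  show "x [^]\<^bsub>ring_of_type_algebra\<^esub> (n::nat) = x ^ n"
    by (induction n) (simp_all add: type_ring_simps)
  show n: "[n] \<cdot>\<^bsub>ring_of_type_algebra\<^esub> x = of_nat n * x" for n :: nat
    by (induction n) (simp_all add: type_ring_simps algebra_simps)
  show "[k] \<cdot>\<^bsub>ring_of_type_algebra\<^esub> x = of_int k * x"
  proof (cases "k \<ge> 0")
    case True
    then show ?thesis using n[of "nat k"] by (simp add: add_pow_int_ge)
  next
    case False
    then show ?thesis using n[of "nat (- k)"] by (simp add: add_pow_int_lt m)
  qed
qed

lemma hom_add_pow_int:
  fixes k :: int
  assumes "ring_hom_cring R S h" "x \<in> carrier R"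
  shows "h ([k] \<cdot>\<^bsub>R\<^esub> x) = [k] \<cdot>\<^bsub>S\<^esub> h x"
proof -
  interpret ring_hom_cring R S h by fact
  have n: "h ([n] \<cdot>\<^bsub>R\<^esub> x) = [n] \<cdot>\<^bsub>S\<^esub> h x" for n :: nat using assms(2) by (induction n) simp_all
  show ?thesis
    using n[of "nat k"] n[of "nat (- k)"] assms(2)
    by (cases "k \<ge> 0") (simp_all add: add_pow_int_ge add_pow_int_lt)
qed

lemma F3_hom:
  assumes "ring_hom_cring R S h" "x \<in> carrier R" "y \<in> carrier R" "z \<in> carrier R"
  shows "F3 S k (h x) (h y) (h z) = h (F3 R k x y z)"
proof -
  interpret ring_hom_cring R S h by fact
  show ?thesis using assms(2-)
    by (simp add: F3_def Let_def a_minus_def hom_add_pow_int[OF assms(1)])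
qed

lemma F3_type_ring:
  fixes x y z :: "'a::comm_ring_1"
  shows "F3 ring_of_type_algebra k x y z =
    x\<^sup>2 + y\<^sup>2 + z\<^sup>2 + 4 * (x\<^sup>2 * y\<^sup>2 + y\<^sup>2 * z\<^sup>2 + z\<^sup>2 * x\<^sup>2) - 16 * (x\<^sup>2 * y\<^sup>2 * z\<^sup>2) - of_int k"
  by (simp add: F3_def Let_def type_ring_simps type_ring_ops)

text \<open>The key identity: with \<open>a, b, c\<close> the numbers \<open>4x\<^sup>2 + 1, 4y\<^sup>2 + 1, 4z\<^sup>2 + 1\<close> it says
  \<open>4 F = abc - 128 x\<^sup>2y\<^sup>2z\<^sup>2 - (4k + 1)\<close>. On the surface the binary form with coefficients
  \<open>a, 16xyz, 2bc\<close> thus has the constant discriminant \<open>d = -2(4k + 1)\<close>.\<close>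

lemma discriminant_identity:
  fixes x y z :: "'a::comm_ring_1"
  shows "16 * x * y * z * (16 * x * y * z) - (4 * x\<^sup>2 + 1) * (2 * (4 * y\<^sup>2 + 1) * (4 * z\<^sup>2 + 1)) =
    of_int (- 2 * (4 * k + 1)) - 8 * (x\<^sup>2 + y\<^sup>2 + z\<^sup>2 + 4 * (x\<^sup>2 * y\<^sup>2 + y\<^sup>2 * z\<^sup>2 + z\<^sup>2 * x\<^sup>2) - 16 * (x\<^sup>2 * y\<^sup>2 * z\<^sup>2) - of_int k)"
  by (simp add: algebra_simps power2_eq_square)

text \<open>A factorisation into linear factors \<open>(p + qX)(r + sX)\<close> has \<open>ps = -qr\<close>, whence \<open>ab = -(ps)\<^sup>2\<close>.\<close>

lemma even_quadratic_irreducible: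
  fixes a b :: "'a::idom"
  assumes a: "a \<noteq> 0" and sq: "\<And>s. a * b \<noteq> - (s * s)"
    and prim: "\<And>f. f dvd a \<Longrightarrow> f dvd b \<Longrightarrow> f dvd 1"
  shows "irreducible [:b, 0, a:]"
proof (rule irreducibleI)
  let ?F = "[:b, 0, a:]"
  show F0: "?F \<noteq> 0" using a by simp
  have const: "g dvd 1" if d: "degree g = 0" and dF: "g dvd ?F" for g
  proof -
    obtain c where c: "g = [:c:]" using d by (rule degree_eq_zeroE)
    have dv: "c dvd coeff ?F n" for n using dF unfolding c const_poly_dvd_iff by blast
    have "c dvd a" "c dvd b" using dv[of 2] dv[of 0] by (simp_all add: numeral_2_eq_2)
    then have "c dvd 1" by (rule prim)
    then obtain c' where "1 = c * c'" by (rule dvdE)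
    then have "1 = g * [:c':]" by (simp add: c one_pCons mult.commute)
    then show ?thesis by (rule dvdI)
  qed
  show "\<not> ?F dvd 1"
  proof
    assume "?F dvd 1"
    then have "degree ?F \<le> degree (1 :: 'a poly)" by (rule dvd_imp_degree_le) simp
    then show False using a by simp
  qed
  fix g h assume gh: "?F = g * h"
  then have nz: "g \<noteq> 0" "h \<noteq> 0" using F0 by (metis mult_zero_left, metis mult_zero_right)
  have "degree g + degree h = 2" using degree_mult_eq[OF nz] gh[symmetric] a by simp
  then consider "degree g = 0" | "degree h = 0" | "degree g = 1" "degree h = 1" by linarith
  then show "g dvd 1 \<or> h dvd 1"
  proof cases
    case 1 then show ?thesis using const[of g] gh by (metis dvd_triv_left)
  next
    case 2 then show ?thesis using const[of h] gh by (metis dvd_triv_right)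
  next
    case 3
    obtain p q where g: "g = [:p, q:]" using 3(1) by (metis One_nat_def degree_pCons_eq degree_eq_zeroE nat.inject pCons_cases degree_0 zero_neq_one)
    obtain r s where h: "h = [:r, s:]" using 3(2) by (metis One_nat_def degree_pCons_eq degree_eq_zeroE nat.inject pCons_cases degree_0 zero_neq_one)
    have e: "b = p * r" "0 = p * s + q * r" "a = q * s" using gh by (simp_all add: g h algebra_simps)
    have "a * b = (q * r) * (p * s)" by (simp add: e algebra_simps)
    also have "q * r = - (p * s)" using e(2) by (metis add.inverse_unique)
    finally have "a * b = - ((p * s) * (p * s))" by simp
    then show ?thesis using sq by blast
  qed
qed

text \<open>The surface is \<open>A z\<^sup>2 + B = 0\<close> with \<open>A, B\<close> polynomials in \<open>x, y\<close>.\<close>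

definition lead_form :: "rat poly poly" where "lead_form = [:[:1, 0, 4:], 0, [:4, 0, - 16:]:]"
definition const_form :: "int \<Rightarrow> rat poly poly" where "const_form k = [:[:- of_int k, 0, 1:], 0, [:1, 0, 4:]:]"
definition surface_poly :: "int \<Rightarrow> qpoly" where "surface_poly k = [:const_form k, 0, lead_form:]"

lemma F3_qpoly: "F3 qpoly_ring k varx vary varz = surface_poly k"
  unfolding F3_type_ring surface_poly_def const_form_def lead_form_def
  by (simp add: power2_eq_square of_int_poly numeral_poly one_pCons)

lemma poly_poly_lead: "poly (poly lead_form [:c:]) 0 = 1 + 4 * c * c"
  by (simp add: lead_form_def algebra_simps)

text \<open>\<open>AB\<close> is not minus a square, because it is positive at \<open>x = 0\<close> and \<open>y\<close> large. A common divisor of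
  \<open>A\<close> and \<open>B\<close> divides the polynomial in \<open>x\<close> got by eliminating \<open>y\<^sup>2\<close>, so it involves \<open>x\<close> only and divides
  both \<open>1 + 4x\<^sup>2\<close> and \<open>4 - 16x\<^sup>2\<close>, which are coprime.\<close>

lemma irreducible_surface_poly: "irreducible (surface_poly k)"
  unfolding surface_poly_def
proof (rule even_quadratic_irreducible)
  show "lead_form \<noteq> 0" by (simp add: lead_form_def)
  fix s
  show "lead_form * const_form k \<noteq> - (s * s)"
  proof
    assume eq: "lead_form * const_form k = - (s * s)"
    \<comment> \<open>Evaluation at \<open>x = 0\<close> and \<open>y = \<bar>k\<bar> + 1\<close> makes the left-hand side positive.\<close>
    define c :: rat where "c = of_int (\<bar>k\<bar> + 1)"
    have "poly (poly (lead_form * const_form k) [:c:]) 0 = poly (poly (- (s * s)) [:c:]) 0" by (simp only: eq)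
    then have "(1 + 4 * c * c) * (c * c - of_int k) = - (poly (poly s [:c:]) 0 * poly (poly s [:c:]) 0)"
      by (simp add: poly_poly_lead const_form_def algebra_simps)
    moreover have "c * c - of_int k > 0"
    proof -
      have "k < (\<bar>k\<bar> + 1) * (\<bar>k\<bar> + 1)" by (simp add: algebra_simps abs_if) (smt (verit) mult_nonneg_nonneg mult_nonpos_nonpos)
      then have "(of_int k :: rat) < of_int ((\<bar>k\<bar> + 1) * (\<bar>k\<bar> + 1))" by (simp only: of_int_less_iff)
      then show ?thesis by (simp add: c_def)
    qed
    moreover have "1 + 4 * c * c > 0" by (smt (verit) c_def mult.assoc zero_le_square mult_nonneg_nonneg zero_le_numeral zero_less_one add_pos_nonneg)
    ultimately show False by (metis mult_pos_pos neg_0_le_iff_le not_le neg_le_0_iff_le zero_le_square)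
  qed
next
  fix f assume f: "f dvd lead_form" "f dvd const_form k"
  \<comment> \<open>The result of eliminating \<open>y\<^sup>2\<close> from the two forms.\<close>
  define r :: "rat poly" where "r = [:1, 0, 4:] * [:1, 0, 4:] - [:- of_int k, 0, 1:] * [:4, 0, - 16:]"
  have "lead_form * [:[:1, 0, 4:]:] - const_form k * [:[:4, 0, - 16:]:] = [:r:]"
    by (simp add: lead_form_def const_form_def r_def algebra_simps)
  then have fr: "f dvd [:r:]" using f by (metis dvd_diff dvd_mult2)
  have "coeff r 4 = 32" by (simp add: r_def numeral_eq_Suc)
  then have "r \<noteq> 0" by auto
  then have "degree f \<le> 0" using dvd_imp_degree_le[OF fr] by simp
  then obtain g where g: "f = [:g:]" by (metis degree_eq_zeroE le_zero_eq)
  have dv: "g dvd coeff lead_form n" for n using f(1) unfolding g const_poly_dvd_iff by blast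
  have "g dvd [:1, 0, 4:]" "g dvd [:4, 0, - 16:]" using dv[of 0] dv[of 2] by (simp_all add: lead_form_def numeral_2_eq_2)
  then have "g dvd [:1, 0, 4:] * [:4:] + [:4, 0, - 16:]" by (intro dvd_add dvd_mult2)
  then have "g dvd [:8:]" by simp
  moreover have "[:8 :: rat:] dvd 1" by (rule dvdI[of _ _ "[:1/8:]"]) (simp add: one_pCons)
  ultimately have "g dvd 1" by (rule dvd_trans)
  then obtain g' where "1 = g * g'" by (rule dvdE)
  then have "1 = f * [:g':]" by (simp add: g one_pCons mult.commute)
  then show "f dvd 1" by (rule dvdI)
qed

lemma surface_ideal_iff: "f \<in> surface_ideal k \<longleftrightarrow> surface_poly k dvd f"
  unfolding surface_ideal_def F3_qpoly cgenideal_def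
  by (auto simp: type_ring_simps dvd_def mult.commute)

lemma surface_primeideal: "primeideal (surface_ideal k) qpoly_ring"
proof (rule primeidealI)
  interpret cring qpoly_ring by (rule cring_from_type_algebra)
  show "ideal (surface_ideal k) qpoly_ring"
    unfolding surface_ideal_def by (rule cgenideal_ideal) (simp add: type_ring_simps)
  show "cring qpoly_ring" by (rule cring_from_type_algebra)
  have p: "prime_elem (surface_poly k)" by (rule irreducible_imp_prime_elem[OF irreducible_surface_poly])
  have "1 \<notin> surface_ideal k" unfolding surface_ideal_iff using p by (simp add: prime_elem_not_unit)
  then show "carrier qpoly_ring \<noteq> surface_ideal k" by (auto simp: type_ring_simps)
  fix a b :: qpoly assume "a \<otimes>\<^bsub>qpoly_ring\<^esub> b \<in> surface_ideal k"
  then show "a \<in> surface_ideal k \<or> b \<in> surface_ideal k"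
    unfolding surface_ideal_iff type_ring_simps using p by (simp add: prime_elem_dvd_mult_iff)
qed

locale affine_surface = fixes k :: int
begin

abbreviation "R \<equiv> coord_ring k"

sublocale I: primeideal "surface_ideal k" qpoly_ring by (rule surface_primeideal)

sublocale fractions R
  unfolding fractions_def coord_ring_def by (rule I.quotient_is_domain)

text \<open>The regular function on the surface defined by a polynomial.\<close>

definition regular :: "qpoly \<Rightarrow> qpoly set" where "regular f = surface_ideal k +>\<^bsub>qpoly_ring\<^esub> f"

lemma regular_hom: "ring_hom_ring qpoly_ring R regular"
  using I.rcos_ring_hom_ring unfolding coord_ring_def regular_def .

sublocale regular: ring_hom_ring qpoly_ring R regular by (rule regular_hom)

lemma regular_closed [simp, intro]: "regular f \<in> carrier R"
  using regular.hom_closed[of f] by (simp add: type_ring_simps)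

lemma regular_simps:
  "regular (f + g) = regular f \<oplus>\<^bsub>R\<^esub> regular g" "regular (f * g) = regular f \<otimes>\<^bsub>R\<^esub> regular g"
  "regular (- f) = \<ominus>\<^bsub>R\<^esub> regular f" "regular (f - g) = regular f \<ominus>\<^bsub>R\<^esub> regular g" "regular 1 = \<one>\<^bsub>R\<^esub>" "regular 0 = \<zero>\<^bsub>R\<^esub>"
  using regular.hom_add[of f g] regular.hom_mult[of f g] regular.hom_a_inv[of f] regular.hom_add[of f "- g"] regular.hom_a_inv[of g]
    regular.hom_one regular.hom_zero
  by (simp_all add: type_ring_simps type_ring_ops a_minus_def)

lemma regular_cases:
  assumes "C \<in> carrier R" obtains f where "C = regular f"
  using assms unfolding coord_ring_def FactRing_def A_RCOSETS_def' regular_def by auto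

lemma regular_eq_0: "regular f = \<zero>\<^bsub>R\<^esub> \<longleftrightarrow> surface_poly k dvd f"
  unfolding surface_ideal_iff[symmetric] regular_def coord_ring_def FactRing_def
  using I.rcos_const_imp_mem[of f] I.a_rcos_const[of f] by (auto simp: type_ring_simps)

lemma regular_eq_iff: "regular f = regular g \<longleftrightarrow> surface_poly k dvd f - g"
  unfolding regular_eq_0[symmetric] regular_simps(4) by simp

lemma regular_mem: "g \<in> regular f \<longleftrightarrow> surface_poly k dvd g - f"
  unfolding regular_def surface_ideal_iff[symmetric] a_r_coset_def' by (auto simp: type_ring_simps algebra_simps) (metis add_diff_cancel_left' add.commute diff_add_cancel)+

lemma rational_function_eq: "rational_function k f = to_fraction R (regular f)"
  by (simp add: rational_function_def regular_def)

end

abbreviation symbol_a :: qpoly where "symbol_a \<equiv> 4 * varx\<^sup>2 + 1"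
abbreviation symbol_t :: qpoly where "symbol_t \<equiv> 16 * varx * vary * varz"
abbreviation symbol_e :: qpoly where "symbol_e \<equiv> 2 * (4 * vary\<^sup>2 + 1) * (4 * varz\<^sup>2 + 1)"
context affine_surface begin

text \<open>The choice of parameters is dictated by \<open>discriminant_identity\<close>.\<close>

definition brauer_algebra where
  "brauer_algebra = clifford R (regular symbol_a) (regular symbol_t) (regular symbol_e)"

lemma symbol_discriminant: "symbol_t * symbol_t - symbol_a * symbol_e = of_int (- 2 * (4 * k + 1)) - 8 * surface_poly k"
  unfolding F3_qpoly[symmetric] F3_type_ring by (rule discriminant_identity)

lemma regular_discriminant:
  "regular symbol_t \<otimes>\<^bsub>R\<^esub> regular symbol_t \<ominus>\<^bsub>R\<^esub> regular symbol_a \<otimes>\<^bsub>R\<^esub> regular symbol_e = regular (of_int (- 2 * (4 * k + 1)))"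
  unfolding regular_simps[symmetric] regular_eq_iff symbol_discriminant by simp

lemma regular_clifford: "clifford_algebra R (regular symbol_a) (regular symbol_t) (regular symbol_e)"
  by (intro clifford_algebra.intro clifford_algebra_axioms.intro is_cring regular_closed)

lemma azumaya_brauer_algebra:
  assumes "4 * k + 1 \<noteq> 0"
  shows "azumaya R brauer_algebra"
  unfolding brauer_algebra_def
proof (rule clifford_algebra.azumaya_clifford[OF regular_clifford])
  define m :: rat where "m = of_int (4 * k + 1)"
  \<comment> \<open>The inverse of \<open>2d\<close>, where \<open>d = -2m\<close>.\<close>
  let ?\<delta> = "[:[:[:- 1 / (4 * m):]:]:] :: qpoly"
  show "regular ?\<delta> \<in> carrier R" by simp
  have m: "m \<noteq> 0" unfolding m_def using assms by (simp only: of_int_eq_0_iff simp_thms)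
  have "(of_int (- 2 * (4 * k + 1)) :: qpoly) + of_int (- 2 * (4 * k + 1)) = of_int (- 4 * (4 * k + 1))"
    by (simp only: of_int_add[symmetric]) simp
  also have "\<dots> = [:[:[:- 4 * m:]:]:]" by (simp only: of_int_poly m_def of_int_mult of_int_minus of_int_numeral)
  finally have "(of_int (- 2 * (4 * k + 1)) + of_int (- 2 * (4 * k + 1))) * ?\<delta> = [:[:[:- 4 * m:]:]:] * ?\<delta>" by (simp only:)
  also have "\<dots> = 1" using m by (simp add: one_pCons)
  finally have "(of_int (- 2 * (4 * k + 1)) + of_int (- 2 * (4 * k + 1))) * ?\<delta> = 1" .
  then show "(clifford_algebra.d R (regular symbol_a) (regular symbol_t) (regular symbol_e) \<oplus>\<^bsub>R\<^esub> clifford_algebra.d R (regular symbol_a) (regular symbol_t) (regular symbol_e)) \<otimes>\<^bsub>R\<^esub> regular ?\<delta> = \<one>\<^bsub>R\<^esub>"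
    unfolding clifford_algebra.d_def[OF regular_clifford] regular_discriminant by (simp only: regular_simps[symmetric])
qed

text \<open>The defining polynomial has degree 2 in \<open>z\<close>, so it divides no nonzero polynomial in \<open>x\<close>.\<close>

lemma symbol_a_nonzero: "regular symbol_a \<noteq> \<zero>\<^bsub>R\<^esub>"
proof
  assume "regular symbol_a = \<zero>\<^bsub>R\<^esub>"
  then have dv: "surface_poly k dvd symbol_a" by (simp only: regular_eq_0)
  have e: "symbol_a = [:[:[:1, 0, 4:]:]:]" by (simp add: power2_eq_square numeral_poly one_pCons)
  have "degree (surface_poly k) \<le> degree symbol_a" by (rule dvd_imp_degree_le[OF dv]) (simp add: e)
  then show False unfolding e by (simp add: surface_poly_def lead_form_def)
qed

end

context padic begin

lemma of_rat_in_eq: "of_rat_in K q = embi (fst (quotient_of q)) \<otimes>\<^bsub>K\<^esub> inv\<^bsub>K\<^esub> embi (snd (quotient_of q))"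
  by (simp only: of_rat_in_def add_pow_one)

lemma quotient_of_cases:
  obtains a b where "b \<noteq> 0" "q = of_int a / of_int b" "fst (quotient_of q) = a" "snd (quotient_of q) = b"
proof (rule that)
  have e: "quotient_of q = (fst (quotient_of q), snd (quotient_of q))" by simp
  show "q = of_int (fst (quotient_of q)) / of_int (snd (quotient_of q))" by (rule quotient_of_div[OF e])
  show "snd (quotient_of q) \<noteq> 0" using quotient_of_denom_pos[OF e] by simp
qed (rule refl)+

lemma of_rat_in_closed [simp, intro]: "of_rat_in K q \<in> carrier K"
proof -
  obtain a b where b: "b \<noteq> 0" "fst (quotient_of q) = a" "snd (quotient_of q) = b" by (rule quotient_of_cases)
  then show ?thesis
    unfolding of_rat_in_eq using Q.K.inv_closed_nonzero(1)[OF emb_closed[OF zint_closed] embi_nonzero[OF b(1)]] by simp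
qed

text \<open>Reduces statements on the reduced fraction of \<open>q\<close> to arbitrary fractions.\<close>

lemma of_rat_in_mult_denominator:
  assumes "b \<noteq> 0" "q = of_int a / of_int b"
  shows "of_rat_in K q \<otimes>\<^bsub>K\<^esub> embi b = embi a"
proof -
  obtain n d where d: "d \<noteq> 0" "q = of_int n / of_int d" "fst (quotient_of q) = n" "snd (quotient_of q) = d"
    by (rule quotient_of_cases)
  note i = Q.K.inv_closed_nonzero[OF emb_closed[OF zint_closed] embi_nonzero[OF d(1)]]
  have nd: "of_rat_in K q \<otimes>\<^bsub>K\<^esub> embi d = embi n"
    unfolding of_rat_in_eq d(3,4) using i by (simp add: Q.K.m_assoc)
  have "(of_int (n * b) :: rat) = of_int (a * d)" using assms d(1,2) by (simp add: field_simps)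
  then have eq: "n * b = a * d" by (simp only: of_int_eq_iff)
  have "(of_rat_in K q \<otimes>\<^bsub>K\<^esub> embi b) \<otimes>\<^bsub>K\<^esub> embi d = (of_rat_in K q \<otimes>\<^bsub>K\<^esub> embi d) \<otimes>\<^bsub>K\<^esub> embi b"
    by (simp add: Q.K.m_ac)
  also have "\<dots> = embi a \<otimes>\<^bsub>K\<^esub> embi d" unfolding nd embi_hom(2)[symmetric] eq ..
  finally show ?thesis using Q.K.m_rcancel[OF embi_nonzero[OF d(1)]] by simp
qed

lemma of_rat_in_eqI:
  assumes "x \<in> carrier K" "b \<noteq> 0" "q = of_int a / of_int b" "x \<otimes>\<^bsub>K\<^esub> embi b = embi a"
  shows "of_rat_in K q = x"
  using of_rat_in_mult_denominator[OF assms(2,3)] Q.K.m_rcancel[OF embi_nonzero[OF assms(2)], of "of_rat_in K q" x] assms(1,4) by simp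

lemma of_rat_in_hom:
  "of_rat_in K (of_int n) = embi n"
  "of_rat_in K (q + r) = of_rat_in K q \<oplus>\<^bsub>K\<^esub> of_rat_in K r"
  "of_rat_in K (q * r) = of_rat_in K q \<otimes>\<^bsub>K\<^esub> of_rat_in K r"
proof -
  show "of_rat_in K (of_int n) = embi n" by (rule of_rat_in_eqI[where b = 1 and a = n]) (simp_all add: embi_hom(6))
  obtain a b where b: "b \<noteq> 0" "q = of_int a / of_int b" by (rule quotient_of_cases)
  obtain c d where d: "d \<noteq> 0" "r = of_int c / of_int d" by (rule quotient_of_cases)
  let ?q = "of_rat_in K q" and ?r = "of_rat_in K r"
  note q = of_rat_in_mult_denominator[OF b] and r = of_rat_in_mult_denominator[OF d]
  have cl: "?q \<in> carrier K" "?r \<in> carrier K" "embi b \<in> carrier K" "embi d \<in> carrier K" by simp_all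
  show "of_rat_in K (q + r) = ?q \<oplus>\<^bsub>K\<^esub> ?r"
  proof (rule of_rat_in_eqI[where b = "b * d" and a = "a * d + c * b"])
    have "(?q \<oplus>\<^bsub>K\<^esub> ?r) \<otimes>\<^bsub>K\<^esub> (embi b \<otimes>\<^bsub>K\<^esub> embi d) = (?q \<otimes>\<^bsub>K\<^esub> embi b) \<otimes>\<^bsub>K\<^esub> embi d \<oplus>\<^bsub>K\<^esub> (?r \<otimes>\<^bsub>K\<^esub> embi d) \<otimes>\<^bsub>K\<^esub> embi b"
      using cl[THEN K_ex] by (elim exE, simp only: K_hom, simp add: algebra_simps)
    then show "(?q \<oplus>\<^bsub>K\<^esub> ?r) \<otimes>\<^bsub>K\<^esub> embi (b * d) = embi (a * d + c * b)" unfolding q r by (simp only: embi_hom)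
  qed (use b d in \<open>simp_all add: field_simps\<close>)
  show "of_rat_in K (q * r) = ?q \<otimes>\<^bsub>K\<^esub> ?r"
  proof (rule of_rat_in_eqI[where b = "b * d" and a = "a * c"])
    have "(?q \<otimes>\<^bsub>K\<^esub> ?r) \<otimes>\<^bsub>K\<^esub> (embi b \<otimes>\<^bsub>K\<^esub> embi d) = (?q \<otimes>\<^bsub>K\<^esub> embi b) \<otimes>\<^bsub>K\<^esub> (?r \<otimes>\<^bsub>K\<^esub> embi d)"
      using cl[THEN K_ex] by (elim exE, simp only: K_hom, simp add: algebra_simps)
    then show "(?q \<otimes>\<^bsub>K\<^esub> ?r) \<otimes>\<^bsub>K\<^esub> embi (b * d) = embi (a * c)" unfolding q r by (simp only: embi_hom)
  qed (use b d in \<open>simp_all add: field_simps\<close>)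
qed

lemma of_rat_in_pow: "of_rat_in K (of_int n ^ i) = embi n [^]\<^bsub>K\<^esub> i"
proof (induction i)
  case 0
  show ?case using of_rat_in_hom(1)[of 1] by (simp add: embi_hom(6))
next
  case (Suc i)
  then show ?case by (simp add: of_rat_in_hom Q.K.m_comm)
qed

lemma of_rat_in_sum: "finite S \<Longrightarrow> (\<Oplus>\<^bsub>K\<^esub>i\<in>S. of_rat_in K (f i)) = of_rat_in K (\<Sum>i\<in>S. f i)"
proof (induction S rule: finite_induct)
  case empty
  show ?case using of_rat_in_hom(1)[of 0] by (simp add: embi_hom(5))
next
  case (insert i S)
  then show ?case by (subst Q.K.finsum_insert) (simp_all add: of_rat_in_hom)
qed

text \<open>Evaluation at a point with integral coordinates passes through the rational numbers, so the \<open>p\<close>-adic value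
  of a regular function is the image of a rational number.\<close>

definition int_eval :: "int \<Rightarrow> int \<Rightarrow> int \<Rightarrow> qpoly \<Rightarrow> rat" where
  "int_eval x y z f = poly (poly (poly f [:[:of_int z:]:]) [:of_int y:]) (of_int x)"

lemma int_eval_sum:
  "int_eval x y z f = (\<Sum>i\<le>degree f. \<Sum>j\<le>degree (coeff f i). \<Sum>l\<le>degree (coeff (coeff f i) j).
    coeff (coeff (coeff f i) j) l * of_int x ^ l * of_int y ^ j * of_int z ^ i)"
proof -
  have e1: "poly (poly h [:c:]) b = (\<Sum>j\<le>degree h. \<Sum>l\<le>degree (coeff h j). coeff (coeff h j) l * b ^ l * c ^ j)"
    for h :: "rat poly poly" and b c
  proof -
    have "poly (poly h [:c:]) b = (\<Sum>j\<le>degree h. poly (coeff h j) b * c ^ j)"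
      by (subst poly_altdef) (simp add: poly_sum poly_power)
    then show ?thesis by (simp add: poly_altdef sum_distrib_right)
  qed
  have "int_eval x y z f = (\<Sum>i\<le>degree f. poly (poly (coeff f i) [:of_int y:]) (of_int x) * of_int z ^ i)"
    unfolding int_eval_def by (subst poly_altdef) (simp add: poly_sum poly_power)
  then show ?thesis by (simp add: e1 sum_distrib_right)
qed

lemma qpoly_eval_int: "qpoly_eval K (embi x, embi y, embi z) f = of_rat_in K (int_eval x y z f)"
  unfolding qpoly_eval_def prod.case int_eval_sum
  by (simp only: of_rat_in_hom(3)[symmetric] of_rat_in_pow[symmetric] of_rat_in_sum finite_atMost)

text \<open>Evaluation kills the defining polynomial, so it is constant on cosets.\<close>

lemma point_eval_regular:
  assumes "int_eval x y z (surface_poly k) = 0"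
  shows "point_eval K (embi x, embi y, embi z) (affine_surface.regular k f) = of_rat_in K (int_eval x y z f)"
proof -
  have "int_eval x y z g = int_eval x y z f" if "g \<in> affine_surface.regular k f" for g
  proof -
    have "surface_poly k dvd g - f" using that by (simp only: affine_surface.regular_mem)
    then obtain h where h: "g - f = surface_poly k * h" by (rule dvdE)
    have "int_eval x y z (g - f) = 0" unfolding h using assms by (simp add: int_eval_def)
    then show ?thesis by (simp add: int_eval_def)
  qed
  then have "qpoly_eval K (embi x, embi y, embi z) ` affine_surface.regular k f =
      (\<lambda>_. of_rat_in K (int_eval x y z f)) ` affine_surface.regular k f"
    by (intro image_cong refl) (simp only: qpoly_eval_int)
  moreover have "f \<in> affine_surface.regular k f" by (simp only: affine_surface.regular_mem diff_self dvd_0_right)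
  ultimately have "qpoly_eval K (embi x, embi y, embi z) ` affine_surface.regular k f = {of_rat_in K (int_eval x y z f)}"
    by (simp only: image_constant)
  then show ?thesis by (simp only: point_eval_def the_elem_eq)
qed

lemma point_eval_hom:
  assumes "int_eval x y z (surface_poly k) = 0"
  shows "ring_hom_cring (coord_ring k) K (point_eval K (embi x, embi y, embi z))"
proof -
  interpret S: affine_surface k .
  note e = point_eval_regular[OF assms]
  have "point_eval K (embi x, embi y, embi z) \<in> ring_hom S.R K"
  proof (rule ring_hom_memI)
    fix C D assume "C \<in> carrier S.R" "D \<in> carrier S.R"
    then obtain f where f: "C = S.regular f" using S.regular_cases by blast
    obtain g where g: "D = S.regular g" using \<open>D \<in> _\<close> S.regular_cases by blast
    note fg = f g
    show "point_eval K (embi x, embi y, embi z) (C \<otimes>\<^bsub>S.R\<^esub> D) = point_eval K (embi x, embi y, embi z) C \<otimes>\<^bsub>K\<^esub> point_eval K (embi x, embi y, embi z) D"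
      unfolding fg S.regular_simps[symmetric] e of_rat_in_hom(2,3)[symmetric] by (simp add: int_eval_def)
    show "point_eval K (embi x, embi y, embi z) (C \<oplus>\<^bsub>S.R\<^esub> D) = point_eval K (embi x, embi y, embi z) C \<oplus>\<^bsub>K\<^esub> point_eval K (embi x, embi y, embi z) D"
      unfolding fg S.regular_simps[symmetric] e of_rat_in_hom(2,3)[symmetric] by (simp add: int_eval_def)
  next
    fix C assume "C \<in> carrier S.R"
    then obtain f where f: "C = S.regular f" by (rule S.regular_cases)
    show "point_eval K (embi x, embi y, embi z) C \<in> carrier K" unfolding f e by simp
  next
    show "point_eval K (embi x, embi y, embi z) \<one>\<^bsub>S.R\<^esub> = \<one>\<^bsub>K\<^esub>"
      unfolding S.regular_simps(5)[symmetric] e using of_rat_in_hom(1)[of 1] by (simp add: int_eval_def embi_hom(6))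
  qed
  then show ?thesis by (intro ring_hom_cring.intro ring_hom_cring_axioms.intro S.is_cring Q.K.is_cring)
qed

lemma int_eval_surface_poly: "int_eval x y z (surface_poly k) = of_int (F3 ring_of_type_algebra k x y z)"
  unfolding F3_qpoly[symmetric] F3_type_ring by (simp add: int_eval_def)

lemma padic_component_inv_int:
  assumes F: "F3 ring_of_type_algebra k x y z = 0"
  shows "padic_component_inv (affine_surface.brauer_algebra k) p (zint x, zint y, zint z) =
    local_inv p (clifford K (embi (4 * x\<^sup>2 + 1)) (embi (16 * x * y * z)) (embi (2 * (4 * y\<^sup>2 + 1) * (4 * z\<^sup>2 + 1))))"
proof -
  have F0: "int_eval x y z (surface_poly k) = 0" by (simp add: int_eval_surface_poly F)
  interpret S: affine_surface k .
  have "int_eval x y z symbol_a = of_int (4 * x\<^sup>2 + 1)" "int_eval x y z symbol_t = of_int (16 * x * y * z)"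
    "int_eval x y z symbol_e = of_int (2 * (4 * y\<^sup>2 + 1) * (4 * z\<^sup>2 + 1))" by (simp_all add: int_eval_def)
  then show ?thesis
    unfolding padic_component_inv_def prod.case S.brauer_algebra_def
      base_change_clifford[OF point_eval_hom[OF F0] S.regular_closed S.regular_closed S.regular_closed]
      point_eval_regular[OF F0]
    by (simp only: of_rat_in_hom(1))
qed

end

text \<open>To show that isomorphic algebras are Brauer equivalent, matrices of size 1 suffice.\<close>

lemma matrix_ring_1:
  assumes "abelian_monoid S"
  shows "carrier (matrix_ring 1 S) = {(0, 0)} \<rightarrow>\<^sub>E carrier S"
    and "M \<in> carrier (matrix_ring 1 S) \<Longrightarrow> N \<in> carrier (matrix_ring 1 S) \<Longrightarrow>
      (\<And>x y. x \<in> carrier S \<Longrightarrow> y \<in> carrier S \<Longrightarrow> x \<otimes>\<^bsub>S\<^esub> y \<in> carrier S) \<Longrightarrow>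
      M \<otimes>\<^bsub>matrix_ring 1 S\<^esub> N = (\<lambda>i\<in>{(0, 0)}. M (0, 0) \<otimes>\<^bsub>S\<^esub> N (0, 0))"
    and "M \<oplus>\<^bsub>matrix_ring 1 S\<^esub> N = (\<lambda>i\<in>{(0, 0)}. M (0, 0) \<oplus>\<^bsub>S\<^esub> N (0, 0))"
    and "\<one>\<^bsub>matrix_ring 1 S\<^esub> = (\<lambda>i\<in>{(0, 0)}. \<one>\<^bsub>S\<^esub>)"
proof -
  interpret abelian_monoid S by fact
  have u: "{..<Suc 0} \<times> {..<Suc 0} = {(0, 0)}" by auto
  show c: "carrier (matrix_ring 1 S) = {(0, 0)} \<rightarrow>\<^sub>E carrier S" by (simp add: matrix_ring_def u)
  show "M \<oplus>\<^bsub>matrix_ring 1 S\<^esub> N = (\<lambda>i\<in>{(0, 0)}. M (0, 0) \<oplus>\<^bsub>S\<^esub> N (0, 0))"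
    "\<one>\<^bsub>matrix_ring 1 S\<^esub> = (\<lambda>i\<in>{(0, 0)}. \<one>\<^bsub>S\<^esub>)"
    by (auto simp: matrix_ring_def u restrict_def fun_eq_iff)
  assume M: "M \<in> carrier (matrix_ring 1 S)" "N \<in> carrier (matrix_ring 1 S)"
    and cl: "\<And>x y. x \<in> carrier S \<Longrightarrow> y \<in> carrier S \<Longrightarrow> x \<otimes>\<^bsub>S\<^esub> y \<in> carrier S"
  have "M (0, 0) \<in> carrier S" "N (0, 0) \<in> carrier S" using M unfolding c by auto
  then have "M (0, 0) \<otimes>\<^bsub>S\<^esub> N (0, 0) \<in> carrier S" by (rule cl)
  then have "(\<Oplus>\<^bsub>S\<^esub>l\<in>{..<1::nat}. M (0, l) \<otimes>\<^bsub>S\<^esub> N (l, 0)) = M (0, 0) \<otimes>\<^bsub>S\<^esub> N (0, 0)"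
    by (simp add: lessThan_Suc)
  then show "M \<otimes>\<^bsub>matrix_ring 1 S\<^esub> N = (\<lambda>i\<in>{(0, 0)}. M (0, 0) \<otimes>\<^bsub>S\<^esub> N (0, 0))"
    by (auto simp: matrix_ring_def u restrict_def fun_eq_iff)
qed

lemma brauer_equivalentI:
  assumes S: "abelian_monoid (alg_ring K A)" "abelian_monoid (alg_ring K A')"
    and cl: "\<And>x y. x \<in> carrier (alg_ring K A) \<Longrightarrow> y \<in> carrier (alg_ring K A) \<Longrightarrow> x \<otimes>\<^bsub>alg_ring K A\<^esub> y \<in> carrier (alg_ring K A)"
    and cl': "\<And>x y. x \<in> carrier (alg_ring K A') \<Longrightarrow> y \<in> carrier (alg_ring K A') \<Longrightarrow> x \<otimes>\<^bsub>alg_ring K A'\<^esub> y \<in> carrier (alg_ring K A')"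
    and one: "\<one>\<^bsub>alg_ring K A\<^esub> \<in> carrier (alg_ring K A)"
    and iso: "alg_iso K A A'"
  shows "brauer_equivalent K A A'"
proof -
  obtain h where h: "h \<in> ring_iso (alg_ring K A) (alg_ring K A')"
    "\<And>c. c \<in> carrier K \<Longrightarrow> h (alg_scalar K A c) = alg_scalar K A' c"
    using iso by (auto simp: alg_iso_def)
  let ?S = "alg_ring K A" and ?S' = "alg_ring K A'"
  let ?M = "matrix_ring 1 ?S" and ?M' = "matrix_ring 1 ?S'"
  let ?r = "\<lambda>x. \<lambda>i\<in>{(0::nat, 0::nat)}. x"
  define H where "H = (\<lambda>M. ?r (h (M (0::nat, 0::nat))))"
  have hS: "h x \<in> carrier ?S'" if "x \<in> carrier ?S" for x using h(1) that by (auto simp: ring_iso_def ring_hom_def)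
  have bij: "bij_betw h (carrier ?S) (carrier ?S')" using h(1) by (auto simp: ring_iso_def)
  have cM: "M (0, 0) \<in> carrier ?S" "M = ?r (M (0, 0))" if "M \<in> carrier ?M" for M
    using that unfolding matrix_ring_1(1)[OF S(1)] by (auto simp: PiE_iff extensional_def fun_eq_iff)
  have cM': "M (0, 0) \<in> carrier ?S'" "M = ?r (M (0, 0))" if "M \<in> carrier ?M'" for M
    using that unfolding matrix_ring_1(1)[OF S(2)] by (auto simp: PiE_iff extensional_def fun_eq_iff)
  have rM: "?r x \<in> carrier ?M" if "x \<in> carrier ?S" for x unfolding matrix_ring_1(1)[OF S(1)] using that by auto
  have rM': "?r x \<in> carrier ?M'" if "x \<in> carrier ?S'" for x unfolding matrix_ring_1(1)[OF S(2)] using that by auto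
  have HM: "H M \<in> carrier ?M'" if "M \<in> carrier ?M" for M unfolding H_def by (intro rM' hS cM(1) that)
  have H0: "H M (0, 0) = h (M (0, 0))" for M by (simp add: H_def)
  have "H \<in> ring_iso ?M ?M'"
  proof (rule ring_iso_memI)
    fix M N assume M: "M \<in> carrier ?M" and N: "N \<in> carrier ?M"
    have "h (M (0, 0) \<otimes>\<^bsub>?S\<^esub> N (0, 0)) = h (M (0, 0)) \<otimes>\<^bsub>?S'\<^esub> h (N (0, 0))"
      "h (M (0, 0) \<oplus>\<^bsub>?S\<^esub> N (0, 0)) = h (M (0, 0)) \<oplus>\<^bsub>?S'\<^esub> h (N (0, 0))"
      using h(1) cM(1)[OF M] cM(1)[OF N] by (auto simp: ring_iso_def ring_hom_def)
    moreover have mM: "M \<otimes>\<^bsub>?M\<^esub> N = ?r (M (0, 0) \<otimes>\<^bsub>?S\<^esub> N (0, 0))"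
      by (rule matrix_ring_1(2)[OF S(1) M N]) (rule cl)
    moreover have mM': "H M \<otimes>\<^bsub>?M'\<^esub> H N = ?r (H M (0, 0) \<otimes>\<^bsub>?S'\<^esub> H N (0, 0))"
      by (rule matrix_ring_1(2)[OF S(2) HM[OF M] HM[OF N]]) (rule cl')
    ultimately show "H (M \<otimes>\<^bsub>?M\<^esub> N) = H M \<otimes>\<^bsub>?M'\<^esub> H N" "H (M \<oplus>\<^bsub>?M\<^esub> N) = H M \<oplus>\<^bsub>?M'\<^esub> H N"
      unfolding mM mM' matrix_ring_1(3)[OF S(1)] matrix_ring_1(3)[OF S(2)] H0
      by (simp_all add: H_def)
  next
    have "h \<one>\<^bsub>?S\<^esub> = \<one>\<^bsub>?S'\<^esub>" using h(1) by (auto simp: ring_iso_def ring_hom_def)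
    then show "H \<one>\<^bsub>?M\<^esub> = \<one>\<^bsub>?M'\<^esub>" unfolding matrix_ring_1(4)[OF S(1)] matrix_ring_1(4)[OF S(2)] by (simp add: H_def)
    show "bij_betw H (carrier ?M) (carrier ?M')"
    proof (rule bij_betwI')
      fix M N assume M: "M \<in> carrier ?M" and N: "N \<in> carrier ?M"
      have "H M = H N \<longleftrightarrow> h (M (0, 0)) = h (N (0, 0))" unfolding H_def by (metis restrict_apply' singletonI)
      also have "\<dots> \<longleftrightarrow> M (0, 0) = N (0, 0)"
        using bij cM(1)[OF M] cM(1)[OF N] by (auto simp: bij_betw_def inj_on_def)
      also have "\<dots> \<longleftrightarrow> M = N" using cM(2)[OF M] cM(2)[OF N] by metis
      finally show "H M = H N \<longleftrightarrow> M = N" .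
    next
      fix N assume N: "N \<in> carrier ?M'"
      obtain x where x: "x \<in> carrier ?S" "h x = N (0, 0)" using bij cM'(1)[OF N] unfolding bij_betw_def by (metis imageE)
      have "H (?r x) = ?r (N (0, 0))" by (simp add: H_def x(2))
      then have "N = H (?r x)" using cM'(2)[OF N] by simp
      then show "\<exists>M\<in>carrier ?M. N = H M" using rM[OF x(1)] by blast
    qed (rule HM)
  qed (rule HM)
  moreover have "H (matrix_scalar 1 K A a) = matrix_scalar 1 K A' a" if a: "a \<in> carrier K" for a
  proof -
    have "matrix_scalar 1 K B a = ?r (alg_scalar K B a)" for B
      by (auto simp: matrix_scalar_def restrict_def fun_eq_iff)
    then show ?thesis using h(2)[OF a] by (simp add: H_def)
  qed
  ultimately show ?thesis unfolding brauer_equivalent_def using zero_less_one by metis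
qed

lemma clifford_iso_quaternion:
  assumes "clifford_algebra K a \<zero>\<^bsub>K\<^esub> b"
  shows "alg_iso K (clifford K a \<zero>\<^bsub>K\<^esub> b) (quaternion_alg K a b)"
    and "abelian_monoid (alg_ring K (quaternion_alg K a b))"
    and "x \<in> carrier (alg_ring K (quaternion_alg K a b)) \<Longrightarrow> y \<in> carrier (alg_ring K (quaternion_alg K a b)) \<Longrightarrow>
      x \<otimes>\<^bsub>alg_ring K (quaternion_alg K a b)\<^esub> y \<in> carrier (alg_ring K (quaternion_alg K a b))"
proof -
  interpret clifford_algebra K a "\<zero>\<^bsub>K\<^esub>" b by fact
  let ?Q = "quaternion_alg K a b"
  have K: "cring K" "a \<in> carrier K" "b \<in> carrier K" by (rule is_cring, simp_all)
  note q = quaternion_alg_eq_clifford[OF K]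
  have rk: "rank ?Q = rank A" by (simp add: q(1))
  have mult: "x \<otimes>\<^bsub>alg_ring K ?Q\<^esub> y = x \<otimes>\<^bsub>B\<^esub> y" if "x \<in> carrier B" "y \<in> carrier B" for x y
  proof (rule alg_ring_mult_cong[OF rk _ that])
    fix i j k assume "i < rank A" "j < rank A" "k < rank A"
    then show "sc A i j k \<in> carrier K \<and> sc ?Q i j k = sc A i j k"
      using is_algebra_clifford q(3)[of i j k] unfolding is_algebra_def by simp
  qed
  have eqs: "carrier (alg_ring K ?Q) = carrier B" "\<zero>\<^bsub>alg_ring K ?Q\<^esub> = \<zero>\<^bsub>B\<^esub>" "\<one>\<^bsub>alg_ring K ?Q\<^esub> = \<one>\<^bsub>B\<^esub>"
    "add (alg_ring K ?Q) = add B"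
    unfolding alg_ring_def rk q(2) by simp_all
  have sc: "alg_scalar K ?Q c = alg_scalar K A c" for c
    unfolding alg_scalar_def alg_smult_def eqs rk ..
  have "(\<lambda>x. x) \<in> ring_iso B (alg_ring K ?Q)"
    by (rule ring_iso_memI) (simp_all add: eqs mult bij_betw_def)
  then show "alg_iso K A ?Q" unfolding alg_iso_def by (intro bexI[of _ "\<lambda>x. x"]) (simp_all add: sc)
  have "add_monoid (alg_ring K ?Q) = add_monoid B" by (simp add: eqs)
  then show "abelian_monoid (alg_ring K ?Q)"
    using B.a_comm_monoid by (intro abelian_monoid.intro) simp
  show "x \<in> carrier (alg_ring K ?Q) \<Longrightarrow> y \<in> carrier (alg_ring K ?Q) \<Longrightarrow> x \<otimes>\<^bsub>alg_ring K ?Q\<^esub> y \<in> carrier (alg_ring K ?Q)"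
    by (simp add: eqs mult)
qed

context affine_surface begin

lemma represents_brauer_algebra:
  assumes m: "4 * k + 1 \<noteq> 0"
  shows "represents_symbol k brauer_algebra symbol_a (of_int (- 2 * (4 * k + 1)))"
  unfolding represents_symbol_def
proof (rule conjI[OF azumaya_brauer_algebra[OF m]])
  let ?\<phi> = "to_fraction R"
  let ?a = "?\<phi> (regular symbol_a)" and ?t = "?\<phi> (regular symbol_t)" and ?e = "?\<phi> (regular symbol_e)"
    and ?b = "?\<phi> (regular (of_int (- 2 * (4 * k + 1))))"
  have hom: "ring_hom_cring R K ?\<phi>"
    by (intro ring_hom_cring.intro ring_hom_cring_axioms.intro is_cring K.is_cring to_fraction_hom)
  have cl: "?a \<in> carrier K" "?t \<in> carrier K" "?e \<in> carrier K" "?b \<in> carrier K" by simp_all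
  have bc: "base_change ?\<phi> brauer_algebra = clifford K ?a ?t ?e"
    unfolding brauer_algebra_def by (rule base_change_clifford[OF hom regular_closed regular_closed regular_closed])
  have CA: "clifford_algebra K ?a ?t ?e"
    by (intro clifford_algebra.intro clifford_algebra_axioms.intro K.is_cring cl)
  have CA0: "clifford_algebra K ?a \<zero>\<^bsub>K\<^esub> ?b"
    by (intro clifford_algebra.intro clifford_algebra_axioms.intro K.is_cring K.zero_closed cl)
  have a0: "?a \<noteq> \<zero>\<^bsub>K\<^esub>"
    using symbol_a_nonzero to_fraction_inj[OF regular_closed zero_closed] to_fraction.hom_zero by metis
  have d: "?b = ?t \<otimes>\<^bsub>K\<^esub> ?t \<ominus>\<^bsub>K\<^esub> ?a \<otimes>\<^bsub>K\<^esub> ?e"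
    unfolding regular_discriminant[symmetric] by (simp add: a_minus_def del: regular_simps)
  note u = K.inv_closed_nonzero[OF cl(1) a0]
  have swap: "alg_iso K (clifford K ?a \<zero>\<^bsub>K\<^esub> ?b) (clifford K ?a ?t ?e)"
    by (rule clifford_swap_iso[OF CA CA0 d u(1,3)])
  have iso: "alg_iso K (clifford K ?a ?t ?e) (quaternion_alg K ?a ?b)"
    by (rule alg_iso_trans[OF clifford_iso_sym[OF CA0 swap] clifford_iso_quaternion(1)[OF CA0]])
  interpret C: clifford_algebra K ?a ?t ?e by (rule CA)
  show "brauer_equivalent (function_field k) (base_change ?\<phi> brauer_algebra)
     (quaternion_alg (function_field k) (rational_function k symbol_a) (rational_function k (of_int (- 2 * (4 * k + 1)))))"
    unfolding bc rational_function_eq function_field_def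
  proof (rule brauer_equivalentI)
    show "abelian_monoid C.B" by (rule C.B.abelian_monoid_axioms)
    show "abelian_monoid (alg_ring K (quaternion_alg K ?a ?b))" by (rule clifford_iso_quaternion(2)[OF CA0])
    show "\<one>\<^bsub>C.B\<^esub> \<in> carrier C.B" by (rule C.B.one_closed)
    show "alg_iso K C.A (quaternion_alg K ?a ?b)" by (rule iso)
    show "x \<otimes>\<^bsub>C.B\<^esub> y \<in> carrier C.B" if "x \<in> carrier C.B" "y \<in> carrier C.B" for x y
      using that by (rule C.B.m_closed)
    show "x \<otimes>\<^bsub>alg_ring K (quaternion_alg K ?a ?b)\<^esub> y \<in> carrier (alg_ring K (quaternion_alg K ?a ?b))"
      if "x \<in> carrier (alg_ring K (quaternion_alg K ?a ?b))" "y \<in> carrier (alg_ring K (quaternion_alg K ?a ?b))" for x y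
      using that by (rule clifford_iso_quaternion(3)[OF CA0])
  qed
qed

end

lemma type_ring_hom: "ring_hom_cring (ring_of_type_algebra :: int ring) real_field of_int"
  by (intro ring_hom_cring.intro ring_hom_cring_axioms.intro cring_from_type_algebra ring_hom_memI)
    (simp_all add: type_ring_simps)

lemma (in padic) zint_point:
  assumes "F3 ring_of_type_algebra k x y z = 0"
  shows "(zint x, zint y, zint z) \<in> surface_points (Zp p) k"
proof -
  have hom: "ring_hom_cring (ring_of_type_algebra :: int ring) (Zp p) zint"
    by (intro ring_hom_cring.intro ring_hom_cring_axioms.intro cring_from_type_algebra ring_hom_memI Zp_cring)
      (simp_all add: type_ring_simps zint_add zint_mult zint_1)
  have "F3 (Zp p) k (zint x) (zint y) (zint z) = zint (F3 ring_of_type_algebra k x y z)"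
    by (rule F3_hom[OF hom]) (simp_all add: type_ring_simps)
  then show ?thesis unfolding assms by (simp add: surface_points_def zint_0)
qed

text \<open>Modulo 4 the equation reads \<open>x\<^sup>2 + y\<^sup>2 + z\<^sup>2 = 1\<close>. As it is symmetric, the odd coordinate may be moved
  to the first place or away from it.\<close>

lemma one_odd_coordinate:
  assumes k: "[k = 1] (mod 4)" and P: "(x, y, z) \<in> surface_points (ring_of_type_algebra :: int ring) k"
  obtains u v w :: int where "F3 ring_of_type_algebra k u v w = 0" "F3 ring_of_type_algebra k v u w = 0"
    "odd u" "even v"
proof -
  have F: "F3 ring_of_type_algebra k x y z = 0" using P by (simp add: surface_points_def type_ring_simps)
  have sq: "c\<^sup>2 mod 4 = (if even c then 0 else 1)" for c :: int
  proof (cases "even c")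
    case True
    then show ?thesis by (auto elim!: evenE simp: power2_eq_square)
  next
    case False
    then obtain b where "c = 2 * b + 1" by (rule oddE)
    then have c2: "c\<^sup>2 = 4 * (b * b + b) + 1" by (simp add: power2_eq_square algebra_simps)
    have "c\<^sup>2 mod 4 = 1" unfolding c2 by (subst mod_mult_self4) simp
    then show ?thesis using False by simp
  qed
  have "x\<^sup>2 + y\<^sup>2 + z\<^sup>2 = k + 4 * (4 * (x\<^sup>2 * y\<^sup>2 * z\<^sup>2) - (x\<^sup>2 * y\<^sup>2 + y\<^sup>2 * z\<^sup>2 + z\<^sup>2 * x\<^sup>2))"
    using F unfolding F3_type_ring by simp
  then have "(x\<^sup>2 + y\<^sup>2 + z\<^sup>2) mod 4 = k mod 4" by (simp only: mod_mult_self2)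
  moreover have "k mod 4 = 1" using k by (simp add: cong_def)
  moreover have "(a + b + c) mod 4 = (a mod 4 + b mod 4 + c mod 4) mod 4" for a b c :: int
    by (intro mod_add_cong) (rule mod_mod_trivial[symmetric])+
  ultimately have s: "(x\<^sup>2 mod 4 + y\<^sup>2 mod 4 + z\<^sup>2 mod 4) mod 4 = 1" by metis
  have perm: "F3 ring_of_type_algebra k b a c = F3 ring_of_type_algebra k a b c"
    "F3 ring_of_type_algebra k b c a = F3 ring_of_type_algebra k a b c"
    "F3 ring_of_type_algebra k c a b = F3 ring_of_type_algebra k a b c"
    "F3 ring_of_type_algebra k c b a = F3 ring_of_type_algebra k a b c" for a b c :: int
    unfolding F3_type_ring by (simp_all add: algebra_simps)
  consider "odd x" "even y" | "odd y" "even x" | "odd z" "even x"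
    using s unfolding sq by (auto split: if_splits)
  then show ?thesis
  proof cases
    case 1 then show ?thesis using that[of x y z] F perm[of x y z] by simp
  next
    case 2 then show ?thesis using that[of y x z] F perm[of x y z] by simp
  next
    case 3 then show ?thesis using that[of z x y] F perm[of x y z] perm[of x z y] by simp
  qed
qed

context padic begin

text \<open>At \<open>p = 2\<close> the parity of \<open>x\<close> decides whether \<open>4x\<^sup>2 + 1\<close> is 1 or 5 modulo 8, that is, whether its square
  root is in the base field or generates the unramified quadratic extension; and \<open>d = -2(4k + 1)\<close> has
  valuation 1.\<close>

lemma inv_int_point:
  assumes F: "F3 ring_of_type_algebra k x y z = 0"
  shows "odd p \<Longrightarrow> \<not> int p dvd (4 * x\<^sup>2 + 1) * (4 * k + 1) \<Longrightarrow>
      padic_component_inv (affine_surface.brauer_algebra k) p (zint x, zint y, zint z) = 0"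
    and "p = 2 \<Longrightarrow> even x \<Longrightarrow> 4 * k + 1 \<noteq> 0 \<Longrightarrow>
      padic_component_inv (affine_surface.brauer_algebra k) p (zint x, zint y, zint z) = 0"
    and "p = 2 \<Longrightarrow> odd x \<Longrightarrow> padic_component_inv (affine_surface.brauer_algebra k) p (zint x, zint y, zint z) = 1 / 2"
proof -
  let ?a = "4 * x\<^sup>2 + 1" and ?t = "16 * x * y * z" and ?e = "2 * (4 * y\<^sup>2 + 1) * (4 * z\<^sup>2 + 1)"
  have d: "?t * ?t - ?a * ?e = - 2 * (4 * k + 1)"
    using discriminant_identity[of x y z k] F unfolding F3_type_ring by simp
  have x8: "x * x mod 8 = 1" if "odd x" using square_mod_8[of x] that by (auto simp: odd_iff_mod_2_eq_one)
  have x8': "x * x mod 8 = 0 \<or> x * x mod 8 = 4" if "even x" using square_mod_8[of x] that by auto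
  {
    assume o: "odd p" and n: "\<not> int p dvd ?a * (4 * k + 1)"
    have "\<not> int p dvd 2"
    proof
      assume "int p dvd 2"
      then have "p dvd 2" by (metis int_dvd_int_iff of_nat_numeral)
      then have "p \<le> 2" by (rule dvd_imp_le) simp
      then have "p = 2" using p_gt(1) by simp
      then show False using o by simp
    qed
    moreover have "\<not> int p dvd ?a" "\<not> int p dvd 4 * k + 1" using n dvd_mult2 dvd_mult by blast+
    moreover have pp: "prime (int p)" using prime_p by simp
    ultimately have "\<not> int p dvd 2 * (4 * k + 1)" by (simp only: prime_dvd_mult_iff[OF pp] simp_thms)
    then have "\<not> int p dvd ?t * ?t - ?a * ?e" unfolding d by (simp only: minus_mult_left[symmetric] dvd_minus_iff simp_thms)
    then show "padic_component_inv (affine_surface.brauer_algebra k) p (zint x, zint y, zint z) = 0"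
      unfolding padic_component_inv_int[OF F] using local_inv_unramified[OF o \<open>\<not> int p dvd ?a\<close>] by blast
  }
  {
    assume p: "p = 2" and ev: "even x" and m: "4 * k + 1 \<noteq> 0"
    have a8: "(4 * s + 1) mod 8 = 1" if "s mod 8 = 0 \<or> s mod 8 = 4" for s :: int using that by presburger
    have "?a mod 8 = 1" unfolding power2_eq_square by (rule a8[OF x8'[OF ev]])
    moreover have "?t * ?t - ?a * ?e \<noteq> 0" unfolding d using m by simp
    ultimately show "padic_component_inv (affine_surface.brauer_algebra k) p (zint x, zint y, zint z) = 0"
      unfolding padic_component_inv_int[OF F] by (rule local_inv_dyadic_square[OF p])
  }
  {
    assume p: "p = 2" and od: "odd x"
    have a8: "(4 * s + 1) mod 8 = 5" if "s mod 8 = 1" for s :: int using that by presburger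
    have "?a mod 8 = 5" unfolding power2_eq_square by (rule a8[OF x8[OF od]])
    moreover have "(?t * ?t - ?a * ?e) mod 4 = 2" unfolding d by presburger
    ultimately show "padic_component_inv (affine_surface.brauer_algebra k) p (zint x, zint y, zint z) = 1 / 2"
      unfolding padic_component_inv_int[OF F] by (rule local_inv_dyadic_nonsquare[OF p])
  }
qed

end

theorem proposition5p4:
  fixes k :: int
  assumes "[k = 1] (mod 4)"
    and "surface_points (ring_of_type_algebra :: int ring) k \<noteq> {}"
  shows "\<exists>A. represents_symbol k A (4 * varx\<^sup>2 + 1) (of_int (- 2 * (4 * k + 1))) \<and>
    brauer_manin_set k A \<noteq> adelic_points k"
proof -
  obtain x y z where P: "(x, y, z) \<in> surface_points (ring_of_type_algebra :: int ring) k" using assms(2) by auto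
  obtain u v w :: int where F: "F3 ring_of_type_algebra k u v w = 0" "F3 ring_of_type_algebra k v u w = 0" and uv: "odd u" "even v"
    by (rule one_odd_coordinate[OF assms(1) P])
  have m: "4 * k + 1 \<noteq> 0" by presburger
  let ?A = "affine_surface.brauer_algebra k"
  define loc where "loc = (\<lambda>x y z p. (padic.zint p x, padic.zint p y, padic.zint p z))"
  \<comment> \<open>The two adelic points differ at the prime 2 only.\<close>
  define Q where "Q = (\<lambda>p\<in>{p. prime p}. loc u v w p)"
  define Q' where "Q' = (\<lambda>p\<in>{p. prime p}. if p = 2 then loc v u w p else loc u v w p)"
  define P where "P = (real_of_int u, real_of_int v, real_of_int w)"
  have pad: "padic p" if "prime p" for p :: nat using that by (rule padic.intro)
  have "F3 real_field k (of_int u) (of_int v) (of_int w) = of_int (F3 ring_of_type_algebra k u v w)"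
    by (rule F3_hom[OF type_ring_hom]) (simp_all add: type_ring_simps)
  then have PR: "P \<in> surface_points real_field k"
    unfolding F P_def by (simp add: surface_points_def type_ring_simps)
  have mem: "(P, Q) \<in> adelic_points k" "(P, Q') \<in> adelic_points k"
    unfolding adelic_points_def Q_def Q'_def loc_def
    using PR padic.zint_point[OF pad F(1)] padic.zint_point[OF pad F(2)] by auto
  let ?i = "\<lambda>Q p. padic_component_inv ?A p (Q p)"
  have i2: "?i Q 2 = 1 / 2" "?i Q' 2 = 0"
    unfolding Q_def Q'_def loc_def
    using padic.inv_int_point(3)[OF pad F(1) refl uv(1)] padic.inv_int_point(2)[OF pad F(2) refl uv(2) m] by simp_all
  have eq: "?i Q' p = ?i Q p" if "prime p" "p \<noteq> 2" for p using that by (simp add: Q_def Q'_def)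
  define S where "S = {p. prime p \<and> p \<noteq> 2 \<and> ?i Q p \<noteq> 0}"
  have "S \<subseteq> {p. p dvd nat \<bar>(4 * u\<^sup>2 + 1) * (4 * k + 1)\<bar>}"
  proof
    fix p assume "p \<in> S"
    then have p: "prime p" "p \<noteq> 2" "?i Q p \<noteq> 0" by (auto simp: S_def)
    then have "odd p" using prime_odd_nat[OF p(1)] prime_ge_2_nat[OF p(1)] by linarith
    then have "int p dvd (4 * u\<^sup>2 + 1) * (4 * k + 1)"
      using padic.inv_int_point(1)[OF pad[OF p(1)] F(1)] p by (auto simp: Q_def loc_def)
    then have "int p dvd int (nat \<bar>(4 * u\<^sup>2 + 1) * (4 * k + 1)\<bar>)" by simp
    then show "p \<in> {p. p dvd nat \<bar>(4 * u\<^sup>2 + 1) * (4 * k + 1)\<bar>}" by (simp only: int_dvd_int_iff mem_Collect_eq)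
  qed
  moreover have "finite {p. p dvd nat \<bar>(4 * u\<^sup>2 + 1) * (4 * k + 1)\<bar>}"
  proof (rule finite_divisors_nat)
    have "4 * u\<^sup>2 + 1 \<noteq> 0" using zero_le_power2[of u] by linarith
    then have "(4 * u\<^sup>2 + 1) * (4 * k + 1) \<noteq> 0" using m by simp
    then show "0 < nat \<bar>(4 * u\<^sup>2 + 1) * (4 * k + 1)\<bar>" by (simp only: zero_less_nat_eq zero_less_abs_iff simp_thms)
  qed
  ultimately have fS: "finite S" by (rule finite_subset)
  have S: "{p. prime p \<and> ?i Q p \<noteq> 0} = insert 2 S" "{p. prime p \<and> ?i Q' p \<noteq> 0} = S"
  proof -
    have n: "?i Q 2 \<noteq> 0" unfolding i2(1) by simp
    have "(prime p \<and> ?i Q p \<noteq> 0 \<longleftrightarrow> p \<in> insert 2 S) \<and> (prime p \<and> ?i Q' p \<noteq> 0 \<longleftrightarrow> p \<in> S)" for p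
    proof (cases "p = 2")
      case True
      then show ?thesis using n i2(2) by (simp add: S_def)
    next
      case False
      then show ?thesis using eq[of p] by (auto simp: S_def)
    qed
    then show "{p. prime p \<and> ?i Q p \<noteq> 0} = insert 2 S" "{p. prime p \<and> ?i Q' p \<noteq> 0} = S" by blast+
  qed
  have sums: "(\<Sum>p | prime p \<and> ?i Q p \<noteq> 0. ?i Q p) = 1 / 2 + (\<Sum>p\<in>S. ?i Q p)"
    "(\<Sum>p | prime p \<and> ?i Q' p \<noteq> 0. ?i Q' p) = (\<Sum>p\<in>S. ?i Q p)"
  proof -
    have "2 \<notin> S" by (simp add: S_def)
    then show "(\<Sum>p | prime p \<and> ?i Q p \<noteq> 0. ?i Q p) = 1 / 2 + (\<Sum>p\<in>S. ?i Q p)"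
      unfolding S using fS i2(1) by (subst sum.insert) simp_all
    show "(\<Sum>p | prime p \<and> ?i Q' p \<noteq> 0. ?i Q' p) = (\<Sum>p\<in>S. ?i Q p)"
      unfolding S by (rule sum.cong) (auto simp: S_def eq)
  qed
  have "brauer_manin_set k ?A \<noteq> adelic_points k"
  proof
    assume "brauer_manin_set k ?A = adelic_points k"
    then have "brauer_manin_pairing (P, Q) ?A = 0" "brauer_manin_pairing (P, Q') ?A = 0"
      using mem unfolding brauer_manin_set_def by blast+
    then have "real_component_inv ?A P + (1 / 2 + (\<Sum>p\<in>S. ?i Q p)) \<in> \<int>" "real_component_inv ?A P + (\<Sum>p\<in>S. ?i Q p) \<in> \<int>"
      by (simp_all only: brauer_manin_pairing_def prod.case sums frac_eq_0_iff)
    then have "(real_component_inv ?A P + (1 / 2 + (\<Sum>p\<in>S. ?i Q p))) - (real_component_inv ?A P + (\<Sum>p\<in>S. ?i Q p)) \<in> \<int>"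
      by (rule Ints_diff)
    then have "(1 / 2 :: rat) \<in> \<int>" by simp
    then obtain n where "1 / 2 = (of_int n :: rat)" by (rule Ints_cases)
    then have "(of_int (2 * n) :: rat) = of_int 1" by simp
    then have "2 * n = 1" by (simp only: of_int_eq_iff)
    then show False by presburger
  qed
  then show ?thesis using affine_surface.represents_brauer_algebra[OF m] by blast
qed

end
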